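(* Let $(\mathcal X,\Gamma,\mathsf d)$ be a metric local diffusion space, and let $\mu$ be a probability measure on $(\Upsilon,\Sigma_{\mathrm v})$ satisfying the closability assumption. If $(\Upsilon,\Gamma^{\Upsilon,\mu},\mathsf d_\Upsilon)$ satisfies the Rademacher property $(\mathsf{Rad}_{\mathsf d_\Upsilon,\mu})$, then $(\mathcal E^{\Upsilon,\mu},\mathscr D(\mathcal E^{\Upsilon,\mu}))$ is a conservative, quasi-regular (w.r.t. $\tau_{\mathrm v}$), strongly local Dirichlet form on $L^2(\mu)$.
   Context: A metric local diffusion space $(\mathcal X,\Gamma,\mathsf d)$, $\mathcal X=(X,\tau,\Sigma,\mathsf m,\mathscr E_{\mathsf d})$, consists of: a non-empty complete separable metric space $(X,\mathsf d)$ with topology $\tau$; a $\sigma$-algebra $\Sigma$ with $\mathscr B_\tau\subset\Sigma\subset\mathscr B_\tau^{\mathsf m}$ (Borel $\sigma$-algebra and its $\mathsf m$-completion); a $\sigma$-finite atomless Radon measure $\mathsf m$ with full support, finite on every set of the ring $\mathscr E_{\mathsf d}$ of all $\mathsf d$-bounded sets in $\Sigma$; and a square field operator $(\Gamma,\mathcal D)$: $\mathcal D$ is an algebra of bounded continuous functions vanishing outside a $\mathsf d$-bounded set, generating $\tau$, with $\varphi\circ\mathbf f-\varphi(0)\in\mathcal D$ for $\mathbf f\in\mathcal D^k$, $\varphi\in\mathcal C_b^\infty(\mathbb R^k)$ (bounded smooth, all derivatives bounded); $\Gamma:\mathcal D\times\mathcal D\to L^\infty(\mathsf m)$ is symmetric,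 bilinear, non-negative definite, takes values in $\mathsf m$-classes of bounded $\Sigma$-measurable functions vanishing outside a set in $\mathscr E_{\mathsf d}$, and satisfies $\Gamma(\varphi\circ\mathbf f-\varphi(0),\psi\circ\mathbf g-\psi(0))=\sum_{i,j}(\partial_i\varphi)(\mathbf f)(\partial_j\psi)(\mathbf g)\Gamma(f_i,g_j)$ a.e.; the form $\int\Gamma(f,g)\,d\mathsf m$ on $\mathcal D$ is closable and densely defined in $L^2(\mathsf m)$, and its closure is a quasi-regular Dirichlet form. A strong lifting $\ell:L^\infty(\mathsf m)\to\mathcal L^\infty(\mathsf m)$ (bounded $\Sigma$-measurable functions; linear, multiplicative, order preserving, $\ell(1)=1$, $[\ell(f)]_{\mathsf m}=f$, $\ell(\varphi)=\varphi$ for $\varphi\in\mathcal C_b(X)$) is fixed. $\Upsilon$ is the set of all $\gamma=\sum_{i\le N}\delta_{x_i}$, $N\in\mathbb N_0\cup\{\infty\}$, $x_i\in X$ (repetitions allowed), finite on sets of $\mathscr E_{\mathsf d}$; $\Sigma_{\mathrm v}$ is generated by $\gamma\mapsto\gamma E$, $E\in\mathscr E_{\mathsf d}$, with $\mu$-completion $\Sigma_{\mathrm v}^\mu$; $\tau_{\mathrm v}$ is generated by $f^\star:\gamma\mapsto\int f\,d\gamma$, $f$ bounded continuous vanishing outside a bounded set. Cylinder functions are $u=F(f_1^\star,\dots,f_k^\star)$, $F\in\mathcal C_b^\infty(\mathbb R^k)$, $f_i\in\mathcal D$; for $u=F(f_1^\star,\dots,f_k^\star)$, $v=G(g_1^\star,\dots,g_m^\star)$,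 $\Gamma^\Upsilon(u,v)(\gamma)=\sum_{i,j}\partial_iF(f_1^\star\gamma,\dots)\,\partial_jG(g_1^\star\gamma,\dots)\int\ell(\Gamma(f_i,g_j))\,d\gamma$. Closability assumption on $\mu$: $\int\gamma E\,d\mu<\infty$ for all $E\in\mathscr E_{\mathsf d}$, and the pre-Dirichlet form $\mathcal E^{\Upsilon,\mu}(u,v)=\int\Gamma^\Upsilon(u,v)\,d\mu$ on $\mu$-classes of cylinder functions is closable on $L^2(\mu)$; its closure is $(\mathcal E^{\Upsilon,\mu},\mathscr D(\mathcal E^{\Upsilon,\mu}))$, with square field operator $\Gamma^{\Upsilon,\mu}$. $\mathsf d_\Upsilon(\gamma,\eta)=\inf_q\big(\int_{X\times X}\mathsf d^2\,dq\big)^{1/2}\in[0,\infty]$, the infimum over measures $q$ on $X\times X$ with marginals $\gamma,\eta$ ($\inf\emptyset=+\infty$). $(\mathsf{Rad}_{\mathsf d_\Upsilon,\mu})$: every bounded $\Sigma_{\mathrm v}^\mu$-measurable $\mathsf d_\Upsilon$-Lipschitz $\hat u:\Upsilon\to\mathbb R$ with Lipschitz constant $L$ has $\mu$-class $u\in\mathscr D(\mathcal E^{\Upsilon,\mu})$ with $\Gamma^{\Upsilon,\mu}(u)\le L^2$ $\mu$-a.e. *)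

theory Defs
  imports "HOL-Probability.Probability"
begin

section \<open>Bilinear forms on \<open>L\<^sup>2\<close>\<close>

text \<open>
  Elements of \<open>L\<^sup>2(M)\<close> are represented by square-integrable functions; equality of classes is
  almost-everywhere equality. A form is a function \<open>E\<close> together with a domain \<open>D\<close>, a set of
  such functions.
\<close>

definition L2 :: "'b measure \<Rightarrow> ('b \<Rightarrow> real) set" where
  "L2 M = {u \<in> borel_measurable M. integrable M (\<lambda>x. (u x)\<^sup>2)}"

definition L2_tendsto :: "'b measure \<Rightarrow> (nat \<Rightarrow> 'b \<Rightarrow> real) \<Rightarrow> ('b \<Rightarrow> real) \<Rightarrow> bool" where
  "L2_tendsto M un u \<longleftrightarrow> (\<lambda>n. \<integral>x. (un n x - u x)\<^sup>2 \<partial>M) \<longlonglongrightarrow> 0"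

definition L2_dense :: "'b measure \<Rightarrow> ('b \<Rightarrow> real) set \<Rightarrow> bool" where
  "L2_dense M D \<longleftrightarrow> D \<subseteq> L2 M \<and> (\<forall>u\<in>L2 M. \<forall>e>0. \<exists>v\<in>D. (\<integral>x. (u x - v x)\<^sup>2 \<partial>M) < e)"

type_synonym 'b form = "('b \<Rightarrow> real) \<Rightarrow> ('b \<Rightarrow> real) \<Rightarrow> real"

text \<open>The squared \<open>E\<^sub>1\<close>-norm.\<close>

definition energy1 :: "'b measure \<Rightarrow> 'b form \<Rightarrow> ('b \<Rightarrow> real) \<Rightarrow> real" where
  "energy1 M E u = E u u + (\<integral>x. (u x)\<^sup>2 \<partial>M)"

definition form_Cauchy :: "'b form \<Rightarrow> (nat \<Rightarrow> 'b \<Rightarrow> real) \<Rightarrow> bool" where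
  "form_Cauchy E un \<longleftrightarrow>
    (\<forall>e>0. \<exists>N. \<forall>i\<ge>N. \<forall>j\<ge>N. E (\<lambda>x. un i x - un j x) (\<lambda>x. un i x - un j x) < e)"

text \<open>
  For sequences of functions that vanish almost everywhere, closability also says that the form
  is well defined on classes.
\<close>

definition closable :: "'b measure \<Rightarrow> 'b form \<Rightarrow> ('b \<Rightarrow> real) set \<Rightarrow> bool" where
  "closable M E D \<longleftrightarrow>
    (\<forall>un. (\<forall>n. un n \<in> D) \<and> form_Cauchy E un \<and> L2_tendsto M un (\<lambda>_. 0)
      \<longrightarrow> (\<lambda>n. E (un n) (un n)) \<longlonglongrightarrow> 0)"

definition approximates ::
  "'b measure \<Rightarrow> 'b form \<Rightarrow> ('b \<Rightarrow> real) set \<Rightarrow> (nat \<Rightarrow> 'b \<Rightarrow> real) \<Rightarrow> ('b \<Rightarrow> real) \<Rightarrow> bool" where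
  "approximates M E D un u \<longleftrightarrow> (\<forall>n. un n \<in> D) \<and> form_Cauchy E un \<and> L2_tendsto M un u"

definition closure_dom :: "'b measure \<Rightarrow> 'b form \<Rightarrow> ('b \<Rightarrow> real) set \<Rightarrow> ('b \<Rightarrow> real) set" where
  "closure_dom M E D = {u \<in> L2 M. \<exists>un. approximates M E D un u}"

definition closure_form :: "'b measure \<Rightarrow> 'b form \<Rightarrow> ('b \<Rightarrow> real) set \<Rightarrow> 'b form" where
  "closure_form M E D u v =
    (THE e. \<forall>un vn. approximates M E D un u \<and> approximates M E D vn v
      \<longrightarrow> (\<lambda>n. E (un n) (vn n)) \<longlonglongrightarrow> e)"

text \<open>
  Extension of a square field operator \<open>G\<close> from \<open>D\<close> to the domain of the closure, by
  \<open>L\<^sup>1\<close>-continuity; it is determined up to null sets.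
\<close>

definition closure_square_field ::
  "'b measure \<Rightarrow> (('b \<Rightarrow> real) \<Rightarrow> ('b \<Rightarrow> real) \<Rightarrow> 'b \<Rightarrow> real) \<Rightarrow> 'b form \<Rightarrow> ('b \<Rightarrow> real) set
    \<Rightarrow> ('b \<Rightarrow> real) \<Rightarrow> ('b \<Rightarrow> real) \<Rightarrow> 'b \<Rightarrow> real" where
  "closure_square_field M G E D u v =
    (SOME h. integrable M h \<and>
      (\<forall>un vn. approximates M E D un u \<and> approximates M E D vn v
        \<longrightarrow> (\<lambda>n. \<integral>\<^sup>+x. ennreal \<bar>G (un n) (vn n) x - h x\<bar> \<partial>M) \<longlonglongrightarrow> 0))"

subsection \<open>Dirichlet forms\<close>

definition Dirichlet_form :: "'b measure \<Rightarrow> 'b form \<Rightarrow> ('b \<Rightarrow> real) set \<Rightarrow> bool" where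
  "Dirichlet_form M E D \<longleftrightarrow>
    \<comment> \<open>a linear space of classes, dense in \<open>L\<^sup>2\<close>\<close>
    L2_dense M D \<and>
    (\<forall>u\<in>D. \<forall>v\<in>L2 M. (AE x in M. u x = v x) \<longrightarrow> v \<in> D \<and> (\<forall>w\<in>D. E u w = E v w)) \<and>
    (\<forall>u\<in>D. \<forall>v\<in>D. \<forall>a b. (\<lambda>x. a * u x + b * v x) \<in> D) \<and>
    \<comment> \<open>bilinear, symmetric, non-negative definite\<close>
    (\<forall>u\<in>D. \<forall>v\<in>D. \<forall>w\<in>D. \<forall>a b. E (\<lambda>x. a * u x + b * v x) w = a * E u w + b * E v w) \<and>
    (\<forall>u\<in>D. \<forall>v\<in>D. E u v = E v u) \<and>
    (\<forall>u\<in>D. 0 \<le> E u u) \<and>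
    \<comment> \<open>closed\<close>
    (\<forall>un. (\<forall>n. un n \<in> D) \<and>
        (\<forall>e>0. \<exists>N. \<forall>i\<ge>N. \<forall>j\<ge>N. energy1 M E (\<lambda>x. un i x - un j x) < e)
      \<longrightarrow> (\<exists>u\<in>D. (\<lambda>n. energy1 M E (\<lambda>x. un n x - u x)) \<longlonglongrightarrow> 0)) \<and>
    \<comment> \<open>Markovian\<close>
    (\<forall>u\<in>D. (\<lambda>x. min 1 (max 0 (u x))) \<in> D \<and>
       E (\<lambda>x. min 1 (max 0 (u x))) (\<lambda>x. min 1 (max 0 (u x))) \<le> E u u)"

definition nest :: "'b topology \<Rightarrow> 'b measure \<Rightarrow> 'b form \<Rightarrow> ('b \<Rightarrow> real) set \<Rightarrow> (nat \<Rightarrow> 'b set) \<Rightarrow> bool"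
  where
  "nest T M E D F \<longleftrightarrow>
    (\<forall>k. closedin T (F k)) \<and> incseq F \<and>
    (\<forall>u\<in>D. \<forall>e>0. \<exists>v\<in>D. (\<exists>k. AE x in M. x \<notin> F k \<longrightarrow> v x = 0) \<and>
       energy1 M E (\<lambda>x. u x - v x) < e)"

definition exceptional :: "'b topology \<Rightarrow> 'b measure \<Rightarrow> 'b form \<Rightarrow> ('b \<Rightarrow> real) set \<Rightarrow> 'b set \<Rightarrow> bool"
  where
  "exceptional T M E D N \<longleftrightarrow> (\<exists>F. nest T M E D F \<and> N \<subseteq> (\<Inter>k. topspace T - F k))"

definition quasi_continuous ::
  "'b topology \<Rightarrow> 'b measure \<Rightarrow> 'b form \<Rightarrow> ('b \<Rightarrow> real) set \<Rightarrow> ('b \<Rightarrow> real) \<Rightarrow> bool" where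
  "quasi_continuous T M E D f \<longleftrightarrow>
    (\<exists>F. nest T M E D F \<and> (\<forall>k. continuous_map (subtopology T (F k)) euclideanreal f))"

text \<open>Quasi-regularity in the sense of Ma and Roeckner.\<close>

definition quasi_regular :: "'b topology \<Rightarrow> 'b measure \<Rightarrow> 'b form \<Rightarrow> ('b \<Rightarrow> real) set \<Rightarrow> bool" where
  "quasi_regular T M E D \<longleftrightarrow>
    (\<exists>F. nest T M E D F \<and> (\<forall>k. compactin T (F k))) \<and>
    (\<exists>A\<subseteq>D. (\<forall>u\<in>D. \<forall>e>0. \<exists>v\<in>A. energy1 M E (\<lambda>x. u x - v x) < e) \<and>
       (\<forall>v\<in>A. \<exists>w. quasi_continuous T M E D w \<and> (AE x in M. w x = v x))) \<and>
    (\<exists>un wn N. (\<forall>n. un n \<in> D \<and> quasi_continuous T M E D (wn n) \<and> (AE x in M. wn n x = un n x)) \<and>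
       exceptional T M E D N \<and>
       (\<forall>x\<in>topspace T - N. \<forall>y\<in>topspace T - N. x \<noteq> y \<longrightarrow> (\<exists>n::nat. wn n x \<noteq> wn n y)))"

text \<open>The \<open>L\<^sup>2\<close>-resolvent, and the semigroup via Hille's exponential formula
  \<open>T\<^sub>t f = lim\<^sub>n (n/t G\<^bsub>n/t\<^esub>)\<^sup>n f\<close>.\<close>

definition resolvent ::
  "'b measure \<Rightarrow> 'b form \<Rightarrow> ('b \<Rightarrow> real) set \<Rightarrow> real \<Rightarrow> ('b \<Rightarrow> real) \<Rightarrow> 'b \<Rightarrow> real" where
  "resolvent M E D \<alpha> f =
    (SOME u. u \<in> D \<and> (\<forall>v\<in>D. E u v + \<alpha> * (\<integral>x. u x * v x \<partial>M) = (\<integral>x. f x * v x \<partial>M)))"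

definition semigroup ::
  "'b measure \<Rightarrow> 'b form \<Rightarrow> ('b \<Rightarrow> real) set \<Rightarrow> real \<Rightarrow> ('b \<Rightarrow> real) \<Rightarrow> 'b \<Rightarrow> real" where
  "semigroup M E D t f =
    (SOME g. g \<in> L2 M \<and>
      L2_tendsto M
        (\<lambda>n. ((\<lambda>h x. (real (Suc n) / t) * resolvent M E D (real (Suc n) / t) h x) ^^ Suc n) f) g)"

text \<open>Only meaningful for finite \<open>M\<close>, where the constants are square integrable.\<close>

definition conservative :: "'b measure \<Rightarrow> 'b form \<Rightarrow> ('b \<Rightarrow> real) set \<Rightarrow> bool" where
  "conservative M E D \<longleftrightarrow> (\<forall>t>0. AE x in M. semigroup M E D t (\<lambda>_. 1) x = 1)"

text \<open>
  Strong locality in its topology-free form (Bouleau and Hirsch; Ambrosio, Gigli and Savare). It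
  contains the case in which \<open>u\<close> is constant on a neighbourhood of the support of \<open>v\<close>.
\<close>

definition strongly_local :: "'b measure \<Rightarrow> 'b form \<Rightarrow> ('b \<Rightarrow> real) set \<Rightarrow> bool" where
  "strongly_local M E D \<longleftrightarrow>
    (\<forall>u\<in>D. \<forall>v\<in>D. \<forall>a. (AE x in M. (u x - a) * v x = 0) \<longrightarrow> E u v = 0)"


section \<open>Bounded smooth functions\<close>

text \<open>
  A function on \<open>\<real>\<^sup>k\<close> is represented by a function of sequences that depends only on the
  coordinates \<open>i < k\<close>. For such functions continuity in the product topology is continuity
  on \<open>\<real>\<^sup>k\<close>.
\<close>

definition partial_deriv :: "nat \<Rightarrow> ((nat \<Rightarrow> real) \<Rightarrow> real) \<Rightarrow> (nat \<Rightarrow> real) \<Rightarrow> real" where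
  "partial_deriv i \<phi> a = deriv (\<lambda>t. \<phi> (a(i := t))) (a i)"

definition Cb_infinity :: "nat \<Rightarrow> ((nat \<Rightarrow> real) \<Rightarrow> real) set" where
  "Cb_infinity k =
    {\<phi>. (\<forall>a b. (\<forall>i<k. a i = b i) \<longrightarrow> \<phi> a = \<phi> b) \<and>
        (\<forall>is. set is \<subseteq> {..<k} \<longrightarrow>
          continuous_on UNIV (foldr partial_deriv is \<phi>) \<and>
          bounded (range (foldr partial_deriv is \<phi>)) \<and>
          (\<forall>i<k. \<forall>a. (\<lambda>t. foldr partial_deriv is \<phi> (a(i := t))) differentiable (at (a i))))}"


section \<open>Metric local diffusion spaces\<close>

text \<open>
  The metric space is a type of class \<open>polish_space\<close>, with \<open>d = dist\<close>. The sigma-algebra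
  \<open>\<Sigma>\<close> is \<open>sets m\<close>.
\<close>

definition bounded_sets :: "'a::metric_space measure \<Rightarrow> 'a set set" where
  "bounded_sets m = {A \<in> sets m. bounded A}"

definition atomless :: "'b measure \<Rightarrow> bool" where
  "atomless m \<longleftrightarrow>
    (\<forall>A\<in>sets m. 0 < emeasure m A \<longrightarrow>
      (\<exists>B\<in>sets m. B \<subseteq> A \<and> 0 < emeasure m B \<and> 0 < emeasure m (A - B)))"

definition Radon :: "'a::topological_space measure \<Rightarrow> bool" where
  "Radon m \<longleftrightarrow>
    (\<forall>K. compact K \<longrightarrow> emeasure m K < \<infinity>) \<and>
    (\<forall>A\<in>sets borel. emeasure m A = (SUP K\<in>{K. compact K \<and> K \<subseteq> A}. emeasure m K))"

definition bounded_functions :: "'b measure \<Rightarrow> ('b \<Rightarrow> real) set" where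
  "bounded_functions m = {f \<in> borel_measurable m. bounded (f ` space m)}"

text \<open>
  Continuous bounded functions vanishing outside a bounded set.
\<close>

definition Cbs :: "('a::metric_space \<Rightarrow> real) set" where
  "Cbs = {f. continuous_on UNIV f \<and> bounded (range f) \<and> bounded {x. f x \<noteq> 0}}"

text \<open>
  \<open>\<Gamma> f g\<close> is a representative of its class, and identities between classes hold almost
  everywhere.
\<close>

locale metric_local_diffusion_space =
  fixes m :: "'a::polish_space measure"
    and D :: "('a \<Rightarrow> real) set"
    and \<Gamma> :: "('a \<Rightarrow> real) \<Rightarrow> ('a \<Rightarrow> real) \<Rightarrow> 'a \<Rightarrow> real"
  assumes space_m: "space m = UNIV"
    and borel_le: "sets borel \<subseteq> sets m"
    and le_completion: "sets m \<subseteq> sets (completion (restr_to_subalg m borel))"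
    and sigma_finite: "sigma_finite_measure m"
    and atomless: "atomless m"
    and Radon: "Radon m"
    and full_support: "\<And>U. open U \<Longrightarrow> U \<noteq> {} \<Longrightarrow> 0 < emeasure m U"
    and finite_bounded: "\<And>A. A \<in> bounded_sets m \<Longrightarrow> emeasure m A < \<infinity>"
    and D_Cbs: "D \<subseteq> Cbs"
    and D_zero: "(\<lambda>_. 0) \<in> D"
    and D_lin: "\<And>f g a b. f \<in> D \<Longrightarrow> g \<in> D \<Longrightarrow> (\<lambda>x. a * f x + b * g x) \<in> D"
    and D_mult: "\<And>f g. f \<in> D \<Longrightarrow> g \<in> D \<Longrightarrow> (\<lambda>x. f x * g x) \<in> D"
    and D_topology: "topology_generated_by {f -` U | f U. f \<in> D \<and> open U} = euclidean"
    and D_comp: "\<And>k f \<phi>. (\<And>i. i < k \<Longrightarrow> f i \<in> D) \<Longrightarrow> \<phi> \<in> Cb_infinity k \<Longrightarrow>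
      (\<lambda>x. \<phi> (\<lambda>i. f i x) - \<phi> (\<lambda>_. 0)) \<in> D"
    and \<Gamma>_bounded: "\<And>f g. f \<in> D \<Longrightarrow> g \<in> D \<Longrightarrow>
      \<Gamma> f g \<in> bounded_functions m \<and> {x. \<Gamma> f g x \<noteq> 0} \<in> bounded_sets m"
    and \<Gamma>_sym: "\<And>f g. f \<in> D \<Longrightarrow> g \<in> D \<Longrightarrow> AE x in m. \<Gamma> f g x = \<Gamma> g f x"
    and \<Gamma>_lin: "\<And>f g h a b. f \<in> D \<Longrightarrow> g \<in> D \<Longrightarrow> h \<in> D \<Longrightarrow>
      AE x in m. \<Gamma> (\<lambda>y. a * f y + b * g y) h x = a * \<Gamma> f h x + b * \<Gamma> g h x"
    and \<Gamma>_nonneg: "\<And>f. f \<in> D \<Longrightarrow> AE x in m. 0 \<le> \<Gamma> f f x"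
    and \<Gamma>_diffusion: "\<And>k l f g \<phi> \<psi>.
      (\<And>i. i < k \<Longrightarrow> f i \<in> D) \<Longrightarrow> (\<And>j. j < l \<Longrightarrow> g j \<in> D) \<Longrightarrow>
      \<phi> \<in> Cb_infinity k \<Longrightarrow> \<psi> \<in> Cb_infinity l \<Longrightarrow>
      AE x in m.
        \<Gamma> (\<lambda>y. \<phi> (\<lambda>i. f i y) - \<phi> (\<lambda>_. 0)) (\<lambda>y. \<psi> (\<lambda>j. g j y) - \<psi> (\<lambda>_. 0)) x =
        (\<Sum>i<k. \<Sum>j<l. partial_deriv i \<phi> (\<lambda>n. f n x) * partial_deriv j \<psi> (\<lambda>n. g n x) *
           \<Gamma> (f i) (g j) x)"
    and base_dense: "L2_dense m D"
    and base_closable: "closable m (\<lambda>f g. \<integral>x. \<Gamma> f g x \<partial>m) D"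
    and base_Dirichlet:
      "Dirichlet_form m (closure_form m (\<lambda>f g. \<integral>x. \<Gamma> f g x \<partial>m) D)
         (closure_dom m (\<lambda>f g. \<integral>x. \<Gamma> f g x \<partial>m) D)"
    and base_quasi_regular:
      "quasi_regular euclidean m (closure_form m (\<lambda>f g. \<integral>x. \<Gamma> f g x \<partial>m) D)
         (closure_dom m (\<lambda>f g. \<integral>x. \<Gamma> f g x \<partial>m) D)"

text \<open>
  A map defined on \<open>L\<^sup>\<infinity>(m)\<close> is a map on bounded measurable functions that is invariant under
  almost-everywhere equality; here this invariance follows from the monotonicity clause.
\<close>

definition strong_lifting ::
  "'a::topological_space measure \<Rightarrow> (('a \<Rightarrow> real) \<Rightarrow> 'a \<Rightarrow> real) \<Rightarrow> bool" where
  "strong_lifting m l \<longleftrightarrow>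
    (\<forall>f\<in>bounded_functions m. l f \<in> bounded_functions m \<and> (AE x in m. l f x = f x)) \<and>
    (\<forall>f\<in>bounded_functions m. \<forall>g\<in>bounded_functions m. (AE x in m. f x \<le> g x) \<longrightarrow> l f \<le> l g) \<and>
    (\<forall>f\<in>bounded_functions m. \<forall>g\<in>bounded_functions m. \<forall>a b.
       l (\<lambda>x. a * f x + b * g x) = (\<lambda>x. a * l f x + b * l g x)) \<and>
    (\<forall>f\<in>bounded_functions m. \<forall>g\<in>bounded_functions m. l (\<lambda>x. f x * g x) = (\<lambda>x. l f x * l g x)) \<and>
    l (\<lambda>_. 1) = (\<lambda>_. 1) \<and>
    (\<forall>f. continuous_on UNIV f \<and> bounded (range f) \<longrightarrow> l f = f)"


section \<open>Configuration spaces\<close>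

text \<open>A configuration is a measure on \<open>\<Sigma>\<close>, a sum of at most countably many Dirac masses.\<close>

definition config_space :: "'a::metric_space measure \<Rightarrow> 'a measure set" where
  "config_space m =
    {\<gamma>. sets \<gamma> = sets m \<and>
      (\<exists>(N::enat) x. \<forall>A\<in>sets m.
         emeasure \<gamma> A = (\<Sum>i. if enat i < N then indicator A (x i) else 0)) \<and>
      (\<forall>A\<in>bounded_sets m. emeasure \<gamma> A < \<infinity>)}"

definition config_algebra :: "'a::metric_space measure \<Rightarrow> 'a measure measure" where
  "config_algebra m =
    sigma (config_space m)
      {{\<gamma> \<in> config_space m. emeasure \<gamma> A \<in> B} | A B. A \<in> bounded_sets m \<and> B \<in> sets borel}"

definition vague_topology :: "'a::metric_space measure \<Rightarrow> 'a measure topology" where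
  "vague_topology m =
    topology_generated_by
      {{\<gamma> \<in> config_space m. (\<integral>x. f x \<partial>\<gamma>) \<in> U} | f U. f \<in> Cbs \<and> open (U::real set)}"

definition cylinder_rep ::
  "'a::metric_space measure \<Rightarrow> ('a \<Rightarrow> real) set \<Rightarrow> ('a measure \<Rightarrow> real) \<Rightarrow>
    nat \<Rightarrow> (nat \<Rightarrow> 'a \<Rightarrow> real) \<Rightarrow> ((nat \<Rightarrow> real) \<Rightarrow> real) \<Rightarrow> bool" where
  "cylinder_rep m D u k f F \<longleftrightarrow>
    F \<in> Cb_infinity k \<and> (\<forall>i<k. f i \<in> D) \<and>
    (\<forall>\<gamma>\<in>config_space m. u \<gamma> = F (\<lambda>i. \<integral>x. f i x \<partial>\<gamma>))"

definition cylinder_functions ::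
  "'a::metric_space measure \<Rightarrow> ('a \<Rightarrow> real) set \<Rightarrow> ('a measure \<Rightarrow> real) set" where
  "cylinder_functions m D = {u. \<exists>k f F. cylinder_rep m D u k f F}"

text \<open>
  The value does not depend on the chosen representations of \<open>u\<close> and \<open>v\<close>, at every
  configuration, by the diffusion property and since the lifting is strong and multiplicative.
\<close>

definition config_square_field ::
  "'a::metric_space measure \<Rightarrow> ('a \<Rightarrow> real) set \<Rightarrow> (('a \<Rightarrow> real) \<Rightarrow> ('a \<Rightarrow> real) \<Rightarrow> 'a \<Rightarrow> real) \<Rightarrow>
    (('a \<Rightarrow> real) \<Rightarrow> 'a \<Rightarrow> real) \<Rightarrow>
    ('a measure \<Rightarrow> real) \<Rightarrow> ('a measure \<Rightarrow> real) \<Rightarrow> 'a measure \<Rightarrow> real" where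
  "config_square_field m D \<Gamma> l u v \<gamma> =
    (THE c. \<exists>k f F k' g G. cylinder_rep m D u k f F \<and> cylinder_rep m D v k' g G \<and>
      c = (\<Sum>i<k. \<Sum>j<k'.
             partial_deriv i F (\<lambda>n. \<integral>x. f n x \<partial>\<gamma>) * partial_deriv j G (\<lambda>n. \<integral>x. g n x \<partial>\<gamma>) *
             (\<integral>x. l (\<Gamma> (f i) (g j)) x \<partial>\<gamma>)))"

definition config_preform ::
  "'a::metric_space measure \<Rightarrow> ('a \<Rightarrow> real) set \<Rightarrow> (('a \<Rightarrow> real) \<Rightarrow> ('a \<Rightarrow> real) \<Rightarrow> 'a \<Rightarrow> real) \<Rightarrow>
    (('a \<Rightarrow> real) \<Rightarrow> 'a \<Rightarrow> real) \<Rightarrow> 'a measure measure \<Rightarrow> 'a measure form" where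
  "config_preform m D \<Gamma> l \<mu> u v = (\<integral>\<gamma>. config_square_field m D \<Gamma> l u v \<gamma> \<partial>\<mu>)"

text \<open>
  A pre-Dirichlet form on \<open>L\<^sup>2(\<mu>)\<close> is densely defined. This has to be said: as \<open>\<Sigma>\<close> may be
  strictly larger than the Borel sigma-algebra and the intensity of \<open>\<mu>\<close> need not be absolutely
  continuous with respect to \<open>m\<close>, the cylinder functions need not be dense in \<open>L\<^sup>2(\<mu>)\<close>.
\<close>

definition closability_assumption ::
  "'a::metric_space measure \<Rightarrow> ('a \<Rightarrow> real) set \<Rightarrow> (('a \<Rightarrow> real) \<Rightarrow> ('a \<Rightarrow> real) \<Rightarrow> 'a \<Rightarrow> real) \<Rightarrow>
    (('a \<Rightarrow> real) \<Rightarrow> 'a \<Rightarrow> real) \<Rightarrow> 'a measure measure \<Rightarrow> bool" where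
  "closability_assumption m D \<Gamma> l \<mu> \<longleftrightarrow>
    (\<forall>A\<in>bounded_sets m. (\<integral>\<^sup>+\<gamma>. emeasure \<gamma> A \<partial>\<mu>) < \<infinity>) \<and>
    L2_dense \<mu> (cylinder_functions m D) \<and>
    closable \<mu> (config_preform m D \<Gamma> l \<mu>) (cylinder_functions m D)"

definition config_dom ::
  "'a::metric_space measure \<Rightarrow> ('a \<Rightarrow> real) set \<Rightarrow> (('a \<Rightarrow> real) \<Rightarrow> ('a \<Rightarrow> real) \<Rightarrow> 'a \<Rightarrow> real) \<Rightarrow>
    (('a \<Rightarrow> real) \<Rightarrow> 'a \<Rightarrow> real) \<Rightarrow> 'a measure measure \<Rightarrow> ('a measure \<Rightarrow> real) set" where
  "config_dom m D \<Gamma> l \<mu> = closure_dom \<mu> (config_preform m D \<Gamma> l \<mu>) (cylinder_functions m D)"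

definition config_form ::
  "'a::metric_space measure \<Rightarrow> ('a \<Rightarrow> real) set \<Rightarrow> (('a \<Rightarrow> real) \<Rightarrow> ('a \<Rightarrow> real) \<Rightarrow> 'a \<Rightarrow> real) \<Rightarrow>
    (('a \<Rightarrow> real) \<Rightarrow> 'a \<Rightarrow> real) \<Rightarrow> 'a measure measure \<Rightarrow> 'a measure form" where
  "config_form m D \<Gamma> l \<mu> = closure_form \<mu> (config_preform m D \<Gamma> l \<mu>) (cylinder_functions m D)"

definition config_closed_square_field ::
  "'a::metric_space measure \<Rightarrow> ('a \<Rightarrow> real) set \<Rightarrow> (('a \<Rightarrow> real) \<Rightarrow> ('a \<Rightarrow> real) \<Rightarrow> 'a \<Rightarrow> real) \<Rightarrow>
    (('a \<Rightarrow> real) \<Rightarrow> 'a \<Rightarrow> real) \<Rightarrow> 'a measure measure \<Rightarrow>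
    ('a measure \<Rightarrow> real) \<Rightarrow> ('a measure \<Rightarrow> real) \<Rightarrow> 'a measure \<Rightarrow> real" where
  "config_closed_square_field m D \<Gamma> l \<mu> =
    closure_square_field \<mu> (config_square_field m D \<Gamma> l) (config_preform m D \<Gamma> l \<mu>)
      (cylinder_functions m D)"

definition couplings :: "'a measure \<Rightarrow> 'a measure \<Rightarrow> 'a measure \<Rightarrow> ('a \<times> 'a) measure set" where
  "couplings m \<gamma> \<eta> =
    {q. sets q = sets (m \<Otimes>\<^sub>M m) \<and> distr q m fst = \<gamma> \<and> distr q m snd = \<eta>}"

text \<open>The root of \<open>c\<close> is the unique \<open>r\<close> with \<open>r\<^sup>2 = c\<close>; the infimum of the empty set is \<open>\<infinity>\<close>.\<close>

definition transport_dist ::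
  "'a::metric_space measure \<Rightarrow> 'a measure \<Rightarrow> 'a measure \<Rightarrow> ennreal" where
  "transport_dist m \<gamma> \<eta> =
    Inf {r. \<exists>q\<in>couplings m \<gamma> \<eta>. r\<^sup>2 = (\<integral>\<^sup>+p. ennreal ((dist (fst p) (snd p))\<^sup>2) \<partial>q)}"

definition transport_Lipschitz ::
  "'a::metric_space measure \<Rightarrow> real \<Rightarrow> ('a measure \<Rightarrow> real) \<Rightarrow> bool" where
  "transport_Lipschitz m L u \<longleftrightarrow> 0 \<le> L \<and>
    (\<forall>\<gamma>\<in>config_space m. \<forall>\<eta>\<in>config_space m. transport_dist m \<gamma> \<eta> < \<infinity> \<longrightarrow>
       \<bar>u \<gamma> - u \<eta>\<bar> \<le> L * enn2real (transport_dist m \<gamma> \<eta>))"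

text \<open>
  Functions measurable for the completion of \<open>\<mu>\<close> have a \<open>\<mu>\<close>-measurable version \<open>u\<close>, which
  represents their class.
\<close>

definition Rademacher_property ::
  "'a::metric_space measure \<Rightarrow> ('a \<Rightarrow> real) set \<Rightarrow> (('a \<Rightarrow> real) \<Rightarrow> ('a \<Rightarrow> real) \<Rightarrow> 'a \<Rightarrow> real) \<Rightarrow>
    (('a \<Rightarrow> real) \<Rightarrow> 'a \<Rightarrow> real) \<Rightarrow> 'a measure measure \<Rightarrow> bool" where
  "Rademacher_property m D \<Gamma> l \<mu> \<longleftrightarrow>
    (\<forall>v L. v \<in> bounded_functions (completion \<mu>) \<and> transport_Lipschitz m L v \<longrightarrow>
      (\<exists>u\<in>config_dom m D \<Gamma> l \<mu>. (AE \<gamma> in \<mu>. u \<gamma> = v \<gamma>) \<and>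
        (AE \<gamma> in \<mu>. config_closed_square_field m D \<Gamma> l \<mu> u u \<gamma> \<le> L\<^sup>2)))"

end

theory Submission
  imports Defs
begin

text \<open>
  The Dirichlet form, its conservativeness and its strong locality only use closability and the chain
  rule; the Rademacher property is used for quasi-regularity.

  \<^emph>\<open>Abstract forms.\<close> Let \<open>E u v = \<integral> G u v\<close> be closable on a linear space of bounded functions that is
  stable under certain smooth functions.
  Everything rests on one compactness principle: a sequence of bounded energy that converges in
  \<open>L\<^sup>2\<close> has its limit in the domain of the closure, and convex combinations of it converge in the
  norm of the domain (\<open>bounded_energy_limit\<close>, by the parallelogram law). Applied to
  \<open>(u\<^sup>2 + e\<^sup>2)\<^bsup>1/2\<^esup>\<close>, it shows that \<open>\<bar>u\<bar>\<close> is in the domain and has at most the energy of \<open>u\<close>, which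
  gives the lattice operations and the Markov property. The operator \<open>G\<close> extends to the domain by
  \<open>L\<^sup>1\<close>-continuity. The functions \<open>e u / (u\<^sup>2 + e\<^sup>2)\<^bsup>1/2\<^esup>\<close> converge weakly to \<open>0\<close> as \<open>e \<rightarrow> 0\<close>, while
  their derivatives converge to the indicator of \<open>{u = 0}\<close>; hence the extension of \<open>G u v\<close> has integral
  \<open>0\<close> over \<open>{u = 0}\<close> (\<open>Gc_zero_set\<close>), and strong locality follows. The form is conservative because
  the constant \<open>1\<close> is in the domain and has no energy.

  \<^emph>\<open>Cylinder functions.\<close> The square field operator of two cylinder functions at a configuration
  \<open>\<gamma> = \<Sum>\<^sub>i \<delta>\<^bsub>x i\<^esub>\<close> is a sum over the points of \<open>\<gamma>\<close>. The contribution of \<open>x i\<close> is the value at \<open>x i\<close>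
  of the lifting of \<open>\<Gamma> h k\<close>, where \<open>h\<close> and \<open>k\<close> are the increments of the two functions when a point
  \<open>y\<close> is added to \<open>\<gamma> - \<delta>\<^bsub>x i\<^esub>\<close>, as functions of \<open>y\<close> (\<open>local_field_rep\<close>). So the operator does not
  depend on the representations, and the properties of \<open>\<Gamma>\<close> pass to it. This makes the abstract results
  applicable (\<open>config_preform_diffusion\<close>).

  \<^emph>\<open>Quasi-regularity.\<close> For a Lipschitz function \<open>g\<close> of bounded support, \<open>\<gamma> \<mapsto> (\<integral> g\<^sup>2 d\<gamma>)\<^bsup>1/2\<^esup>\<close> is Lipschitz
  for the transport distance, with the same constant (\<open>root_star_coupling\<close>), and continuous for the
  vague topology. Countably many truncations of such functions separate the configurations. With \<open>g\<close>
  the distance to the first \<open>n + 1\<close> points of a dense sequence, slightly increased, truncated and localised,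
  one gets
  \<open>2\<close>-Lipschitz functions that decrease to \<open>0\<close> as \<open>n \<rightarrow> \<infinity>\<close>. By the Rademacher property their energies are
  bounded, so convex combinations of them tend to \<open>0\<close> in the domain. A weighted series of these
  combinations yields cut-off functions (\<open>nest_of_decreasing\<close>), and so a nest of sets on which the
  functions are uniformly small. Such sets are vaguely compact (\<open>sublevel_compact\<close>): the number of
  points in a ball is bounded there and these points stay in a compact set, which makes the set of
  configurations a closed subset of the continuous image of a product of compact spaces
  (\<open>vague_relatively_compact\<close>).
\<close>

section \<open>Semi-inner products on spaces of functions\<close>

text \<open>
  A non-negative definite symmetric bilinear form \<open>Q\<close> on a linear space \<open>V\<close> of functions. The
  \<open>L\<^sup>2\<close>-product, the given form, its closure and the \<open>E\<^sub>1\<close>-product are all of this kind.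
\<close>

locale semi_inner =
  fixes V :: "('b \<Rightarrow> real) set" and Q :: "'b form"
  assumes lin: "\<And>u v a b. u \<in> V \<Longrightarrow> v \<in> V \<Longrightarrow> (\<lambda>x. a * u x + b * v x) \<in> V"
    and Q_lin: "\<And>u v w a b. u \<in> V \<Longrightarrow> v \<in> V \<Longrightarrow> w \<in> V \<Longrightarrow>
      Q (\<lambda>x. a * u x + b * v x) w = a * Q u w + b * Q v w"
    and Q_sym: "\<And>u v. u \<in> V \<Longrightarrow> v \<in> V \<Longrightarrow> Q u v = Q v u"
    and Q_nonneg: "\<And>u. u \<in> V \<Longrightarrow> 0 \<le> Q u u"
begin

text \<open>The seminorm of \<open>Q\<close>.\<close>

definition nrm :: "('b \<Rightarrow> real) \<Rightarrow> real" where
  "nrm u = sqrt (Q u u)"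

lemma add: "u \<in> V \<Longrightarrow> v \<in> V \<Longrightarrow> (\<lambda>x. u x + v x) \<in> V"
  using lin[of u v 1 1] by simp

lemma diff: "u \<in> V \<Longrightarrow> v \<in> V \<Longrightarrow> (\<lambda>x. u x - v x) \<in> V"
  using lin[of u v 1 "-1"] by simp

lemma scale: "u \<in> V \<Longrightarrow> (\<lambda>x. a * u x) \<in> V"
  using lin[of u u a 0] by simp

lemma Q_lin2: "u \<in> V \<Longrightarrow> v \<in> V \<Longrightarrow> w \<in> V \<Longrightarrow>
    Q w (\<lambda>x. a * u x + b * v x) = a * Q w u + b * Q w v"
  using Q_lin[of u v w a b] lin[of u v a b] by (simp add: Q_sym)

lemma Q_add: "u \<in> V \<Longrightarrow> v \<in> V \<Longrightarrow> w \<in> V \<Longrightarrow> Q (\<lambda>x. u x + v x) w = Q u w + Q v w"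
  using Q_lin[of u v w 1 1] by simp

lemma Q_add2: "u \<in> V \<Longrightarrow> v \<in> V \<Longrightarrow> w \<in> V \<Longrightarrow> Q w (\<lambda>x. u x + v x) = Q w u + Q w v"
  using Q_lin2[of u v w 1 1] by simp

lemma Q_diff: "u \<in> V \<Longrightarrow> v \<in> V \<Longrightarrow> w \<in> V \<Longrightarrow> Q (\<lambda>x. u x - v x) w = Q u w - Q v w"
  using Q_lin[of u v w 1 "-1"] by simp

lemma Q_diff2: "u \<in> V \<Longrightarrow> v \<in> V \<Longrightarrow> w \<in> V \<Longrightarrow> Q w (\<lambda>x. u x - v x) = Q w u - Q w v"
  using Q_lin2[of u v w 1 "-1"] by simp

lemma Q_scale: "u \<in> V \<Longrightarrow> w \<in> V \<Longrightarrow> Q (\<lambda>x. a * u x) w = a * Q u w"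
  using Q_lin[of u u w a 0] by simp

lemma Q_scale2: "u \<in> V \<Longrightarrow> w \<in> V \<Longrightarrow> Q w (\<lambda>x. a * u x) = a * Q w u"
  using Q_lin2[of u u w a 0] by simp

lemma nrm_nonneg [simp]: "u \<in> V \<Longrightarrow> 0 \<le> nrm u"
  by (simp add: nrm_def Q_nonneg)

lemma nrm_sq: "u \<in> V \<Longrightarrow> (nrm u)\<^sup>2 = Q u u"
  by (simp add: nrm_def Q_nonneg)

lemma Cauchy_Schwarz_sq:
  assumes u: "u \<in> V" and v: "v \<in> V"
  shows "(Q u v)\<^sup>2 \<le> Q u u * Q v v"
proof -
  have pos: "0 \<le> a\<^sup>2 * Q u u + 2 * a * b * Q u v + b\<^sup>2 * Q v v" for a b
  proof -
    have "Q (\<lambda>x. a * u x + b * v x) (\<lambda>x. a * u x + b * v x)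
        = a\<^sup>2 * Q u u + 2 * a * b * Q u v + b\<^sup>2 * Q v v"
      using u v Q_sym[OF v u] lin[OF u v]
      by (simp add: Q_lin Q_lin2 power2_eq_square algebra_simps)
    with Q_nonneg[OF lin[OF u v]] show ?thesis by metis
  qed
  show ?thesis
  proof (cases "Q v v = 0")
    case True
    have "Q u v = 0"
    proof (rule ccontr)
      assume ne: "Q u v \<noteq> 0"
      show False
        using pos[of 1 "- (Q u u + 1) / (2 * Q u v)"] ne True by (simp add: field_simps)
    qed
    then show ?thesis using True by simp
  next
    case False
    with Q_nonneg[OF v] have p: "0 < Q v v" by simp
    have "0 \<le> (Q v v)\<^sup>2 * Q u u + 2 * Q v v * (- Q u v) * Q u v + (- Q u v)\<^sup>2 * Q v v"
      using pos[of "Q v v" "- Q u v"] .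
    also have "\<dots> = Q v v * (Q u u * Q v v - (Q u v)\<^sup>2)"
      by (simp add: power2_eq_square algebra_simps)
    finally show ?thesis using p by (simp add: zero_le_mult_iff)
  qed
qed

lemma Cauchy_Schwarz: "u \<in> V \<Longrightarrow> v \<in> V \<Longrightarrow> \<bar>Q u v\<bar> \<le> nrm u * nrm v"
proof -
  assume a: "u \<in> V" "v \<in> V"
  have "sqrt ((Q u v)\<^sup>2) \<le> sqrt (Q u u * Q v v)"
    using Cauchy_Schwarz_sq[OF a] by (rule real_sqrt_le_mono)
  then show ?thesis by (simp add: nrm_def real_sqrt_mult)
qed

lemma nrm_triangle:
  assumes u: "u \<in> V" and v: "v \<in> V"
  shows "nrm (\<lambda>x. u x + v x) \<le> nrm u + nrm v"
proof -
  have "(nrm (\<lambda>x. u x + v x))\<^sup>2 = Q u u + 2 * Q u v + Q v v"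
    using u v Q_sym[OF v u] add[OF u v] by (simp add: nrm_sq Q_add Q_add2)
  also have "\<dots> \<le> (nrm u + nrm v)\<^sup>2"
    using Cauchy_Schwarz[OF u v] u v by (simp add: nrm_sq power2_sum)
  finally show ?thesis
    by (rule power2_le_imp_le) (simp add: u v)
qed

lemma nrm_scale: "u \<in> V \<Longrightarrow> nrm (\<lambda>x. a * u x) = \<bar>a\<bar> * nrm u"
  using scale[of u a] by (simp add: nrm_def Q_scale Q_scale2 real_sqrt_mult flip: mult.assoc)

lemma nrm_minus: "u \<in> V \<Longrightarrow> v \<in> V \<Longrightarrow> nrm (\<lambda>x. u x - v x) = nrm (\<lambda>x. v x - u x)"
  using nrm_scale[OF diff[of u v], of "-1"] by simp

lemma nrm_triangle3:
  assumes "u \<in> V" "v \<in> V" "w \<in> V"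
  shows "nrm (\<lambda>x. u x - w x) \<le> nrm (\<lambda>x. u x - v x) + nrm (\<lambda>x. v x - w x)"
  using nrm_triangle[OF diff[OF assms(1,2)] diff[OF assms(2,3)]] by simp

lemma nrm_rev_triangle:
  assumes u: "u \<in> V" and v: "v \<in> V"
  shows "\<bar>nrm u - nrm v\<bar> \<le> nrm (\<lambda>x. u x - v x)"
  using nrm_triangle[OF diff[OF u v] v] nrm_triangle[OF diff[OF v u] u] nrm_minus[OF u v]
  by simp

lemma parallelogram:
  assumes u: "u \<in> V" and v: "v \<in> V"
  shows "Q (\<lambda>x. u x - v x) (\<lambda>x. u x - v x) + Q (\<lambda>x. u x + v x) (\<lambda>x. u x + v x)
    = 2 * Q u u + 2 * Q v v"
  using u v Q_sym[OF v u] add[OF u v] diff[OF u v]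
  by (simp add: Q_add Q_add2 Q_diff Q_diff2)

lemma nrm_diff_tendsto_iff:
  assumes "\<And>n. un n \<in> V" "u \<in> V"
  shows "(\<lambda>n. nrm (\<lambda>x. un n x - u x)) \<longlonglongrightarrow> 0 \<longleftrightarrow>
    (\<lambda>n. Q (\<lambda>x. un n x - u x) (\<lambda>x. un n x - u x)) \<longlonglongrightarrow> 0"
proof
  assume "(\<lambda>n. nrm (\<lambda>x. un n x - u x)) \<longlonglongrightarrow> 0"
  from tendsto_power[OF this, of 2]
  show "(\<lambda>n. Q (\<lambda>x. un n x - u x) (\<lambda>x. un n x - u x)) \<longlonglongrightarrow> 0"
    using assms by (simp add: nrm_sq diff)
next
  assume "(\<lambda>n. Q (\<lambda>x. un n x - u x) (\<lambda>x. un n x - u x)) \<longlonglongrightarrow> 0"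
  from tendsto_real_sqrt[OF this] show "(\<lambda>n. nrm (\<lambda>x. un n x - u x)) \<longlonglongrightarrow> 0"
    by (simp add: nrm_def)
qed

lemma nrm_tendsto:
  assumes V: "\<And>n. un n \<in> V" "u \<in> V"
    and lim: "(\<lambda>n. nrm (\<lambda>x. un n x - u x)) \<longlonglongrightarrow> 0"
  shows "(\<lambda>n. nrm (un n)) \<longlonglongrightarrow> nrm u"
proof -
  have "(\<lambda>n. nrm (un n) - nrm u) \<longlonglongrightarrow> 0"
    by (rule Lim_null_comparison[OF _ lim]) (simp add: nrm_rev_triangle V)
  then show ?thesis by (simp add: LIM_zero_iff)
qed

lemma Q_diff_bound:
  assumes V: "u \<in> V" "v \<in> V" "u' \<in> V" "v' \<in> V"
  shows "\<bar>Q u v - Q u' v'\<bar> \<le> nrm (\<lambda>x. u x - u' x) * nrm v + nrm u' * nrm (\<lambda>x. v x - v' x)"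
proof -
  have "Q u v - Q u' v' = Q (\<lambda>x. u x - u' x) v + Q u' (\<lambda>x. v x - v' x)"
    using V by (simp add: Q_diff Q_diff2)
  then show ?thesis
    using Cauchy_Schwarz[OF diff[OF V(1,3)] V(2)] Cauchy_Schwarz[OF V(3) diff[OF V(2,4)]] by linarith
qed

lemma Q_tendsto:
  assumes V: "\<And>n. un n \<in> V" "u \<in> V" "\<And>n. vn n \<in> V" "v \<in> V"
    and u: "(\<lambda>n. nrm (\<lambda>x. un n x - u x)) \<longlonglongrightarrow> 0"
    and v: "(\<lambda>n. nrm (\<lambda>x. vn n x - v x)) \<longlonglongrightarrow> 0"
  shows "(\<lambda>n. Q (un n) (vn n)) \<longlonglongrightarrow> Q u v"
proof -
  have "(\<lambda>n. nrm (\<lambda>x. un n x - u x) * nrm (vn n) + nrm u * nrm (\<lambda>x. vn n x - v x))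
      \<longlonglongrightarrow> 0 * nrm v + nrm u * 0"
    by (intro tendsto_intros u v nrm_tendsto V)
  then have "(\<lambda>n. nrm (\<lambda>x. un n x - u x) * nrm (vn n) + nrm u * nrm (\<lambda>x. vn n x - v x))
      \<longlonglongrightarrow> 0" by simp
  then have "(\<lambda>n. Q (un n) (vn n) - Q u v) \<longlonglongrightarrow> 0"
    by (rule Lim_null_comparison[rotated]) (use Q_diff_bound V in auto)
  then show ?thesis by (simp add: LIM_zero_iff)
qed

lemma form_Cauchy_iff_nrm:
  assumes V: "\<And>n. un n \<in> V"
  shows "form_Cauchy Q un \<longleftrightarrow> (\<forall>e>0. \<exists>N. \<forall>i\<ge>N. \<forall>j\<ge>N. nrm (\<lambda>x. un i x - un j x) < e)"
proof
  assume c: "form_Cauchy Q un"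
  show "\<forall>e>0. \<exists>N. \<forall>i\<ge>N. \<forall>j\<ge>N. nrm (\<lambda>x. un i x - un j x) < e"
  proof (intro allI impI)
    fix e :: real assume "e > 0"
    then have "e\<^sup>2 > 0" by simp
    with c obtain N where
      "\<forall>i\<ge>N. \<forall>j\<ge>N. Q (\<lambda>x. un i x - un j x) (\<lambda>x. un i x - un j x) < e\<^sup>2"
      unfolding form_Cauchy_def by metis
    then have "\<forall>i\<ge>N. \<forall>j\<ge>N. nrm (\<lambda>x. un i x - un j x) < e"
      using \<open>e > 0\<close> real_sqrt_less_mono[of _ "e\<^sup>2"] unfolding nrm_def by fastforce
    then show "\<exists>N. \<forall>i\<ge>N. \<forall>j\<ge>N. nrm (\<lambda>x. un i x - un j x) < e" ..
  qed
next
  assume c: "\<forall>e>0. \<exists>N. \<forall>i\<ge>N. \<forall>j\<ge>N. nrm (\<lambda>x. un i x - un j x) < e"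
  show "form_Cauchy Q un"
    unfolding form_Cauchy_def
  proof (intro allI impI)
    fix e :: real assume "e > 0"
    then have "sqrt e > 0" by simp
    with c obtain N where N: "\<forall>i\<ge>N. \<forall>j\<ge>N. nrm (\<lambda>x. un i x - un j x) < sqrt e" by blast
    have "\<forall>i\<ge>N. \<forall>j\<ge>N. Q (\<lambda>x. un i x - un j x) (\<lambda>x. un i x - un j x) < e"
      using N unfolding nrm_def by (simp add: real_sqrt_less_iff)
    then show "\<exists>N. \<forall>i\<ge>N. \<forall>j\<ge>N. Q (\<lambda>x. un i x - un j x) (\<lambda>x. un i x - un j x) < e" ..
  qed
qed

lemma form_Cauchy_nrm_bounded:
  assumes V: "\<And>n. un n \<in> V" and c: "form_Cauchy Q un"
  obtains B where "B > 0" "\<And>n. nrm (un n) \<le> B"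
proof -
  from c[unfolded form_Cauchy_iff_nrm[OF V]] obtain N where
    N: "\<And>i j. i \<ge> N \<Longrightarrow> j \<ge> N \<Longrightarrow> nrm (\<lambda>x. un i x - un j x) < 1"
    by (meson zero_less_one)
  define B where "B = (\<Sum>n\<le>N. nrm (un n)) + 1"
  have s: "nrm (un n) \<le> (\<Sum>n\<le>N. nrm (un n))" if "n \<le> N" for n
    using that V by (intro member_le_sum) auto
  have "nrm (un n) \<le> B" for n
  proof (cases "n \<le> N")
    case True then show ?thesis using s[OF True] unfolding B_def by simp
  next
    case False
    then have "nrm (\<lambda>x. un n x - un N x) < 1" using N by simp
    then show ?thesis using nrm_rev_triangle[OF V V, of n N] s[of N] unfolding B_def by simp
  qed
  moreover have "B > 0" unfolding B_def by (intro add_nonneg_pos sum_nonneg) (use V in auto)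
  ultimately show ?thesis using that by blast
qed

lemma form_Cauchy_lin:
  assumes V: "\<And>n. un n \<in> V" "\<And>n. vn n \<in> V" and c: "form_Cauchy Q un" "form_Cauchy Q vn"
  shows "form_Cauchy Q (\<lambda>n x. a * un n x + b * vn n x)"
  unfolding form_Cauchy_iff_nrm[OF lin[OF V]]
proof (intro allI impI)
  fix e :: real assume "e > 0"
  define d where "d = e / (\<bar>a\<bar> + \<bar>b\<bar> + 1)"
  have d: "d > 0" using \<open>e > 0\<close> unfolding d_def by (simp add: add_nonneg_pos)
  from c[unfolded form_Cauchy_iff_nrm[OF V(1)] form_Cauchy_iff_nrm[OF V(2)]] d
  obtain N1 N2 where N1: "\<And>i j. i \<ge> N1 \<Longrightarrow> j \<ge> N1 \<Longrightarrow> nrm (\<lambda>x. un i x - un j x) < d"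
    and N2: "\<And>i j. i \<ge> N2 \<Longrightarrow> j \<ge> N2 \<Longrightarrow> nrm (\<lambda>x. vn i x - vn j x) < d"
    by meson
  show "\<exists>N. \<forall>i\<ge>N. \<forall>j\<ge>N.
      nrm (\<lambda>x. (a * un i x + b * vn i x) - (a * un j x + b * vn j x)) < e"
  proof (intro exI[of _ "max N1 N2"] allI impI)
    fix i j assume ij: "max N1 N2 \<le> i" "max N1 N2 \<le> j"
    have "nrm (\<lambda>x. (a * un i x + b * vn i x) - (a * un j x + b * vn j x))
        = nrm (\<lambda>x. a * (un i x - un j x) + b * (vn i x - vn j x))"
      by (simp add: algebra_simps)
    also have "\<dots> \<le> \<bar>a\<bar> * nrm (\<lambda>x. un i x - un j x) + \<bar>b\<bar> * nrm (\<lambda>x. vn i x - vn j x)"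
      using nrm_triangle[OF scale[OF diff[OF V(1) V(1), of i j], of a]
          scale[OF diff[OF V(2) V(2), of i j], of b]]
        nrm_scale[OF diff[OF V(1) V(1), of i j], of a] nrm_scale[OF diff[OF V(2) V(2), of i j], of b]
      by simp
    also have "\<dots> \<le> \<bar>a\<bar> * d + \<bar>b\<bar> * d"
      using N1[of i j] N2[of i j] ij by (intro add_mono mult_left_mono) auto
    also have "\<dots> < (\<bar>a\<bar> + \<bar>b\<bar> + 1) * d" using d by (simp add: algebra_simps)
    also have "\<dots> = e"
      using add_nonneg_pos[of "\<bar>a\<bar> + \<bar>b\<bar>" 1] unfolding d_def by (simp add: field_simps)
    finally show "nrm (\<lambda>x. (a * un i x + b * vn i x) - (a * un j x + b * vn j x)) < e" .
  qed
qed

lemma Q_convergent: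
  assumes V: "\<And>n. un n \<in> V" "\<And>n. vn n \<in> V" and c: "form_Cauchy Q un" "form_Cauchy Q vn"
  shows "convergent (\<lambda>n. Q (un n) (vn n))"
proof -
  obtain B1 where B1: "B1 > 0" "\<And>n. nrm (un n) \<le> B1"
    using form_Cauchy_nrm_bounded[OF V(1) c(1)] by blast
  obtain B2 where B2: "B2 > 0" "\<And>n. nrm (vn n) \<le> B2"
    using form_Cauchy_nrm_bounded[OF V(2) c(2)] by blast
  have "Cauchy (\<lambda>n. Q (un n) (vn n))"
  proof (rule CauchyI)
    fix e :: real assume "e > 0"
    define d where "d = e / (B1 + B2)"
    have d: "d > 0" using \<open>e > 0\<close> B1 B2 unfolding d_def by simp
    from c[unfolded form_Cauchy_iff_nrm[OF V(1)] form_Cauchy_iff_nrm[OF V(2)]] d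
    obtain N1 N2 where N1: "\<And>i j. i \<ge> N1 \<Longrightarrow> j \<ge> N1 \<Longrightarrow> nrm (\<lambda>x. un i x - un j x) < d"
      and N2: "\<And>i j. i \<ge> N2 \<Longrightarrow> j \<ge> N2 \<Longrightarrow> nrm (\<lambda>x. vn i x - vn j x) < d"
      by meson
    show "\<exists>M. \<forall>i\<ge>M. \<forall>j\<ge>M. norm (Q (un i) (vn i) - Q (un j) (vn j)) < e"
    proof (intro exI[of _ "max N1 N2"] allI impI)
      fix i j assume ij: "max N1 N2 \<le> i" "max N1 N2 \<le> j"
      have "\<bar>Q (un i) (vn i) - Q (un j) (vn j)\<bar>
          \<le> nrm (\<lambda>x. un i x - un j x) * nrm (vn i) + nrm (un j) * nrm (\<lambda>x. vn i x - vn j x)"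
        by (rule Q_diff_bound) (use V in auto)
      also have "\<dots> \<le> nrm (\<lambda>x. un i x - un j x) * B2 + B1 * nrm (\<lambda>x. vn i x - vn j x)"
        using B1 B2 V by (intro add_mono mult_left_mono mult_right_mono) (auto simp: diff)
      also have "\<dots> < d * B2 + B1 * d"
        using N1[of i j] N2[of i j] ij B1 B2 by (intro add_strict_mono mult_strict_right_mono mult_strict_left_mono) auto
      also have "\<dots> = (B1 + B2) * d" by (simp add: algebra_simps)
      also have "\<dots> = e" using B1(1) B2(1) unfolding d_def by simp
      finally show "norm (Q (un i) (vn i) - Q (un j) (vn j)) < e" by simp
    qed
  qed
  then show ?thesis by (simp add: Cauchy_convergent_iff)
qed

lemma nrm_sum_le:
  assumes "finite S" "\<And>i. i \<in> S \<Longrightarrow> a i \<in> V" "(\<lambda>_. 0) \<in> V"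
  shows "(\<lambda>x. \<Sum>i\<in>S. a i x) \<in> V \<and> nrm (\<lambda>x. \<Sum>i\<in>S. a i x) \<le> (\<Sum>i\<in>S. nrm (a i))"
  using assms(1,2)
proof (induction S rule: finite_induct)
  case empty
  show ?case using nrm_scale[OF assms(3), of 0] assms(3) by simp
next
  case (insert i S)
  then show ?case
    using nrm_triangle[of "a i" "\<lambda>x. \<Sum>i\<in>S. a i x"] add[of "a i" "\<lambda>x. \<Sum>i\<in>S. a i x"] by simp
qed

end


section \<open>Completeness of \<open>L\<^sup>1\<close> and \<open>L\<^sup>2\<close>\<close>

lemma L2_mult_integrable:
  assumes "u \<in> L2 M" "v \<in> L2 M"
  shows "integrable M (\<lambda>x. u x * v x)"
proof (rule Bochner_Integration.integrable_bound)
  have [measurable]: "u \<in> borel_measurable M" "v \<in> borel_measurable M"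
    using assms by (auto simp: L2_def)
  show "integrable M (\<lambda>x. (u x)\<^sup>2 + (v x)\<^sup>2)" using assms by (auto simp: L2_def)
  show "(\<lambda>x. u x * v x) \<in> borel_measurable M" by measurable
  show "AE x in M. norm (u x * v x) \<le> norm ((u x)\<^sup>2 + (v x)\<^sup>2)"
  proof (intro AE_I2)
    fix x
    have "0 \<le> (\<bar>u x\<bar> - \<bar>v x\<bar>)\<^sup>2" by simp
    then have "2 * (\<bar>u x\<bar> * \<bar>v x\<bar>) \<le> (u x)\<^sup>2 + (v x)\<^sup>2"
      by (simp add: power2_diff algebra_simps)
    moreover have "0 \<le> \<bar>u x\<bar> * \<bar>v x\<bar>" by simp
    ultimately show "norm (u x * v x) \<le> norm ((u x)\<^sup>2 + (v x)\<^sup>2)"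
      by (simp only: real_norm_def abs_mult abs_of_nonneg[OF add_nonneg_nonneg[OF zero_le_power2 zero_le_power2]])
  qed
qed

lemma L2_lin:
  assumes "u \<in> L2 M" "v \<in> L2 M"
  shows "(\<lambda>x. a * u x + b * v x) \<in> L2 M"
proof -
  have [measurable]: "u \<in> borel_measurable M" "v \<in> borel_measurable M"
    using assms by (auto simp: L2_def)
  have eq: "(\<lambda>x. (a * u x + b * v x)\<^sup>2)
      = (\<lambda>x. a\<^sup>2 * (u x)\<^sup>2 + (2 * a * b) * (u x * v x) + b\<^sup>2 * (v x)\<^sup>2)"
    by (auto simp: power2_eq_square algebra_simps)
  have "integrable M (\<lambda>x. (a * u x + b * v x)\<^sup>2)"
    unfolding eq using assms L2_mult_integrable[OF assms] by (auto simp: L2_def)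
  then show ?thesis by (simp add: L2_def)
qed

lemma L2_diff: "u \<in> L2 M \<Longrightarrow> v \<in> L2 M \<Longrightarrow> (\<lambda>x. u x - v x) \<in> L2 M"
  using L2_lin[of u M v 1 "-1"] by simp

lemma L2_square_integrable: "u \<in> L2 M \<Longrightarrow> integrable M (\<lambda>x. (u x)\<^sup>2)"
  by (simp add: L2_def)

text \<open>The square of the seminorm \<open>L2.nrm M\<close> of this interpretation is the integral of the square.\<close>

interpretation L2: semi_inner "L2 M" "\<lambda>u v. \<integral>x. u x * v x \<partial>M" for M
proof
  fix u v w :: "'a \<Rightarrow> real" and a b
  assume "u \<in> L2 M" "v \<in> L2 M" "w \<in> L2 M"
  then show "(\<integral>x. (a * u x + b * v x) * w x \<partial>M)
      = a * (\<integral>x. u x * w x \<partial>M) + b * (\<integral>x. v x * w x \<partial>M)"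
    using L2_mult_integrable[of u M w] L2_mult_integrable[of v M w]
    by (simp add: ring_distribs mult.assoc)
qed (auto intro: L2_lin simp: mult.commute)

lemma L2_tendsto_iff_nrm:
  assumes "\<And>n. un n \<in> L2 M" "u \<in> L2 M"
  shows "L2_tendsto M un u \<longleftrightarrow> (\<lambda>n. L2.nrm M (\<lambda>x. un n x - u x)) \<longlonglongrightarrow> 0"
  using L2.nrm_diff_tendsto_iff[OF assms] by (simp add: L2_tendsto_def power2_eq_square)

lemma L2_nrm_eq: "L2.nrm M u = sqrt (\<integral>x. (u x)\<^sup>2 \<partial>M)"
  by (simp add: L2.nrm_def power2_eq_square)

lemma L2_tendsto_lin:
  assumes "\<And>n. un n \<in> L2 M" "u \<in> L2 M" "\<And>n. vn n \<in> L2 M" "v \<in> L2 M"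
    and "L2_tendsto M un u" "L2_tendsto M vn v"
  shows "L2_tendsto M (\<lambda>n x. a * un n x + b * vn n x) (\<lambda>x. a * u x + b * v x)"
proof -
  have u: "(\<lambda>n. L2.nrm M (\<lambda>x. un n x - u x)) \<longlonglongrightarrow> 0"
    and v: "(\<lambda>n. L2.nrm M (\<lambda>x. vn n x - v x)) \<longlonglongrightarrow> 0"
    using assms by (simp_all add: L2_tendsto_iff_nrm)
  have "(\<lambda>n. \<bar>a\<bar> * L2.nrm M (\<lambda>x. un n x - u x) + \<bar>b\<bar> * L2.nrm M (\<lambda>x. vn n x - v x))
      \<longlonglongrightarrow> \<bar>a\<bar> * 0 + \<bar>b\<bar> * 0"
    by (intro tendsto_intros u v)
  then have lim: "(\<lambda>n. \<bar>a\<bar> * L2.nrm M (\<lambda>x. un n x - u x) + \<bar>b\<bar> * L2.nrm M (\<lambda>x. vn n x - v x))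
      \<longlonglongrightarrow> 0" by simp
  have "(\<lambda>n. L2.nrm M (\<lambda>x. (a * un n x + b * vn n x) - (a * u x + b * v x))) \<longlonglongrightarrow> 0"
  proof (rule Lim_null_comparison[OF _ lim], intro always_eventually allI)
    fix n
    have d: "(\<lambda>x. un n x - u x) \<in> L2 M" "(\<lambda>x. vn n x - v x) \<in> L2 M"
      using assms by (auto intro: L2_diff)
    have "L2.nrm M (\<lambda>x. (a * un n x + b * vn n x) - (a * u x + b * v x))
        = L2.nrm M (\<lambda>x. a * (un n x - u x) + b * (vn n x - v x))"
      by (simp add: algebra_simps)
    also have "\<dots> \<le> \<bar>a\<bar> * L2.nrm M (\<lambda>x. un n x - u x) + \<bar>b\<bar> * L2.nrm M (\<lambda>x. vn n x - v x)"
      using L2.nrm_triangle[OF L2.scale[OF d(1), of a] L2.scale[OF d(2), of b]]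
        L2.nrm_scale[OF d(1), of a] L2.nrm_scale[OF d(2), of b] by simp
    finally show "norm (L2.nrm M (\<lambda>x. (a * un n x + b * vn n x) - (a * u x + b * v x)))
      \<le> \<bar>a\<bar> * L2.nrm M (\<lambda>x. un n x - u x) + \<bar>b\<bar> * L2.nrm M (\<lambda>x. vn n x - v x)"
      using L2.nrm_nonneg[OF L2_diff[OF L2_lin L2_lin, of "un n" M "vn n" u v a b a b]] assms
      by simp
  qed
  then show ?thesis
    using assms by (subst L2_tendsto_iff_nrm) (auto intro: L2_lin)
qed

text \<open>Fatou's lemma for real-valued functions, with a bound on the integrals.\<close>

lemma integral_le_of_AE_tendsto:
  fixes f :: "nat \<Rightarrow> 'b \<Rightarrow> real"
  assumes int: "\<And>n. integrable M (f n)" and nn: "\<And>n x. 0 \<le> f n x"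
    and g: "g \<in> borel_measurable M" "\<And>x. 0 \<le> g x"
    and lim: "AE x in M. (\<lambda>n. f n x) \<longlonglongrightarrow> g x"
    and bd: "\<And>n. (\<integral>x. f n x \<partial>M) \<le> C"
  shows "integrable M g \<and> (\<integral>x. g x \<partial>M) \<le> C"
proof -
  have C: "0 \<le> C" using bd[of 0] Bochner_Integration.integral_nonneg[of M "f 0"] nn by (smt (verit))
  have [measurable]: "f n \<in> borel_measurable M" for n using int by auto
  note g(1)[measurable]
  have "(\<integral>\<^sup>+x. ennreal (g x) \<partial>M) = (\<integral>\<^sup>+x. liminf (\<lambda>n. ennreal (f n x)) \<partial>M)"
  proof (rule nn_integral_cong_AE)
    show "AE x in M. ennreal (g x) = liminf (\<lambda>n. ennreal (f n x))"
      using lim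
    proof eventually_elim
      case (elim x)
      then have "(\<lambda>n. ennreal (f n x)) \<longlonglongrightarrow> ennreal (g x)" by (rule tendsto_ennrealI)
      then show ?case by (simp add: lim_imp_Liminf)
    qed
  qed
  also have "\<dots> \<le> liminf (\<lambda>n. \<integral>\<^sup>+x. ennreal (f n x) \<partial>M)"
    by (rule nn_integral_liminf) simp
  also have "\<dots> \<le> ennreal C"
    using bd nn int C
    by (intro Liminf_le) (auto intro!: always_eventually simp: nn_integral_eq_integral ennreal_leI)
  finally have le: "(\<integral>\<^sup>+x. ennreal (g x) \<partial>M) \<le> ennreal C" .
  have i: "integrable M g"
    using le g by (intro integrableI_nonneg) (auto simp: less_top[symmetric] top_unique)
  then have "ennreal (\<integral>x. g x \<partial>M) \<le> ennreal C"
    using le g by (simp add: nn_integral_eq_integral)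
  then show ?thesis using i C by simp
qed

lemma L1_complete:
  fixes f :: "nat \<Rightarrow> 'b \<Rightarrow> real"
  assumes int: "\<And>n. integrable M (f n)"
    and c: "\<And>e. e > 0 \<Longrightarrow> \<exists>N. \<forall>i\<ge>N. \<forall>j\<ge>N. (\<integral>x. \<bar>f i x - f j x\<bar> \<partial>M) < e"
  obtains h where "integrable M h" "(\<lambda>n. \<integral>x. \<bar>f n x - h x\<bar> \<partial>M) \<longlonglongrightarrow> 0"
proof -
  obtain r where r: "strict_mono r" and cau: "AE x in M. Cauchy (\<lambda>i. f (r i) x)"
    by (rule cauchy_L1_AE_cauchy_subseq[of M f]) (use int c in auto)
  have [measurable]: "f n \<in> borel_measurable M" for n using int by auto
  define h where "h x = lim (\<lambda>i. f (r i) x)" for x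
  have hm [measurable]: "h \<in> borel_measurable M" unfolding h_def by measurable
  have lim: "AE x in M. (\<lambda>i. f (r i) x) \<longlonglongrightarrow> h x"
    using cau by eventually_elim (simp add: h_def Cauchy_convergent_iff convergent_LIMSEQ_iff)
  have key: "integrable M (\<lambda>x. \<bar>f n x - h x\<bar>) \<and> (\<integral>x. \<bar>f n x - h x\<bar> \<partial>M) \<le> e"
    if N: "\<forall>i\<ge>N. \<forall>j\<ge>N. (\<integral>x. \<bar>f i x - f j x\<bar> \<partial>M) < e" and n: "n \<ge> N" for n N e
  proof (rule integral_le_of_AE_tendsto[where f = "\<lambda>k x. \<bar>f n x - f (r (k + N)) x\<bar>"])
    show "AE x in M. (\<lambda>k. \<bar>f n x - f (r (k + N)) x\<bar>) \<longlonglongrightarrow> \<bar>f n x - h x\<bar>"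
      using lim
    proof eventually_elim
      case (elim x)
      then have "(\<lambda>k. f (r (k + N)) x) \<longlonglongrightarrow> h x" by (rule LIMSEQ_ignore_initial_segment)
      then show ?case by (intro tendsto_intros)
    qed
    show "(\<integral>x. \<bar>f n x - f (r (k + N)) x\<bar> \<partial>M) \<le> e" for k
      using N n seq_suble[OF r, of "k + N"] by (meson le_add2 le_trans less_imp_le)
  qed (use int in auto)
  have ih: "integrable M h"
  proof -
    obtain N where "\<forall>i\<ge>N. \<forall>j\<ge>N. (\<integral>x. \<bar>f i x - f j x\<bar> \<partial>M) < 1" using c[of 1] by auto
    from key[OF this order_refl] have "integrable M (\<lambda>x. \<bar>f N x - h x\<bar>)" by simp
    then have "integrable M (\<lambda>x. f N x - h x)"
      by (subst (asm) integrable_abs_iff) auto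
    from Bochner_Integration.integrable_diff[OF int[of N] this] show ?thesis by simp
  qed
  have "(\<lambda>n. \<integral>x. \<bar>f n x - h x\<bar> \<partial>M) \<longlonglongrightarrow> 0"
  proof (rule LIMSEQ_I)
    fix e :: real assume "e > 0"
    then have "e / 2 > 0" by simp
    from c[OF this] obtain N where N: "\<forall>i\<ge>N. \<forall>j\<ge>N. (\<integral>x. \<bar>f i x - f j x\<bar> \<partial>M) < e / 2" by auto
    have "norm ((\<integral>x. \<bar>f n x - h x\<bar> \<partial>M) - 0) < e" if "n \<ge> N" for n
      using key[OF N that] \<open>e > 0\<close> by simp
    then show "\<exists>no. \<forall>n\<ge>no. norm ((\<integral>x. \<bar>f n x - h x\<bar> \<partial>M) - 0) < e" by blast
  qed
  with ih that show ?thesis by blast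
qed

lemma (in prob_space) L2_imp_integrable: "u \<in> L2 M \<Longrightarrow> integrable M u"
  by (rule square_integrable_imp_integrable) (auto simp: L2_def)

lemma (in prob_space) bounded_imp_L2:
  assumes "u \<in> borel_measurable M" "AE x in M. \<bar>u x\<bar> \<le> c"
  shows "u \<in> L2 M"
  unfolding L2_def
proof (intro CollectI conjI assms(1) integrable_const_bound[where B = "c\<^sup>2"])
  show "AE x in M. norm ((u x)\<^sup>2) \<le> c\<^sup>2"
    using assms(2) by eventually_elim (simp add: abs_le_square_iff[symmetric])
qed (use assms(1) in measurable)

lemma (in prob_space) L1_le_L2:
  assumes u: "u \<in> L2 M"
  shows "(\<integral>x. \<bar>u x\<bar> \<partial>M) \<le> L2.nrm M u"
proof -
  have a: "(\<lambda>x. \<bar>u x\<bar>) \<in> L2 M" using u by (auto simp: L2_def)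
  have o: "(\<lambda>x. 1) \<in> L2 M" by (auto simp: L2_def)
  show ?thesis
    using L2.Cauchy_Schwarz[OF a o] by (simp add: L2.nrm_def prob_space)
qed

lemma (in prob_space) L2_tendsto_AE_subseq:
  assumes u: "\<And>n. un n \<in> L2 M" "u \<in> L2 M" and lim: "L2_tendsto M un u"
  obtains r where "strict_mono (r :: nat \<Rightarrow> nat)" "AE x in M. (\<lambda>n. un (r n) x) \<longlonglongrightarrow> u x"
proof -
  have d: "(\<lambda>x. un n x - u x) \<in> L2 M" for n using u by (auto intro: L2_diff)
  have l: "(\<lambda>n. L2.nrm M (\<lambda>x. un n x - u x)) \<longlonglongrightarrow> 0"
    using lim L2_tendsto_iff_nrm[OF u] by simp
  have l1: "(\<lambda>n. \<integral>x. norm (un n x - u x) \<partial>M) \<longlonglongrightarrow> 0"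
    by (rule Lim_null_comparison[OF _ l]) (use L1_le_L2[OF d] in auto)
  from tendsto_L1_AE_subseq[OF L2_imp_integrable[OF d] l1]
  obtain r where r: "strict_mono r" "AE x in M. (\<lambda>n. un (r n) x - u x) \<longlonglongrightarrow> 0" by blast
  from r(2) have "AE x in M. (\<lambda>n. un (r n) x) \<longlonglongrightarrow> u x"
    by eventually_elim (simp add: LIM_zero_iff)
  with r(1) that show ?thesis by blast
qed

text \<open>A Cauchy sequence in \<open>L\<^sup>2\<close> is Cauchy in \<open>L\<^sup>1\<close>, as the measure is finite. Hence a subsequence
  converges almost everywhere, and Fatou's lemma identifies its limit as the limit in \<open>L\<^sup>2\<close>.\<close>

lemma (in prob_space) L2_complete:
  assumes u: "\<And>n. un n \<in> L2 M"
    and c: "\<And>e. e > 0 \<Longrightarrow> \<exists>N. \<forall>i\<ge>N. \<forall>j\<ge>N. (\<integral>x. (un i x - un j x)\<^sup>2 \<partial>M) < e"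
  obtains u where "u \<in> L2 M" "L2_tendsto M un u"
proof -
  have d: "(\<lambda>x. un i x - un j x) \<in> L2 M" for i j using u by (auto intro: L2_diff)
  have [measurable]: "un n \<in> borel_measurable M" for n using u by (simp add: L2_def)
  have "\<exists>N. \<forall>i\<ge>N. \<forall>j\<ge>N. (\<integral>x. norm (un i x - un j x) \<partial>M) < e" if "e > 0" for e :: real
  proof -
    have "e\<^sup>2 > 0" using that by simp
    from c[OF this] obtain N where N: "\<forall>i\<ge>N. \<forall>j\<ge>N. (\<integral>x. (un i x - un j x)\<^sup>2 \<partial>M) < e\<^sup>2" by auto
    have "(\<integral>x. norm (un i x - un j x) \<partial>M) < e" if "i \<ge> N" "j \<ge> N" for i j
    proof -
      have "L2.nrm M (\<lambda>x. un i x - un j x) < sqrt (e\<^sup>2)"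
        unfolding L2_nrm_eq using N that by (intro real_sqrt_less_mono) auto
      then show ?thesis using L1_le_L2[OF d, of i j] \<open>e > 0\<close> by simp
    qed
    then show ?thesis by blast
  qed
  then obtain r where r: "strict_mono r" and cau: "AE x in M. Cauchy (\<lambda>i. un (r i) x)"
    using cauchy_L1_AE_cauchy_subseq[of M un, OF L2_imp_integrable[OF u]] by metis
  define h where "h x = lim (\<lambda>i. un (r i) x)" for x
  have hm [measurable]: "h \<in> borel_measurable M" unfolding h_def by measurable
  have lim: "AE x in M. (\<lambda>i. un (r i) x) \<longlonglongrightarrow> h x"
    using cau by eventually_elim (simp add: h_def Cauchy_convergent_iff convergent_LIMSEQ_iff)
  have key: "integrable M (\<lambda>x. (un n x - h x)\<^sup>2) \<and> (\<integral>x. (un n x - h x)\<^sup>2 \<partial>M) \<le> e"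
    if N: "\<forall>i\<ge>N. \<forall>j\<ge>N. (\<integral>x. (un i x - un j x)\<^sup>2 \<partial>M) < e" and n: "n \<ge> N" for n N e
  proof (rule integral_le_of_AE_tendsto[where f = "\<lambda>k x. (un n x - un (r (k + N)) x)\<^sup>2"])
    show "AE x in M. (\<lambda>k. (un n x - un (r (k + N)) x)\<^sup>2) \<longlonglongrightarrow> (un n x - h x)\<^sup>2"
      using lim
    proof eventually_elim
      case (elim x)
      then have "(\<lambda>k. un (r (k + N)) x) \<longlonglongrightarrow> h x" by (rule LIMSEQ_ignore_initial_segment)
      then show ?case by (intro tendsto_intros)
    qed
    show "(\<integral>x. (un n x - un (r (k + N)) x)\<^sup>2 \<partial>M) \<le> e" for k
      using N n seq_suble[OF r, of "k + N"] by (meson le_add2 le_trans less_imp_le)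
  qed (use L2_square_integrable[OF d] in auto)
  have hL2: "h \<in> L2 M"
  proof -
    obtain N where "\<forall>i\<ge>N. \<forall>j\<ge>N. (\<integral>x. (un i x - un j x)\<^sup>2 \<partial>M) < 1" using c[of 1] by auto
    from key[OF this order_refl] have "(\<lambda>x. un N x - h x) \<in> L2 M" by (simp add: L2_def)
    from L2_diff[OF u[of N] this] show ?thesis by simp
  qed
  have "L2_tendsto M un h"
    unfolding L2_tendsto_def
  proof (rule LIMSEQ_I)
    fix e :: real assume "e > 0"
    then have "e / 2 > 0" by simp
    from c[OF this] obtain N where N: "\<forall>i\<ge>N. \<forall>j\<ge>N. (\<integral>x. (un i x - un j x)\<^sup>2 \<partial>M) < e / 2" by auto
    have "norm ((\<integral>x. (un n x - h x)\<^sup>2 \<partial>M) - 0) < e" if "n \<ge> N" for n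
      using key[OF N that] \<open>e > 0\<close> by simp
    then show "\<exists>no. \<forall>n\<ge>no. norm ((\<integral>x. (un n x - h x)\<^sup>2 \<partial>M) - 0) < e" by blast
  qed
  with hL2 that show ?thesis by blast
qed

lemma L2_tendsto_unique:
  assumes "\<And>n. un n \<in> L2 M" "u \<in> L2 M" "v \<in> L2 M" "L2_tendsto M un u" "L2_tendsto M un v"
  shows "AE x in M. u x = v x"
proof -
  have "L2_tendsto M (\<lambda>n x. 1 * un n x + (-1) * un n x) (\<lambda>x. 1 * u x + (-1) * v x)"
    by (rule L2_tendsto_lin) (use assms in auto)
  then have "(\<integral>x. (u x - v x)\<^sup>2 \<partial>M) = 0"
    by (simp add: L2_tendsto_def LIMSEQ_const_iff power2_commute)
  then have "AE x in M. (u x - v x)\<^sup>2 = 0"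
    using L2_square_integrable[OF L2_diff[OF assms(2,3)]]
    by (subst (asm) integral_nonneg_eq_0_iff_AE) auto
  then show ?thesis by eventually_elim simp
qed

context prob_space
begin

lemma L2_tendsto_comparison:
  assumes w: "\<And>n. wn n \<in> L2 M" "w \<in> L2 M" and u: "\<And>n. un n \<in> L2 M" "u \<in> L2 M"
    and lim: "L2_tendsto M un u" and d: "d \<longlonglongrightarrow> (0::real)"
    and le: "\<And>n x. x \<in> space M \<Longrightarrow> \<bar>wn n x - w x\<bar> \<le> \<bar>un n x - u x\<bar> + d n"
  shows "L2_tendsto M wn w"
  unfolding L2_tendsto_def
proof (rule Lim_null_comparison)
  have "(\<lambda>n. 2 * (\<integral>x. (un n x - u x)\<^sup>2 \<partial>M) + 2 * (d n)\<^sup>2) \<longlonglongrightarrow> 2 * 0 + 2 * 0\<^sup>2"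
    by (intro tendsto_intros d lim[unfolded L2_tendsto_def])
  then show "(\<lambda>n. 2 * (\<integral>x. (un n x - u x)\<^sup>2 \<partial>M) + 2 * (d n)\<^sup>2) \<longlonglongrightarrow> 0" by simp
  show "\<forall>\<^sub>F n in sequentially. norm (\<integral>x. (wn n x - w x)\<^sup>2 \<partial>M)
      \<le> 2 * (\<integral>x. (un n x - u x)\<^sup>2 \<partial>M) + 2 * (d n)\<^sup>2"
  proof (intro always_eventually allI)
    fix n
    have i: "integrable M (\<lambda>x. (un n x - u x)\<^sup>2)"
      using L2_square_integrable[OF L2_diff[OF u]] .
    have "(\<integral>x. (wn n x - w x)\<^sup>2 \<partial>M) \<le> (\<integral>x. 2 * (un n x - u x)\<^sup>2 + 2 * (d n)\<^sup>2 \<partial>M)"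
    proof (rule integral_mono)
      fix x assume "x \<in> space M"
      then have "(wn n x - w x)\<^sup>2 \<le> (\<bar>un n x - u x\<bar> + d n)\<^sup>2"
        using le[of x n] by (metis abs_ge_zero power2_abs power_mono)
      also have "\<dots> \<le> 2 * (un n x - u x)\<^sup>2 + 2 * (d n)\<^sup>2"
      proof -
        have "2 * (un n x - u x)\<^sup>2 + 2 * (d n)\<^sup>2 - (\<bar>un n x - u x\<bar> + d n)\<^sup>2 = (\<bar>un n x - u x\<bar> - d n)\<^sup>2"
          by (simp only: power2_sum power2_diff[of "\<bar>un n x - u x\<bar>"] power2_abs)
        then show ?thesis using zero_le_power2[of "\<bar>un n x - u x\<bar> - d n"] by linarith
      qed
      finally show "(wn n x - w x)\<^sup>2 \<le> 2 * (un n x - u x)\<^sup>2 + 2 * (d n)\<^sup>2" .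
    qed (use i L2_square_integrable[OF L2_diff[OF w]] in auto)
    then show "norm (\<integral>x. (wn n x - w x)\<^sup>2 \<partial>M) \<le> 2 * (\<integral>x. (un n x - u x)\<^sup>2 \<partial>M) + 2 * (d n)\<^sup>2"
      using i by (simp add: prob_space)
  qed
qed

lemma L2_tendsto_bounded:
  assumes w: "\<And>n. wn n \<in> borel_measurable M" "w \<in> borel_measurable M"
    and bd: "\<And>n. AE x in M. \<bar>wn n x - w x\<bar> \<le> c"
    and lim: "AE x in M. (\<lambda>n. wn n x) \<longlonglongrightarrow> w x"
  shows "L2_tendsto M wn w"
proof -
  note w[measurable]
  have "(\<lambda>n. \<integral>x. (wn n x - w x)\<^sup>2 \<partial>M) \<longlonglongrightarrow> (\<integral>x. 0 \<partial>M)"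
  proof (rule integral_dominated_convergence[where w = "\<lambda>_. c\<^sup>2"])
    show "AE x in M. (\<lambda>n. (wn n x - w x)\<^sup>2) \<longlonglongrightarrow> 0"
      using lim
    proof eventually_elim
      case (elim x)
      then have "(\<lambda>n. (wn n x - w x)\<^sup>2) \<longlonglongrightarrow> (w x - w x)\<^sup>2" by (intro tendsto_intros)
      then show ?case by simp
    qed
    show "AE x in M. norm ((wn n x - w x)\<^sup>2) \<le> c\<^sup>2" for n
      using bd[of n]
    proof eventually_elim
      case (elim x)
      then have "\<bar>wn n x - w x\<bar>\<^sup>2 \<le> c\<^sup>2" by (intro power_mono) auto
      then show ?case by simp
    qed
  qed simp_all
  then show ?thesis by (simp add: L2_tendsto_def)
qed

end


section \<open>Convex combinations of bounded sequences\<close>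

text \<open>The convex hull of a set of functions.\<close>

inductive_set cvx :: "('b \<Rightarrow> real) set \<Rightarrow> ('b \<Rightarrow> real) set" for W where
  base: "w \<in> W \<Longrightarrow> w \<in> cvx W"
| step: "u \<in> cvx W \<Longrightarrow> v \<in> cvx W \<Longrightarrow> 0 \<le> t \<Longrightarrow> t \<le> 1 \<Longrightarrow>
    (\<lambda>x. t * u x + (1 - t) * v x) \<in> cvx W"

lemma cvx_induct_prop:
  assumes "u \<in> cvx W" "\<And>w. w \<in> W \<Longrightarrow> P w"
    and "\<And>u v t. P u \<Longrightarrow> P v \<Longrightarrow> 0 \<le> t \<Longrightarrow> t \<le> 1 \<Longrightarrow> P (\<lambda>x. t * u x + (1 - t) * v x)"
  shows "P u"
  using assms(1) by induction (use assms(2,3) in blast)+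

lemma cvx_mono: "W \<subseteq> W' \<Longrightarrow> cvx W \<subseteq> cvx W'"
proof
  fix u assume "W \<subseteq> W'" "u \<in> cvx W"
  from this(2,1) show "u \<in> cvx W'" by induction (auto intro: cvx.intros)
qed

context semi_inner
begin

lemma nrm_zero: "u \<in> V \<Longrightarrow> nrm (\<lambda>_. 0) = 0"
  using nrm_scale[of u 0] by simp

lemma cvx_ball:
  assumes "u \<in> cvx W" "\<And>w. w \<in> W \<Longrightarrow> w \<in> V \<and> nrm (\<lambda>x. w x - z x) \<le> e" and z: "z \<in> V"
  shows "u \<in> V \<and> nrm (\<lambda>x. u x - z x) \<le> e"
proof (rule cvx_induct_prop[OF assms(1,2)])
  fix u v :: "'b \<Rightarrow> real" and t :: real
  assume u: "u \<in> V \<and> nrm (\<lambda>x. u x - z x) \<le> e" and v: "v \<in> V \<and> nrm (\<lambda>x. v x - z x) \<le> e"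
    and t: "0 \<le> t" "t \<le> 1"
  have "nrm (\<lambda>x. t * u x + (1 - t) * v x - z x)
      = nrm (\<lambda>x. t * (u x - z x) + (1 - t) * (v x - z x))"
    by (simp add: algebra_simps)
  also have "\<dots> \<le> t * nrm (\<lambda>x. u x - z x) + (1 - t) * nrm (\<lambda>x. v x - z x)"
    using nrm_triangle[OF scale[OF diff[OF _ z], of u t] scale[OF diff[OF _ z], of v "1 - t"]]
      nrm_scale[OF diff[OF _ z], of u t] nrm_scale[OF diff[OF _ z], of v "1 - t"] u v t by simp
  also have "\<dots> \<le> t * e + (1 - t) * e"
    using u v t by (intro add_mono mult_left_mono) auto
  also have "t * e + (1 - t) * e = e" by (simp add: algebra_simps)
  finally show "(\<lambda>x. t * u x + (1 - t) * v x) \<in> V \<and> nrm (\<lambda>x. t * u x + (1 - t) * v x - z x) \<le> e"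
    using u v by (simp add: lin)
qed

text \<open>
  The elements of almost minimal norm in the convex hulls of the tails of a bounded sequence form
  a Cauchy sequence, by the parallelogram law.
\<close>

lemma convex_Cauchy:
  assumes V: "\<And>n. wn n \<in> V" and z: "(\<lambda>_. 0) \<in> V" and B: "\<And>n. nrm (wn n) \<le> B"
  obtains vn where "\<And>n. vn n \<in> cvx (wn ` {n..})" "form_Cauchy Q vn"
proof -
  define K where "K n = cvx (wn ` {n..})" for n :: nat
  have B0: "0 \<le> B" using B[of 0] nrm_nonneg[OF V[of 0]] by linarith
  have KV: "u \<in> V" and KB: "nrm u \<le> B" if "u \<in> K n" for u n
    using cvx_ball[of u "wn ` {n..}" "\<lambda>_. 0" B] that V B z unfolding K_def by auto
  have QB: "Q u u \<le> B\<^sup>2" if "u \<in> K n" for u n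
    using KB[OF that] KV[OF that] by (metis nrm_nonneg nrm_sq power_mono)
  define d where "d n = (INF u\<in>K n. Q u u)" for n
  have ne: "K n \<noteq> {}" for n
    using cvx.base[of "wn n" "wn ` {n..}"] unfolding K_def by auto
  have bb: "bdd_below ((\<lambda>u. Q u u) ` K n)" for n
    by (rule bdd_belowI[of _ 0]) (use KV Q_nonneg in auto)
  have dle: "d n \<le> Q u u" if "u \<in> K n" for u n
    unfolding d_def by (rule cINF_lower[OF bb that])
  have dB: "d n \<le> B\<^sup>2" for n
    using ne[of n] dle[of _ n] QB[of _ n] by (meson all_not_in_conv order_trans)
  have Kmono: "K n \<subseteq> K k" if "k \<le> n" for k n
    unfolding K_def by (rule cvx_mono) (use that in auto)
  have dmono: "incseq d"
    unfolding incseq_def d_def by (intro allI impI cINF_superset_mono ne bb Kmono) auto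
  have "\<exists>v. v \<in> K n \<and> Q v v < d n + 1 / Suc n" for n
  proof -
    have "(INF u\<in>K n. Q u u) < d n + 1 / Suc n" unfolding d_def[symmetric] by simp
    then show ?thesis by (subst (asm) cINF_less_iff[OF ne bb]) auto
  qed
  then obtain vn where vn: "\<And>n. vn n \<in> K n" "\<And>n. Q (vn n) (vn n) < d n + 1 / Suc n" by metis
  obtain L where L: "d \<longlonglongrightarrow> L"
    using incseq_convergent[OF dmono, of "B\<^sup>2"] dB by blast
  have step: "Q (\<lambda>x. vn i x - vn j x) (\<lambda>x. vn i x - vn j x) \<le> 2 * \<bar>d j - d i\<bar> + 4 * (1 / Suc k)"
    if "k \<le> i" "i \<le> j" for i j k
  proof -
    have vi: "vn i \<in> V" and vj: "vn j \<in> V" using vn KV by auto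
    have "(\<lambda>x. (1/2) * vn i x + (1 - 1/2) * vn j x) \<in> K i"
      using vn(1)[of i] vn(1)[of j] Kmono[OF that(2)] unfolding K_def by (intro cvx.step) auto
    from dle[OF this] have "d i \<le> Q (\<lambda>x. (1/2) * (vn i x + vn j x)) (\<lambda>x. (1/2) * (vn i x + vn j x))"
      by (simp add: algebra_simps)
    also have "\<dots> = (1/2) * ((1/2) * Q (\<lambda>x. vn i x + vn j x) (\<lambda>x. vn i x + vn j x))"
      by (simp only: Q_scale[OF add[OF vi vj] scale[OF add[OF vi vj]]]
          Q_scale2[OF add[OF vi vj] add[OF vi vj]])
    finally have "4 * d i \<le> Q (\<lambda>x. vn i x + vn j x) (\<lambda>x. vn i x + vn j x)" by simp
    moreover have "1 / real (Suc i) \<le> 1 / Suc k" "1 / real (Suc j) \<le> 1 / Suc k"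
      using that by (auto intro!: divide_left_mono)
    ultimately show ?thesis
      using parallelogram[OF vi vj] vn(2)[of i] vn(2)[of j] abs_ge_self[of "d j - d i"]
      by (simp del: of_nat_Suc)
  qed
  have "form_Cauchy Q vn"
    unfolding form_Cauchy_def
  proof (intro allI impI)
    fix e :: real assume e: "e > 0"
    have "Cauchy d" using L by (simp add: LIMSEQ_imp_Cauchy)
    then obtain N1 where N1: "\<And>i j. i \<ge> N1 \<Longrightarrow> j \<ge> N1 \<Longrightarrow> \<bar>d i - d j\<bar> < e / 4"
      using CauchyD[of d "e / 4"] e by (auto simp: real_norm_def)
    obtain N2 where N2: "8 / e < real N2" using reals_Archimedean2 by blast
    define N where "N = max N1 N2"
    have "real (Suc N) > 8 / e" using N2 unfolding N_def by (simp add: of_nat_max)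
    then have N3: "4 * (1 / real (Suc N)) < e / 2" using e by (simp add: field_simps)
    have le: "Q (\<lambda>x. vn i x - vn j x) (\<lambda>x. vn i x - vn j x) < e"
      if "N \<le> i" "i \<le> j" for i j
      using step[OF that] N1[of j i] that N3 unfolding N_def by auto
    have "Q (\<lambda>x. vn i x - vn j x) (\<lambda>x. vn i x - vn j x) < e" if "N \<le> i" "N \<le> j" for i j
    proof (cases "i \<le> j")
      case True then show ?thesis using le that by simp
    next
      case False
      have "Q (\<lambda>x. vn i x - vn j x) (\<lambda>x. vn i x - vn j x)
          = Q (\<lambda>x. vn j x - vn i x) (\<lambda>x. vn j x - vn i x)"
        using nrm_minus[of "vn i" "vn j"] KV[OF vn(1)] nrm_sq[OF diff] by metis
      then show ?thesis using le[of j i] that False by simp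
    qed
    then show "\<exists>N. \<forall>i\<ge>N. \<forall>j\<ge>N. Q (\<lambda>x. vn i x - vn j x) (\<lambda>x. vn i x - vn j x) < e" by blast
  qed
  with vn(1) that show ?thesis unfolding K_def by blast
qed

end


section \<open>Closable forms with a square field operator\<close>

text \<open>
  A closable form \<open>E u v = \<integral> G u v\<close> on a dense space of bounded functions in \<open>L\<^sup>2\<close> of a
  probability space. The diffusion property is only recorded for the two families of smooth
  functions \<open>t \<mapsto> (t\<^sup>2 + e\<^sup>2)\<^bsup>1/2\<^esup>\<close> and \<open>t \<mapsto> e t / (t\<^sup>2 + e\<^sup>2)\<^bsup>1/2\<^esup>\<close>; as \<open>e \<rightarrow> 0\<close>, the first converges
  to the absolute value, and the derivative of the second to the indicator of \<open>{0}\<close>.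
\<close>

locale diffusion_preform = prob_space M
  for M :: "'b measure" +
  fixes D0 :: "('b \<Rightarrow> real) set" and G :: "('b \<Rightarrow> real) \<Rightarrow> ('b \<Rightarrow> real) \<Rightarrow> 'b \<Rightarrow> real"
  assumes D0_dense: "L2_dense M D0"
    and D0_lin: "\<And>u v a b. u \<in> D0 \<Longrightarrow> v \<in> D0 \<Longrightarrow> (\<lambda>x. a * u x + b * v x) \<in> D0"
    and D0_one: "(\<lambda>_. 1) \<in> D0"
    and D0_bounded: "\<And>u. u \<in> D0 \<Longrightarrow> \<exists>c. \<forall>x\<in>space M. \<bar>u x\<bar> \<le> c"
    and G_int: "\<And>u v. u \<in> D0 \<Longrightarrow> v \<in> D0 \<Longrightarrow> integrable M (G u v)"
    and G_lin: "\<And>u v w a b x. u \<in> D0 \<Longrightarrow> v \<in> D0 \<Longrightarrow> w \<in> D0 \<Longrightarrow> x \<in> space M \<Longrightarrow>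
      G (\<lambda>x. a * u x + b * v x) w x = a * G u w x + b * G v w x"
    and G_sym: "\<And>u v x. u \<in> D0 \<Longrightarrow> v \<in> D0 \<Longrightarrow> x \<in> space M \<Longrightarrow> G u v x = G v u x"
    and G_nonneg: "\<And>u x. u \<in> D0 \<Longrightarrow> x \<in> space M \<Longrightarrow> 0 \<le> G u u x"
    and G_one: "\<And>v x. v \<in> D0 \<Longrightarrow> x \<in> space M \<Longrightarrow> G (\<lambda>_. 1) v x = 0"
    and D0_sqrt: "\<And>u e. u \<in> D0 \<Longrightarrow> 0 < e \<Longrightarrow> (\<lambda>x. sqrt ((u x)\<^sup>2 + e\<^sup>2)) \<in> D0"
    and G_sqrt: "\<And>u v e x. u \<in> D0 \<Longrightarrow> v \<in> D0 \<Longrightarrow> 0 < e \<Longrightarrow> x \<in> space M \<Longrightarrow>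
      G (\<lambda>x. sqrt ((u x)\<^sup>2 + e\<^sup>2)) v x = u x / sqrt ((u x)\<^sup>2 + e\<^sup>2) * G u v x"
    and D0_trunc: "\<And>u e. u \<in> D0 \<Longrightarrow> 0 < e \<Longrightarrow> (\<lambda>x. e * u x / sqrt ((u x)\<^sup>2 + e\<^sup>2)) \<in> D0"
    and G_trunc: "\<And>u v e x. u \<in> D0 \<Longrightarrow> v \<in> D0 \<Longrightarrow> 0 < e \<Longrightarrow> x \<in> space M \<Longrightarrow>
      G (\<lambda>x. e * u x / sqrt ((u x)\<^sup>2 + e\<^sup>2)) v x = (e / sqrt ((u x)\<^sup>2 + e\<^sup>2)) ^ 3 * G u v x"
    and closable_form: "closable M (\<lambda>u v. \<integral>x. G u v x \<partial>M) D0"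
begin

text \<open>The form, the domain of its closure, and the closure. A sequence \<open>un\<close> with \<open>app un u\<close> exhibits
  \<open>u\<close> as an element of the domain.\<close>

abbreviation E :: "'b form" where
  "E \<equiv> (\<lambda>u v. \<integral>x. G u v x \<partial>M)"

abbreviation dom :: "('b \<Rightarrow> real) set" where
  "dom \<equiv> closure_dom M E D0"

abbreviation EE :: "'b form" where
  "EE \<equiv> closure_form M E D0"

abbreviation app :: "(nat \<Rightarrow> 'b \<Rightarrow> real) \<Rightarrow> ('b \<Rightarrow> real) \<Rightarrow> bool" where
  "app \<equiv> approximates M E D0"

lemma D0_L2: "u \<in> D0 \<Longrightarrow> u \<in> L2 M"
  using D0_dense by (auto simp: L2_dense_def)

lemma dom_L2: "u \<in> dom \<Longrightarrow> u \<in> L2 M"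
  by (auto simp: closure_dom_def)

lemma dom_app: "u \<in> dom \<Longrightarrow> \<exists>un. app un u"
  by (auto simp: closure_dom_def)

sublocale E: semi_inner D0 E
proof
  fix u v w a b assume D: "u \<in> D0" "v \<in> D0" "w \<in> D0"
  have "E (\<lambda>x. a * u x + b * v x) w = (\<integral>x. a * G u w x + b * G v w x \<partial>M)"
    by (rule Bochner_Integration.integral_cong) (use G_lin D in auto)
  then show "E (\<lambda>x. a * u x + b * v x) w = a * E u w + b * E v w"
    using G_int D by simp
next
  fix u v assume "u \<in> D0" "v \<in> D0"
  then show "E u v = E v u"
    by (intro Bochner_Integration.integral_cong) (auto simp: G_sym)
next
  fix u assume "u \<in> D0"
  then show "0 \<le> E u u"
    by (intro Bochner_Integration.integral_nonneg_AE) (auto simp: G_nonneg)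
qed (rule D0_lin)

subsection \<open>The closure\<close>

lemma appD: "app un u \<Longrightarrow> un n \<in> D0" "app un u \<Longrightarrow> form_Cauchy E un"
    "app un u \<Longrightarrow> L2_tendsto M un u"
  by (auto simp: approximates_def)

lemma app_lin:
  assumes "u \<in> L2 M" "v \<in> L2 M" "app un u" "app vn v"
  shows "app (\<lambda>n x. a * un n x + b * vn n x) (\<lambda>x. a * u x + b * v x)"
  using assms D0_lin E.form_Cauchy_lin[of un vn a b] L2_tendsto_lin[of un M u vn v a b] D0_L2
  by (auto simp: approximates_def)

lemma app_diff:
  assumes "u \<in> L2 M" "v \<in> L2 M" "app un u" "app vn v"
  shows "app (\<lambda>n x. un n x - vn n x) (\<lambda>x. u x - v x)"
  using app_lin[OF assms, of 1 "-1"] by simp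

lemma app_const: "u \<in> D0 \<Longrightarrow> app (\<lambda>_. u) u"
proof -
  assume u: "u \<in> D0"
  have "(\<lambda>_. 0) \<in> D0" using E.scale[OF D0_one, of 0] by simp
  then have "E (\<lambda>x. 0) (\<lambda>x. 0) = 0" using E.Q_scale[of "\<lambda>_. 1" "\<lambda>_. 0" 0] D0_one by simp
  then show ?thesis using u by (simp add: approximates_def form_Cauchy_def L2_tendsto_def)
qed

lemma D0_dom: "u \<in> D0 \<Longrightarrow> u \<in> dom"
  using app_const D0_L2 by (auto simp: closure_dom_def)

lemma app_subseq:
  assumes "app un u" "strict_mono r"
  shows "app (\<lambda>n. un (r n)) u"
  unfolding approximates_def
proof (intro conjI allI)
  show "form_Cauchy E (\<lambda>n. un (r n))"
    unfolding form_Cauchy_def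
  proof (intro allI impI)
    fix e :: real assume "e > 0"
    then obtain N where "\<forall>i\<ge>N. \<forall>j\<ge>N. E (\<lambda>x. un i x - un j x) (\<lambda>x. un i x - un j x) < e"
      using appD(2)[OF assms(1)] unfolding form_Cauchy_def by metis
    then show "\<exists>N. \<forall>i\<ge>N. \<forall>j\<ge>N.
        E (\<lambda>x. un (r i) x - un (r j) x) (\<lambda>x. un (r i) x - un (r j) x) < e"
      using seq_suble[OF assms(2)] by (meson le_trans)
  qed
  show "L2_tendsto M (\<lambda>n. un (r n)) u"
    using LIMSEQ_subseq_LIMSEQ[OF appD(3)[OF assms(1), unfolded L2_tendsto_def] assms(2)]
    by (simp add: L2_tendsto_def o_def)
qed (use appD(1)[OF assms(1)] in auto)

lemma app_diff_null:
  assumes u: "u \<in> L2 M" and a: "app un u" "app un' u"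
  shows "(\<lambda>n. E.nrm (\<lambda>x. un n x - un' n x)) \<longlonglongrightarrow> 0"
proof -
  have "app (\<lambda>n x. un n x - un' n x) (\<lambda>x. 0)"
    using app_diff[OF u u a] by simp
  then have "(\<lambda>n. E (\<lambda>x. un n x - un' n x) (\<lambda>x. un n x - un' n x)) \<longlonglongrightarrow> 0"
    using closable_form[unfolded closable_def, rule_format, of "\<lambda>n x. un n x - un' n x"]
    by (simp add: approximates_def)
  from tendsto_real_sqrt[OF this] show ?thesis by (simp add: E.nrm_def)
qed

lemma app_nrm_bounded:
  assumes "app un u" obtains B where "B > 0" "\<And>n. E.nrm (un n) \<le> B"
  using E.form_Cauchy_nrm_bounded[of un] appD[OF assms] by blast

text \<open>By closability two sequences that approximate the same function differ by a null sequence for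
  the form, so the limit in the definition of the closure does not depend on the sequences.\<close>

lemma closure_form_tendsto:
  assumes u: "u \<in> L2 M" "app un u" and v: "v \<in> L2 M" "app vn v"
  shows "(\<lambda>n. E (un n) (vn n)) \<longlonglongrightarrow> EE u v"
proof -
  obtain e where e: "(\<lambda>n. E (un n) (vn n)) \<longlonglongrightarrow> e"
    using E.Q_convergent[of un vn] appD[OF u(2)] appD[OF v(2)] unfolding convergent_def by blast
  have lim: "(\<lambda>n. E (un' n) (vn' n)) \<longlonglongrightarrow> e" if un': "app un' u" and vn': "app vn' v" for un' vn'
  proof -
    obtain B where B: "\<And>n. E.nrm (un n) \<le> B" using app_nrm_bounded[OF u(2)] by blast
    obtain C where C: "\<And>n. E.nrm (vn' n) \<le> C" using app_nrm_bounded[OF vn'] by blast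
    have "(\<lambda>n. E.nrm (\<lambda>x. un' n x - un n x) * C + B * E.nrm (\<lambda>x. vn' n x - vn n x))
        \<longlonglongrightarrow> 0 * C + B * 0"
      by (intro tendsto_intros app_diff_null[OF u(1) un' u(2)] app_diff_null[OF v(1) vn' v(2)])
    then have l: "(\<lambda>n. E.nrm (\<lambda>x. un' n x - un n x) * C + B * E.nrm (\<lambda>x. vn' n x - vn n x))
        \<longlonglongrightarrow> 0" by simp
    have "(\<lambda>n. E (un' n) (vn' n) - E (un n) (vn n)) \<longlonglongrightarrow> 0"
    proof (rule Lim_null_comparison[OF _ l], intro always_eventually allI)
      fix n
      note D = appD(1)[OF un', of n] appD(1)[OF vn', of n] appD(1)[OF u(2), of n] appD(1)[OF v(2), of n]
      have "\<bar>E (un' n) (vn' n) - E (un n) (vn n)\<bar>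
          \<le> E.nrm (\<lambda>x. un' n x - un n x) * E.nrm (vn' n) + E.nrm (un n) * E.nrm (\<lambda>x. vn' n x - vn n x)"
        by (rule E.Q_diff_bound[OF D])
      also have "\<dots> \<le> E.nrm (\<lambda>x. un' n x - un n x) * C + B * E.nrm (\<lambda>x. vn' n x - vn n x)"
        using B[of n] C[of n] E.nrm_nonneg[OF E.diff[OF D(1,3)]] E.nrm_nonneg[OF E.diff[OF D(2,4)]]
        by (intro add_mono mult_left_mono mult_right_mono) auto
      finally show "norm (E (un' n) (vn' n) - E (un n) (vn n))
          \<le> E.nrm (\<lambda>x. un' n x - un n x) * C + B * E.nrm (\<lambda>x. vn' n x - vn n x)" by simp
    qed
    from tendsto_add[OF this e] show ?thesis by simp
  qed
  have "EE u v = e"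
    unfolding closure_form_def
  proof (rule the_equality)
    show "\<forall>un vn. app un u \<and> app vn v \<longrightarrow> (\<lambda>n. E (un n) (vn n)) \<longlonglongrightarrow> e"
      using lim by blast
    fix e' assume "\<forall>un vn. app un u \<and> app vn v \<longrightarrow> (\<lambda>n. E (un n) (vn n)) \<longlonglongrightarrow> e'"
    with u v have "(\<lambda>n. E (un n) (vn n)) \<longlonglongrightarrow> e'" by blast
    with e show "e' = e" using LIMSEQ_unique by blast
  qed
  with e show ?thesis by simp
qed

lemma EE_eq_E: "u \<in> D0 \<Longrightarrow> v \<in> D0 \<Longrightarrow> EE u v = E u v"
  using closure_form_tendsto[OF D0_L2 app_const D0_L2 app_const, of u v]
  by (simp add: LIMSEQ_const_iff)

sublocale EE: semi_inner dom EE
proof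
  fix u v a b assume D: "u \<in> dom" "v \<in> dom"
  then obtain un vn where a: "app un u" "app vn v" using dom_app by blast
  show "(\<lambda>x. a * u x + b * v x) \<in> dom"
    using app_lin[OF dom_L2[OF D(1)] dom_L2[OF D(2)] a] L2_lin[OF dom_L2[OF D(1)] dom_L2[OF D(2)]]
    by (auto simp: closure_dom_def)
  fix w assume w: "w \<in> dom"
  then obtain wn where wn: "app wn w" using dom_app by blast
  have 1: "(\<lambda>n. E (\<lambda>x. a * un n x + b * vn n x) (wn n)) \<longlonglongrightarrow> EE (\<lambda>x. a * u x + b * v x) w"
    by (rule closure_form_tendsto[OF L2_lin[OF dom_L2[OF D(1)] dom_L2[OF D(2)]]
          app_lin[OF dom_L2[OF D(1)] dom_L2[OF D(2)] a] dom_L2[OF w] wn])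
  have "(\<lambda>n. a * E (un n) (wn n) + b * E (vn n) (wn n)) \<longlonglongrightarrow> a * EE u w + b * EE v w"
    by (intro tendsto_intros closure_form_tendsto) (use D w a wn dom_L2 in auto)
  moreover have "E (\<lambda>x. a * un n x + b * vn n x) (wn n) = a * E (un n) (wn n) + b * E (vn n) (wn n)" for n
    by (rule E.Q_lin) (use appD(1) a wn in auto)
  ultimately show "EE (\<lambda>x. a * u x + b * v x) w = a * EE u w + b * EE v w"
    using 1 LIMSEQ_unique by simp
next
  fix u v assume D: "u \<in> dom" "v \<in> dom"
  then obtain un vn where a: "app un u" "app vn v" using dom_app by blast
  have "(\<lambda>n. E (un n) (vn n)) \<longlonglongrightarrow> EE u v" "(\<lambda>n. E (vn n) (un n)) \<longlonglongrightarrow> EE v u"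
    by (rule closure_form_tendsto; use D a dom_L2 in auto)+
  moreover have "E (un n) (vn n) = E (vn n) (un n)" for n
    by (rule E.Q_sym) (use appD(1) a in auto)
  ultimately show "EE u v = EE v u" using LIMSEQ_unique by simp
next
  fix u assume D: "u \<in> dom"
  then obtain un where a: "app un u" using dom_app by blast
  have "(\<lambda>n. E (un n) (un n)) \<longlonglongrightarrow> EE u u"
    by (rule closure_form_tendsto) (use D a dom_L2 in auto)
  moreover have "0 \<le> E (un n) (un n)" for n by (rule E.Q_nonneg) (use appD(1) a in auto)
  ultimately show "0 \<le> EE u u" by (meson LIMSEQ_le_const)
qed

lemma app_cong:
  assumes "AE x in M. u x = v x" "u \<in> L2 M" "v \<in> L2 M" "app un u"
  shows "app un v"
proof -
  have "(\<integral>x. (un n x - u x)\<^sup>2 \<partial>M) = (\<integral>x. (un n x - v x)\<^sup>2 \<partial>M)" for n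
  proof (rule integral_cong_AE)
    have [measurable]: "un n \<in> borel_measurable M" "u \<in> borel_measurable M" "v \<in> borel_measurable M"
      using assms D0_L2[OF appD(1)[OF assms(4)]] by (auto simp: L2_def)
    show "(\<lambda>x. (un n x - u x)\<^sup>2) \<in> borel_measurable M" "(\<lambda>x. (un n x - v x)\<^sup>2) \<in> borel_measurable M"
      by measurable
    show "AE x in M. (un n x - u x)\<^sup>2 = (un n x - v x)\<^sup>2"
      using assms(1) by eventually_elim simp
  qed
  then show ?thesis using assms(4) by (simp add: approximates_def L2_tendsto_def)
qed

lemma dom_cong:
  assumes "AE x in M. u x = v x" "u \<in> dom" "v \<in> L2 M"
  shows "v \<in> dom" "\<And>w. w \<in> dom \<Longrightarrow> EE u w = EE v w"
proof -
  obtain un where a: "app un u" using dom_app assms(2) by blast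
  have av: "app un v" by (rule app_cong[OF assms(1) dom_L2[OF assms(2)] assms(3) a])
  then show "v \<in> dom" using assms(3) by (auto simp: closure_dom_def)
  fix w assume w: "w \<in> dom"
  then obtain wn where wn: "app wn w" using dom_app by blast
  show "EE u w = EE v w"
    using closure_form_tendsto[OF dom_L2[OF assms(2)] a dom_L2[OF w] wn]
      closure_form_tendsto[OF assms(3) av dom_L2[OF w] wn] LIMSEQ_unique by blast
qed

text \<open>The Hilbert space structure of the domain: the square of the norm \<open>H.nrm\<close> is \<^const>\<open>energy1\<close>.\<close>

sublocale H: semi_inner dom "\<lambda>u v. EE u v + (\<integral>x. u x * v x \<partial>M)"
proof
  fix u v w a b assume D: "u \<in> dom" "v \<in> dom" "w \<in> dom"
  show "EE (\<lambda>x. a * u x + b * v x) w + (\<integral>x. (a * u x + b * v x) * w x \<partial>M)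
      = a * (EE u w + (\<integral>x. u x * w x \<partial>M)) + b * (EE v w + (\<integral>x. v x * w x \<partial>M))"
    using EE.Q_lin[OF D] L2.Q_lin[of u M v w a b] D dom_L2 by (simp add: algebra_simps)
next
  fix u v assume D: "u \<in> dom" "v \<in> dom"
  show "EE u v + (\<integral>x. u x * v x \<partial>M) = EE v u + (\<integral>x. v x * u x \<partial>M)"
    using EE.Q_sym[OF D] by (simp add: mult.commute)
next
  fix u assume D: "u \<in> dom"
  show "0 \<le> EE u u + (\<integral>x. u x * u x \<partial>M)" using EE.Q_nonneg[OF D] by simp
qed (rule EE.lin)

lemma energy1_eq: "energy1 M EE u = EE u u + (\<integral>x. u x * u x \<partial>M)"
  by (simp add: energy1_def power2_eq_square)

lemma H_nrm_sq: "u \<in> dom \<Longrightarrow> (H.nrm u)\<^sup>2 = energy1 M EE u"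
  by (simp add: H.nrm_sq energy1_eq)

lemma EE_le_H: "u \<in> dom \<Longrightarrow> EE.nrm u \<le> H.nrm u"
  by (simp add: EE.nrm_def H.nrm_def)

lemma L2_le_H: "u \<in> dom \<Longrightarrow> L2.nrm M u \<le> H.nrm u"
  using EE.Q_nonneg by (simp add: L2.nrm_def H.nrm_def)

lemma H_le: "u \<in> dom \<Longrightarrow> H.nrm u \<le> EE.nrm u + L2.nrm M u"
  unfolding EE.nrm_def H.nrm_def L2.nrm_def
  by (rule sqrt_add_le_add_sqrt) (auto simp: EE.Q_nonneg)

lemma energy1_tendsto_iff:
  assumes "\<And>n. un n \<in> dom" "u \<in> dom"
  shows "(\<lambda>n. energy1 M EE (\<lambda>x. un n x - u x)) \<longlonglongrightarrow> 0 \<longleftrightarrow> (\<lambda>n. H.nrm (\<lambda>x. un n x - u x)) \<longlonglongrightarrow> 0"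
  using H.nrm_diff_tendsto_iff[OF assms] by (simp add: energy1_eq)

lemma H_tendsto_imp:
  assumes "\<And>n. un n \<in> dom" "u \<in> dom" and lim: "(\<lambda>n. H.nrm (\<lambda>x. un n x - u x)) \<longlonglongrightarrow> 0"
  shows "(\<lambda>n. EE.nrm (\<lambda>x. un n x - u x)) \<longlonglongrightarrow> 0" "L2_tendsto M un u"
proof -
  have d: "(\<lambda>x. un n x - u x) \<in> dom" for n using assms by (auto intro: EE.diff)
  show "(\<lambda>n. EE.nrm (\<lambda>x. un n x - u x)) \<longlonglongrightarrow> 0"
    by (rule Lim_null_comparison[OF _ lim]) (simp add: EE_le_H d)
  have "(\<lambda>n. L2.nrm M (\<lambda>x. un n x - u x)) \<longlonglongrightarrow> 0"
    by (rule Lim_null_comparison[OF _ lim]) (simp add: L2_le_H d dom_L2)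
  then show "L2_tendsto M un u"
    using L2_tendsto_iff_nrm[of un M u] assms dom_L2 by blast
qed

lemma H_tendsto_intro:
  assumes "\<And>n. un n \<in> dom" "u \<in> dom" and lim: "(\<lambda>n. EE.nrm (\<lambda>x. un n x - u x)) \<longlonglongrightarrow> 0" "L2_tendsto M un u"
  shows "(\<lambda>n. H.nrm (\<lambda>x. un n x - u x)) \<longlonglongrightarrow> 0"
proof -
  have d: "(\<lambda>x. un n x - u x) \<in> dom" for n using assms by (auto intro: EE.diff)
  have "(\<lambda>n. L2.nrm M (\<lambda>x. un n x - u x)) \<longlonglongrightarrow> 0"
    using L2_tendsto_iff_nrm[of un M u] assms dom_L2 by blast
  from tendsto_add[OF lim(1) this]
  have l: "(\<lambda>n. EE.nrm (\<lambda>x. un n x - u x) + L2.nrm M (\<lambda>x. un n x - u x)) \<longlonglongrightarrow> 0" by simp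
  show ?thesis
    by (rule Lim_null_comparison[OF _ l]) (simp add: H_le d)
qed

lemma app_EE_tendsto:
  assumes u: "u \<in> dom" and a: "app un u"
  shows "(\<lambda>n. EE.nrm (\<lambda>x. un n x - u x)) \<longlonglongrightarrow> 0"
proof (rule LIMSEQ_I)
  fix e :: real assume e: "e > 0"
  then have "e / 2 > 0" by simp
  then obtain N where N: "\<And>i j. i \<ge> N \<Longrightarrow> j \<ge> N \<Longrightarrow> E.nrm (\<lambda>x. un i x - un j x) < e / 2"
    using appD(2)[OF a] E.form_Cauchy_iff_nrm[of un] appD(1)[OF a] by meson
  have "norm (EE.nrm (\<lambda>x. un n x - u x) - 0) < e" if n: "n \<ge> N" for n
  proof -
    have ac: "app (\<lambda>k x. un n x - un k x) (\<lambda>x. un n x - u x)"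
      using app_diff[OF D0_L2[OF appD(1)[OF a]] dom_L2[OF u] app_const[OF appD(1)[OF a]] a] .
    have d: "(\<lambda>x. un n x - u x) \<in> dom" using u D0_dom[OF appD(1)[OF a]] by (rule EE.diff[rotated])
    have "(\<lambda>k. E.nrm (\<lambda>x. un n x - un k x)) \<longlonglongrightarrow> EE.nrm (\<lambda>x. un n x - u x)"
      unfolding E.nrm_def EE.nrm_def
      by (intro tendsto_real_sqrt closure_form_tendsto dom_L2[OF d] ac)
    moreover have "\<exists>M. \<forall>k\<ge>M. E.nrm (\<lambda>x. un n x - un k x) \<le> e / 2"
      using N n by (meson less_imp_le)
    ultimately have "EE.nrm (\<lambda>x. un n x - u x) \<le> e / 2" by (rule LIMSEQ_le_const2)
    then show ?thesis using e EE.nrm_nonneg[OF d] by simp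
  qed
  then show "\<exists>no. \<forall>n\<ge>no. norm (EE.nrm (\<lambda>x. un n x - u x) - 0) < e" by blast
qed

lemma app_H_tendsto: "u \<in> dom \<Longrightarrow> app un u \<Longrightarrow> (\<lambda>n. H.nrm (\<lambda>x. un n x - u x)) \<longlonglongrightarrow> 0"
  by (rule H_tendsto_intro) (auto intro: app_EE_tendsto appD D0_dom)

lemma D0_energy_dense:
  assumes "u \<in> dom" "e > 0"
  obtains v where "v \<in> D0" "H.nrm (\<lambda>x. u x - v x) < e"
proof -
  obtain un where a: "app un u" using dom_app assms by blast
  from order_tendstoD(2)[OF app_H_tendsto[OF assms(1) a] assms(2)]
  obtain n where "H.nrm (\<lambda>x. un n x - u x) < e" unfolding eventually_sequentially by blast
  then show ?thesis
    using that[of "un n"] appD(1)[OF a] H.nrm_minus[OF assms(1) D0_dom[OF appD(1)[OF a]]] by simp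
qed

text \<open>A Cauchy sequence in the domain is replaced by one in \<open>D0\<close> at distance tending to \<open>0\<close>; this one
  approximates its limit in \<open>L\<^sup>2\<close>.\<close>

lemma H_complete:
  assumes V: "\<And>n. un n \<in> dom"
    and c: "\<And>e. e > 0 \<Longrightarrow> \<exists>N. \<forall>i\<ge>N. \<forall>j\<ge>N. H.nrm (\<lambda>x. un i x - un j x) < e"
  obtains u where "u \<in> dom" "(\<lambda>n. H.nrm (\<lambda>x. un n x - u x)) \<longlonglongrightarrow> 0"
proof -
  have "\<exists>w. w \<in> D0 \<and> H.nrm (\<lambda>x. un n x - w x) < 1 / Suc n" for n
    by (rule D0_energy_dense[OF V[of n], of "1 / Suc n"]) auto
  then have "\<exists>wn. \<forall>n. wn n \<in> D0 \<and> H.nrm (\<lambda>x. un n x - wn n x) < 1 / Suc n"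
    by (intro choice allI)
  then obtain wn where wn: "\<And>n. wn n \<in> D0" "\<And>n. H.nrm (\<lambda>x. un n x - wn n x) < 1 / Suc n" by blast
  have wd: "wn n \<in> dom" for n using wn D0_dom by blast
  have diff: "(\<lambda>n. H.nrm (\<lambda>x. un n x - wn n x)) \<longlonglongrightarrow> 0"
  proof (rule Lim_null_comparison[OF _ LIMSEQ_inverse_real_of_nat])
    show "\<forall>\<^sub>F n in sequentially. norm (H.nrm (\<lambda>x. un n x - wn n x)) \<le> inverse (real (Suc n))"
      using wn(2) by (intro always_eventually allI)
        (simp add: V wd H.diff inverse_eq_divide less_imp_le del: of_nat_Suc)
  qed
  have wc: "\<exists>N. \<forall>i\<ge>N. \<forall>j\<ge>N. H.nrm (\<lambda>x. wn i x - wn j x) < e" if "e > 0" for e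
  proof -
    have e3: "e / 3 > 0" using that by simp
    obtain N1 where N1: "\<And>i j. i \<ge> N1 \<Longrightarrow> j \<ge> N1 \<Longrightarrow> H.nrm (\<lambda>x. un i x - un j x) < e / 3"
      using c[OF e3] by meson
    obtain N2 where N2: "\<And>i. i \<ge> N2 \<Longrightarrow> H.nrm (\<lambda>x. un i x - wn i x) < e / 3"
      using order_tendstoD(2)[OF diff e3] unfolding eventually_sequentially by blast
    have "H.nrm (\<lambda>x. wn i x - wn j x) < e" if "i \<ge> max N1 N2" "j \<ge> max N1 N2" for i j
      using H.nrm_triangle3[OF wd V wd, of i j i] H.nrm_triangle3[OF V V wd, of i j j]
        H.nrm_minus[OF wd V, of i i] N1[of i j] N2[of i] N2[of j] that by simp
    then show ?thesis by blast
  qed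
  have "form_Cauchy E wn"
    unfolding E.form_Cauchy_iff_nrm[OF wn(1)]
  proof (intro allI impI)
    fix e :: real assume "e > 0"
    from wc[OF this] obtain N where N: "\<forall>i\<ge>N. \<forall>j\<ge>N. H.nrm (\<lambda>x. wn i x - wn j x) < e" by blast
    have "E.nrm (\<lambda>x. wn i x - wn j x) \<le> H.nrm (\<lambda>x. wn i x - wn j x)" for i j
      using EE_le_H[OF EE.diff[OF wd wd], of i j] EE_eq_E[OF E.diff E.diff, of "wn i" "wn j" "wn i" "wn j"] wn(1)
      by (simp add: E.nrm_def EE.nrm_def)
    with N show "\<exists>N. \<forall>i\<ge>N. \<forall>j\<ge>N. E.nrm (\<lambda>x. wn i x - wn j x) < e" by (meson le_less_trans)
  qed
  moreover have "\<exists>N. \<forall>i\<ge>N. \<forall>j\<ge>N. (\<integral>x. (wn i x - wn j x)\<^sup>2 \<partial>M) < e" if "e > 0" for e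
  proof -
    have se: "sqrt e > 0" using that by simp
    from wc[OF se] obtain N where N: "\<forall>i\<ge>N. \<forall>j\<ge>N. H.nrm (\<lambda>x. wn i x - wn j x) < sqrt e" by blast
    have "L2.nrm M (\<lambda>x. wn i x - wn j x) < sqrt e" if "i \<ge> N" "j \<ge> N" for i j
      using N that L2_le_H[OF EE.diff[OF wd wd], of i j] by (meson le_less_trans)
    then show ?thesis unfolding L2_nrm_eq by (auto simp: real_sqrt_less_iff)
  qed
  then obtain u where u: "u \<in> L2 M" "L2_tendsto M wn u"
    using L2_complete[of wn] D0_L2[OF wn(1)] by blast
  ultimately have a: "app wn u" using wn by (simp add: approximates_def)
  then have ud: "u \<in> dom" using u by (auto simp: closure_dom_def)
  have "(\<lambda>n. H.nrm (\<lambda>x. un n x - u x)) \<longlonglongrightarrow> 0"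
  proof (rule Lim_null_comparison)
    show "(\<lambda>n. H.nrm (\<lambda>x. un n x - wn n x) + H.nrm (\<lambda>x. wn n x - u x)) \<longlonglongrightarrow> 0"
      using tendsto_add[OF diff app_H_tendsto[OF ud a]] by simp
    show "\<forall>\<^sub>F n in sequentially. norm (H.nrm (\<lambda>x. un n x - u x))
        \<le> H.nrm (\<lambda>x. un n x - wn n x) + H.nrm (\<lambda>x. wn n x - u x)"
      using H.nrm_triangle3[OF V wd ud] H.nrm_nonneg[OF H.diff[OF V ud]] by simp
  qed
  with ud that show ?thesis by blast
qed

lemma zero_dom: "(\<lambda>_. 0) \<in> dom"
  using D0_dom[OF E.scale[OF D0_one, of 0]] by simp

lemma one_dom: "(\<lambda>_. 1) \<in> dom"
  using D0_dom[OF D0_one] .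

lemma const_dom: "(\<lambda>_. c) \<in> dom"
  using EE.scale[OF one_dom, of c] by simp

lemma EE_one: "v \<in> dom \<Longrightarrow> EE (\<lambda>_. 1) v = 0"
proof -
  assume v: "v \<in> dom"
  then obtain vn where a: "app vn v" using dom_app by blast
  have "(\<lambda>n. E (\<lambda>_. 1) (vn n)) \<longlonglongrightarrow> EE (\<lambda>_. 1) v"
    by (rule closure_form_tendsto[OF D0_L2[OF D0_one] app_const[OF D0_one] dom_L2[OF v] a])
  moreover have "E (\<lambda>_. 1) (vn n) = (\<integral>x. 0 \<partial>M)" for n
    by (rule Bochner_Integration.integral_cong) (use G_one appD(1)[OF a] in auto)
  ultimately show ?thesis by (simp add: LIMSEQ_const_iff)
qed

lemma EE_const: "v \<in> dom \<Longrightarrow> EE (\<lambda>_. c) v = 0"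
  using EE.Q_scale[OF one_dom, of v c] EE_one[of v] by simp

lemma EE_null: "u \<in> dom \<Longrightarrow> AE x in M. u x = 0 \<Longrightarrow> H.nrm u = 0"
proof -
  assume u: "u \<in> dom" and z: "AE x in M. u x = 0"
  have "EE u u = EE (\<lambda>_. 0) u" using dom_cong(2)[OF z u] zero_dom dom_L2 u by blast
  then have "EE u u = 0" using EE_const[OF u, of 0] by simp
  moreover have "(\<integral>x. u x * u x \<partial>M) = 0"
    using z by (intro integral_eq_zero_AE) auto
  ultimately show ?thesis by (simp add: H.nrm_def)
qed

text \<open>
  A sequence of bounded energy that converges in \<open>L\<^sup>2\<close> has its limit in the domain, and convex
  combinations of it converge in the norm of the domain.
\<close>

lemma bounded_energy_limit:
  assumes W: "\<And>n. wn n \<in> dom" and C: "\<And>n. EE.nrm (wn n) \<le> C"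
    and lim: "L2_tendsto M wn u" and u: "u \<in> L2 M"
  shows "\<exists>vn. u \<in> dom \<and> (\<forall>n. vn n \<in> cvx (wn ` {n..}) \<and> vn n \<in> dom) \<and>
    (\<lambda>n. H.nrm (\<lambda>x. vn n x - u x)) \<longlonglongrightarrow> 0"
proof -
  have WL: "wn n \<in> L2 M" for n using W dom_L2 by blast
  have l2: "(\<lambda>n. L2.nrm M (\<lambda>x. wn n x - u x)) \<longlonglongrightarrow> 0"
    using lim L2_tendsto_iff_nrm[of wn M u] WL u by blast
  then have "(\<lambda>n. L2.nrm M (wn n)) \<longlonglongrightarrow> L2.nrm M u"
    by (intro L2.nrm_tendsto WL u)
  then have "Bseq (\<lambda>n. L2.nrm M (wn n))" by (intro convergent_imp_Bseq convergentI)
  then obtain B where B': "\<And>n. norm (L2.nrm M (wn n)) \<le> B" by (elim BseqE) blast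
  have B: "L2.nrm M (wn n) \<le> B" for n using B'[of n] by simp
  have "H.nrm (wn n) \<le> C + B" for n
    using H_le[OF W] C[of n] B[of n] by (meson add_mono order_trans)
  then obtain vn where vn: "\<And>n. vn n \<in> cvx (wn ` {n..})"
      and cau: "form_Cauchy (\<lambda>u v. EE u v + (\<integral>x. u x * v x \<partial>M)) vn"
    using H.convex_Cauchy[of wn] W zero_dom by blast
  have vd: "vn n \<in> dom" for n
    by (rule cvx_induct_prop[OF vn]) (use W EE.lin in auto)
  have "\<exists>N. \<forall>i\<ge>N. \<forall>j\<ge>N. H.nrm (\<lambda>x. vn i x - vn j x) < e" if "e > 0" for e
    using cau that by (simp only: H.form_Cauchy_iff_nrm[OF vd])
  from H_complete[OF vd this]
  obtain w where w: "w \<in> dom" "(\<lambda>n. H.nrm (\<lambda>x. vn n x - w x)) \<longlonglongrightarrow> 0" .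
  have "(\<lambda>n. L2.nrm M (\<lambda>x. vn n x - u x)) \<longlonglongrightarrow> 0"
  proof (rule LIMSEQ_I)
    fix e :: real assume e: "e > 0"
    then have "e / 2 > 0" by simp
    from order_tendstoD(2)[OF l2 this] obtain N where N: "\<And>n. n \<ge> N \<Longrightarrow> L2.nrm M (\<lambda>x. wn n x - u x) < e / 2"
      unfolding eventually_sequentially by blast
    have "L2.nrm M (\<lambda>x. vn n x - u x) \<le> e / 2" if "n \<ge> N" for n
      using L2.cvx_ball[OF vn[of n], of M u "e / 2"] WL N u that by (force intro: less_imp_le)
    then show "\<exists>no. \<forall>n\<ge>no. norm (L2.nrm M (\<lambda>x. vn n x - u x) - 0) < e"
      using e L2.nrm_nonneg[OF L2_diff[OF dom_L2[OF vd] u]] by fastforce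
  qed
  then have "L2_tendsto M vn u" using L2_tendsto_iff_nrm[of vn M u] dom_L2[OF vd] u by blast
  moreover have "L2_tendsto M vn w" by (rule H_tendsto_imp(2)[OF vd w])
  ultimately have ae: "AE x in M. w x = u x"
    using L2_tendsto_unique[of vn M w u] dom_L2[OF vd] dom_L2[OF w(1)] u by blast
  have ud: "u \<in> dom" by (rule dom_cong(1)[OF ae w(1) u])
  have "H.nrm (\<lambda>x. w x - u x) = 0"
    by (rule EE_null[OF EE.diff[OF w(1) ud]]) (use ae in eventually_elim, simp)
  then have le: "H.nrm (\<lambda>x. vn n x - u x) \<le> H.nrm (\<lambda>x. vn n x - w x)" for n
    using H.nrm_triangle3[OF vd w(1) ud, of n] by simp
  have "(\<lambda>n. H.nrm (\<lambda>x. vn n x - u x)) \<longlonglongrightarrow> 0"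
    by (rule Lim_null_comparison[OF _ w(2)]) (use le H.nrm_nonneg[OF H.diff[OF vd ud]] in auto)
  then show ?thesis using ud vn vd by (intro exI[of _ vn]) simp
qed

lemma EE_lsc:
  assumes W: "\<And>n. wn n \<in> dom" and C: "\<And>n. EE.nrm (wn n) \<le> C"
    and lim: "L2_tendsto M wn u" and u: "u \<in> L2 M"
  shows "u \<in> dom" "EE.nrm u \<le> C"
proof -
  from bounded_energy_limit[OF W C lim u]
  obtain vn where vn: "u \<in> dom" "\<And>n. vn n \<in> cvx (wn ` {n..})" "\<And>n. vn n \<in> dom"
      "(\<lambda>n. H.nrm (\<lambda>x. vn n x - u x)) \<longlonglongrightarrow> 0" by blast
  show "u \<in> dom" by fact
  have "EE.nrm (vn n) \<le> C" for n
    using EE.cvx_ball[OF vn(2), of n "\<lambda>_. 0" C] W C zero_dom by auto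
  moreover have "(\<lambda>n. EE.nrm (vn n)) \<longlonglongrightarrow> EE.nrm u"
    by (rule EE.nrm_tendsto[OF vn(3,1) H_tendsto_imp(1)[OF vn(3,1,4)]])
  ultimately show "EE.nrm u \<le> C" by (meson LIMSEQ_le_const2)
qed

text \<open>A sequence as above converges weakly. If \<open>EE (wn n) v\<close> exceeded \<open>EE u v + e\<close> along a subsequence,
  then so would its convex combinations, which converge strongly.\<close>

lemma EE_weak_le:
  assumes W: "\<And>n. wn n \<in> dom" and C: "\<And>n. EE.nrm (wn n) \<le> C"
    and lim: "L2_tendsto M wn u" and u: "u \<in> L2 M" and v: "v \<in> dom" and e: "e > 0"
  shows "\<forall>\<^sub>F n in sequentially. EE (wn n) v < EE u v + e"
proof (rule ccontr)
  assume "\<not> ?thesis"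
  then have "\<exists>\<^sub>F n in sequentially. EE u v + e \<le> EE (wn n) v"
    by (simp add: not_eventually not_less)
  then have inf: "\<forall>N. \<exists>n>N. EE u v + e \<le> EE (wn n) v"
    unfolding frequently_sequentially by (meson Suc_le_lessD)
  obtain r where r: "strict_mono (r :: nat \<Rightarrow> nat)" "\<And>n. EE u v + e \<le> EE (wn (r n)) v"
    using infinite_enumerate[of "{n. EE u v + e \<le> EE (wn n) v}"] inf
    unfolding infinite_nat_iff_unbounded mem_Collect_eq by blast
  have lim': "L2_tendsto M (\<lambda>n. wn (r n)) u"
    using LIMSEQ_subseq_LIMSEQ[OF lim[unfolded L2_tendsto_def] r(1)]
    by (simp add: L2_tendsto_def o_def)
  from bounded_energy_limit[of "\<lambda>n. wn (r n)" C u, OF W C lim' u]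
  obtain vn where vn: "u \<in> dom" "\<And>n. vn n \<in> cvx ((\<lambda>n. wn (r n)) ` {n..})" "\<And>n. vn n \<in> dom"
      "(\<lambda>n. H.nrm (\<lambda>x. vn n x - u x)) \<longlonglongrightarrow> 0" by blast
  have "vn n \<in> dom \<and> EE u v + e \<le> EE (vn n) v" for n
  proof (rule cvx_induct_prop[OF vn(2)])
    fix a b t assume a: "a \<in> dom \<and> EE u v + e \<le> EE a v" and b: "b \<in> dom \<and> EE u v + e \<le> EE b v"
      and t: "0 \<le> t" "t \<le> (1::real)"
    have "EE u v + e = t * (EE u v + e) + (1 - t) * (EE u v + e)" by (simp add: algebra_simps)
    also have "\<dots> \<le> t * EE a v + (1 - t) * EE b v"
      using a b t by (intro add_mono mult_left_mono) auto
    finally show "(\<lambda>x. t * a x + (1 - t) * b x) \<in> dom \<and>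
        EE u v + e \<le> EE (\<lambda>x. t * a x + (1 - t) * b x) v"
      using a b v EE.lin EE.Q_lin[of a b v t "1 - t"] by simp
  qed (use W r in auto)
  then have "EE u v + e \<le> EE (vn n) v" for n by blast
  moreover have "(\<lambda>n. EE (vn n) v) \<longlonglongrightarrow> EE u v"
    by (rule EE.Q_tendsto[OF vn(3,1) v v H_tendsto_imp(1)[OF vn(3,1,4)]]) (simp add: EE.nrm_zero[OF v])
  ultimately have "EE u v + e \<le> EE u v" by (meson LIMSEQ_le_const)
  with e show False by simp
qed

lemma EE_weak_tendsto:
  assumes W: "\<And>n. wn n \<in> dom" and C: "\<And>n. EE.nrm (wn n) \<le> C"
    and lim: "L2_tendsto M wn u" and u: "u \<in> L2 M" and v: "v \<in> dom"
  shows "(\<lambda>n. EE (wn n) v) \<longlonglongrightarrow> EE u v"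
proof (rule order_tendstoI)
  have ud: "u \<in> dom" by (rule EE_lsc(1)[OF W C lim u])
  fix a assume a: "EE u v < a"
  from EE_weak_le[OF W C lim u v, of "a - EE u v"] a
  show "\<forall>\<^sub>F n in sequentially. EE (wn n) v < a" by simp
next
  have ud: "u \<in> dom" by (rule EE_lsc(1)[OF W C lim u])
  fix a assume a: "a < EE u v"
  have mv: "(\<lambda>x. - 1 * v x) \<in> dom" by (rule EE.scale[OF v])
  have neg: "EE w (\<lambda>x. - 1 * v x) = - EE w v" if "w \<in> dom" for w
    using EE.Q_scale2[OF v that, of "-1"] by simp
  have "\<forall>\<^sub>F n in sequentially. EE (wn n) (\<lambda>x. - 1 * v x) < EE u (\<lambda>x. - 1 * v x) + (EE u v - a)"
    by (rule EE_weak_le[OF W C lim u mv]) (use a in simp)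
  then show "\<forall>\<^sub>F n in sequentially. a < EE (wn n) v"
    by (rule eventually_mono) (simp only: neg[OF W] neg[OF ud])
qed

subsection \<open>Lattice operations and the Markov property\<close>

lemma D0_contraction:
  assumes "u \<in> D0" "w \<in> D0" "\<And>x. x \<in> space M \<Longrightarrow> G w w x \<le> G u u x"
  shows "E.nrm w \<le> E.nrm u"
  unfolding E.nrm_def
  by (intro real_sqrt_le_mono Bochner_Integration.integral_mono G_int assms)

lemma E_sqrt_le:
  assumes u: "u \<in> D0" and e: "e > 0"
  shows "E.nrm (\<lambda>x. sqrt ((u x)\<^sup>2 + e\<^sup>2)) \<le> E.nrm u"
proof (rule D0_contraction[OF u D0_sqrt[OF u e]])
  fix x assume x: "x \<in> space M"
  let ?s = "\<lambda>x. sqrt ((u x)\<^sup>2 + e\<^sup>2)"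
  have "G ?s ?s x = u x / ?s x * (u x / ?s x * G u u x)"
    using G_sqrt[OF u D0_sqrt[OF u e] e x] G_sym[OF u D0_sqrt[OF u e] x] G_sqrt[OF u u e x] by simp
  also have "\<dots> = (u x)\<^sup>2 / ((u x)\<^sup>2 + e\<^sup>2) * G u u x"
    by (simp add: power2_eq_square)
  also have "\<dots> \<le> 1 * G u u x"
    using e by (intro mult_right_mono G_nonneg u x) (simp add: divide_le_eq add_nonneg_pos)
  finally show "G ?s ?s x \<le> G u u x" by simp
qed

lemma EE_nrm_eq: "u \<in> D0 \<Longrightarrow> EE.nrm u = E.nrm u"
  using EE_eq_E[of u u] by (simp add: EE.nrm_def E.nrm_def)

lemma sqrt_approx_abs: "\<bar>sqrt (s\<^sup>2 + e\<^sup>2) - \<bar>t\<bar>\<bar> \<le> \<bar>s - t\<bar> + \<bar>e\<bar>" for s t e :: real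
proof -
  have "sqrt (s\<^sup>2 + e\<^sup>2) \<le> sqrt (s\<^sup>2) + sqrt (e\<^sup>2)" by (rule sqrt_add_le_add_sqrt) auto
  then have "sqrt (s\<^sup>2 + e\<^sup>2) \<le> \<bar>s\<bar> + \<bar>e\<bar>" by simp
  moreover have "\<bar>s\<bar> \<le> sqrt (s\<^sup>2 + e\<^sup>2)" using real_sqrt_le_mono[of "s\<^sup>2" "s\<^sup>2 + e\<^sup>2"] by simp
  ultimately show ?thesis by linarith
qed

text \<open>Approximation of \<open>\<bar>u\<bar>\<close> by \<open>(u\<^sub>n\<^sup>2 + n\<^sup>-\<^sup>2)\<^bsup>1/2\<^esup>\<close>, whose energy is at most that of \<open>u\<^sub>n\<close>.\<close>

lemma abs_dom:
  assumes u: "u \<in> dom"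
  shows "(\<lambda>x. \<bar>u x\<bar>) \<in> dom" "EE.nrm (\<lambda>x. \<bar>u x\<bar>) \<le> EE.nrm u"
proof -
  obtain un where a: "app un u" using dom_app u by blast
  define wn where "wn n = (\<lambda>x. sqrt ((un n x)\<^sup>2 + (1 / Suc n)\<^sup>2))" for n
  have wD: "wn n \<in> D0" for n unfolding wn_def by (rule D0_sqrt) (use appD(1)[OF a] in auto)
  have uL: "(\<lambda>x. \<bar>u x\<bar>) \<in> L2 M" using dom_L2[OF u] by (auto simp: L2_def)
  have lim: "L2_tendsto M wn (\<lambda>x. \<bar>u x\<bar>)"
  proof (rule L2_tendsto_comparison[OF D0_L2[OF wD] uL D0_L2[OF appD(1)[OF a]] dom_L2[OF u] appD(3)[OF a]])
    show "(\<lambda>n. 1 / real (Suc n)) \<longlonglongrightarrow> 0" by (rule LIMSEQ_Suc[OF lim_1_over_n])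
    show "\<bar>wn n x - \<bar>u x\<bar>\<bar> \<le> \<bar>un n x - u x\<bar> + 1 / real (Suc n)" for n x
      using sqrt_approx_abs[of "un n x" "1 / Suc n" "u x"] unfolding wn_def by simp
  qed
  have nu: "(\<lambda>n. E.nrm (un n)) \<longlonglongrightarrow> EE.nrm u"
    unfolding E.nrm_def EE.nrm_def
    by (intro tendsto_real_sqrt closure_form_tendsto dom_L2[OF u] a)
  have key: "(\<lambda>x. \<bar>u x\<bar>) \<in> dom \<and> EE.nrm (\<lambda>x. \<bar>u x\<bar>) \<le> EE.nrm u + e" if "e > 0" for e
  proof -
    have "\<forall>\<^sub>F n in sequentially. E.nrm (un n) < EE.nrm u + e"
      by (rule order_tendstoD(2)[OF nu]) (use that in simp)
    then obtain N where N: "\<And>n. n \<ge> N \<Longrightarrow> E.nrm (un n) < EE.nrm u + e"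
      unfolding eventually_sequentially by blast
    have "EE.nrm (wn (n + N)) \<le> EE.nrm u + e" for n
      using E_sqrt_le[OF appD(1)[OF a], of "1 / Suc (n + N)" "n + N"] N[of "n + N"]
        EE_nrm_eq[OF wD, of "n + N"] unfolding wn_def by simp
    moreover have "L2_tendsto M (\<lambda>n. wn (n + N)) (\<lambda>x. \<bar>u x\<bar>)"
      using LIMSEQ_ignore_initial_segment[OF lim[unfolded L2_tendsto_def], of N]
      by (simp add: L2_tendsto_def)
    ultimately show ?thesis
      using EE_lsc[of "\<lambda>n. wn (n + N)", OF D0_dom[OF wD] _ _ uL] by blast
  qed
  show "(\<lambda>x. \<bar>u x\<bar>) \<in> dom" using key[of 1] by simp
  show "EE.nrm (\<lambda>x. \<bar>u x\<bar>) \<le> EE.nrm u" by (rule field_le_epsilon) (use key in blast)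
qed

text \<open>Minimum and maximum are half of \<open>u + v\<close> minus or plus half of \<open>\<bar>u - v\<bar>\<close>; by the parallelogram
  law their energies add up to at most the sum of the energies of \<open>u\<close> and \<open>v\<close>.\<close>

lemma lattice_dom:
  assumes u: "u \<in> dom" and v: "v \<in> dom"
  shows "(\<lambda>x. min (u x) (v x)) \<in> dom" "(\<lambda>x. max (u x) (v x)) \<in> dom"
    "EE (\<lambda>x. min (u x) (v x)) (\<lambda>x. min (u x) (v x)) \<le> EE u u + EE v v"
    "EE (\<lambda>x. max (u x) (v x)) (\<lambda>x. max (u x) (v x)) \<le> EE u u + EE v v"
proof -
  define a where "a = (\<lambda>x. (1/2) * (u x + v x))"
  define b where "b = (\<lambda>x. (1/2) * \<bar>u x - v x\<bar>)"
  have d: "(\<lambda>x. \<bar>u x - v x\<bar>) \<in> dom" by (rule abs_dom(1)[OF EE.diff[OF u v]])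
  have s: "(\<lambda>x. u x + v x) \<in> dom" by (rule EE.add[OF u v])
  have a: "a \<in> dom" unfolding a_def by (rule EE.scale[OF s])
  have b: "b \<in> dom" unfolding b_def by (rule EE.scale[OF d])
  have mi: "(\<lambda>x. min (u x) (v x)) = (\<lambda>x. a x - b x)"
    unfolding a_def b_def by (auto simp: min_def field_simps)
  have ma: "(\<lambda>x. max (u x) (v x)) = (\<lambda>x. a x + b x)"
    unfolding a_def b_def by (auto simp: max_def field_simps)
  show 1: "(\<lambda>x. min (u x) (v x)) \<in> dom" unfolding mi by (rule EE.diff[OF a b])
  show 2: "(\<lambda>x. max (u x) (v x)) \<in> dom" unfolding ma by (rule EE.add[OF a b])
  have "EE b b = (1/4) * (EE.nrm (\<lambda>x. \<bar>u x - v x\<bar>))\<^sup>2"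
    unfolding b_def by (simp only: EE.nrm_sq[OF d] EE.Q_scale[OF d EE.scale[OF d]] EE.Q_scale2[OF d d])
  also have "\<dots> \<le> (1/4) * (EE.nrm (\<lambda>x. u x - v x))\<^sup>2"
    using abs_dom(2)[OF EE.diff[OF u v]] EE.nrm_nonneg[OF d] by (intro mult_left_mono power_mono) auto
  also have "\<dots> = (1/4) * EE (\<lambda>x. u x - v x) (\<lambda>x. u x - v x)"
    using EE.nrm_sq[OF EE.diff[OF u v]] by simp
  finally have bb: "EE b b \<le> (1/4) * EE (\<lambda>x. u x - v x) (\<lambda>x. u x - v x)" .
  have aa: "EE a a = (1/4) * EE (\<lambda>x. u x + v x) (\<lambda>x. u x + v x)"
    unfolding a_def by (simp add: EE.Q_scale[OF s EE.scale[OF s]] EE.Q_scale2[OF s s] del: times_divide_eq_left times_divide_eq_right)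
  have "EE (\<lambda>x. min (u x) (v x)) (\<lambda>x. min (u x) (v x)) + EE (\<lambda>x. max (u x) (v x)) (\<lambda>x. max (u x) (v x))
      = 2 * EE a a + 2 * EE b b"
    unfolding mi ma by (rule EE.parallelogram[OF a b])
  also have "\<dots> \<le> EE u u + EE v v"
    using aa bb EE.parallelogram[OF u v] by simp
  finally have le: "EE (\<lambda>x. min (u x) (v x)) (\<lambda>x. min (u x) (v x))
      + EE (\<lambda>x. max (u x) (v x)) (\<lambda>x. max (u x) (v x)) \<le> EE u u + EE v v" .
  show "EE (\<lambda>x. min (u x) (v x)) (\<lambda>x. min (u x) (v x)) \<le> EE u u + EE v v"
    "EE (\<lambda>x. max (u x) (v x)) (\<lambda>x. max (u x) (v x)) \<le> EE u u + EE v v"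
    using le EE.Q_nonneg[OF 1] EE.Q_nonneg[OF 2] by simp_all
qed

text \<open>The constants \<open>0\<close> and \<open>1\<close> have no energy.\<close>

lemma clip_dom:
  assumes u: "u \<in> dom"
  shows "(\<lambda>x. min 1 (max 0 (u x))) \<in> dom"
    "EE (\<lambda>x. min 1 (max 0 (u x))) (\<lambda>x. min 1 (max 0 (u x))) \<le> EE u u"
proof -
  note 0 = lattice_dom[OF zero_dom u] and z = EE_const[OF zero_dom, of 0] EE_const[OF one_dom, of 1]
  note 1 = lattice_dom[OF one_dom 0(2)]
  show "(\<lambda>x. min 1 (max 0 (u x))) \<in> dom"
    "EE (\<lambda>x. min 1 (max 0 (u x))) (\<lambda>x. min 1 (max 0 (u x))) \<le> EE u u"
    using 0 1 z by auto
qed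

theorem Dirichlet_form_closure: "Dirichlet_form M EE dom"
proof -
  have dense: "L2_dense M dom"
    using D0_dense D0_dom dom_L2 unfolding L2_dense_def by (meson subsetI)
  have closed: "\<exists>u\<in>dom. (\<lambda>n. energy1 M EE (\<lambda>x. un n x - u x)) \<longlonglongrightarrow> 0"
    if un: "\<forall>n. un n \<in> dom"
      and c: "\<forall>e>0. \<exists>N. \<forall>i\<ge>N. \<forall>j\<ge>N. energy1 M EE (\<lambda>x. un i x - un j x) < e" for un
  proof -
    have V: "un n \<in> dom" for n using un by blast
    have "form_Cauchy (\<lambda>u v. EE u v + (\<integral>x. u x * v x \<partial>M)) un"
      using c unfolding form_Cauchy_def energy1_eq .
    then have "\<exists>N. \<forall>i\<ge>N. \<forall>j\<ge>N. H.nrm (\<lambda>x. un i x - un j x) < e" if "e > 0" for e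
      using that by (simp only: H.form_Cauchy_iff_nrm[OF V])
    from H_complete[OF V this] obtain u where u: "u \<in> dom"
      "(\<lambda>n. H.nrm (\<lambda>x. un n x - u x)) \<longlonglongrightarrow> 0" .
    then show ?thesis using energy1_tendsto_iff[of un, OF V u(1)] by (intro bexI[of _ u]) simp_all
  qed
  show ?thesis
    unfolding Dirichlet_form_def
    using dense closed dom_cong EE.lin EE.Q_lin EE.Q_sym EE.Q_nonneg clip_dom by auto
qed

subsection \<open>The square field operator on the domain\<close>

lemma G_pointwise: "x \<in> space M \<Longrightarrow> semi_inner D0 (\<lambda>u v. G u v x)"
  by unfold_locales (auto intro: D0_lin G_lin G_sym G_nonneg)

lemma G_borel [measurable]: "u \<in> D0 \<Longrightarrow> v \<in> D0 \<Longrightarrow> G u v \<in> borel_measurable M"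
  using G_int by blast

lemma G_L1_le:
  assumes u: "u \<in> D0" and v: "v \<in> D0"
  shows "(\<integral>x. \<bar>G u v x\<bar> \<partial>M) \<le> E.nrm u * E.nrm v"
proof -
  have sq: "(\<lambda>x. sqrt (G w w x)) \<in> L2 M \<and> L2.nrm M (\<lambda>x. sqrt (G w w x)) = E.nrm w" if w: "w \<in> D0" for w
  proof -
    have eq: "\<And>x. x \<in> space M \<Longrightarrow> (sqrt (G w w x))\<^sup>2 = G w w x" using G_nonneg[OF w] by simp
    have "integrable M (\<lambda>x. (sqrt (G w w x))\<^sup>2)"
      using G_int[OF w w] by (subst Bochner_Integration.integrable_cong[OF refl eq]) auto
    moreover have "(\<integral>x. (sqrt (G w w x))\<^sup>2 \<partial>M) = (\<integral>x. G w w x \<partial>M)"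
      by (rule Bochner_Integration.integral_cong[OF refl eq])
    moreover have "(\<lambda>x. sqrt (G w w x)) \<in> borel_measurable M" using G_borel[OF w w] by measurable
    ultimately show ?thesis by (simp add: L2_def L2_nrm_eq E.nrm_def)
  qed
  have "(\<integral>x. \<bar>G u v x\<bar> \<partial>M) \<le> (\<integral>x. sqrt (G u u x) * sqrt (G v v x) \<partial>M)"
  proof (rule integral_mono)
    show "integrable M (\<lambda>x. sqrt (G u u x) * sqrt (G v v x))"
      using sq[OF u] sq[OF v] L2_mult_integrable by blast
    show "\<bar>G u v x\<bar> \<le> sqrt (G u u x) * sqrt (G v v x)" if "x \<in> space M" for x
      using semi_inner.Cauchy_Schwarz[OF G_pointwise[OF that] u v]
      by (simp add: semi_inner.nrm_def[OF G_pointwise[OF that]])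
  qed (use G_int[OF u v] in auto)
  also have "\<dots> \<le> E.nrm u * E.nrm v"
    using L2.Cauchy_Schwarz[of "\<lambda>x. sqrt (G u u x)" M "\<lambda>x. sqrt (G v v x)"] sq[OF u] sq[OF v] by simp
  finally show ?thesis .
qed

lemma G_diff_L1_le:
  assumes D: "u \<in> D0" "v \<in> D0" "u' \<in> D0" "v' \<in> D0"
  shows "(\<integral>x. \<bar>G u v x - G u' v' x\<bar> \<partial>M)
    \<le> E.nrm (\<lambda>x. u x - u' x) * E.nrm v + E.nrm u' * E.nrm (\<lambda>x. v x - v' x)"
proof -
  have d: "(\<lambda>x. u x - u' x) \<in> D0" "(\<lambda>x. v x - v' x) \<in> D0" using D E.diff by auto
  have eq: "G u v x - G u' v' x = G (\<lambda>x. u x - u' x) v x + G u' (\<lambda>x. v x - v' x) x"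
    if "x \<in> space M" for x
    using semi_inner.Q_diff[OF G_pointwise[OF that]] semi_inner.Q_diff2[OF G_pointwise[OF that]] D by simp
  have "(\<integral>x. \<bar>G u v x - G u' v' x\<bar> \<partial>M)
      \<le> (\<integral>x. \<bar>G (\<lambda>x. u x - u' x) v x\<bar> + \<bar>G u' (\<lambda>x. v x - v' x) x\<bar> \<partial>M)"
    by (rule integral_mono) (use G_int D d eq in auto)
  also have "\<dots> = (\<integral>x. \<bar>G (\<lambda>x. u x - u' x) v x\<bar> \<partial>M) + (\<integral>x. \<bar>G u' (\<lambda>x. v x - v' x) x\<bar> \<partial>M)"
    by (rule Bochner_Integration.integral_add) (use G_int D d in auto)
  also have "\<dots> \<le> E.nrm (\<lambda>x. u x - u' x) * E.nrm v + E.nrm u' * E.nrm (\<lambda>x. v x - v' x)"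
    by (intro add_mono G_L1_le D d)
  finally show ?thesis .
qed

text \<open>The extension of \<open>G\<close> to the domain. Its defining property is established in \<open>Gc_spec\<close>: the map
  \<open>(u, v) \<mapsto> G u v\<close> is continuous into \<open>L\<^sup>1\<close>, by the pointwise Cauchy-Schwarz inequality.\<close>

abbreviation Gc :: "('b \<Rightarrow> real) \<Rightarrow> ('b \<Rightarrow> real) \<Rightarrow> 'b \<Rightarrow> real" where
  "Gc \<equiv> closure_square_field M G E D0"

lemma nn_integral_L1_tendsto_iff:
  assumes "\<And>n. integrable M (f n)" "integrable M h"
  shows "(\<lambda>n. \<integral>\<^sup>+x. ennreal \<bar>f n x - h x\<bar> \<partial>M) \<longlonglongrightarrow> 0 \<longleftrightarrow>
    (\<lambda>n. \<integral>x. \<bar>f n x - h x\<bar> \<partial>M) \<longlonglongrightarrow> (0::real)"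
proof -
  have "(\<integral>\<^sup>+x. ennreal \<bar>f n x - h x\<bar> \<partial>M) = ennreal (\<integral>x. \<bar>f n x - h x\<bar> \<partial>M)" for n
    by (rule nn_integral_eq_integral) (use assms in auto)
  then show ?thesis
    using tendsto_ennreal_iff[of "\<lambda>n. \<integral>x. \<bar>f n x - h x\<bar> \<partial>M" sequentially 0] by simp
qed

lemma Gc_ex:
  assumes u: "u \<in> dom" and v: "v \<in> dom"
  shows "\<exists>h. integrable M h \<and> (\<forall>un vn. app un u \<and> app vn v \<longrightarrow>
    (\<lambda>n. \<integral>x. \<bar>G (un n) (vn n) x - h x\<bar> \<partial>M) \<longlonglongrightarrow> 0)"
proof -
  obtain un vn where a: "app un u" "app vn v" using dom_app u v by blast
  note D = appD(1)[OF a(1)] appD(1)[OF a(2)]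
  obtain B where B: "B > 0" "\<And>n. E.nrm (un n) \<le> B" using app_nrm_bounded[OF a(1)] by blast
  obtain C where C: "C > 0" "\<And>n. E.nrm (vn n) \<le> C" using app_nrm_bounded[OF a(2)] by blast
  have cau: "\<exists>N. \<forall>i\<ge>N. \<forall>j\<ge>N. (\<integral>x. \<bar>G (un i) (vn i) x - G (un j) (vn j) x\<bar> \<partial>M) < e" if e: "e > 0" for e
  proof -
    define d where "d = e / (B + C)"
    have d: "d > 0" using e B C unfolding d_def by simp
    from appD(2)[OF a(1)] appD(2)[OF a(2)] d
    obtain N1 N2 where N1: "\<And>i j. i \<ge> N1 \<Longrightarrow> j \<ge> N1 \<Longrightarrow> E.nrm (\<lambda>x. un i x - un j x) < d"
      and N2: "\<And>i j. i \<ge> N2 \<Longrightarrow> j \<ge> N2 \<Longrightarrow> E.nrm (\<lambda>x. vn i x - vn j x) < d"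
      unfolding E.form_Cauchy_iff_nrm[OF D(1)] E.form_Cauchy_iff_nrm[OF D(2)] by meson
    have "(\<integral>x. \<bar>G (un i) (vn i) x - G (un j) (vn j) x\<bar> \<partial>M) < e"
      if ij: "i \<ge> max N1 N2" "j \<ge> max N1 N2" for i j
    proof -
      have "(\<integral>x. \<bar>G (un i) (vn i) x - G (un j) (vn j) x\<bar> \<partial>M)
          \<le> E.nrm (\<lambda>x. un i x - un j x) * E.nrm (vn i) + E.nrm (un j) * E.nrm (\<lambda>x. vn i x - vn j x)"
        by (rule G_diff_L1_le[OF D D])
      also have "\<dots> \<le> E.nrm (\<lambda>x. un i x - un j x) * C + B * E.nrm (\<lambda>x. vn i x - vn j x)"
        by (intro add_mono mult_left_mono mult_right_mono B C E.nrm_nonneg E.diff D)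
      also have "\<dots> < d * C + B * d"
        using N1[of i j] N2[of i j] ij B C
        by (intro add_strict_mono mult_strict_right_mono mult_strict_left_mono) auto
      also have "\<dots> = (B + C) * d" by (simp add: algebra_simps)
      also have "\<dots> = e" using B(1) C(1) unfolding d_def by simp
      finally show ?thesis .
    qed
    then show ?thesis by blast
  qed
  from L1_complete[of M "\<lambda>n. G (un n) (vn n)", OF G_int[OF D] cau]
  obtain h where h: "integrable M h" "(\<lambda>n. \<integral>x. \<bar>G (un n) (vn n) x - h x\<bar> \<partial>M) \<longlonglongrightarrow> 0" .
  have "(\<lambda>n. \<integral>x. \<bar>G (un' n) (vn' n) x - h x\<bar> \<partial>M) \<longlonglongrightarrow> 0" if a': "app un' u" "app vn' v" for un' vn'
  proof -
    note D' = appD(1)[OF a'(1)] appD(1)[OF a'(2)]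
    obtain C' where C': "C' > 0" "\<And>n. E.nrm (vn' n) \<le> C'" using app_nrm_bounded[OF a'(2)] by blast
    have "(\<lambda>n. E.nrm (\<lambda>x. un' n x - un n x) * C' + B * E.nrm (\<lambda>x. vn' n x - vn n x)
        + (\<integral>x. \<bar>G (un n) (vn n) x - h x\<bar> \<partial>M)) \<longlonglongrightarrow> 0 * C' + B * 0 + 0"
      by (intro tendsto_intros app_diff_null[OF dom_L2[OF u] a'(1) a(1)]
          app_diff_null[OF dom_L2[OF v] a'(2) a(2)] h(2))
    then have l: "(\<lambda>n. E.nrm (\<lambda>x. un' n x - un n x) * C' + B * E.nrm (\<lambda>x. vn' n x - vn n x)
        + (\<integral>x. \<bar>G (un n) (vn n) x - h x\<bar> \<partial>M)) \<longlonglongrightarrow> 0" by simp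
    show ?thesis
    proof (rule Lim_null_comparison[OF _ l], intro always_eventually allI)
      fix n
      have "(\<integral>x. \<bar>G (un' n) (vn' n) x - h x\<bar> \<partial>M)
          \<le> (\<integral>x. \<bar>G (un' n) (vn' n) x - G (un n) (vn n) x\<bar> + \<bar>G (un n) (vn n) x - h x\<bar> \<partial>M)"
        by (rule integral_mono) (use G_int D D' h(1) in auto)
      also have "\<dots> = (\<integral>x. \<bar>G (un' n) (vn' n) x - G (un n) (vn n) x\<bar> \<partial>M) + (\<integral>x. \<bar>G (un n) (vn n) x - h x\<bar> \<partial>M)"
        by (rule Bochner_Integration.integral_add) (use G_int D D' h(1) in auto)
      also have "(\<integral>x. \<bar>G (un' n) (vn' n) x - G (un n) (vn n) x\<bar> \<partial>M)
          \<le> E.nrm (\<lambda>x. un' n x - un n x) * E.nrm (vn' n) + E.nrm (un n) * E.nrm (\<lambda>x. vn' n x - vn n x)"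
        by (rule G_diff_L1_le[OF D' D])
      also have "\<dots> \<le> E.nrm (\<lambda>x. un' n x - un n x) * C' + B * E.nrm (\<lambda>x. vn' n x - vn n x)"
        by (intro add_mono mult_left_mono mult_right_mono B C' E.nrm_nonneg E.diff D D')
      finally show "norm (\<integral>x. \<bar>G (un' n) (vn' n) x - h x\<bar> \<partial>M)
          \<le> E.nrm (\<lambda>x. un' n x - un n x) * C' + B * E.nrm (\<lambda>x. vn' n x - vn n x)
            + (\<integral>x. \<bar>G (un n) (vn n) x - h x\<bar> \<partial>M)" by simp
    qed
  qed
  with h(1) show ?thesis by blast
qed

lemma Gc_spec:
  assumes u: "u \<in> dom" and v: "v \<in> dom"
  shows "integrable M (Gc u v)"
    "\<And>un vn. app un u \<Longrightarrow> app vn v \<Longrightarrow> (\<lambda>n. \<integral>x. \<bar>G (un n) (vn n) x - Gc u v x\<bar> \<partial>M) \<longlonglongrightarrow> 0"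
proof -
  let ?P = "\<lambda>h. integrable M h \<and> (\<forall>un vn. app un u \<and> app vn v \<longrightarrow>
    (\<lambda>n. \<integral>\<^sup>+x. ennreal \<bar>G (un n) (vn n) x - h x\<bar> \<partial>M) \<longlonglongrightarrow> 0)"
  obtain h where h: "integrable M h" "\<And>un vn. app un u \<Longrightarrow> app vn v \<Longrightarrow>
      (\<lambda>n. \<integral>x. \<bar>G (un n) (vn n) x - h x\<bar> \<partial>M) \<longlonglongrightarrow> 0"
    using Gc_ex[OF u v] by blast
  have "?P h"
  proof (intro conjI h(1) allI impI)
    fix un vn assume a: "app un u \<and> app vn v"
    then show "(\<lambda>n. \<integral>\<^sup>+x. ennreal \<bar>G (un n) (vn n) x - h x\<bar> \<partial>M) \<longlonglongrightarrow> 0"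
      using h appD(1) G_int
      by (subst nn_integral_L1_tendsto_iff[of "\<lambda>n. G (un n) (vn n)" h]) auto
  qed
  then have P: "?P (Gc u v)" unfolding closure_square_field_def by (rule someI[of ?P h])
  then show i: "integrable M (Gc u v)" by blast
  fix un vn assume a: "app un u" "app vn v"
  with P have "(\<lambda>n. \<integral>\<^sup>+x. ennreal \<bar>G (un n) (vn n) x - Gc u v x\<bar> \<partial>M) \<longlonglongrightarrow> 0" by blast
  then show "(\<lambda>n. \<integral>x. \<bar>G (un n) (vn n) x - Gc u v x\<bar> \<partial>M) \<longlonglongrightarrow> 0"
    using nn_integral_L1_tendsto_iff[of "\<lambda>n. G (un n) (vn n)" "Gc u v"] i G_int appD(1) a by blast
qed

lemma L1_tendsto_integral:
  assumes "\<And>n. integrable M (f n)" "integrable M h" "(\<lambda>n. \<integral>x. \<bar>f n x - h x\<bar> \<partial>M) \<longlonglongrightarrow> (0::real)"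
  shows "(\<lambda>n. \<integral>x. f n x \<partial>M) \<longlonglongrightarrow> (\<integral>x. h x \<partial>M)"
proof -
  have "(\<lambda>n. (\<integral>x. f n x \<partial>M) - (\<integral>x. h x \<partial>M)) \<longlonglongrightarrow> 0"
  proof (rule Lim_null_comparison[OF _ assms(3)], intro always_eventually allI)
    fix n
    have "(\<integral>x. f n x \<partial>M) - (\<integral>x. h x \<partial>M) = (\<integral>x. f n x - h x \<partial>M)" using assms(1,2) by simp
    then show "norm ((\<integral>x. f n x \<partial>M) - (\<integral>x. h x \<partial>M)) \<le> (\<integral>x. \<bar>f n x - h x\<bar> \<partial>M)"
      using integral_norm_bound[of M "\<lambda>x. f n x - h x"] by simp
  qed
  then show ?thesis by (simp add: LIM_zero_iff)
qed

lemma Gc_integral: "u \<in> dom \<Longrightarrow> v \<in> dom \<Longrightarrow> (\<integral>x. Gc u v x \<partial>M) = EE u v"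
proof -
  assume u: "u \<in> dom" and v: "v \<in> dom"
  then obtain un vn where a: "app un u" "app vn v" using dom_app by blast
  have "(\<lambda>n. E (un n) (vn n)) \<longlonglongrightarrow> (\<integral>x. Gc u v x \<partial>M)"
    by (rule L1_tendsto_integral) (use G_int appD(1) a Gc_spec u v in auto)
  then show ?thesis
    using closure_form_tendsto[OF dom_L2[OF u] a(1) dom_L2[OF v] a(2)] LIMSEQ_unique by blast
qed

lemma Gc_unique:
  assumes u: "u \<in> dom" and v: "v \<in> dom" and a: "app un u" "app vn v" and h: "integrable M h"
    and lim: "(\<lambda>n. \<integral>x. \<bar>G (un n) (vn n) x - h x\<bar> \<partial>M) \<longlonglongrightarrow> 0"
  shows "AE x in M. Gc u v x = h x"
proof -
  note i = Gc_spec(1)[OF u v] and g = G_int[OF appD(1)[OF a(1)] appD(1)[OF a(2)]]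
  have le: "(\<integral>x. \<bar>Gc u v x - h x\<bar> \<partial>M)
      \<le> (\<integral>x. \<bar>G (un n) (vn n) x - Gc u v x\<bar> \<partial>M) + (\<integral>x. \<bar>G (un n) (vn n) x - h x\<bar> \<partial>M)" for n
  proof -
    have "(\<integral>x. \<bar>Gc u v x - h x\<bar> \<partial>M)
        \<le> (\<integral>x. \<bar>G (un n) (vn n) x - Gc u v x\<bar> + \<bar>G (un n) (vn n) x - h x\<bar> \<partial>M)"
      by (rule integral_mono) (use i g h in auto)
    then show ?thesis
      using Bochner_Integration.integral_add[of M "\<lambda>x. \<bar>G (un n) (vn n) x - Gc u v x\<bar>"
          "\<lambda>x. \<bar>G (un n) (vn n) x - h x\<bar>"] i g h by auto
  qed
  have "(\<lambda>n. (\<integral>x. \<bar>G (un n) (vn n) x - Gc u v x\<bar> \<partial>M) + (\<integral>x. \<bar>G (un n) (vn n) x - h x\<bar> \<partial>M)) \<longlonglongrightarrow> 0"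
    using tendsto_add[OF Gc_spec(2)[OF u v a] lim] by simp
  then have "(\<integral>x. \<bar>Gc u v x - h x\<bar> \<partial>M) \<le> 0"
    by (rule LIMSEQ_le_const) (use le in blast)
  moreover have "0 \<le> (\<integral>x. \<bar>Gc u v x - h x\<bar> \<partial>M)" by simp
  ultimately have "(\<integral>x. \<bar>Gc u v x - h x\<bar> \<partial>M) = 0" by (rule antisym)
  then have "AE x in M. \<bar>Gc u v x - h x\<bar> = 0"
    using i h by (subst (asm) integral_nonneg_eq_0_iff_AE) auto
  then show ?thesis by eventually_elim simp
qed

lemma Gc_lin:
  assumes D: "u \<in> dom" "v \<in> dom" "w \<in> dom"
  shows "AE x in M. Gc (\<lambda>x. a * u x + b * v x) w x = a * Gc u w x + b * Gc v w x"
proof -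
  obtain un where un: "app un u" using dom_app[OF D(1)] by blast
  obtain vn where vn: "app vn v" using dom_app[OF D(2)] by blast
  obtain wn where wn: "app wn w" using dom_app[OF D(3)] by blast
  note ap = un vn wn
  note A = appD(1)[OF ap(1)] appD(1)[OF ap(2)] appD(1)[OF ap(3)]
  note i = Gc_spec(1)[OF D(1,3)] Gc_spec(1)[OF D(2,3)]
  show ?thesis
  proof (rule Gc_unique[OF EE.lin[OF D(1,2)] D(3) app_lin[OF dom_L2[OF D(1)] dom_L2[OF D(2)] ap(1,2)] ap(3)])
    show "integrable M (\<lambda>x. a * Gc u w x + b * Gc v w x)" using i by simp
    have "(\<lambda>n. \<bar>a\<bar> * (\<integral>x. \<bar>G (un n) (wn n) x - Gc u w x\<bar> \<partial>M) + \<bar>b\<bar> * (\<integral>x. \<bar>G (vn n) (wn n) x - Gc v w x\<bar> \<partial>M))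
        \<longlonglongrightarrow> \<bar>a\<bar> * 0 + \<bar>b\<bar> * 0"
      by (intro tendsto_intros Gc_spec(2) D ap)
    then have l: "(\<lambda>n. \<bar>a\<bar> * (\<integral>x. \<bar>G (un n) (wn n) x - Gc u w x\<bar> \<partial>M) + \<bar>b\<bar> * (\<integral>x. \<bar>G (vn n) (wn n) x - Gc v w x\<bar> \<partial>M))
        \<longlonglongrightarrow> 0" by simp
    show "(\<lambda>n. \<integral>x. \<bar>G (\<lambda>x. a * un n x + b * vn n x) (wn n) x - (a * Gc u w x + b * Gc v w x)\<bar> \<partial>M) \<longlonglongrightarrow> 0"
    proof (rule Lim_null_comparison[OF _ l], intro always_eventually allI)
      fix n
      have "(\<integral>x. \<bar>G (\<lambda>x. a * un n x + b * vn n x) (wn n) x - (a * Gc u w x + b * Gc v w x)\<bar> \<partial>M)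
          \<le> (\<integral>x. \<bar>a\<bar> * \<bar>G (un n) (wn n) x - Gc u w x\<bar> + \<bar>b\<bar> * \<bar>G (vn n) (wn n) x - Gc v w x\<bar> \<partial>M)"
      proof (rule integral_mono)
        fix x assume x: "x \<in> space M"
        have "G (\<lambda>x. a * un n x + b * vn n x) (wn n) x - (a * Gc u w x + b * Gc v w x)
            = a * (G (un n) (wn n) x - Gc u w x) + b * (G (vn n) (wn n) x - Gc v w x)"
          using G_lin[OF A(1,2,3) x, of a n b n n] by (simp add: algebra_simps)
        then show "\<bar>G (\<lambda>x. a * un n x + b * vn n x) (wn n) x - (a * Gc u w x + b * Gc v w x)\<bar>
            \<le> \<bar>a\<bar> * \<bar>G (un n) (wn n) x - Gc u w x\<bar> + \<bar>b\<bar> * \<bar>G (vn n) (wn n) x - Gc v w x\<bar>"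
          by (simp only: abs_mult[symmetric] abs_triangle_ineq)
      qed (use G_int[OF D0_lin[OF A(1,2)] A(3)] G_int[OF A(1,3)] G_int[OF A(2,3)] i in auto)
      also have "\<dots> = \<bar>a\<bar> * (\<integral>x. \<bar>G (un n) (wn n) x - Gc u w x\<bar> \<partial>M) + \<bar>b\<bar> * (\<integral>x. \<bar>G (vn n) (wn n) x - Gc v w x\<bar> \<partial>M)"
        using G_int[OF A(1,3)] G_int[OF A(2,3)] i by simp
      finally show "norm (\<integral>x. \<bar>G (\<lambda>x. a * un n x + b * vn n x) (wn n) x - (a * Gc u w x + b * Gc v w x)\<bar> \<partial>M)
          \<le> \<bar>a\<bar> * (\<integral>x. \<bar>G (un n) (wn n) x - Gc u w x\<bar> \<partial>M) + \<bar>b\<bar> * (\<integral>x. \<bar>G (vn n) (wn n) x - Gc v w x\<bar> \<partial>M)"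
        by simp
    qed
  qed
qed

lemma Gc_sym:
  assumes D: "u \<in> dom" "v \<in> dom"
  shows "AE x in M. Gc u v x = Gc v u x"
proof -
  obtain un where un: "app un u" using dom_app[OF D(1)] by blast
  obtain vn where vn: "app vn v" using dom_app[OF D(2)] by blast
  note ap = un vn
  show ?thesis
  proof (rule Gc_unique[OF D ap Gc_spec(1)[OF D(2,1)]])
    have "(\<integral>x. \<bar>G (un n) (vn n) x - Gc v u x\<bar> \<partial>M) = (\<integral>x. \<bar>G (vn n) (un n) x - Gc v u x\<bar> \<partial>M)" for n
      by (rule Bochner_Integration.integral_cong) (use G_sym appD(1) ap in auto)
    then show "(\<lambda>n. \<integral>x. \<bar>G (un n) (vn n) x - Gc v u x\<bar> \<partial>M) \<longlonglongrightarrow> 0"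
      using Gc_spec(2)[OF D(2,1) ap(2,1)] by simp
  qed
qed

subsection \<open>Strong locality and conservativeness\<close>

lemma trunc_bounds:
  assumes "e > (0::real)"
  shows "\<bar>e * t / sqrt (t\<^sup>2 + e\<^sup>2)\<bar> \<le> e" "0 \<le> (e / sqrt (t\<^sup>2 + e\<^sup>2)) ^ 3" "(e / sqrt (t\<^sup>2 + e\<^sup>2)) ^ 3 \<le> 1"
proof -
  have p: "0 < sqrt (t\<^sup>2 + e\<^sup>2)" using assms by (simp add: add_nonneg_pos)
  have t: "\<bar>t\<bar> \<le> sqrt (t\<^sup>2 + e\<^sup>2)" using real_sqrt_le_mono[of "t\<^sup>2" "t\<^sup>2 + e\<^sup>2"] by simp
  have e: "e \<le> sqrt (t\<^sup>2 + e\<^sup>2)" using real_sqrt_le_mono[of "e\<^sup>2" "t\<^sup>2 + e\<^sup>2"] assms by simp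
  show "\<bar>e * t / sqrt (t\<^sup>2 + e\<^sup>2)\<bar> \<le> e"
    using p t assms by (simp add: abs_mult pos_divide_le_eq)
  show "0 \<le> (e / sqrt (t\<^sup>2 + e\<^sup>2)) ^ 3" using p assms by simp
  show "(e / sqrt (t\<^sup>2 + e\<^sup>2)) ^ 3 \<le> 1" using p e assms by (intro power_le_one) auto
qed

lemma E_trunc_le:
  assumes u: "u \<in> D0" and e: "e > 0"
  shows "E.nrm (\<lambda>x. e * u x / sqrt ((u x)\<^sup>2 + e\<^sup>2)) \<le> E.nrm u"
proof (rule D0_contraction[OF u D0_trunc[OF u e]])
  fix x assume x: "x \<in> space M"
  let ?s = "\<lambda>x. e * u x / sqrt ((u x)\<^sup>2 + e\<^sup>2)" and ?k = "(e / sqrt ((u x)\<^sup>2 + e\<^sup>2)) ^ 3"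
  have "G ?s ?s x = ?k * (?k * G u u x)"
    using G_trunc[OF u D0_trunc[OF u e] e x] G_sym[OF u D0_trunc[OF u e] x] G_trunc[OF u u e x] by simp
  also have "\<dots> \<le> 1 * (1 * G u u x)"
    by (intro mult_mono mult_right_mono trunc_bounds[OF e] mult_nonneg_nonneg G_nonneg u x zero_le_one)
  finally show "G ?s ?s x \<le> G u u x" by simp
qed

text \<open>The chain rule for \<open>t \<mapsto> e t / (t\<^sup>2 + e\<^sup>2)\<^bsup>1/2\<^esup>\<close> on the domain, with an energy bound
  uniform in \<open>e\<close>.\<close>

lemma trunc_chain:
  assumes u: "u \<in> dom"
  shows "\<exists>B. \<forall>e>0. (\<lambda>x. e * u x / sqrt ((u x)\<^sup>2 + e\<^sup>2)) \<in> dom \<and>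
    EE.nrm (\<lambda>x. e * u x / sqrt ((u x)\<^sup>2 + e\<^sup>2)) \<le> B \<and>
    (\<forall>v\<in>dom. EE (\<lambda>x. e * u x / sqrt ((u x)\<^sup>2 + e\<^sup>2)) v
      = (\<integral>x. (e / sqrt ((u x)\<^sup>2 + e\<^sup>2)) ^ 3 * Gc u v x \<partial>M))"
proof -
  obtain un' where a': "app un' u" using dom_app u by blast
  \<comment> \<open>almost everywhere convergence is needed for the composition with the derivative\<close>
  obtain r where r: "strict_mono (r :: nat \<Rightarrow> nat)" "AE x in M. (\<lambda>n. un' (r n) x) \<longlonglongrightarrow> u x"
    by (rule L2_tendsto_AE_subseq[OF D0_L2[OF appD(1)[OF a']] dom_L2[OF u] appD(3)[OF a']])
  define un where "un n = un' (r n)" for n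
  have a: "app un u" unfolding un_def by (rule app_subseq[OF a' r(1)])
  have ae: "AE x in M. (\<lambda>n. un n x) \<longlonglongrightarrow> u x" using r(2) unfolding un_def .
  obtain B where B: "B > 0" "\<And>n. E.nrm (un n) \<le> B" using app_nrm_bounded[OF a] by blast
  note D = appD(1)[OF a]
  have um [measurable]: "u \<in> borel_measurable M" using dom_L2[OF u] by (simp add: L2_def)
  have unm [measurable]: "un n \<in> borel_measurable M" for n using D0_L2[OF D] by (simp add: L2_def)
  show ?thesis
  proof (intro exI[of _ B] allI impI)
    fix e :: real assume e: "e > 0"
    define T where "T = (\<lambda>t. e * t / sqrt (t\<^sup>2 + e\<^sup>2))"
    define k where "k = (\<lambda>t. (e / sqrt (t\<^sup>2 + e\<^sup>2)) ^ 3)"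
    have pos: "sqrt (t\<^sup>2 + e\<^sup>2) \<noteq> 0" for t
      using add_nonneg_pos[of "t\<^sup>2" "e\<^sup>2"] e by simp
    have Tc: "isCont T t" and kc: "isCont k t" for t
      unfolding T_def k_def using pos by (intro continuous_intros; simp)+
    have [measurable]: "T \<in> borel_measurable borel" "k \<in> borel_measurable borel"
      unfolding T_def k_def by measurable
    have TL: "(\<lambda>x. T (u x)) \<in> L2 M"
    proof (rule bounded_imp_L2[where c = e])
      show "AE x in M. \<bar>T (u x)\<bar> \<le> e"
        unfolding T_def by (intro AE_I2 trunc_bounds(1)[OF e])
    qed measurable
    have TD: "(\<lambda>x. T (un n x)) \<in> D0" for n
      unfolding T_def by (rule D0_trunc[OF D e])
    have TB: "EE.nrm (\<lambda>x. T (un n x)) \<le> B" for n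
      using E_trunc_le[OF D e, of n] B(2)[of n] EE_nrm_eq[OF TD, of n] unfolding T_def by simp
    have lim: "L2_tendsto M (\<lambda>n x. T (un n x)) (\<lambda>x. T (u x))"
    proof (rule L2_tendsto_bounded[where c = "2 * e"])
      show "AE x in M. \<bar>T (un n x) - T (u x)\<bar> \<le> 2 * e" for n
        using trunc_bounds(1)[OF e, of "un n _"] trunc_bounds(1)[OF e, of "u _"] unfolding T_def
        by (intro AE_I2) (smt (verit))
      show "AE x in M. (\<lambda>n. T (un n x)) \<longlonglongrightarrow> T (u x)"
        using ae by eventually_elim (rule isCont_tendsto_compose[OF Tc])
    qed (auto simp: T_def)
    have 1: "(\<lambda>x. T (u x)) \<in> dom" "EE.nrm (\<lambda>x. T (u x)) \<le> B"
      by (rule EE_lsc[OF D0_dom[OF TD] TB lim TL])+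
    have 2: "EE (\<lambda>x. T (u x)) v = (\<integral>x. k (u x) * Gc u v x \<partial>M)" if v: "v \<in> dom" for v
    proof -
      obtain vn where vn: "app vn v" using dom_app[OF v] by blast
      note Dv = appD(1)[OF vn]
      note i = Gc_spec(1)[OF u v]
      have [measurable]: "Gc u v \<in> borel_measurable M" using i by auto
      \<comment> \<open>\<open>T (un n)\<close> converges only weakly, but \<open>vn n\<close> converges strongly\<close>
      have w: "(\<lambda>n. EE (\<lambda>x. T (un n x)) v) \<longlonglongrightarrow> EE (\<lambda>x. T (u x)) v"
        by (rule EE_weak_tendsto[OF D0_dom[OF TD] TB lim TL v])
      have l0: "(\<lambda>n. B * EE.nrm (\<lambda>x. vn n x - v x)) \<longlonglongrightarrow> 0"
        using tendsto_mult_left[OF app_EE_tendsto[OF v vn], of B] by simp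
      have "(\<lambda>n. EE (\<lambda>x. T (un n x)) (vn n) - EE (\<lambda>x. T (un n x)) v) \<longlonglongrightarrow> 0"
      proof (rule Lim_null_comparison[OF _ l0], intro always_eventually allI)
        fix n
        have "\<bar>EE (\<lambda>x. T (un n x)) (vn n) - EE (\<lambda>x. T (un n x)) v\<bar>
            = \<bar>EE (\<lambda>x. T (un n x)) (\<lambda>x. vn n x - v x)\<bar>"
          by (simp add: EE.Q_diff2[OF D0_dom[OF Dv] v D0_dom[OF TD]])
        also have "\<dots> \<le> EE.nrm (\<lambda>x. T (un n x)) * EE.nrm (\<lambda>x. vn n x - v x)"
          by (rule EE.Cauchy_Schwarz[OF D0_dom[OF TD] EE.diff[OF D0_dom[OF Dv] v]])
        also have "\<dots> \<le> B * EE.nrm (\<lambda>x. vn n x - v x)"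
          by (intro mult_right_mono TB EE.nrm_nonneg EE.diff[OF D0_dom[OF Dv] v])
        finally show "norm (EE (\<lambda>x. T (un n x)) (vn n) - EE (\<lambda>x. T (un n x)) v)
            \<le> B * EE.nrm (\<lambda>x. vn n x - v x)" by simp
      qed
      from tendsto_add[OF this w]
      have lhs: "(\<lambda>n. EE (\<lambda>x. T (un n x)) (vn n)) \<longlonglongrightarrow> EE (\<lambda>x. T (u x)) v" by simp
      have eq: "EE (\<lambda>x. T (un n x)) (vn n) = (\<integral>x. k (un n x) * G (un n) (vn n) x \<partial>M)" for n
        unfolding EE_eq_E[OF TD Dv]
        by (rule Bochner_Integration.integral_cong) (use G_trunc[OF D Dv e] in \<open>auto simp: T_def k_def\<close>)
      have kb: "0 \<le> k t" "k t \<le> 1" for t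
        using trunc_bounds(2,3)[OF e, of t] unfolding k_def by auto
      have ik: "integrable M (\<lambda>x. k (w x) * h x)" if "integrable M h" "w \<in> borel_measurable M" for w h
      proof (rule Bochner_Integration.integrable_bound[OF that(1)])
        show "(\<lambda>x. k (w x) * h x) \<in> borel_measurable M" using that by measurable
        show "AE x in M. norm (k (w x) * h x) \<le> norm (h x)"
          using kb by (intro AE_I2) (simp add: abs_mult mult_left_le_one_le)
      qed
      have iku: "integrable M (\<lambda>x. k (u x) * Gc u v x)" by (rule ik[OF i um])
      have rhs: "(\<lambda>n. \<integral>x. k (un n x) * G (un n) (vn n) x \<partial>M) \<longlonglongrightarrow> (\<integral>x. k (u x) * Gc u v x \<partial>M)"
      proof (rule L1_tendsto_integral[OF ik[OF G_int[OF D Dv] unm] iku])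
        have "(\<lambda>n. \<integral>x. \<bar>k (un n x) - k (u x)\<bar> * \<bar>Gc u v x\<bar> \<partial>M) \<longlonglongrightarrow> (\<integral>x. 0 \<partial>M)"
        proof (rule integral_dominated_convergence[where w = "\<lambda>x. \<bar>Gc u v x\<bar>"])
          show "AE x in M. (\<lambda>n. \<bar>k (un n x) - k (u x)\<bar> * \<bar>Gc u v x\<bar>) \<longlonglongrightarrow> 0"
            using ae
          proof eventually_elim
            case (elim x)
            have "(\<lambda>n. \<bar>k (un n x) - k (u x)\<bar> * \<bar>Gc u v x\<bar>) \<longlonglongrightarrow> \<bar>k (u x) - k (u x)\<bar> * \<bar>Gc u v x\<bar>"
              by (intro tendsto_intros isCont_tendsto_compose[OF kc elim])
            then show ?case by simp
          qed
          show "AE x in M. norm (\<bar>k (un n x) - k (u x)\<bar> * \<bar>Gc u v x\<bar>) \<le> \<bar>Gc u v x\<bar>" for n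
          proof (intro AE_I2)
            fix x
            have "\<bar>k (un n x) - k (u x)\<bar> \<le> 1" using kb[of "un n x"] kb[of "u x"] by linarith
            then show "norm (\<bar>k (un n x) - k (u x)\<bar> * \<bar>Gc u v x\<bar>) \<le> \<bar>Gc u v x\<bar>"
              by (simp add: abs_mult mult_left_le_one_le)
          qed
        qed (use i in auto)
        from tendsto_add[OF Gc_spec(2)[OF u v a vn] this]
        have l: "(\<lambda>n. (\<integral>x. \<bar>G (un n) (vn n) x - Gc u v x\<bar> \<partial>M)
            + (\<integral>x. \<bar>k (un n x) - k (u x)\<bar> * \<bar>Gc u v x\<bar> \<partial>M)) \<longlonglongrightarrow> 0" by simp
        show "(\<lambda>n. \<integral>x. \<bar>k (un n x) * G (un n) (vn n) x - k (u x) * Gc u v x\<bar> \<partial>M) \<longlonglongrightarrow> 0"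
        proof (rule Lim_null_comparison[OF _ l], intro always_eventually allI)
          fix n
          have i2: "integrable M (\<lambda>x. \<bar>k (un n x) - k (u x)\<bar> * \<bar>Gc u v x\<bar>)"
            using Bochner_Integration.integrable_diff[OF ik[OF i unm, of n] iku]
            by (subst abs_mult[symmetric]) (simp add: left_diff_distrib)
          have i1: "integrable M (\<lambda>x. \<bar>G (un n) (vn n) x - Gc u v x\<bar>)"
            using G_int[OF D Dv, of n n] i by auto
          have "(\<integral>x. \<bar>k (un n x) * G (un n) (vn n) x - k (u x) * Gc u v x\<bar> \<partial>M)
              \<le> (\<integral>x. \<bar>G (un n) (vn n) x - Gc u v x\<bar> + \<bar>k (un n x) - k (u x)\<bar> * \<bar>Gc u v x\<bar> \<partial>M)"
          proof (rule integral_mono)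
            fix x
            have "k (un n x) * G (un n) (vn n) x - k (u x) * Gc u v x
                = k (un n x) * (G (un n) (vn n) x - Gc u v x) + (k (un n x) - k (u x)) * Gc u v x"
              by (simp add: algebra_simps)
            then have "\<bar>k (un n x) * G (un n) (vn n) x - k (u x) * Gc u v x\<bar>
                \<le> k (un n x) * \<bar>G (un n) (vn n) x - Gc u v x\<bar> + \<bar>k (un n x) - k (u x)\<bar> * \<bar>Gc u v x\<bar>"
              using abs_triangle_ineq[of "k (un n x) * (G (un n) (vn n) x - Gc u v x)" "(k (un n x) - k (u x)) * Gc u v x"]
                kb(1)[of "un n x"] by (simp add: abs_mult)
            also have "k (un n x) * \<bar>G (un n) (vn n) x - Gc u v x\<bar> \<le> \<bar>G (un n) (vn n) x - Gc u v x\<bar>"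
              using kb[of "un n x"] by (simp add: mult_left_le_one_le)
            finally show "\<bar>k (un n x) * G (un n) (vn n) x - k (u x) * Gc u v x\<bar>
                \<le> \<bar>G (un n) (vn n) x - Gc u v x\<bar> + \<bar>k (un n x) - k (u x)\<bar> * \<bar>Gc u v x\<bar>" by simp
          qed (use i1 i2 ik[OF G_int[OF D Dv] unm, of n n n] iku in auto)
          also have "\<dots> = (\<integral>x. \<bar>G (un n) (vn n) x - Gc u v x\<bar> \<partial>M)
              + (\<integral>x. \<bar>k (un n x) - k (u x)\<bar> * \<bar>Gc u v x\<bar> \<partial>M)"
            by (rule Bochner_Integration.integral_add[OF i1 i2])
          finally show "norm (\<integral>x. \<bar>k (un n x) * G (un n) (vn n) x - k (u x) * Gc u v x\<bar> \<partial>M)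
              \<le> (\<integral>x. \<bar>G (un n) (vn n) x - Gc u v x\<bar> \<partial>M)
                + (\<integral>x. \<bar>k (un n x) - k (u x)\<bar> * \<bar>Gc u v x\<bar> \<partial>M)" by simp
        qed
      qed
      show ?thesis using lhs rhs unfolding eq by (rule LIMSEQ_unique)
    qed
    show "(\<lambda>x. e * u x / sqrt ((u x)\<^sup>2 + e\<^sup>2)) \<in> dom \<and>
      EE.nrm (\<lambda>x. e * u x / sqrt ((u x)\<^sup>2 + e\<^sup>2)) \<le> B \<and>
      (\<forall>v\<in>dom. EE (\<lambda>x. e * u x / sqrt ((u x)\<^sup>2 + e\<^sup>2)) v
        = (\<integral>x. (e / sqrt ((u x)\<^sup>2 + e\<^sup>2)) ^ 3 * Gc u v x \<partial>M))"
      using 1 2 unfolding T_def k_def by blast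
  qed
qed

text \<open>The square field operator vanishes on the zero set of its argument.\<close>

lemma Gc_zero_set:
  assumes u: "u \<in> dom" and v: "v \<in> dom"
  shows "(\<integral>x. indicator {x. u x = 0} x * Gc u v x \<partial>M) = 0"
proof -
  from trunc_chain[OF u] obtain B where
    B: "\<And>e. e > 0 \<Longrightarrow> (\<lambda>x. e * u x / sqrt ((u x)\<^sup>2 + e\<^sup>2)) \<in> dom"
       "\<And>e. e > 0 \<Longrightarrow> EE.nrm (\<lambda>x. e * u x / sqrt ((u x)\<^sup>2 + e\<^sup>2)) \<le> B"
       "\<And>e. e > 0 \<Longrightarrow> EE (\<lambda>x. e * u x / sqrt ((u x)\<^sup>2 + e\<^sup>2)) v
          = (\<integral>x. (e / sqrt ((u x)\<^sup>2 + e\<^sup>2)) ^ 3 * Gc u v x \<partial>M)"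
    using v by blast
  \<comment> \<open>as \<open>e \<rightarrow> 0\<close> the truncations tend to \<open>0\<close>, their derivatives to the indicator of \<open>{0}\<close>\<close>
  define e where "e n = 1 / real (Suc n)" for n
  have e: "e n > 0" for n unfolding e_def by simp
  have elim0: "e \<longlonglongrightarrow> 0" unfolding e_def by (rule LIMSEQ_Suc[OF lim_1_over_n])
  have [measurable]: "u \<in> borel_measurable M" using dom_L2[OF u] by (simp add: L2_def)
  note i = Gc_spec(1)[OF u v]
  have [measurable]: "Gc u v \<in> borel_measurable M" using i by auto
  have lim: "L2_tendsto M (\<lambda>n x. e n * u x / sqrt ((u x)\<^sup>2 + (e n)\<^sup>2)) (\<lambda>_. 0)"
  proof (rule L2_tendsto_bounded[where c = 1])
    fix n
    have "e n \<le> 1" unfolding e_def by simp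
    then show "AE x in M. \<bar>e n * u x / sqrt ((u x)\<^sup>2 + (e n)\<^sup>2) - 0\<bar> \<le> 1"
      using trunc_bounds(1)[OF e[of n]] by (intro AE_I2) (metis diff_zero order_trans)
  next
    show "AE x in M. (\<lambda>n. e n * u x / sqrt ((u x)\<^sup>2 + (e n)\<^sup>2)) \<longlonglongrightarrow> 0"
      by (intro AE_I2 Lim_null_comparison[OF _ elim0] always_eventually allI)
        (use trunc_bounds(1)[OF e] in simp)
  qed auto
  have z: "(\<lambda>_. 0) \<in> L2 M" using dom_L2[OF zero_dom] .
  have "(\<lambda>n. EE (\<lambda>x. e n * u x / sqrt ((u x)\<^sup>2 + (e n)\<^sup>2)) v) \<longlonglongrightarrow> EE (\<lambda>_. 0) v"
    by (rule EE_weak_tendsto[OF B(1)[OF e] B(2)[OF e] lim z v])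
  then have lhs: "(\<lambda>n. EE (\<lambda>x. e n * u x / sqrt ((u x)\<^sup>2 + (e n)\<^sup>2)) v) \<longlonglongrightarrow> 0"
    using EE_const[OF v, of 0] by simp
  have "(\<lambda>n. \<integral>x. (e n / sqrt ((u x)\<^sup>2 + (e n)\<^sup>2)) ^ 3 * Gc u v x \<partial>M)
      \<longlonglongrightarrow> (\<integral>x. indicator {x. u x = 0} x * Gc u v x \<partial>M)"
  proof (rule integral_dominated_convergence[where w = "\<lambda>x. \<bar>Gc u v x\<bar>"])
    show "AE x in M. (\<lambda>n. (e n / sqrt ((u x)\<^sup>2 + (e n)\<^sup>2)) ^ 3 * Gc u v x)
        \<longlonglongrightarrow> indicator {x. u x = 0} x * Gc u v x"
    proof (intro AE_I2 tendsto_mult tendsto_const)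
      fix x
      show "(\<lambda>n. (e n / sqrt ((u x)\<^sup>2 + (e n)\<^sup>2)) ^ 3) \<longlonglongrightarrow> indicator {x. u x = 0} x"
      proof (cases "u x = 0")
        case True
        have "e n / sqrt ((u x)\<^sup>2 + (e n)\<^sup>2) = 1" for n using True e[of n] by simp
        then show ?thesis using True by simp
      next
        case False
        have "(\<lambda>n. (e n / sqrt ((u x)\<^sup>2 + (e n)\<^sup>2)) ^ 3) \<longlonglongrightarrow> (0 / sqrt ((u x)\<^sup>2 + 0\<^sup>2)) ^ 3"
          by (intro tendsto_intros elim0) (use False in auto)
        then show ?thesis using False by simp
      qed
    qed
    show "AE x in M. norm ((e n / sqrt ((u x)\<^sup>2 + (e n)\<^sup>2)) ^ 3 * Gc u v x) \<le> \<bar>Gc u v x\<bar>" for n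
    proof (intro AE_I2)
      fix x
      show "norm ((e n / sqrt ((u x)\<^sup>2 + (e n)\<^sup>2)) ^ 3 * Gc u v x) \<le> \<bar>Gc u v x\<bar>"
        using trunc_bounds(2,3)[OF e[of n], of "u x"]
        by (simp only: real_norm_def abs_mult abs_of_nonneg mult_left_le_one_le abs_ge_zero)
    qed
  qed (use i in auto)
  then have "(\<lambda>n. EE (\<lambda>x. e n * u x / sqrt ((u x)\<^sup>2 + (e n)\<^sup>2)) v)
      \<longlonglongrightarrow> (\<integral>x. indicator {x. u x = 0} x * Gc u v x \<partial>M)"
    using B(3)[OF e] by simp
  then show ?thesis using lhs by (rule LIMSEQ_unique)
qed

text \<open>
  If \<open>(u - a) v = 0\<close>, then the square field operator of \<open>u - a\<close> and \<open>v\<close> is integrated over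
  \<open>{u = a}\<close> and \<open>{v = 0}\<close>, which cover the space, and over their intersection. All three integrals vanish.
\<close>

theorem strongly_local_closure: "strongly_local M EE dom"
  unfolding strongly_local_def
proof (intro ballI allI impI)
  fix u v a assume u: "u \<in> dom" and v: "v \<in> dom" and ae: "AE x in M. (u x - a) * v x = 0"
  define w where "w = (\<lambda>x. u x - a)"
  have w: "w \<in> dom" unfolding w_def by (rule EE.diff[OF u const_dom])
  have wv: "EE w v = EE u v"
    unfolding w_def using EE.Q_diff[OF u const_dom v] EE_const[OF v] by simp
  define p where "p = (\<lambda>x. 1 * w x + 1 * v x)"
  define q where "q = (\<lambda>x. 1 * w x + (-1) * v x)"
  have p: "p \<in> dom" and q: "q \<in> dom" unfolding p_def q_def by (rule EE.lin[OF w v])+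
  have m [measurable]: "w \<in> borel_measurable M" "v \<in> borel_measurable M" "p \<in> borel_measurable M" "q \<in> borel_measurable M"
    using dom_L2 w v p q by (auto simp: L2_def)
  note I = Gc_spec(1)[OF w v] Gc_spec(1)[OF v w] Gc_spec(1)[OF p v] Gc_spec(1)[OF q v] Gc_spec(1)[OF v v]
  have ii: "integrable M (\<lambda>x. indicator {x. f x = 0} x * h x)"
    if "f \<in> borel_measurable M" "integrable M h" for f h :: "'b \<Rightarrow> real"
  proof -
    have "(\<lambda>x. indicator {x. f x = 0} x * h x) = (\<lambda>x. (if f x = 0 then 1 else 0) * h x)"
      by (auto simp: indicator_def)
    moreover have "integrable M (\<lambda>x. (if f x = 0 then 1 else 0) * h x)"
    proof (rule Bochner_Integration.integrable_bound[OF that(2)])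
      show "(\<lambda>x. (if f x = 0 then 1 else 0) * h x) \<in> borel_measurable M" using that by measurable
    qed auto
    ultimately show ?thesis by simp
  qed
  \<comment> \<open>where \<open>w v = 0\<close>, the sets \<open>{w + v = 0}\<close> and \<open>{w - v = 0}\<close> both equal \<open>{w = 0, v = 0}\<close>\<close>
  have eq: "AE x in M. 2 * Gc w v x =
      2 * (indicator {x. w x = 0} x * Gc w v x) + 2 * (indicator {x. v x = 0} x * Gc v w x)
      - indicator {x. p x = 0} x * Gc p v x - indicator {x. q x = 0} x * Gc q v x"
    using ae Gc_lin[OF w v v, of 1 1] Gc_lin[OF w v v, of 1 "-1"] Gc_sym[OF w v]
  proof eventually_elim
    case (elim x)
    have z: "w x = 0 \<or> v x = 0" using elim(1) by (simp add: w_def)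
    have pq: "p x = 0 \<longleftrightarrow> w x = 0 \<and> v x = 0" "q x = 0 \<longleftrightarrow> w x = 0 \<and> v x = 0"
      using z by (auto simp: p_def q_def)
    have gp: "Gc p v x = Gc w v x + Gc v v x" and gq: "Gc q v x = Gc w v x - Gc v v x"
      using elim(2,3) unfolding p_def q_def by simp_all
    show ?case using z pq gp gq elim(4) by (auto simp: indicator_def)
  qed
  have "(\<integral>x. 2 * Gc w v x \<partial>M) = (\<integral>x. 2 * (indicator {x. w x = 0} x * Gc w v x) + 2 * (indicator {x. v x = 0} x * Gc v w x)
      - indicator {x. p x = 0} x * Gc p v x - indicator {x. q x = 0} x * Gc q v x \<partial>M)"
    by (rule integral_cong_AE) (use eq ii[OF m(1) I(1)] ii[OF m(2) I(2)] ii[OF m(3) I(3)] ii[OF m(4) I(4)] I in auto)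
  also have "\<dots> = 0"
    using ii[OF m(1) I(1)] ii[OF m(2) I(2)] ii[OF m(3) I(3)] ii[OF m(4) I(4)]
      Gc_zero_set[OF w v] Gc_zero_set[OF v w] Gc_zero_set[OF p v] Gc_zero_set[OF q v] by simp
  finally show "EE u v = 0" using Gc_integral[OF w v] wv by simp
qed

text \<open>Since constants have no energy, the resolvent equation for a constant is solved by a constant;
  the solution is unique up to null sets.\<close>

lemma resolvent_one:
  assumes a: "a > 0" and f: "f \<in> L2 M" "AE x in M. f x = c"
  shows "resolvent M EE dom a f \<in> dom" "AE x in M. a * resolvent M EE dom a f x = c"
proof -
  let ?P = "\<lambda>u. u \<in> dom \<and> (\<forall>v\<in>dom. EE u v + a * (\<integral>x. u x * v x \<partial>M) = (\<integral>x. f x * v x \<partial>M))"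
  have int: "(\<integral>x. f x * v x \<partial>M) = c * (\<integral>x. v x \<partial>M)" if v: "v \<in> dom" for v
  proof -
    have "(\<integral>x. f x * v x \<partial>M) = (\<integral>x. c * v x \<partial>M)"
    proof (rule integral_cong_AE)
      show "AE x in M. f x * v x = c * v x" using f(2) by eventually_elim simp
    qed (use f(1) dom_L2[OF v] in \<open>auto simp: L2_def\<close>)
    then show ?thesis by simp
  qed
  have "?P (\<lambda>_. c / a)"
    using const_dom EE_const int a by simp
  then have P: "?P (resolvent M EE dom a f)" unfolding resolvent_def by (rule someI[of ?P])
  define u where "u = resolvent M EE dom a f"
  have u: "u \<in> dom" and eq: "\<And>v. v \<in> dom \<Longrightarrow> EE u v + a * (\<integral>x. u x * v x \<partial>M) = c * (\<integral>x. v x \<partial>M)"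
    using P int unfolding u_def by auto
  show "resolvent M EE dom a f \<in> dom" using P by blast
  define w where "w = (\<lambda>x. u x - c / a)"
  have w: "w \<in> dom" unfolding w_def by (rule EE.diff[OF u const_dom])
  have L: "u \<in> L2 M" "w \<in> L2 M" "(\<lambda>_. c / a) \<in> L2 M" using dom_L2 u w const_dom by auto
  have "EE w w = EE u w" using EE.Q_diff[OF u const_dom w] EE_const[OF w] by (simp add: w_def)
  moreover have "(\<integral>x. w x * w x \<partial>M) = (\<integral>x. u x * w x \<partial>M) - c / a * (\<integral>x. w x \<partial>M)"
    using L2.Q_diff[OF L(1,3,2)] by (simp add: w_def)
  ultimately have "EE w w + a * (\<integral>x. w x * w x \<partial>M) = 0"
    using eq[OF w] a by (simp add: right_diff_distrib)
  moreover have "0 \<le> a * (\<integral>x. w x * w x \<partial>M)" using a by simp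
  ultimately have "a * (\<integral>x. w x * w x \<partial>M) = 0" using EE.Q_nonneg[OF w] by linarith
  then have "(\<integral>x. w x * w x \<partial>M) = 0" using a by simp
  then have "AE x in M. w x * w x = 0"
    using L2_mult_integrable[OF L(2,2)] by (subst (asm) integral_nonneg_eq_0_iff_AE) auto
  then have "AE x in M. w x = 0" by eventually_elim simp
  then have "AE x in M. a * u x = c" by eventually_elim (use a in \<open>simp add: w_def field_simps\<close>)
  then show "AE x in M. a * resolvent M EE dom a f x = c" unfolding u_def .
qed

theorem conservative_closure: "conservative M EE dom"
  unfolding conservative_def
proof (intro allI impI)
  fix t :: real assume t: "t > 0"
  let ?R = "\<lambda>n. ((\<lambda>h x. (real (Suc n) / t) * resolvent M EE dom (real (Suc n) / t) h x) ^^ Suc n) (\<lambda>_. 1)"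
  have iter: "((\<lambda>h x. b * resolvent M EE dom b h x) ^^ k) (\<lambda>_. 1) \<in> L2 M \<and>
      (AE x in M. ((\<lambda>h x. b * resolvent M EE dom b h x) ^^ k) (\<lambda>_. 1) x = 1)" if b: "b > 0" for b k
  proof (induction k)
    case 0
    show ?case using dom_L2[OF one_dom] by simp
  next
    case (Suc k)
    let ?h = "((\<lambda>h x. b * resolvent M EE dom b h x) ^^ k) (\<lambda>_. 1)"
    have h: "?h \<in> L2 M" "AE x in M. ?h x = 1" using Suc by auto
    show ?case
      using dom_L2[OF EE.scale[OF resolvent_one(1)[OF b h], of b]] resolvent_one(2)[OF b h] by simp
  qed
  have R: "?R n \<in> L2 M" "AE x in M. ?R n x = 1" for n
    using iter[of "real (Suc n) / t" "Suc n"] t by simp_all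
  have R0: "(\<integral>x. (?R n x - g x)\<^sup>2 \<partial>M) = (\<integral>x. (1 - g x)\<^sup>2 \<partial>M)" if g: "g \<in> L2 M" for g n
  proof (rule integral_cong_AE)
    have [measurable]: "?R n \<in> borel_measurable M" "g \<in> borel_measurable M"
      using R(1)[of n] g unfolding L2_def by blast+
    show "(\<lambda>x. (?R n x - g x)\<^sup>2) \<in> borel_measurable M" "(\<lambda>x. (1 - g x)\<^sup>2) \<in> borel_measurable M"
      by measurable
    show "AE x in M. (?R n x - g x)\<^sup>2 = (1 - g x)\<^sup>2" using R(2)[of n] by eventually_elim simp
  qed
  let ?P = "\<lambda>g. g \<in> L2 M \<and> L2_tendsto M ?R g"
  have "?P (\<lambda>_. 1)" using R0[of "\<lambda>_. 1"] dom_L2[OF one_dom] by (simp add: L2_tendsto_def)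
  then have P: "?P (semigroup M EE dom t (\<lambda>_. 1))" unfolding semigroup_def by (rule someI[of ?P])
  define g where "g = semigroup M EE dom t (\<lambda>_. 1)"
  have g: "g \<in> L2 M" "L2_tendsto M ?R g" using P unfolding g_def by blast+
  then have "(\<integral>x. (1 - g x)\<^sup>2 \<partial>M) = 0"
    unfolding L2_tendsto_def R0[OF g(1)] by (simp add: LIMSEQ_const_iff)
  then have "AE x in M. (1 - g x)\<^sup>2 = 0"
    using L2_square_integrable[OF L2_diff[OF dom_L2[OF one_dom] g(1)]]
    by (subst (asm) integral_nonneg_eq_0_iff_AE) auto
  then have "AE x in M. g x = 1" by eventually_elim simp
  then show "AE x in M. semigroup M EE dom t (\<lambda>_. 1) x = 1" unfolding g_def .
qed

subsection \<open>Nests\<close>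

lemma EE_nrm_le_of_Gc:
  assumes u: "u \<in> dom" and L: "0 \<le> L" and le: "AE x in M. Gc u u x \<le> L\<^sup>2"
  shows "EE.nrm u \<le> L"
proof -
  have "EE u u \<le> (\<integral>x. L\<^sup>2 \<partial>M)"
    unfolding Gc_integral[OF u u, symmetric]
    by (rule integral_mono_AE[OF Gc_spec(1)[OF u u] _ le]) simp
  then have "EE u u \<le> L\<^sup>2" by (simp add: prob_space)
  from real_sqrt_le_mono[OF this] show ?thesis using L by (simp add: EE.nrm_def)
qed

lemma nest_topspace:
  assumes T: "topspace T = space M"
  shows "nest T M EE dom (\<lambda>_. topspace T)"
  unfolding nest_def
proof (intro conjI ballI allI impI)
  fix u and e :: real assume u: "u \<in> dom" and e: "e > 0"
  show "\<exists>v\<in>dom. (\<exists>k. AE x in M. x \<notin> topspace T \<longrightarrow> v x = 0) \<and> energy1 M EE (\<lambda>x. u x - v x) < e"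
    using u e EE_const[OF zero_dom, of 0] by (intro bexI[of _ u]) (auto simp: T energy1_def)
qed (auto simp: incseq_def)

text \<open>
  Functions of bounded energy that decrease to \<open>0\<close> produce nests. Convex combinations \<open>a\<^sub>j\<close> of
  them are small in the norm of the domain, and \<open>a\<^sub>j\<close> dominates some \<open>v\<^bsub>N j\<^esub>\<close>. The cut-off
  functions are obtained from the tails of \<open>\<Sum>\<^sub>j 2\<^sup>j a\<^sub>j\<close>. The members \<open>F k\<close> of the nest only have to be
  closed, to increase, and to contain the set where \<open>v\<^bsub>N j\<^esub> \<le> 2\<^sup>-\<^sup>j\<close> for all \<open>j \<ge> k\<close>, up to null sets.
\<close>

lemma nest_of_decreasing:
  assumes v: "\<And>n. v n \<in> dom" and C: "\<And>n. EE.nrm (v n) \<le> C"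
    and nn: "\<And>n. AE x in M. 0 \<le> v n x" and le1: "\<And>n. AE x in M. v n x \<le> 1"
    and dec: "\<And>n. AE x in M. v (Suc n) x \<le> v n x"
    and lim: "AE x in M. (\<lambda>n. v n x) \<longlonglongrightarrow> 0"
  shows "\<exists>N::nat \<Rightarrow> nat. \<forall>F. (\<forall>k. closedin T (F k)) \<and> incseq F \<and>
    (\<forall>k. AE x in M. (\<forall>j\<ge>k. v (N j) x \<le> (1 / 2) ^ j) \<longrightarrow> x \<in> F k) \<longrightarrow> nest T M EE dom F"
proof -
  have vL: "v n \<in> L2 M" for n using v dom_L2 by blast
  have vm: "v n \<in> borel_measurable M" for n using vL by (simp add: L2_def)
  have l0: "L2_tendsto M v (\<lambda>_. 0)"
  proof (rule L2_tendsto_bounded[where c = 1, OF vm _ _ lim])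
    show "AE x in M. \<bar>v n x - 0\<bar> \<le> 1" for n
      using nn[of n] le1[of n] by eventually_elim simp
  qed simp
  obtain b where b: "\<forall>n. b n \<in> cvx (v ` {n..}) \<and> b n \<in> dom"
      "(\<lambda>n. H.nrm (\<lambda>x. b n x - 0)) \<longlonglongrightarrow> 0"
    using bounded_energy_limit[OF v C l0 dom_L2[OF zero_dom]] by blast
  have "AE x in M. \<forall>n. v (Suc n) x \<le> v n x" using dec by (simp add: AE_all_countable)
  then have decAE: "AE x in M. \<forall>m n. m \<le> n \<longrightarrow> v n x \<le> v m x"
  proof eventually_elim
    case (elim x)
    then have "v (Suc n) x \<le> v n x" for n by blast
    from lift_Suc_antimono_le[of "\<lambda>n. v n x", OF this] show ?case by simp
  qed
  \<comment> \<open>a convex combination of a decreasing sequence dominates its member of largest index\<close>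
  have dom_b: "\<exists>N. AE x in M. v N x \<le> b n x" for n
  proof (rule cvx_induct_prop[where P = "\<lambda>w. \<exists>N. AE x in M. v N x \<le> w x"])
    show "b n \<in> cvx (v ` {n..})" using b(1) by blast
    show "\<exists>N. AE x in M. v N x \<le> w x" if "w \<in> v ` {n..}" for w using that by auto
    fix p q t assume "\<exists>N. AE x in M. v N x \<le> p x" "\<exists>N. AE x in M. v N x \<le> q x"
      and t: "0 \<le> t" "t \<le> (1::real)"
    then obtain N1 N2 where N: "AE x in M. v N1 x \<le> p x" "AE x in M. v N2 x \<le> q x" by blast
    have "AE x in M. v (max N1 N2) x \<le> t * p x + (1 - t) * q x"
      using N decAE
    proof eventually_elim
      case (elim x)
      have "v (max N1 N2) x = t * v (max N1 N2) x + (1 - t) * v (max N1 N2) x"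
        by (simp add: algebra_simps)
      also have "\<dots> \<le> t * p x + (1 - t) * q x"
        using elim t by (intro add_mono mult_left_mono) (meson max.cobounded1 max.cobounded2 order_trans, simp)+
      finally show ?case .
    qed
    then show "\<exists>N. AE x in M. v N x \<le> t * p x + (1 - t) * q x" by blast
  qed
  have "\<exists>n. H.nrm (b n) < (1 / 4) ^ j" for j
    using order_tendstoD(2)[OF b(2), of "(1 / 4) ^ j"] unfolding eventually_sequentially by auto
  then have "\<exists>i. \<forall>j. H.nrm (b (i j)) < (1 / 4) ^ j" by (intro choice allI)
  then obtain i where i: "\<And>j. H.nrm (b (i j)) < (1 / 4) ^ j" by blast
  define a where "a j = b (i j)" for j :: nat
  have a: "a j \<in> dom" "H.nrm (a j) < (1 / 4) ^ j" for j using b i unfolding a_def by auto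
  have "\<exists>N. \<forall>j. AE x in M. v (N j) x \<le> a j x" using dom_b unfolding a_def by (intro choice allI)
  then obtain N where N: "\<And>j. AE x in M. v (N j) x \<le> a j x" by blast
  \<comment> \<open>\<open>2\<^sup>j a\<^sub>j\<close> has norm at most \<open>2\<^sup>-\<^sup>j\<close>, so the series converges; its tail beyond \<open>k\<close> is at least
    \<open>1\<close> where \<open>a\<^sub>j \<ge> 2\<^sup>-\<^sup>j\<close> for some \<open>j \<ge> k\<close>\<close>
  define S where "S n = (\<lambda>x. \<Sum>j<n. 2 ^ j * a j x)" for n :: nat
  have tm: "(\<lambda>x. 2 ^ j * a j x) \<in> dom" "H.nrm (\<lambda>x. 2 ^ j * a j x) \<le> (1 / 2) ^ j" for j
  proof -
    show "(\<lambda>x. 2 ^ j * a j x) \<in> dom" by (rule EE.scale[OF a(1)])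
    have "H.nrm (\<lambda>x. 2 ^ j * a j x) = 2 ^ j * H.nrm (a j)" by (simp add: H.nrm_scale[OF a(1)])
    also have "\<dots> \<le> 2 ^ j * (1 / 4) ^ j" using a(2)[of j] by simp
    also have "\<dots> = (1 / 2) ^ j" by (simp flip: power_mult_distrib)
    finally show "H.nrm (\<lambda>x. 2 ^ j * a j x) \<le> (1 / 2) ^ j" .
  qed
  have S: "S n \<in> dom" for n
    unfolding S_def using H.nrm_sum_le[of "{..<n}" "\<lambda>j x. 2 ^ j * a j x"] tm zero_dom by simp
  have Sdiff: "S n x - S k x = (\<Sum>j\<in>{k..<n}. 2 ^ j * a j x)" if "k \<le> n" for k n x
    unfolding S_def using that sum_diff_nat_ivl[of 0 k n "\<lambda>j. 2 ^ j * a j x"]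
    by (simp add: atLeast0LessThan)
  have Sn: "H.nrm (\<lambda>x. S n x - S k x) \<le> 2 * (1 / 2) ^ k" if "k \<le> n" for k n
  proof -
    have "H.nrm (\<lambda>x. S n x - S k x) = H.nrm (\<lambda>x. \<Sum>j\<in>{k..<n}. 2 ^ j * a j x)"
      by (simp only: Sdiff[OF that])
    also have "\<dots> \<le> (\<Sum>j\<in>{k..<n}. H.nrm (\<lambda>x. 2 ^ j * a j x))"
      using H.nrm_sum_le[of "{k..<n}" "\<lambda>j x. 2 ^ j * a j x"] tm zero_dom by simp
    also have "\<dots> \<le> (\<Sum>j\<in>{k..<n}. (1 / 2) ^ j)" by (intro sum_mono tm)
    also have "\<dots> = 2 * (1 / 2) ^ k - 2 * (1 / 2) ^ n"
      using that by (induction n rule: dec_induct) auto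
    also have "\<dots> \<le> 2 * (1 / 2) ^ k" by simp
    finally show ?thesis .
  qed
  have Scau: "\<exists>K. \<forall>m\<ge>K. \<forall>n\<ge>K. H.nrm (\<lambda>x. S m x - S n x) < e" if e: "e > 0" for e
  proof -
    obtain K where K: "(1 / 2 :: real) ^ K < e / 2" using real_arch_pow_inv[of "e / 2" "1 / 2"] e by auto
    have le: "H.nrm (\<lambda>x. S n x - S m x) < e" if "K \<le> m" "m \<le> n" for m n
    proof -
      have "(1 / 2 :: real) ^ m \<le> (1 / 2) ^ K" by (rule power_decreasing[OF that(1)]) auto
      then show ?thesis using Sn[OF that(2)] K by linarith
    qed
    have "H.nrm (\<lambda>x. S m x - S n x) < e" if "K \<le> m" "K \<le> n" for m n
      using le[of m n] le[of n m] that H.nrm_minus[OF S S, of m n] by (cases "m \<le> n") auto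
    then show ?thesis by blast
  qed
  from H_complete[OF S Scau] obtain s where s: "s \<in> dom" "(\<lambda>n. H.nrm (\<lambda>x. S n x - s x)) \<longlonglongrightarrow> 0" .
  have SL: "L2_tendsto M S s" by (rule H_tendsto_imp(2)[OF S s])
  obtain r where r: "strict_mono (r :: nat \<Rightarrow> nat)" "AE x in M. (\<lambda>n. S (r n) x) \<longlonglongrightarrow> s x"
    by (rule L2_tendsto_AE_subseq[OF dom_L2[OF S] dom_L2[OF s(1)] SL])
  have allN: "AE x in M. \<forall>j. v (N j) x \<le> a j x" using N by (simp add: AE_all_countable)
  have alln: "AE x in M. \<forall>n. 0 \<le> v n x" using nn by (simp add: AE_all_countable)
  have tail: "AE x in M. \<forall>k j. k \<le> j \<longrightarrow> 2 ^ j * a j x \<le> s x - S k x"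
    using allN alln r(2)
  proof eventually_elim
    case (elim x)
    have anx: "0 \<le> 2 ^ j * a j x" for j using elim(1,2) by (meson order_trans zero_le_mult_iff zero_le_numeral zero_le_power)
    have mono: "S k x \<le> S n x" if "k \<le> n" for k n
    proof -
      have "0 \<le> (\<Sum>j\<in>{k..<n}. 2 ^ j * a j x)" by (intro sum_nonneg anx)
      then show ?thesis using Sdiff[OF that, of x] by linarith
    qed
    have Ss: "S n x \<le> s x" for n
    proof (rule LIMSEQ_le_const[OF elim(3)])
      show "\<exists>M. \<forall>k\<ge>M. S n x \<le> S (r k) x"
        using mono seq_suble[OF r(1)] by (meson order_trans)
    qed
    show ?case
    proof (intro allI impI)
      fix k j :: nat assume kj: "k \<le> j"
      have "2 ^ j * a j x = S (Suc j) x - S j x" unfolding S_def by simp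
      also have "\<dots> \<le> s x - S k x" using Ss[of "Suc j"] mono[OF kj] by simp
      finally show "2 ^ j * a j x \<le> s x - S k x" .
    qed
  qed
  define g where "g k = (\<lambda>x. 1 - (s x - S k x))" for k
  define w where "w k = (\<lambda>x. min 1 (max 0 (g k x)))" for k
  have sk: "(\<lambda>x. s x - S k x) \<in> dom" for k by (rule EE.diff[OF s(1) S])
  have gd: "g k \<in> dom" for k unfolding g_def by (rule EE.diff[OF one_dom sk])
  have wd: "w k \<in> dom" for k unfolding w_def by (rule clip_dom(1)[OF gd])
  have "(\<lambda>n. H.nrm (\<lambda>x. s x - S n x)) \<longlonglongrightarrow> 0"
    using s(2) H.nrm_minus[OF S s(1)] by simp
  then have "Bseq (\<lambda>n. H.nrm (\<lambda>x. s x - S n x))" by (intro convergent_imp_Bseq convergentI)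
  then obtain B where B: "\<And>n. norm (H.nrm (\<lambda>x. s x - S n x)) \<le> B" by (elim BseqE) blast
  have gE: "EE (g k) (g k) \<le> B\<^sup>2" for k
  proof -
    have "EE (g k) (g k) = EE (\<lambda>x. s x - S k x) (\<lambda>x. s x - S k x)"
      unfolding g_def using EE.Q_diff[OF one_dom sk gd[unfolded g_def]] EE.Q_diff2[OF one_dom sk sk]
        EE_one[OF gd[unfolded g_def]] EE_one[OF sk] EE.Q_sym[OF one_dom sk] by simp
    also have "\<dots> = (EE.nrm (\<lambda>x. s x - S k x))\<^sup>2" by (rule EE.nrm_sq[OF sk, symmetric])
    also have "\<dots> \<le> B\<^sup>2"
      using EE_le_H[OF sk, of k] B[of k] EE.nrm_nonneg[OF sk, of k] by (intro power_mono) auto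
    finally show ?thesis .
  qed
  have wE: "EE (w k) (w k) \<le> B\<^sup>2" for k
    using clip_dom(2)[OF gd, of k] gE[of k] unfolding w_def by linarith
  have wr: "0 \<le> w k x" "w k x \<le> 1" for k x unfolding w_def by auto
  have wlim: "L2_tendsto M w (\<lambda>_. 1)"
  proof (rule L2_tendsto_comparison[OF dom_L2[OF wd] dom_L2[OF one_dom] dom_L2[OF S] dom_L2[OF s(1)] SL tendsto_const])
    show "\<bar>w n x - 1\<bar> \<le> \<bar>S n x - s x\<bar> + 0" for n x
      unfolding w_def g_def by (auto simp: min_def max_def)
  qed
  show ?thesis
  proof (intro exI[of _ N] allI impI)
    fix F assume F: "(\<forall>k. closedin T (F k)) \<and> incseq F \<and>
      (\<forall>k. AE x in M. (\<forall>j\<ge>k. v (N j) x \<le> (1 / 2) ^ j) \<longrightarrow> x \<in> F k)"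
    have w0: "AE x in M. x \<notin> F k \<longrightarrow> w k x = 0" for k
    proof -
      have "AE x in M. (\<forall>j\<ge>k. v (N j) x \<le> (1 / 2) ^ j) \<longrightarrow> x \<in> F k" using F by blast
      then show ?thesis
        using allN tail
      proof eventually_elim
        case (elim x)
        show ?case
        proof
          assume "x \<notin> F k"
          then obtain j where j: "k \<le> j" "(1 / 2) ^ j < v (N j) x" using elim(1) by (meson not_le)
          have "(1::real) = 2 ^ j * (1 / 2) ^ j" by (simp flip: power_mult_distrib)
          also have "\<dots> \<le> 2 ^ j * a j x" using j(2) elim(2) by (intro mult_left_mono) (auto intro: less_imp_le less_le_trans)
          also have "\<dots> \<le> s x - S k x" using elim(3) j(1) by blast
          finally show "w k x = 0" unfolding w_def g_def by simp
        qed
      qed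
    qed
    show "nest T M EE dom F"
      unfolding nest_def
    proof (intro conjI ballI allI impI)
      fix u and e :: real assume u: "u \<in> dom" and e: "e > 0"
      then have "sqrt e / 2 > 0" by simp
      then obtain u0 where u0: "u0 \<in> D0" "H.nrm (\<lambda>x. u x - u0 x) < sqrt e / 2"
        using D0_energy_dense[OF u] by blast
      have u0d: "u0 \<in> dom" by (rule D0_dom[OF u0(1)])
      obtain c where c: "\<And>x. x \<in> space M \<Longrightarrow> \<bar>u0 x\<bar> \<le> c" using D0_bounded[OF u0(1)] by blast
      obtain x0 where "x0 \<in> space M" using not_empty by blast
      then have c0: "0 \<le> c" using c[of x0] by linarith
      \<comment> \<open>\<open>u0\<close> truncated at height \<open>c w\<^sub>k\<close>, where \<open>\<bar>u0\<bar> \<le> c\<close>; no bound on the square field of \<open>u0\<close> is needed\<close>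
      define f where "f k = (\<lambda>x. max (min (u0 x) (c * w k x)) (- c * w k x))" for k
      note cw = EE.scale[OF wd] and mi = lattice_dom[OF u0d EE.scale[OF wd]]
      note ma = lattice_dom[OF mi(1) EE.scale[OF wd]]
      have fd: "f k \<in> dom" for k unfolding f_def by (rule ma(2))
      have cwE: "EE (\<lambda>x. t * w k x) (\<lambda>x. t * w k x) \<le> t\<^sup>2 * B\<^sup>2" for t k
      proof -
        have "EE (\<lambda>x. t * w k x) (\<lambda>x. t * w k x) = t\<^sup>2 * EE (w k) (w k)"
          by (simp add: EE.Q_scale[OF wd EE.scale[OF wd]] EE.Q_scale2[OF wd wd] power2_eq_square)
        then show ?thesis using wE[of k] by (simp add: mult_left_mono)
      qed
      have "EE (f k) (f k) \<le> EE u0 u0 + c\<^sup>2 * B\<^sup>2 + c\<^sup>2 * B\<^sup>2" for k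
        using ma(4)[of c k "- c" k] mi(3)[of c k] cwE[of c k] cwE[of "- c" k]
        unfolding f_def power2_minus by linarith
      then have fE: "EE.nrm (f k) \<le> sqrt (EE u0 u0 + c\<^sup>2 * B\<^sup>2 + c\<^sup>2 * B\<^sup>2)" for k
        unfolding EE.nrm_def by (rule real_sqrt_le_mono)
      have cwlim: "L2_tendsto M (\<lambda>n x. c * w n x + 0 * w n x) (\<lambda>x. c * 1 + 0 * 1)"
        by (rule L2_tendsto_lin) (use dom_L2[OF wd] dom_L2[OF one_dom] wlim in auto)
      have flim: "L2_tendsto M f u0"
      proof (rule L2_tendsto_comparison[OF dom_L2[OF fd] dom_L2[OF u0d] _ _ cwlim tendsto_const[of 0]])
        fix n x assume x: "x \<in> space M"
        have "0 \<le> c * w n x" "c * w n x \<le> c"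
          using wr[of n x] c0 by (auto intro: mult_left_le)
        then show "\<bar>f n x - u0 x\<bar> \<le> \<bar>c * w n x + 0 * w n x - (c * 1 + 0 * 1)\<bar> + 0"
          using c[OF x] unfolding f_def by (auto simp: max_def min_def abs_le_iff)
      qed (use dom_L2[OF EE.scale[OF wd, of c]] dom_L2[OF const_dom] in auto)
      obtain z where z: "\<forall>n. z n \<in> cvx (f ` {n..}) \<and> z n \<in> dom" "(\<lambda>n. H.nrm (\<lambda>x. z n x - u0 x)) \<longlonglongrightarrow> 0"
        using bounded_energy_limit[OF fd fE flim dom_L2[OF u0d]] by blast
      from order_tendstoD(2)[OF z(2) \<open>sqrt e / 2 > 0\<close>] obtain n where
        n: "H.nrm (\<lambda>x. z n x - u0 x) < sqrt e / 2" unfolding eventually_sequentially by blast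
      have zd: "z n \<in> dom" using z(1) by blast
      have z0: "\<exists>k. AE x in M. x \<notin> F k \<longrightarrow> z n x = 0"
      proof (rule cvx_induct_prop[where P = "\<lambda>p. \<exists>k. AE x in M. x \<notin> F k \<longrightarrow> p x = 0"])
        show "z n \<in> cvx (f ` {n..})" using z(1) by blast
        fix p assume "p \<in> f ` {n..}"
        then obtain k where p: "p = f k" by blast
        have "AE x in M. x \<notin> F k \<longrightarrow> p x = 0"
          using w0[of k] by eventually_elim (auto simp: p f_def)
        then show "\<exists>k. AE x in M. x \<notin> F k \<longrightarrow> p x = 0" by blast
      next
        fix p q :: "'b \<Rightarrow> real" and t :: real
        assume "\<exists>k. AE x in M. x \<notin> F k \<longrightarrow> p x = 0" "\<exists>k. AE x in M. x \<notin> F k \<longrightarrow> q x = 0"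
        then obtain k1 k2 where k: "AE x in M. x \<notin> F k1 \<longrightarrow> p x = 0" "AE x in M. x \<notin> F k2 \<longrightarrow> q x = 0" by blast
        have "F k1 \<subseteq> F (max k1 k2)" "F k2 \<subseteq> F (max k1 k2)" using F by (auto simp: incseq_def)
        then have "AE x in M. x \<notin> F (max k1 k2) \<longrightarrow> t * p x + (1 - t) * q x = 0"
          using k by (auto elim!: eventually_elim2)
        then show "\<exists>k. AE x in M. x \<notin> F k \<longrightarrow> t * p x + (1 - t) * q x = 0" by blast
      qed
      have "H.nrm (\<lambda>x. u x - z n x) < sqrt e"
        using H.nrm_triangle3[OF u u0d zd] u0(2) n H.nrm_minus[OF zd u0d] by simp
      then have "(H.nrm (\<lambda>x. u x - z n x))\<^sup>2 < (sqrt e)\<^sup>2"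
        using H.nrm_nonneg[OF EE.diff[OF u zd]] by (intro power_strict_mono) auto
      then have "energy1 M EE (\<lambda>x. u x - z n x) < e"
        using e by (simp add: H_nrm_sq[OF EE.diff[OF u zd]])
      then show "\<exists>v\<in>dom. (\<exists>k. AE x in M. x \<notin> F k \<longrightarrow> v x = 0) \<and> energy1 M EE (\<lambda>x. u x - v x) < e"
        using z0 zd by blast
    qed (use F in blast)+
  qed
qed

end


section \<open>The algebra of bounded smooth functions\<close>

text \<open>
  The condition that \<^const>\<open>Cb_infinity\<close> puts on each iterated partial derivative: it is continuous,
  bounded, and differentiable in each of the first \<open>k\<close> coordinates.
\<close>

definition bdiff :: "nat \<Rightarrow> ((nat \<Rightarrow> real) \<Rightarrow> real) \<Rightarrow> bool" where
  "bdiff k \<phi> \<longleftrightarrow> continuous_on UNIV \<phi> \<and> bounded (range \<phi>) \<and>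
    (\<forall>i<k. \<forall>a. (\<lambda>t. \<phi> (a(i := t))) differentiable (at (a i)))"

text \<open>The function only depends on the first \<open>k\<close> coordinates.\<close>

definition depends :: "nat \<Rightarrow> ((nat \<Rightarrow> real) \<Rightarrow> real) \<Rightarrow> bool" where
  "depends k \<phi> \<longleftrightarrow> (\<forall>a b. (\<forall>i<k. a i = b i) \<longrightarrow> \<phi> a = \<phi> b)"

lemma Cb_iff:
  "\<phi> \<in> Cb_infinity k \<longleftrightarrow> depends k \<phi> \<and>
    (\<forall>is. set is \<subseteq> {..<k} \<longrightarrow> bdiff k (foldr partial_deriv is \<phi>))"
  unfolding Cb_infinity_def bdiff_def depends_def by blast

text \<open>Coinduction: it suffices that \<open>\<phi>\<close> lies in a set of such functions that is closed under partial
  derivatives.\<close>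

lemma Cb_coinduct:
  assumes S: "\<phi> \<in> S" and dep: "depends k \<phi>"
    and step: "\<And>\<psi>. \<psi> \<in> S \<Longrightarrow> bdiff k \<psi> \<and> (\<forall>i<k. partial_deriv i \<psi> \<in> S)"
  shows "\<phi> \<in> Cb_infinity k"
proof -
  have "foldr partial_deriv is \<phi> \<in> S" if "set is \<subseteq> {..<k}" for "is"
    using that by (induction "is") (use S step in auto)
  then show ?thesis using step dep unfolding Cb_iff by blast
qed

lemma Cb_bdiff: "\<phi> \<in> Cb_infinity k \<Longrightarrow> bdiff k \<phi>"
  unfolding Cb_iff by (drule conjunct2, drule spec[of _ "[]"]) simp

lemma Cb_depends: "\<phi> \<in> Cb_infinity k \<Longrightarrow> depends k \<phi>"
  unfolding Cb_iff by blast

lemma Cb_cong: "\<phi> \<in> Cb_infinity k \<Longrightarrow> (\<And>i. i < k \<Longrightarrow> a i = b i) \<Longrightarrow> \<phi> a = \<phi> b"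
  using Cb_depends unfolding depends_def by blast

lemma Cb_continuous: "\<phi> \<in> Cb_infinity k \<Longrightarrow> continuous_on UNIV \<phi>"
  using Cb_bdiff unfolding bdiff_def by blast

lemma Cb_bounded: "\<phi> \<in> Cb_infinity k \<Longrightarrow> \<exists>c. \<forall>a. \<bar>\<phi> a\<bar> \<le> c"
  using Cb_bdiff unfolding bdiff_def bounded_iff by auto

lemma depends_partial:
  assumes "depends k \<phi>" "i < k"
  shows "depends k (partial_deriv i \<phi>)"
  unfolding depends_def partial_deriv_def
proof (intro allI impI)
  fix a b :: "nat \<Rightarrow> real" assume ab: "\<forall>j<k. a j = b j"
  have "(\<lambda>t. \<phi> (a(i := t))) = (\<lambda>t. \<phi> (b(i := t)))"
    using assms(1) ab unfolding depends_def by auto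
  then show "deriv (\<lambda>t. \<phi> (a(i := t))) (a i) = deriv (\<lambda>t. \<phi> (b(i := t))) (b i)"
    using ab assms(2) by simp
qed

lemma Cb_partial:
  assumes p: "\<phi> \<in> Cb_infinity k" and i: "i < k"
  shows "partial_deriv i \<phi> \<in> Cb_infinity k"
  unfolding Cb_iff
proof (intro conjI allI impI)
  show "depends k (partial_deriv i \<phi>)" by (rule depends_partial[OF Cb_depends[OF p] i])
  fix "is" assume "set is \<subseteq> {..<k}"
  then have "set (is @ [i]) \<subseteq> {..<k}" using i by auto
  then have "bdiff k (foldr partial_deriv (is @ [i]) \<phi>)" using p unfolding Cb_iff by blast
  then show "bdiff k (foldr partial_deriv is (partial_deriv i \<phi>))" by simp
qed

lemma bdiff_has_deriv:
  assumes "bdiff k \<phi>" "i < k"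
  shows "((\<lambda>t. \<phi> (a(i := t))) has_real_derivative partial_deriv i \<phi> a) (at (a i))"
  using assms unfolding bdiff_def partial_deriv_def by (simp add: DERIV_deriv_iff_real_differentiable)

lemma partial_deriv_eqI:
  "((\<lambda>t. \<phi> (a(i := t))) has_real_derivative D) (at (a i)) \<Longrightarrow> partial_deriv i \<phi> a = D"
  unfolding partial_deriv_def by (rule DERIV_imp_deriv)

lemma bdiff_intro:
  assumes "continuous_on UNIV \<phi>" "\<And>a. \<bar>\<phi> a\<bar> \<le> c"
    and "\<And>i a. i < k \<Longrightarrow> \<exists>D. ((\<lambda>t. \<phi> (a(i := t))) has_real_derivative D) (at (a i))"
  shows "bdiff k \<phi>"
  using assms unfolding bdiff_def bounded_iff
  by (auto simp: real_differentiable_def)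

lemma bdiff_const: "bdiff k (\<lambda>_. c)"
  by (rule bdiff_intro[where c = "\<bar>c\<bar>"]) (auto intro: derivative_eq_intros)

lemma partial_const: "partial_deriv i (\<lambda>_. c) = (\<lambda>_. 0)"
  by (rule ext, rule partial_deriv_eqI) (auto intro: derivative_eq_intros)

text \<open>The algebra generated by a set of functions.\<close>

inductive_set alg :: "((nat \<Rightarrow> real) \<Rightarrow> real) set \<Rightarrow> ((nat \<Rightarrow> real) \<Rightarrow> real) set" for B where
  base: "\<phi> \<in> B \<Longrightarrow> \<phi> \<in> alg B"
| const: "(\<lambda>_. c) \<in> alg B"
| add: "\<phi> \<in> alg B \<Longrightarrow> \<psi> \<in> alg B \<Longrightarrow> (\<lambda>a. \<phi> a + \<psi> a) \<in> alg B"
| mult: "\<phi> \<in> alg B \<Longrightarrow> \<psi> \<in> alg B \<Longrightarrow> (\<lambda>a. \<phi> a * \<psi> a) \<in> alg B"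

lemma bdiff_add:
  assumes "bdiff k \<phi>" "bdiff k \<psi>"
  shows "bdiff k (\<lambda>a. \<phi> a + \<psi> a)"
    "i < k \<Longrightarrow> partial_deriv i (\<lambda>a. \<phi> a + \<psi> a) = (\<lambda>a. partial_deriv i \<phi> a + partial_deriv i \<psi> a)"
proof -
  have d: "((\<lambda>t. \<phi> (a(i := t)) + \<psi> (a(i := t))) has_real_derivative
      partial_deriv i \<phi> a + partial_deriv i \<psi> a) (at (a i))" if "i < k" for i a
    by (rule DERIV_add[OF bdiff_has_deriv[OF assms(1) that, of a] bdiff_has_deriv[OF assms(2) that, of a]])
  obtain c1 c2 where c: "\<forall>a. \<bar>\<phi> a\<bar> \<le> c1" "\<forall>a. \<bar>\<psi> a\<bar> \<le> c2"
    using assms unfolding bdiff_def bounded_iff by auto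
  show "bdiff k (\<lambda>a. \<phi> a + \<psi> a)"
  proof (rule bdiff_intro[where c = "c1 + c2"])
    show "continuous_on UNIV (\<lambda>a. \<phi> a + \<psi> a)"
      using assms unfolding bdiff_def by (intro continuous_intros) auto
    show "\<bar>\<phi> a + \<psi> a\<bar> \<le> c1 + c2" for a
      using c abs_triangle_ineq[of "\<phi> a" "\<psi> a"] by (meson add_mono order_trans)
  qed (use d in blast)
  show "partial_deriv i (\<lambda>a. \<phi> a + \<psi> a) = (\<lambda>a. partial_deriv i \<phi> a + partial_deriv i \<psi> a)"
    if "i < k" using d[OF that] by (intro ext partial_deriv_eqI)
qed

lemma bdiff_mult:
  assumes "bdiff k \<phi>" "bdiff k \<psi>"
  shows "bdiff k (\<lambda>a. \<phi> a * \<psi> a)"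
    "i < k \<Longrightarrow> partial_deriv i (\<lambda>a. \<phi> a * \<psi> a)
      = (\<lambda>a. partial_deriv i \<phi> a * \<psi> a + \<phi> a * partial_deriv i \<psi> a)"
proof -
  have d: "((\<lambda>t. \<phi> (a(i := t)) * \<psi> (a(i := t))) has_real_derivative
      partial_deriv i \<phi> a * \<psi> a + \<phi> a * partial_deriv i \<psi> a) (at (a i))" if "i < k" for i a
    using DERIV_mult[OF bdiff_has_deriv[OF assms(1) that, of a] bdiff_has_deriv[OF assms(2) that, of a]]
    by (simp add: mult.commute add.commute)
  obtain c1 c2 where c: "\<forall>a. \<bar>\<phi> a\<bar> \<le> c1" "\<forall>a. \<bar>\<psi> a\<bar> \<le> c2"
    using assms unfolding bdiff_def bounded_iff by auto
  show "bdiff k (\<lambda>a. \<phi> a * \<psi> a)"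
  proof (rule bdiff_intro[where c = "c1 * c2"])
    show "continuous_on UNIV (\<lambda>a. \<phi> a * \<psi> a)"
      using assms unfolding bdiff_def by (intro continuous_intros) auto
    show "\<bar>\<phi> a * \<psi> a\<bar> \<le> c1 * c2" for a
      unfolding abs_mult using c by (intro mult_mono) (auto intro: order_trans[OF abs_ge_zero])
  qed (use d in blast)
  show "partial_deriv i (\<lambda>a. \<phi> a * \<psi> a)
      = (\<lambda>a. partial_deriv i \<phi> a * \<psi> a + \<phi> a * partial_deriv i \<psi> a)"
    if "i < k" using d[OF that] by (intro ext partial_deriv_eqI)
qed

text \<open>By the product rule, smoothness of an algebra only has to be checked on generators: their
  derivatives must lie in the algebra.\<close>

lemma alg_subset_Cb:
  assumes B: "\<And>\<phi>. \<phi> \<in> B \<Longrightarrow> bdiff k \<phi> \<and> depends k \<phi> \<and> (\<forall>i<k. partial_deriv i \<phi> \<in> alg B)"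
    and p: "\<phi> \<in> alg B"
  shows "\<phi> \<in> Cb_infinity k"
proof (rule Cb_coinduct[OF p])
  show "depends k \<phi>"
    using p
  proof induction
    case (add \<phi> \<psi>)
    then show ?case unfolding depends_def by (metis (no_types, lifting))
  next
    case (mult \<phi> \<psi>)
    then show ?case unfolding depends_def by (metis (no_types, lifting))
  qed (use B in \<open>auto simp: depends_def\<close>)
  show "bdiff k \<psi> \<and> (\<forall>i<k. partial_deriv i \<psi> \<in> alg B)" if "\<psi> \<in> alg B" for \<psi>
    using that
  proof induction
    case (base \<phi>)
    then show ?case using B by blast
  next
    case (const c)
    then show ?case using bdiff_const partial_const alg.const by metis
  next
    case (add \<phi> \<psi>)
    then show ?case using bdiff_add[of k \<phi> \<psi>] by (auto intro: alg.add)
  next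
    case (mult \<phi> \<psi>)
    then show ?case using bdiff_mult[of k \<phi> \<psi>] by (auto intro!: alg.add alg.mult)
  qed
qed

lemma Cb_alg: "alg (Cb_infinity k) = Cb_infinity k"
  using alg_subset_Cb[of "Cb_infinity k" k] Cb_bdiff Cb_depends Cb_partial alg.base by blast

lemma Cb_const: "(\<lambda>_. c) \<in> Cb_infinity k"
  using alg.const[of c "Cb_infinity k"] by (simp add: Cb_alg)

lemma Cb_add: "\<phi> \<in> Cb_infinity k \<Longrightarrow> \<psi> \<in> Cb_infinity k \<Longrightarrow> (\<lambda>a. \<phi> a + \<psi> a) \<in> Cb_infinity k"
  using alg.add[of \<phi> "Cb_infinity k" \<psi>] by (simp add: Cb_alg)

lemma Cb_mult: "\<phi> \<in> Cb_infinity k \<Longrightarrow> \<psi> \<in> Cb_infinity k \<Longrightarrow> (\<lambda>a. \<phi> a * \<psi> a) \<in> Cb_infinity k"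
  using alg.mult[of \<phi> "Cb_infinity k" \<psi>] by (simp add: Cb_alg)

lemma Cb_lin: "\<phi> \<in> Cb_infinity k \<Longrightarrow> \<psi> \<in> Cb_infinity k \<Longrightarrow> (\<lambda>a. c * \<phi> a + d * \<psi> a) \<in> Cb_infinity k"
  by (intro Cb_add Cb_mult Cb_const)

lemma partial_deriv_comp:
  assumes p: "bdiff k \<phi>" and i: "i < k" and \<psi>: "(\<psi> has_real_derivative D) (at (\<phi> a))"
  shows "((\<lambda>t. \<psi> (\<phi> (a(i := t)))) has_real_derivative D * partial_deriv i \<phi> a) (at (a i))"
proof -
  have "(\<psi> has_real_derivative D) (at (\<phi> (a(i := a i))))" using \<psi> by simp
  from DERIV_chain2[OF this bdiff_has_deriv[OF p i]] show ?thesis .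
qed

text \<open>The function \<open>t \<mapsto> (t\<^sup>2 + e\<^sup>2)\<^bsup>-1/2\<^esup>\<close> has the derivative \<open>- t (t\<^sup>2 + e\<^sup>2)\<^bsup>-3/2\<^esup>\<close>, a
  polynomial in the function and its argument.\<close>

lemma inv_sqrt_deriv:
  assumes "e > (0::real)"
  shows "((\<lambda>t. 1 / sqrt (t\<^sup>2 + e\<^sup>2)) has_real_derivative - t * (1 / sqrt (t\<^sup>2 + e\<^sup>2)) ^ 3) (at t)"
    "((\<lambda>t. sqrt (t\<^sup>2 + e\<^sup>2)) has_real_derivative t / sqrt (t\<^sup>2 + e\<^sup>2)) (at t)"
    "((\<lambda>t. e * t / sqrt (t\<^sup>2 + e\<^sup>2)) has_real_derivative (e / sqrt (t\<^sup>2 + e\<^sup>2)) ^ 3) (at t)"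
proof -
  have pos: "0 < t\<^sup>2 + e\<^sup>2" using assms by (simp add: add_nonneg_pos)
  define s where "s = sqrt (t\<^sup>2 + e\<^sup>2)"
  have s: "s > 0" "s\<^sup>2 = t\<^sup>2 + e\<^sup>2" using pos by (auto simp: s_def)
  show 2: "((\<lambda>t. sqrt (t\<^sup>2 + e\<^sup>2)) has_real_derivative t / sqrt (t\<^sup>2 + e\<^sup>2)) (at t)"
    using pos by (auto intro!: derivative_eq_intros simp: field_simps)
  have "((\<lambda>t. 1 / sqrt (t\<^sup>2 + e\<^sup>2)) has_real_derivative
      (0 * sqrt (t\<^sup>2 + e\<^sup>2) - 1 * (t / sqrt (t\<^sup>2 + e\<^sup>2))) / (sqrt (t\<^sup>2 + e\<^sup>2) * sqrt (t\<^sup>2 + e\<^sup>2))) (at t)"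
    by (rule DERIV_divide[OF DERIV_const 2]) (use pos in auto)
  then show "((\<lambda>t. 1 / sqrt (t\<^sup>2 + e\<^sup>2)) has_real_derivative - t * (1 / sqrt (t\<^sup>2 + e\<^sup>2)) ^ 3) (at t)"
    by (rule DERIV_cong) (use s(1) in \<open>simp add: s_def[symmetric] power3_eq_cube field_simps del: real_sqrt_mult_self\<close>)
  have "((\<lambda>t. e * t / sqrt (t\<^sup>2 + e\<^sup>2)) has_real_derivative
      (e * sqrt (t\<^sup>2 + e\<^sup>2) - e * t * (t / sqrt (t\<^sup>2 + e\<^sup>2))) / (sqrt (t\<^sup>2 + e\<^sup>2) * sqrt (t\<^sup>2 + e\<^sup>2))) (at t)"
    by (rule DERIV_divide[OF _ 2]) (use pos in \<open>auto intro!: derivative_eq_intros\<close>)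
  moreover have "(e * s - e * t * (t / s)) / (s * s) = (e / s) ^ 3"
  proof -
    have "(e * s - e * t * (t / s)) / (s * s) = e * (s\<^sup>2 - t\<^sup>2) / s ^ 3"
      using s(1) by (simp add: field_simps power2_eq_square power3_eq_cube)
    also have "\<dots> = (e / s) ^ 3" unfolding s(2) by (simp add: power_divide power2_eq_square power3_eq_cube)
    finally show ?thesis .
  qed
  ultimately show "((\<lambda>t. e * t / sqrt (t\<^sup>2 + e\<^sup>2)) has_real_derivative (e / sqrt (t\<^sup>2 + e\<^sup>2)) ^ 3) (at t)"
    unfolding s_def by simp
qed

lemma Cb_inv_sqrt:
  assumes F: "F \<in> Cb_infinity k" and e: "e > (0::real)"
  shows "(\<lambda>a. 1 / sqrt ((F a)\<^sup>2 + e\<^sup>2)) \<in> Cb_infinity k"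
proof -
  let ?s = "\<lambda>a. 1 / sqrt ((F a)\<^sup>2 + e\<^sup>2)"
  let ?B = "insert ?s (Cb_infinity k)"
  note g = Cb_bdiff[OF F]
  have pos: "0 < (F a)\<^sup>2 + e\<^sup>2" for a using e by (simp add: add_nonneg_pos)
  have d: "((\<lambda>t. ?s (a(i := t))) has_real_derivative - F a * ?s a ^ 3 * partial_deriv i F a) (at (a i))"
    if "i < k" for i a
    by (rule partial_deriv_comp[OF g that inv_sqrt_deriv(1)[OF e]])
  have "bdiff k ?s"
  proof (rule bdiff_intro[where c = "1 / e"])
    show "continuous_on UNIV ?s"
      using Cb_continuous[OF F] pos by (intro continuous_intros) (auto simp: less_imp_neq[symmetric])
    show "\<bar>?s a\<bar> \<le> 1 / e" for a
    proof -
      have "e \<le> sqrt ((F a)\<^sup>2 + e\<^sup>2)" using real_sqrt_le_mono[of "e\<^sup>2" "(F a)\<^sup>2 + e\<^sup>2"] e by simp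
      then show ?thesis using e by (simp add: frac_le)
    qed
  qed (use d in blast)
  moreover have "depends k ?s" using Cb_cong[OF F] unfolding depends_def by metis
  moreover have "partial_deriv i ?s \<in> alg ?B" if i: "i < k" for i
  proof -
    have "partial_deriv i ?s = (\<lambda>a. (- 1) * F a * (?s a * (?s a * ?s a)) * partial_deriv i F a)"
    proof (intro ext partial_deriv_eqI)
      fix a
      have "- F a * ?s a ^ 3 * partial_deriv i F a
          = (- 1) * F a * (?s a * (?s a * ?s a)) * partial_deriv i F a"
        by (simp only: power3_eq_cube mult.assoc mult_minus_left mult_1)
      with d[OF i, of a] show "((\<lambda>t. ?s (a(i := t))) has_real_derivative
          (- 1) * F a * (?s a * (?s a * ?s a)) * partial_deriv i F a) (at (a i))" by metis
    qed
    moreover have "\<dots> \<in> alg ?B"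
      using F Cb_partial[OF F i] by (intro alg.mult alg.const alg.base) auto
    ultimately show ?thesis by simp
  qed
  ultimately have B1: "bdiff k ?s \<and> depends k ?s \<and> (\<forall>i<k. partial_deriv i ?s \<in> alg ?B)" by blast
  have "bdiff k \<phi> \<and> depends k \<phi> \<and> (\<forall>i<k. partial_deriv i \<phi> \<in> alg ?B)" if "\<phi> \<in> ?B" for \<phi>
    using that B1 Cb_bdiff Cb_depends Cb_partial by (metis alg.base insertCI insertE)
  from alg_subset_Cb[OF this alg.base, of ?s] show ?thesis by blast
qed

lemma Cb_sqrt:
  assumes F: "F \<in> Cb_infinity k" and e: "e > (0::real)"
  shows "(\<lambda>a. sqrt ((F a)\<^sup>2 + e\<^sup>2)) \<in> Cb_infinity k"
proof -
  have "(\<lambda>a. (F a * F a + e * e) * (1 / sqrt ((F a)\<^sup>2 + e\<^sup>2))) \<in> Cb_infinity k"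
    by (intro Cb_mult Cb_add Cb_const F Cb_inv_sqrt e)
  moreover have "(F a * F a + e * e) * (1 / sqrt ((F a)\<^sup>2 + e\<^sup>2)) = sqrt ((F a)\<^sup>2 + e\<^sup>2)" for a
    by (simp add: power2_eq_square real_div_sqrt)
  ultimately show ?thesis by simp
qed

lemma Cb_trunc:
  assumes F: "F \<in> Cb_infinity k" and e: "e > (0::real)"
  shows "(\<lambda>a. e * F a / sqrt ((F a)\<^sup>2 + e\<^sup>2)) \<in> Cb_infinity k"
proof -
  have "(\<lambda>a. e * F a * (1 / sqrt ((F a)\<^sup>2 + e\<^sup>2))) \<in> Cb_infinity k"
    by (intro Cb_mult Cb_add Cb_const F Cb_inv_sqrt e)
  then show ?thesis by simp
qed

lemma Cb_translate:
  assumes F: "F \<in> Cb_infinity k"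
  shows "(\<lambda>a. F (\<lambda>i. c i + a i)) \<in> Cb_infinity k"
    "i < k \<Longrightarrow> partial_deriv i (\<lambda>a. F (\<lambda>i. c i + a i)) = (\<lambda>a. partial_deriv i F (\<lambda>i. c i + a i))"
proof -
  let ?S = "(\<lambda>F a. F (\<lambda>i. c i + a i)) ` Cb_infinity k"
  have d: "((\<lambda>t. F (\<lambda>j. c j + (a(i := t)) j)) has_real_derivative partial_deriv i F (\<lambda>i. c i + a i)) (at (a i))"
    if F: "F \<in> Cb_infinity k" and i: "i < k" for F i a
  proof -
    have "((\<lambda>t. F ((\<lambda>i. c i + a i)(i := c i + t))) has_real_derivative
        partial_deriv i F (\<lambda>i. c i + a i) * 1) (at (a i))"
      by (rule DERIV_chain2[where f = "\<lambda>s. F ((\<lambda>i. c i + a i)(i := s))" and g = "\<lambda>t. c i + t"])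
        (use bdiff_has_deriv[OF Cb_bdiff[OF F] i, of "\<lambda>i. c i + a i"] in \<open>auto intro!: derivative_eq_intros\<close>)
    moreover have "(\<lambda>i. c i + a i)(i := c i + t) = (\<lambda>j. c j + (a(i := t)) j)" for t by auto
    ultimately show ?thesis by simp
  qed
  have g: "bdiff k (\<lambda>a. F (\<lambda>i. c i + a i))" if F: "F \<in> Cb_infinity k" for F
  proof -
    obtain b where b: "\<forall>a. \<bar>F a\<bar> \<le> b" using Cb_bounded[OF F] by blast
    show ?thesis
    proof (rule bdiff_intro[where c = b])
      show "continuous_on UNIV (\<lambda>a. F (\<lambda>i. c i + a i))"
        by (rule continuous_on_compose2[OF Cb_continuous[OF F]])
          (auto intro!: continuous_on_coordinatewise_then_product continuous_intros continuous_on_product_coordinates)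
    qed (use b d[OF F] in auto)
  qed
  have pd: "partial_deriv i (\<lambda>a. F (\<lambda>i. c i + a i)) = (\<lambda>a. partial_deriv i F (\<lambda>i. c i + a i))"
    if F: "F \<in> Cb_infinity k" and i: "i < k" for F i
    by (rule ext, rule partial_deriv_eqI, rule d[OF F i])
  show "partial_deriv i (\<lambda>a. F (\<lambda>i. c i + a i)) = (\<lambda>a. partial_deriv i F (\<lambda>i. c i + a i))" if "i < k"
    by (rule pd[OF F that])
  show "(\<lambda>a. F (\<lambda>i. c i + a i)) \<in> Cb_infinity k"
  proof (rule Cb_coinduct[of _ ?S])
    show "depends k (\<lambda>a. F (\<lambda>i. c i + a i))"
      unfolding depends_def by (intro allI impI Cb_cong[OF F]) simp
    show "bdiff k \<psi> \<and> (\<forall>i<k. partial_deriv i \<psi> \<in> ?S)" if "\<psi> \<in> ?S" for \<psi>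
      using that g pd Cb_partial by (auto intro!: image_eqI)
  qed (use F in blast)
qed

text \<open>A function of \<open>k\<close> variables, as a function of the variables \<open>n, \<dots>, n + k - 1\<close> out of \<open>l\<close>.\<close>

lemma Cb_shift:
  assumes F: "F \<in> Cb_infinity k" and l: "n + k \<le> l"
  shows "(\<lambda>a. F (\<lambda>i. a (n + i))) \<in> Cb_infinity l"
proof -
  let ?S = "insert (\<lambda>_. 0) ((\<lambda>F a. F (\<lambda>i. a (n + i))) ` Cb_infinity k)"
  have d: "((\<lambda>t. F (\<lambda>j. (a(i := t)) (n + j))) has_real_derivative
      (if n \<le> i \<and> i < n + k then partial_deriv (i - n) F (\<lambda>i. a (n + i)) else 0)) (at (a i))"
    if F: "F \<in> Cb_infinity k" for F i a
  proof (cases "n \<le> i \<and> i < n + k")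
    case True
    then have i: "i - n < k" by auto
    have "(\<lambda>j. (a(i := t)) (n + j)) = (\<lambda>j. a (n + j))(i - n := t)" for t
      using True by (auto simp: fun_eq_iff)
    then show ?thesis using True bdiff_has_deriv[OF Cb_bdiff[OF F] i, of "\<lambda>i. a (n + i)"] by simp
  next
    case False
    have "F (\<lambda>j. (a(i := t)) (n + j)) = F (\<lambda>j. a (n + j))" for t
      by (rule Cb_cong[OF F]) (use False in auto)
    then show ?thesis unfolding if_not_P[OF False] by simp
  qed
  have g: "bdiff l (\<lambda>a. F (\<lambda>i. a (n + i)))" if F: "F \<in> Cb_infinity k" for F
  proof -
    obtain b where b: "\<forall>a. \<bar>F a\<bar> \<le> b" using Cb_bounded[OF F] by blast
    show ?thesis
    proof (rule bdiff_intro[where c = b])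
      show "continuous_on UNIV (\<lambda>a. F (\<lambda>i. a (n + i)))"
        by (rule continuous_on_compose2[OF Cb_continuous[OF F]])
          (auto intro!: continuous_on_coordinatewise_then_product continuous_intros continuous_on_product_coordinates)
    qed (use b d[OF F] in auto)
  qed
  have pd: "partial_deriv i (\<lambda>a. F (\<lambda>i. a (n + i))) =
      (if n \<le> i \<and> i < n + k then (\<lambda>a. partial_deriv (i - n) F (\<lambda>i. a (n + i))) else (\<lambda>_. 0))"
    if F: "F \<in> Cb_infinity k" for F i
    by (rule ext, rule partial_deriv_eqI) (use d[OF F, of _ i] in auto)
  show ?thesis
  proof (rule Cb_coinduct[of _ ?S])
    show "depends l (\<lambda>a. F (\<lambda>i. a (n + i)))"
      unfolding depends_def using l by (intro allI impI Cb_cong[OF F]) simp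
    show "bdiff l \<psi> \<and> (\<forall>i<l. partial_deriv i \<psi> \<in> ?S)" if "\<psi> \<in> ?S" for \<psi>
    proof (cases "\<psi> = (\<lambda>_. 0)")
      case True then show ?thesis by (simp add: bdiff_const partial_const)
    next
      case False
      with that obtain F where F: "F \<in> Cb_infinity k" "\<psi> = (\<lambda>a. F (\<lambda>i. a (n + i)))" by blast
      have "partial_deriv i \<psi> \<in> ?S" for i
        unfolding F(2) pd[OF F(1)] using Cb_partial[OF F(1), of "i - n"] by auto
      then show ?thesis using g[OF F(1)] F(2) by simp
    qed
  qed (use F in blast)
qed


section \<open>Configurations as image measures of counting measures\<close>

text \<open>The point configuration with the points \<open>x i\<close>, \<open>i \<in> I\<close>.\<close>

definition points :: "'a measure \<Rightarrow> 'i set \<Rightarrow> ('i \<Rightarrow> 'a) \<Rightarrow> 'a measure" where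
  "points m I x = distr (count_space I) m x"

text \<open>Balls around an arbitrary fixed point; they exhaust the bounded sets.\<close>

abbreviation ball0 :: "real \<Rightarrow> 'a::metric_space set" where
  "ball0 r \<equiv> cball undefined r"

text \<open>The indices of the points in a ball.\<close>

definition inds :: "'i set \<Rightarrow> ('i \<Rightarrow> 'a::metric_space) \<Rightarrow> real \<Rightarrow> 'i set" where
  "inds I x r = {i \<in> I. x i \<in> ball0 r}"

text \<open>Measurable functions that vanish outside a bounded set.\<close>

definition bsupp :: "'a::metric_space measure \<Rightarrow> ('a \<Rightarrow> real) \<Rightarrow> bool" where
  "bsupp m f \<longleftrightarrow> f \<in> borel_measurable m \<and> (\<exists>r. \<forall>x. f x \<noteq> 0 \<longrightarrow> x \<in> ball0 r)"

text \<open>The map \<open>\<gamma> \<mapsto> \<integral> f d\<gamma>\<close>.\<close>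

abbreviation star :: "('a \<Rightarrow> real) \<Rightarrow> 'a measure \<Rightarrow> real" where
  "star f \<gamma> \<equiv> \<integral>x. f x \<partial>\<gamma>"

text \<open>A configuration is given by an index set \<open>{i. i < N}\<close> with \<open>N \<le> \<infinity>\<close>; any countable index set is
  as good.\<close>

lemma exists_enum:
  assumes "countable (I :: 'i set)"
  shows "\<exists>(N::enat) b. bij_betw b {i. enat i < N} I"
proof (cases "finite I")
  case True
  have "{i. enat i < enat (card I)} = {..<card I}" by auto
  then show ?thesis using bij_betw_from_nat_into_finite[OF True] by metis
next
  case False
  have "{i. enat i < \<infinity>} = UNIV" by auto
  then show ?thesis using bij_betw_from_nat_into[OF assms False] by metis
qed

text \<open>A Polish space with a measure whose sigma-algebra contains the Borel sets. No more is needed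
  for the topology of configurations and for the transport distance.\<close>

locale config_base =
  fixes m :: "'a::polish_space measure"
  assumes space_UNIV: "space m = UNIV" and borel_sets: "sets borel \<subseteq> sets m"
begin

lemma borel_imp_m: "A \<in> sets borel \<Longrightarrow> A \<in> sets m"
  using borel_sets by blast

lemma continuous_measurable: "continuous_on UNIV f \<Longrightarrow> f \<in> borel_measurable m"
  for f :: "'a \<Rightarrow> real"
  using measurable_mono[of borel borel borel m] borel_measurable_continuous_onI[of f]
  by (auto simp: space_UNIV borel_sets)

lemma ball0_bounded_sets: "ball0 r \<in> bounded_sets m"
  by (simp add: bounded_sets_def borel_imp_m bounded_cball)

lemma bounded_subset_ball0: "bounded (A :: 'a set) \<Longrightarrow> \<exists>r. A \<subseteq> ball0 r"
  using bounded_any_center[of A undefined] by (auto simp: subset_eq)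

lemma ball0_mono: "r \<le> s \<Longrightarrow> (ball0 r :: 'a set) \<subseteq> ball0 s"
  by auto

lemma bsuppI: "f \<in> borel_measurable m \<Longrightarrow> bounded {x. f x \<noteq> 0} \<Longrightarrow> bsupp m f"
  unfolding bsupp_def using bounded_subset_ball0[of "{x. f x \<noteq> 0}"] by blast

lemma Cbs_bsupp: "f \<in> Cbs \<Longrightarrow> bsupp m f"
  by (rule bsuppI) (auto simp: Cbs_def intro: continuous_measurable)

lemma sets_points [simp]: "sets (points m I x) = sets m"
  by (simp add: points_def)

lemma space_points [simp]: "space (points m I x) = UNIV"
  by (simp add: points_def space_UNIV)

lemma points_measurable: "x \<in> measurable (count_space I) m"
  by (simp add: space_UNIV)

lemma emeasure_points: "A \<in> sets m \<Longrightarrow> emeasure (points m I x) A = emeasure (count_space I) {i \<in> I. x i \<in> A}"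
  unfolding points_def
  by (subst emeasure_distr[OF points_measurable]) (auto intro!: arg_cong[where f = "emeasure _"])

lemma emeasure_points_nn: "A \<in> sets m \<Longrightarrow> emeasure (points m I x) A = (\<integral>\<^sup>+i. indicator A (x i) \<partial>count_space I)"
  using nn_integral_distr[OF points_measurable[of x I], of "indicator A"]
  by (simp add: points_def)

text \<open>Only finitely many of the points lie in a given ball.\<close>

definition lfin :: "'i set \<Rightarrow> ('i \<Rightarrow> 'a) \<Rightarrow> bool" where
  "lfin I x \<longleftrightarrow> (\<forall>r. finite (inds I x r))"

lemma points_finite_iff:
  "(\<forall>A\<in>bounded_sets m. emeasure (points m I x) A < \<infinity>) \<longleftrightarrow> lfin I x"
proof
  assume a: "\<forall>A\<in>bounded_sets m. emeasure (points m I x) A < \<infinity>"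
  show "lfin I x"
    unfolding lfin_def
  proof
    fix r
    have "emeasure (points m I x) (ball0 r) < \<infinity>" using a ball0_bounded_sets by blast
    then show "finite (inds I x r)"
      by (subst (asm) emeasure_points)
        (auto simp: emeasure_count_space inds_def borel_imp_m top_unique less_top[symmetric] split: if_splits)
  qed
next
  assume l: "lfin I x"
  show "\<forall>A\<in>bounded_sets m. emeasure (points m I x) A < \<infinity>"
  proof
    fix A assume A: "A \<in> bounded_sets m"
    then obtain r where "A \<subseteq> ball0 r" using bounded_subset_ball0 unfolding bounded_sets_def by blast
    then have "{i \<in> I. x i \<in> A} \<subseteq> inds I x r" unfolding inds_def by blast
    then have "finite {i \<in> I. x i \<in> A}" using l finite_subset unfolding lfin_def by blast
    then show "emeasure (points m I x) A < \<infinity>"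
      using A by (subst emeasure_points) (auto simp: bounded_sets_def emeasure_count_space of_nat_less_top)
  qed
qed

lemma points_eq_sum:
  assumes "bij_betw b {i. enat i < N} I" "A \<in> sets m"
  shows "emeasure (points m I x) A = (\<Sum>i. if enat i < N then indicator A (x (b i)) else 0)"
proof -
  have "emeasure (points m I x) A = (\<integral>\<^sup>+i. indicator A (x (b i)) \<partial>count_space {i. enat i < N})"
    unfolding emeasure_points_nn[OF assms(2)] by (rule nn_integral_bij_count_space[OF assms(1), symmetric])
  also have "\<dots> = (\<integral>\<^sup>+i. (if enat i < N then indicator A (x (b i)) else 0) \<partial>count_space UNIV)"
    by (subst nn_integral_count_space_indicator) (auto intro!: nn_integral_cong simp: indicator_def)
  finally show ?thesis by (simp add: nn_integral_count_space_nat)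
qed

lemma points_config:
  assumes "countable I" "lfin I x"
  shows "points m I x \<in> config_space m"
proof -
  obtain N b where b: "bij_betw b {i. enat i < (N::enat)} I" using exists_enum[OF assms(1)] by blast
  have "\<forall>A\<in>sets m. emeasure (points m I x) A = (\<Sum>i. if enat i < N then indicator A ((x \<circ> b) i) else 0)"
    unfolding o_def by (intro ballI points_eq_sum[OF b])
  then show ?thesis
    unfolding config_space_def using points_finite_iff[of I x] assms(2) by auto
qed

lemma config_points:
  assumes "\<gamma> \<in> config_space m"
  obtains I :: "nat set" and x where "\<gamma> = points m I x" "lfin I x"
proof -
  from assms obtain N :: enat and x where s: "sets \<gamma> = sets m"
    and e: "\<forall>A\<in>sets m. emeasure \<gamma> A = (\<Sum>i. if enat i < N then indicator A (x i) else 0)"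
    and f: "\<forall>A\<in>bounded_sets m. emeasure \<gamma> A < \<infinity>"
    unfolding config_space_def by blast
  have "\<gamma> = points m {i. enat i < N} x"
  proof (rule measure_eqI)
    fix A assume "A \<in> sets \<gamma>"
    then show "emeasure \<gamma> A = emeasure (points m {i. enat i < N} x) A"
      using e s points_eq_sum[of "\<lambda>i. i" N "{i. enat i < N}" A x] by (simp add: bij_betw_def)
  qed (simp add: s)
  then show ?thesis using that f points_finite_iff by blast
qed

lemma star_points:
  assumes l: "lfin I x" and f: "f \<in> borel_measurable m" and r: "\<And>y. f y \<noteq> 0 \<Longrightarrow> y \<in> ball0 r"
  shows "star f (points m I x) = (\<Sum>i\<in>inds I x r. f (x i))"
proof -
  have fin: "finite (inds I x r)" using l by (simp add: lfin_def)
  have sub: "{i \<in> I. f (x i) \<noteq> 0} \<subseteq> inds I x r" using r unfolding inds_def by blast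
  have "star f (points m I x) = (\<integral>i. f (x i) \<partial>count_space I)"
    unfolding points_def by (rule integral_distr[OF points_measurable f])
  also have "\<dots> = (\<Sum>i | i \<in> I \<and> f (x i) \<noteq> 0. f (x i))"
    by (rule lebesgue_integral_count_space_finite_support) (rule finite_subset[OF sub fin])
  also have "\<dots> = (\<Sum>i\<in>inds I x r. f (x i))"
    by (rule sum.mono_neutral_left[OF fin sub]) (auto simp: inds_def)
  finally show ?thesis .
qed

lemma star_points_ex:
  assumes f: "bsupp m f"
  shows "\<exists>r. \<forall>(I :: 'i set) x r'. lfin I x \<longrightarrow> r \<le> r' \<longrightarrow> star f (points m I x) = (\<Sum>i\<in>inds I x r'. f (x i))"
proof -
  obtain r where r: "\<And>y. f y \<noteq> 0 \<Longrightarrow> y \<in> ball0 r" and fm: "f \<in> borel_measurable m"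
    using f unfolding bsupp_def by blast
  have "star f (points m I x) = (\<Sum>i\<in>inds I x r'. f (x i))" if "lfin (I :: 'i set) x" "r \<le> r'" for I x r'
    by (rule star_points[OF that(1) fm]) (use r ball0_mono[OF that(2)] in blast)
  then show ?thesis by (intro exI[of _ r] allI impI)
qed

lemma bsupp_integrable:
  assumes g: "\<gamma> \<in> config_space m" and f: "bsupp m f"
  shows "integrable \<gamma> f"
proof -
  obtain I :: "nat set" and x where \<gamma>: "\<gamma> = points m I x" "lfin I x" using config_points[OF g] by blast
  obtain r where r: "\<And>y. f y \<noteq> 0 \<Longrightarrow> y \<in> ball0 r" and fm: "f \<in> borel_measurable m"
    using f unfolding bsupp_def by blast
  have fin: "finite (inds I x r)" using \<gamma> by (simp add: lfin_def)
  have "integrable (count_space I) (\<lambda>i. f (x i))"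
  proof -
    have "(\<integral>\<^sup>+i. ennreal (norm (f (x i))) \<partial>count_space I) = (\<Sum>i\<in>inds I x r. ennreal (norm (f (x i))))"
      by (rule nn_integral_count_space'[OF fin]) (use r in \<open>auto simp: inds_def\<close>)
    also have "\<dots> < \<infinity>" by simp
    finally show ?thesis by (simp add: integrable_iff_bounded)
  qed
  then show ?thesis
    unfolding \<gamma>(1) points_def by (simp add: integrable_distr_eq[OF points_measurable fm])
qed

subsection \<open>Moving and removing a point\<close>

lemma inds_upd_eq: "inds I (x(i := y)) r - {i} = inds I x r - {i}"
  by (auto simp: inds_def)

lemma lfin_upd: "lfin I x \<Longrightarrow> lfin I (x(i := y))"
  unfolding lfin_def
proof
  fix r assume "\<forall>r. finite (inds I x r)"
  then have "finite (inds I (x(i := y)) r - {i})" by (simp add: inds_upd_eq)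
  then show "finite (inds I (x(i := y)) r)" by simp
qed

lemma lfin_subset: "lfin I x \<Longrightarrow> J \<subseteq> I \<Longrightarrow> lfin J x"
  unfolding lfin_def
proof
  fix r assume "\<forall>r. finite (inds I x r)" "J \<subseteq> I"
  then show "finite (inds J x r)" using finite_subset[of "inds J x r" "inds I x r"] by (auto simp: inds_def)
qed

text \<open>The integrals change as expected if the point \<open>x i\<close> is moved to \<open>y\<close>, or removed.\<close>

lemma star_upd:
  assumes l: "lfin I x" and f: "bsupp m f" and i: "i \<in> I"
  shows "star f (points m I (x(i := y))) = (star f (points m I x) - f (x i)) + f y"
    "star f (points m (I - {i}) x) = star f (points m I x) - f (x i)"
proof -
  obtain r0 where r0: "\<forall>(I :: 'b set) x r'. lfin I x \<longrightarrow> r0 \<le> r' \<longrightarrow> star f (points m I x) = (\<Sum>i\<in>inds I x r'. f (x i))"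
    using star_points_ex[OF f] ..
  define r where "r = max r0 (max (dist undefined y) (dist undefined (x i)))"
  have r1: "star f (points m I x) = (\<Sum>i\<in>inds I x r. f (x i))" if "lfin I x" for I :: "'b set" and x
    by (rule r0[rule_format, OF that]) (simp add: r_def)
  have fin: "finite (inds I x r)" "finite (inds I (x(i:=y)) r)" using l lfin_upd[OF l] unfolding lfin_def by blast+
  have mem: "i \<in> inds I x r" "i \<in> inds I (x(i := y)) r"
    using i unfolding inds_def r_def by auto
  have "star f (points m I (x(i := y))) = f y + (\<Sum>j\<in>inds I (x(i := y)) r - {i}. f ((x(i := y)) j))"
    unfolding r1[OF lfin_upd[OF l]] using sum.remove[OF fin(2) mem(2), of "\<lambda>j. f ((x(i := y)) j)"] by simp
  also have "(\<Sum>j\<in>inds I (x(i := y)) r - {i}. f ((x(i := y)) j)) = (\<Sum>j\<in>inds I x r - {i}. f (x j))"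
    unfolding inds_upd_eq by (intro sum.cong) auto
  also have "\<dots> = star f (points m I x) - f (x i)"
    unfolding r1[OF l] using sum.remove[OF fin(1) mem(1), of "\<lambda>j. f (x j)"] by simp
  finally show "star f (points m I (x(i := y))) = (star f (points m I x) - f (x i)) + f y"
    by (simp only: add.commute)
  have "inds (I - {i}) x r = inds I x r - {i}" by (auto simp: inds_def)
  then show "star f (points m (I - {i}) x) = star f (points m I x) - f (x i)"
    unfolding r1[OF lfin_subset[OF l Diff_subset]] r1[OF l]
    using sum.remove[OF fin(1) mem(1), of "\<lambda>j. f (x j)"] by simp
qed

subsection \<open>Measurability\<close>

lemma space_config [simp]: "space (config_algebra m) = config_space m"
  unfolding config_algebra_def by (rule space_measure_of) blast

lemma emeasure_config_measurable:
  assumes A: "A \<in> bounded_sets m"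
  shows "(\<lambda>\<gamma>. emeasure \<gamma> A) \<in> borel_measurable (config_algebra m)"
proof (rule measurableI)
  fix B :: "ennreal set" assume B: "B \<in> sets borel"
  have "{\<gamma> \<in> config_space m. emeasure \<gamma> A \<in> B} \<in> sets (config_algebra m)"
    unfolding config_algebra_def by (subst sets_measure_of) (use A B in blast)+
  then show "(\<lambda>\<gamma>. emeasure \<gamma> A) -` B \<inter> space (config_algebra m) \<in> sets (config_algebra m)"
    by (simp add: vimage_def Int_def conj_commute)
qed simp

lemma config_sets: "\<gamma> \<in> config_space m \<Longrightarrow> sets \<gamma> = sets m"
  by (simp add: config_space_def)

lemma config_borel: "\<gamma> \<in> config_space m \<Longrightarrow> borel_measurable \<gamma> = borel_measurable m"
  by (rule measurable_cong_sets) (auto simp: config_sets)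

text \<open>The generators of the sigma-algebra are the maps \<open>\<gamma> \<mapsto> \<gamma> A\<close> for bounded \<open>A\<close>; the ball in the
  integrand makes the induction over \<open>f\<close> stay within bounded sets.\<close>

lemma nn_integral_config_measurable:
  assumes f: "(f :: 'a \<Rightarrow> ennreal) \<in> borel_measurable m"
  shows "(\<lambda>\<gamma>. \<integral>\<^sup>+x. f x * indicator (ball0 r) x \<partial>\<gamma>) \<in> borel_measurable (config_algebra m)"
  using f
proof (induction rule: borel_measurable_induct)
  case (cong f g)
  then have "f = g" by (auto simp: space_UNIV)
  then show ?case using cong by simp
next
  case (set A)
  have AB: "A \<inter> ball0 r \<in> bounded_sets m"
    using set ball0_bounded_sets[of r] by (auto simp: bounded_sets_def intro: bounded_subset)
  have eq: "(\<integral>\<^sup>+x. indicator A x * indicator (ball0 r) x \<partial>\<gamma>) = emeasure \<gamma> (A \<inter> ball0 r)"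
    if "\<gamma> \<in> space (config_algebra m)" for \<gamma>
  proof -
    have "A \<inter> ball0 r \<in> sets \<gamma>" using AB that by (simp add: config_sets bounded_sets_def)
    from nn_integral_indicator[OF this] show ?thesis by (simp only: indicator_inter_arith)
  qed
  then show ?case
    using emeasure_config_measurable[OF AB] by (subst measurable_cong[OF eq])
next
  case (mult u c)
  have eq: "(\<integral>\<^sup>+x. c * u x * indicator (ball0 r) x \<partial>\<gamma>) = c * (\<integral>\<^sup>+x. u x * indicator (ball0 r) x \<partial>\<gamma>)"
    if "\<gamma> \<in> space (config_algebra m)" for \<gamma>
  proof -
    have "u \<in> borel_measurable \<gamma>" "ball0 r \<in> sets \<gamma>"
      using mult that by (auto simp: config_borel config_sets borel_imp_m)
    then show ?thesis by (subst nn_integral_cmult[symmetric]) (auto simp: mult.assoc)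
  qed
  show ?case by (subst measurable_cong[OF eq]) (auto intro!: borel_measurable_times_ennreal mult)
next
  case (add u v)
  have eq: "(\<integral>\<^sup>+x. (v x + u x) * indicator (ball0 r) x \<partial>\<gamma>)
      = (\<integral>\<^sup>+x. v x * indicator (ball0 r) x \<partial>\<gamma>) + (\<integral>\<^sup>+x. u x * indicator (ball0 r) x \<partial>\<gamma>)"
    if "\<gamma> \<in> space (config_algebra m)" for \<gamma>
  proof -
    have "u \<in> borel_measurable \<gamma>" "v \<in> borel_measurable \<gamma>" "ball0 r \<in> sets \<gamma>"
      using add that by (auto simp: config_borel config_sets borel_imp_m)
    then show ?thesis by (subst nn_integral_add[symmetric]) (auto simp: ring_distribs)
  qed
  show ?case by (subst measurable_cong[OF eq]) (auto intro!: borel_measurable_add add)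
next
  case (seq U)
  have eq: "(\<integral>\<^sup>+x. (SUP i. U i) x * indicator (ball0 r) x \<partial>\<gamma>)
      = (SUP i. \<integral>\<^sup>+x. U i x * indicator (ball0 r) x \<partial>\<gamma>)"
    if "\<gamma> \<in> space (config_algebra m)" for \<gamma>
  proof -
    have [measurable]: "U i \<in> borel_measurable \<gamma>" "ball0 r \<in> sets \<gamma>" for i
      using seq that by (auto simp: config_borel config_sets borel_imp_m)
    have "(\<integral>\<^sup>+x. (SUP i. U i) x * indicator (ball0 r) x \<partial>\<gamma>)
        = (\<integral>\<^sup>+x. (SUP i. U i x * indicator (ball0 r) x) \<partial>\<gamma>)"
      by (intro nn_integral_cong) (auto simp: indicator_def image_image)
    also have "\<dots> = (SUP i. \<integral>\<^sup>+x. U i x * indicator (ball0 r) x \<partial>\<gamma>)"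
      by (rule nn_integral_monotone_convergence_SUP)
        (use seq.hyps in \<open>auto simp: incseq_def le_fun_def intro!: mult_right_mono\<close>)
    finally show ?thesis .
  qed
  show ?case by (subst measurable_cong[OF eq]) (auto intro!: borel_measurable_SUP seq)
qed

lemma star_measurable:
  assumes f: "bsupp m f"
  shows "star f \<in> borel_measurable (config_algebra m)"
proof -
  obtain r where r: "\<And>y. f y \<noteq> 0 \<Longrightarrow> y \<in> ball0 r" and fm [measurable]: "f \<in> borel_measurable m"
    using f unfolding bsupp_def by blast
  have eq: "star f \<gamma> = enn2real (\<integral>\<^sup>+x. ennreal (f x) * indicator (ball0 r) x \<partial>\<gamma>)
      - enn2real (\<integral>\<^sup>+x. ennreal (- f x) * indicator (ball0 r) x \<partial>\<gamma>)"
    if "\<gamma> \<in> space (config_algebra m)" for \<gamma>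
  proof -
    have e: "ennreal (f x) * indicator (ball0 r) x = ennreal (f x)"
      "ennreal (- f x) * indicator (ball0 r) x = ennreal (- f x)" for x
      using r[of x] by (cases "f x = 0"; auto simp: indicator_def)+
    show ?thesis
      unfolding e by (rule real_lebesgue_integral_def[OF bsupp_integrable]) (use f that in auto)
  qed
  moreover have "(\<lambda>\<gamma>. enn2real (\<integral>\<^sup>+x. ennreal (f x) * indicator (ball0 r) x \<partial>\<gamma>)
      - enn2real (\<integral>\<^sup>+x. ennreal (- f x) * indicator (ball0 r) x \<partial>\<gamma>)) \<in> borel_measurable (config_algebra m)"
    by (intro borel_measurable_diff borel_measurable_enn2real nn_integral_config_measurable) measurable
  ultimately show ?thesis by (subst measurable_cong[OF eq])
qed

lemma star_integrable:
  assumes f: "bsupp m f" and bd: "\<And>y. \<bar>f y\<bar> \<le> c"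
    and \<mu>: "sets \<mu> = sets (config_algebra m)"
    and fin: "\<And>A. A \<in> bounded_sets m \<Longrightarrow> (\<integral>\<^sup>+\<gamma>. emeasure \<gamma> A \<partial>\<mu>) < \<infinity>"
  shows "integrable \<mu> (star f)"
proof (rule integrableI_bounded)
  have sp: "space \<mu> = config_space m" using sets_eq_imp_space_eq[OF \<mu>] by simp
  show "star f \<in> borel_measurable \<mu>"
    using star_measurable[OF f] measurable_cong_sets[OF \<mu> refl] by blast
  obtain r where r: "\<And>y. f y \<noteq> 0 \<Longrightarrow> y \<in> ball0 r" and fm: "f \<in> borel_measurable m"
    using f unfolding bsupp_def by blast
  have c: "0 \<le> c" using bd[of undefined] by linarith
  have em: "(\<lambda>\<gamma>. emeasure \<gamma> (ball0 r)) \<in> borel_measurable \<mu>"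
    using emeasure_config_measurable[OF ball0_bounded_sets] measurable_cong_sets[OF \<mu> refl] by blast
  have "(\<integral>\<^sup>+\<gamma>. ennreal (norm (star f \<gamma>)) \<partial>\<mu>) \<le> (\<integral>\<^sup>+\<gamma>. ennreal c * emeasure \<gamma> (ball0 r) \<partial>\<mu>)"
  proof (rule nn_integral_mono)
    fix \<gamma> assume "\<gamma> \<in> space \<mu>"
    then have g: "\<gamma> \<in> config_space m" by (simp add: sp)
    have "ennreal (norm (star f \<gamma>)) \<le> (\<integral>\<^sup>+x. ennreal (norm (f x)) \<partial>\<gamma>)"
      by (rule integral_norm_bound_ennreal[OF bsupp_integrable[OF g f]])
    also have "\<dots> \<le> (\<integral>\<^sup>+x. ennreal c * indicator (ball0 r) x \<partial>\<gamma>)"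
    proof (rule nn_integral_mono)
      fix x show "ennreal (norm (f x)) \<le> ennreal c * indicator (ball0 r) x"
        using r[of x] bd[of x] by (cases "f x = 0") (auto simp: ennreal_leI)
    qed
    also have "\<dots> = ennreal c * emeasure \<gamma> (ball0 r)"
      by (rule nn_integral_cmult_indicator) (simp add: config_sets[OF g] borel_imp_m)
    finally show "ennreal (norm (star f \<gamma>)) \<le> ennreal c * emeasure \<gamma> (ball0 r)" .
  qed
  also have "\<dots> = ennreal c * (\<integral>\<^sup>+\<gamma>. emeasure \<gamma> (ball0 r) \<partial>\<mu>)"
    by (rule nn_integral_cmult[OF em])
  also have "\<dots> < \<infinity>"
    using fin[OF ball0_bounded_sets] by (simp add: ennreal_mult_less_top)
  finally show "(\<integral>\<^sup>+\<gamma>. ennreal (norm (star f \<gamma>)) \<partial>\<mu>) < \<infinity>" .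
qed


section \<open>Functions that are Lipschitz for the transport distance\<close>

lemma Cbs_square: "g \<in> Cbs \<Longrightarrow> (\<lambda>x. (g x)\<^sup>2) \<in> Cbs"
  unfolding Cbs_def
proof (intro CollectI, elim CollectE conjE, intro conjI)
  assume "bounded (range g)"
  then obtain c where "\<forall>x. \<bar>g x\<bar> \<le> c" by (auto simp: bounded_iff)
  then have "\<bar>g x\<bar>\<^sup>2 \<le> c\<^sup>2" for x by (intro power_mono) auto
  then have "\<bar>(g x)\<^sup>2\<bar> \<le> c\<^sup>2" for x by simp
  then show "bounded (range (\<lambda>x. (g x)\<^sup>2))" by (auto simp: bounded_iff)
qed (auto intro: continuous_intros)

text \<open>
  For a Lipschitz function \<open>g\<close> the map \<open>\<gamma> \<mapsto> (\<integral> g\<^sup>2 d\<gamma>)\<^bsup>1/2\<^esup>\<close> is Lipschitz with the same constant: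
  by the triangle inequality in \<open>L\<^sup>2(q)\<close> for a coupling \<open>q\<close>.
\<close>

lemma root_star_coupling:
  assumes g: "g \<in> Cbs" and L: "0 \<le> L" and lip: "\<And>x y. \<bar>g x - g y\<bar> \<le> L * dist x y"
    and \<gamma>: "\<gamma> \<in> config_space m" and \<eta>: "\<eta> \<in> config_space m" and q: "q \<in> couplings m \<gamma> \<eta>"
    and r: "r\<^sup>2 = (\<integral>\<^sup>+p. ennreal ((dist (fst p) (snd p))\<^sup>2) \<partial>q)" "r < \<infinity>"
  shows "\<bar>sqrt (star (\<lambda>x. (g x)\<^sup>2) \<gamma>) - sqrt (star (\<lambda>x. (g x)\<^sup>2) \<eta>)\<bar> \<le> L * enn2real r"
proof -
  have qs: "sets q = sets (m \<Otimes>\<^sub>M m)" and q1: "distr q m fst = \<gamma>" and q2: "distr q m snd = \<eta>"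
    using q by (auto simp: couplings_def)
  have f1: "fst \<in> measurable q m" and f2: "snd \<in> measurable q m"
    using measurable_cong_sets[OF qs refl, of m] by auto
  have idm: "(\<lambda>x. x) \<in> measurable m borel"
    using measurable_mono[of borel borel borel m] measurable_ident[of borel] borel_sets
    by (auto simp: space_UNIV id_def)
  have dm: "(\<lambda>p. dist (fst p) (snd p)) \<in> borel_measurable q"
    by (intro borel_measurable_dist measurable_compose[OF f1 idm] measurable_compose[OF f2 idm])
  have gm: "g \<in> borel_measurable m" using g by (auto simp: Cbs_def intro: continuous_measurable)
  have g2: "bsupp m (\<lambda>x. (g x)\<^sup>2)" by (rule Cbs_bsupp[OF Cbs_square[OF g]])
  then have g2m: "(\<lambda>x. (g x)\<^sup>2) \<in> borel_measurable m" by (simp add: bsupp_def)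
  have a: "(\<lambda>p. g (fst p)) \<in> L2 q"
    unfolding L2_def using bsupp_integrable[OF \<gamma> g2] integrable_distr_eq[OF f1 g2m] q1 measurable_compose[OF f1 gm] by simp
  have b: "(\<lambda>p. g (snd p)) \<in> L2 q"
    unfolding L2_def using bsupp_integrable[OF \<eta> g2] integrable_distr_eq[OF f2 g2m] q2 measurable_compose[OF f2 gm] by simp
  have an: "L2.nrm q (\<lambda>p. g (fst p)) = sqrt (star (\<lambda>x. (g x)\<^sup>2) \<gamma>)"
    unfolding L2_nrm_eq using integral_distr[OF f1 g2m] q1 by simp
  have bn: "L2.nrm q (\<lambda>p. g (snd p)) = sqrt (star (\<lambda>x. (g x)\<^sup>2) \<eta>)"
    unfolding L2_nrm_eq using integral_distr[OF f2 g2m] q2 by simp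
  define s where "s = enn2real r"
  have s: "0 \<le> s" "r = ennreal s" using r(2) by (auto simp: s_def less_top)
  have "ennreal (\<integral>p. (g (fst p) - g (snd p))\<^sup>2 \<partial>q) = (\<integral>\<^sup>+p. ennreal ((g (fst p) - g (snd p))\<^sup>2) \<partial>q)"
    by (rule nn_integral_eq_integral[symmetric]) (use L2_square_integrable[OF L2_diff[OF a b]] in auto)
  also have "\<dots> \<le> (\<integral>\<^sup>+p. ennreal (L\<^sup>2) * ennreal ((dist (fst p) (snd p))\<^sup>2) \<partial>q)"
  proof (rule nn_integral_mono)
    fix p
    have "(g (fst p) - g (snd p))\<^sup>2 \<le> (L * dist (fst p) (snd p))\<^sup>2"
      using lip[of "fst p" "snd p"] by (metis abs_ge_zero power2_abs power_mono)
    then show "ennreal ((g (fst p) - g (snd p))\<^sup>2) \<le> ennreal (L\<^sup>2) * ennreal ((dist (fst p) (snd p))\<^sup>2)"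
      by (simp add: ennreal_mult[symmetric] power_mult_distrib ennreal_leI)
  qed
  also have "\<dots> = ennreal (L\<^sup>2) * r\<^sup>2"
    unfolding r(1) by (rule nn_integral_cmult) (use dm in measurable)
  also have "\<dots> = ennreal ((L * s)\<^sup>2)"
    using s by (simp add: ennreal_power ennreal_mult[symmetric] power_mult_distrib)
  finally have "(\<integral>p. (g (fst p) - g (snd p))\<^sup>2 \<partial>q) \<le> (L * s)\<^sup>2" by simp
  then have "L2.nrm q (\<lambda>p. g (fst p) - g (snd p)) \<le> L * s"
    unfolding L2_nrm_eq using real_sqrt_le_mono[of _ "(L * s)\<^sup>2"] L s(1) by fastforce
  then show ?thesis
    using L2.nrm_rev_triangle[OF a b] unfolding an bn s_def by linarith
qed

text \<open>The Lipschitz condition for the infimum follows from that for the cost of each coupling.\<close>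

lemma transport_LipschitzI:
  assumes L: "0 \<le> L"
    and le: "\<And>\<gamma> \<eta> q r. \<gamma> \<in> config_space m \<Longrightarrow> \<eta> \<in> config_space m \<Longrightarrow> q \<in> couplings m \<gamma> \<eta> \<Longrightarrow>
      r\<^sup>2 = (\<integral>\<^sup>+p. ennreal ((dist (fst p) (snd p))\<^sup>2) \<partial>q) \<Longrightarrow> r < \<infinity> \<Longrightarrow> \<bar>u \<gamma> - u \<eta>\<bar> \<le> L * enn2real r"
  shows "transport_Lipschitz m L u"
  unfolding transport_Lipschitz_def
proof (intro conjI ballI impI L)
  fix \<gamma> \<eta> assume g: "\<gamma> \<in> config_space m" "\<eta> \<in> config_space m" and fin: "transport_dist m \<gamma> \<eta> < \<infinity>"
  define S where "S = {r. \<exists>q\<in>couplings m \<gamma> \<eta>. r\<^sup>2 = (\<integral>\<^sup>+p. ennreal ((dist (fst p) (snd p))\<^sup>2) \<partial>q)}"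
  have t: "transport_dist m \<gamma> \<eta> = Inf S" by (simp add: transport_dist_def S_def)
  have S: "\<bar>u \<gamma> - u \<eta>\<bar> \<le> L * enn2real r" if "r \<in> S" "r < \<infinity>" for r
    using le[OF g] that unfolding S_def by blast
  obtain r0 where r0: "r0 \<in> S" "r0 < \<infinity>" using fin unfolding t Inf_less_iff by blast
  show "\<bar>u \<gamma> - u \<eta>\<bar> \<le> L * enn2real (transport_dist m \<gamma> \<eta>)"
  proof (cases "L = 0")
    case True then show ?thesis using S[OF r0] by simp
  next
    case False
    with L have L: "L > 0" by simp
    have "ennreal (\<bar>u \<gamma> - u \<eta>\<bar> / L) \<le> Inf S"
    proof (rule Inf_greatest)
      fix r assume r: "r \<in> S"
      show "ennreal (\<bar>u \<gamma> - u \<eta>\<bar> / L) \<le> r"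
      proof (cases "r < \<infinity>")
        case True
        then have "\<bar>u \<gamma> - u \<eta>\<bar> / L \<le> enn2real r" using S[OF r True] L by (simp add: divide_le_eq mult.commute)
        then have "ennreal (\<bar>u \<gamma> - u \<eta>\<bar> / L) \<le> ennreal (enn2real r)" by (rule ennreal_leI)
        also have "ennreal (enn2real r) = r" using True by simp
        finally show ?thesis .
      next
        case False
        then have "r = \<top>" using top.not_eq_extremum[of r] by auto
        then show ?thesis by simp
      qed
    qed
    then have "enn2real (ennreal (\<bar>u \<gamma> - u \<eta>\<bar> / L)) \<le> enn2real (Inf S)"
      by (rule enn2real_mono) (use fin t in simp)
    then show ?thesis using L unfolding t by (simp add: divide_le_eq mult.commute)
  qed
qed

lemma truncated_root_Lipschitz:
  assumes g: "g \<in> Cbs" and L: "0 \<le> L" and lip: "\<And>x y. \<bar>g x - g y\<bar> \<le> L * dist x y"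
  shows "transport_Lipschitz m L (\<lambda>\<gamma>. min c (sqrt (star (\<lambda>x. (g x)\<^sup>2) \<gamma>)))"
proof (rule transport_LipschitzI[OF L])
  fix \<gamma> \<eta> q and r :: ennreal
  assume "\<gamma> \<in> config_space m" "\<eta> \<in> config_space m" "q \<in> couplings m \<gamma> \<eta>"
    "r\<^sup>2 = (\<integral>\<^sup>+p. ennreal ((dist (fst p) (snd p))\<^sup>2) \<partial>q)" "r < \<infinity>"
  from root_star_coupling[OF g L lip this]
  show "\<bar>min c (sqrt (star (\<lambda>x. (g x)\<^sup>2) \<gamma>)) - min c (sqrt (star (\<lambda>x. (g x)\<^sup>2) \<eta>))\<bar> \<le> L * enn2real r"
    by linarith
qed

section \<open>The vague topology\<close>

lemma zero_Cbs: "(\<lambda>_. 0) \<in> Cbs"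
  by (auto simp: Cbs_def bounded_iff)

lemma topspace_vague [simp]: "topspace (vague_topology m) = config_space m"
proof -
  have "{\<gamma> \<in> config_space m. star (\<lambda>_. 0) \<gamma> \<in> UNIV} \<in>
    {{\<gamma> \<in> config_space m. star f \<gamma> \<in> U} | f U. f \<in> Cbs \<and> open (U::real set)}"
    using zero_Cbs by blast
  then show ?thesis unfolding vague_topology_def topology_generated_by_topspace by auto
qed

lemma star_continuous:
  assumes f: "f \<in> Cbs"
  shows "continuous_map (vague_topology m) euclideanreal (star f)"
  unfolding continuous_map_def
proof (intro conjI allI impI)
  fix U :: "real set" assume "openin euclideanreal U"
  then have "{\<gamma> \<in> config_space m. star f \<gamma> \<in> U} \<in>
    {{\<gamma> \<in> config_space m. star f \<gamma> \<in> U} | f U. f \<in> Cbs \<and> open (U::real set)}"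
    using f by auto
  then show "openin (vague_topology m) {\<gamma> \<in> topspace (vague_topology m). star f \<gamma> \<in> U}"
    unfolding topspace_vague unfolding vague_topology_def by (rule topology_generated_by_Basis)
qed simp

lemma truncated_root_continuous:
  assumes g: "g \<in> Cbs"
  shows "continuous_map (vague_topology m) euclideanreal (\<lambda>\<gamma>. min c (sqrt (star (\<lambda>x. (g x)\<^sup>2) \<gamma>)))"
  by (intro continuous_map_real_min continuous_map_sqrt star_continuous Cbs_square g) simp

lemma truncated_root_measurable:
  assumes g: "g \<in> Cbs"
  shows "(\<lambda>\<gamma>. min c (sqrt (star (\<lambda>x. (g x)\<^sup>2) \<gamma>))) \<in> borel_measurable (config_algebra m)"
  using star_measurable[OF Cbs_bsupp[OF Cbs_square[OF g]]] by measurable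

subsection \<open>Separation of points\<close>

text \<open>A configuration is carried by a countable set, so it is determined by its atoms.\<close>

lemma config_eqI:
  assumes "\<gamma> \<in> config_space m" "\<eta> \<in> config_space m" "\<And>z. emeasure \<gamma> {z} = emeasure \<eta> {z}"
  shows "\<gamma> = \<eta>"
proof -
  obtain I :: "nat set" and x where \<gamma>: "\<gamma> = points m I x" "lfin I x" using config_points[OF assms(1)] by blast
  obtain J :: "nat set" and y where \<eta>: "\<eta> = points m J y" "lfin J y" using config_points[OF assms(2)] by blast
  define C where "C = x ` I \<union> y ` J"
  have C: "countable C" unfolding C_def by auto
  have sing: "{z} \<in> sets m" for z by (rule borel_imp_m) simp
  have Cm: "A \<inter> C \<in> sets m" if "A \<in> sets m" for A
  proof -
    have "countable (A \<inter> C)" using C by (simp add: countable_Int2)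
    then show ?thesis by (rule sets.countable[OF sing])
  qed
  show ?thesis
  proof (rule measure_eqI)
    show "sets \<gamma> = sets \<eta>" using assms by (simp add: config_sets)
    fix A assume "A \<in> sets \<gamma>"
    then have A: "A \<in> sets m" using config_sets[OF assms(1)] by simp
    have "{i \<in> I. x i \<in> A} = {i \<in> I. x i \<in> A \<inter> C}" "{i \<in> J. y i \<in> A} = {i \<in> J. y i \<in> A \<inter> C}"
      by (auto simp: C_def)
    then have "emeasure \<gamma> A = emeasure \<gamma> (A \<inter> C)" "emeasure \<eta> A = emeasure \<eta> (A \<inter> C)"
      unfolding \<gamma>(1) \<eta>(1) emeasure_points[OF A] emeasure_points[OF Cm[OF A]] by simp_all
    moreover have "emeasure \<gamma> (A \<inter> C) = (\<integral>\<^sup>+z. emeasure \<gamma> {z} \<partial>count_space (A \<inter> C))"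
      by (rule emeasure_countable_singleton) (use C sing config_sets[OF assms(1)] in auto)
    moreover have "emeasure \<eta> (A \<inter> C) = (\<integral>\<^sup>+z. emeasure \<eta> {z} \<partial>count_space (A \<inter> C))"
      by (rule emeasure_countable_singleton) (use C sing config_sets[OF assms(2)] in auto)
    ultimately show "emeasure \<gamma> A = emeasure \<eta> A" using assms(3) by simp
  qed
qed

text \<open>A tent of height \<open>1\<close> and slope \<open>n\<close>.\<close>

definition tent :: "'a \<Rightarrow> nat \<Rightarrow> 'a \<Rightarrow> real" where
  "tent y n x = max 0 (1 - real n * dist y x)"

lemma tent_Lipschitz: "\<bar>tent y n a - tent y n b\<bar> \<le> real n * dist a b"
proof -
  have "\<bar>real n * dist y a - real n * dist y b\<bar> \<le> real n * dist a b"
    using abs_dist_diff_le[of a y b] unfolding right_diff_distrib[symmetric] abs_mult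
    by (simp add: dist_commute mult_left_mono)
  then show ?thesis unfolding tent_def by linarith
qed

lemma tent_bound: "0 \<le> tent y n x" "tent y n x \<le> 1"
  unfolding tent_def by auto

lemma tent_support: "0 < n \<Longrightarrow> tent y n x \<noteq> 0 \<Longrightarrow> dist y x < 1 / real n"
  unfolding tent_def by (auto simp: max_def field_simps split: if_splits)

lemma tent_Cbs: "0 < n \<Longrightarrow> tent y n \<in> Cbs"
  unfolding Cbs_def
proof (intro CollectI conjI)
  assume n: "0 < n"
  show "continuous_on UNIV (tent y n)" unfolding tent_def by (intro continuous_intros)
  show "bounded (range (tent y n))" using tent_bound by (auto simp: bounded_iff intro!: exI[of _ 1])
  have "{x. tent y n x \<noteq> 0} \<subseteq> cball y (1 / real n)" using tent_support[OF n] by (force intro: less_imp_le)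
  then show "bounded {x. tent y n x \<noteq> 0}" using bounded_cball bounded_subset by blast
qed

text \<open>The tents of slope \<open>n\<close> around points at distance less than \<open>n\<^sup>-\<^sup>2\<close> from \<open>z\<close> converge to the
  indicator of \<open>{z}\<close>.\<close>

lemma tent_star_tendsto:
  assumes I: "lfin (I :: nat set) x" and y: "\<And>n. dist (y n) z < 1 / (real (Suc n))\<^sup>2"
  shows "(\<lambda>n. star (\<lambda>x. (tent (y n) (Suc n) x)\<^sup>2) (points m I x)) \<longlonglongrightarrow> real (card {i \<in> I. x i = z})"
proof -
  define r where "r = dist undefined z + 2"
  have fin: "finite (inds I x r)" using I by (simp add: lfin_def)
  have sn: "1 / (real (Suc n))\<^sup>2 \<le> 1 / real (Suc n)" for n
    by (rule divide_left_mono) (auto simp: power2_eq_square simp del: of_nat_Suc)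
  have inv1: "1 / real (Suc n) \<le> 1" for n by simp
  have star: "star (\<lambda>x. (tent (y n) (Suc n) x)\<^sup>2) (points m I x) = (\<Sum>i\<in>inds I x r. (tent (y n) (Suc n) (x i))\<^sup>2)" for n
  proof (rule star_points[OF I])
    show "(\<lambda>x. (tent (y n) (Suc n) x)\<^sup>2) \<in> borel_measurable m"
      using Cbs_bsupp[OF Cbs_square[OF tent_Cbs]] unfolding bsupp_def by blast
    fix w assume "(tent (y n) (Suc n) w)\<^sup>2 \<noteq> 0"
    then have "dist (y n) w < 1 / real (Suc n)" by (intro tent_support) auto
    moreover have "dist (y n) z \<le> 1" using y[of n] sn[of n] inv1[of n] by linarith
    ultimately have "dist (y n) w \<le> 1" "dist (y n) z \<le> 1" using inv1[of n] by linarith+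
    then show "w \<in> ball0 r"
      using dist_triangle[of undefined w "y n"] dist_triangle[of undefined "y n" z]
      unfolding r_def by (simp add: dist_commute)
  qed
  have lim: "(\<lambda>n. (tent (y n) (Suc n) w)\<^sup>2) \<longlonglongrightarrow> (if w = z then 1 else 0)" for w
  proof (cases "w = z")
    case True
    have "(\<lambda>n. tent (y n) (Suc n) z) \<longlonglongrightarrow> 1"
    proof (rule tendsto_sandwich[of "\<lambda>n. 1 - 1 / real (Suc n)" _ _ "\<lambda>_. 1"])
      show "\<forall>\<^sub>F n in sequentially. 1 - 1 / real (Suc n) \<le> tent (y n) (Suc n) z"
      proof (intro always_eventually allI)
        fix n
        have "real (Suc n) * dist (y n) z \<le> real (Suc n) * (1 / (real (Suc n))\<^sup>2)"
          using y[of n] by (intro mult_left_mono) auto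
        also have "\<dots> = 1 / real (Suc n)" by (simp add: power2_eq_square del: of_nat_Suc)
        finally show "1 - 1 / real (Suc n) \<le> tent (y n) (Suc n) z" unfolding tent_def by linarith
      qed
      show "(\<lambda>n. 1 - 1 / real (Suc n)) \<longlonglongrightarrow> 1"
        using tendsto_diff[OF tendsto_const[of "1::real"] LIMSEQ_Suc[OF lim_1_over_n]] by simp
    qed (use tent_bound in auto)
    from tendsto_power[OF this, of 2] show ?thesis using True by simp
  next
    case False
    then have d: "dist w z > 0" by simp
    have "(\<lambda>n. 2 * (1 / real (Suc n))) \<longlonglongrightarrow> 2 * 0"
      by (intro tendsto_intros LIMSEQ_Suc[OF lim_1_over_n])
    then have "\<forall>\<^sub>F n in sequentially. 2 * (1 / real (Suc n)) < dist w z"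
      by (rule order_tendstoD) (use d in simp)
    then have "\<forall>\<^sub>F n in sequentially. (tent (y n) (Suc n) w)\<^sup>2 = 0"
    proof eventually_elim
      case (elim n)
      have "tent (y n) (Suc n) w = 0"
      proof (rule ccontr)
        assume "tent (y n) (Suc n) w \<noteq> 0"
        then have "dist (y n) w < 1 / real (Suc n)" by (intro tent_support) auto
        moreover have "dist (y n) z < 1 / real (Suc n)" using y[of n] sn[of n] by linarith
        ultimately show False
          using elim dist_triangle[of w z "y n"] by (simp add: dist_commute del: of_nat_Suc)
      qed
      then show ?case by simp
    qed
    then show ?thesis using False by (simp add: tendsto_eventually)
  qed
  have "(\<lambda>n. \<Sum>i\<in>inds I x r. (tent (y n) (Suc n) (x i))\<^sup>2) \<longlonglongrightarrow> (\<Sum>i\<in>inds I x r. if x i = z then 1 else 0)"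
    by (intro tendsto_sum lim)
  also have "(\<Sum>i\<in>inds I x r. if x i = z then 1 else 0) = real (card {i \<in> inds I x r. x i = z})"
    using fin by (simp add: sum.If_cases Int_def)
  also have "{i \<in> inds I x r. x i = z} = {i \<in> I. x i = z}"
    by (auto simp: inds_def r_def)
  finally show ?thesis unfolding star .
qed

text \<open>Countably many truncated roots of tents separate the configurations.\<close>

lemma tents_separate:
  assumes dense: "\<And>z e. 0 < e \<Longrightarrow> \<exists>j::nat. dist (Y j) z < e"
    and \<gamma>: "\<gamma> \<in> config_space m" and \<eta>: "\<eta> \<in> config_space m"
    and eq: "\<And>j n c. min (real c) (sqrt (star (\<lambda>x. (tent (Y j) (Suc n) x)\<^sup>2) \<gamma>))
        = min (real c) (sqrt (star (\<lambda>x. (tent (Y j) (Suc n) x)\<^sup>2) \<eta>))"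
  shows "\<gamma> = \<eta>"
proof -
  have st: "star (\<lambda>x. (tent (Y j) (Suc n) x)\<^sup>2) \<gamma> = star (\<lambda>x. (tent (Y j) (Suc n) x)\<^sup>2) \<eta>" for j n
  proof -
    obtain c :: nat where c: "max (sqrt (star (\<lambda>x. (tent (Y j) (Suc n) x)\<^sup>2) \<gamma>)) (sqrt (star (\<lambda>x. (tent (Y j) (Suc n) x)\<^sup>2) \<eta>)) < real c"
      using reals_Archimedean2 by blast
    then show ?thesis using eq[of c j n] by simp
  qed
  obtain I :: "nat set" and x where g: "\<gamma> = points m I x" "lfin I x" using config_points[OF \<gamma>] by blast
  obtain J :: "nat set" and x' where h: "\<eta> = points m J x'" "lfin J x'" using config_points[OF \<eta>] by blast
  have fin: "finite {i \<in> I. x i = z}" "finite {i \<in> J. x' i = z}" for z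
    using g(2) h(2) finite_subset[of "{i \<in> I. x i = z}" "inds I x (dist undefined z)"]
      finite_subset[of "{i \<in> J. x' i = z}" "inds J x' (dist undefined z)"]
    by (auto simp: lfin_def inds_def)
  show ?thesis
  proof (rule config_eqI[OF \<gamma> \<eta>])
    fix z
    have "\<exists>j. dist (Y j) z < 1 / (real (Suc n))\<^sup>2" for n by (rule dense) simp
    then obtain j where j: "\<And>n. dist (Y (j n)) z < 1 / (real (Suc n))\<^sup>2" by metis
    have "real (card {i \<in> I. x i = z}) = real (card {i \<in> J. x' i = z})"
      using tent_star_tendsto[OF g(2) j] tent_star_tendsto[OF h(2) j]
      unfolding g(1)[symmetric] h(1)[symmetric] st by (rule LIMSEQ_unique)
    moreover have sing: "{z} \<in> sets m" by (rule borel_imp_m) simp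
    ultimately show "emeasure \<gamma> {z} = emeasure \<eta> {z}"
      unfolding g(1) h(1) emeasure_points[OF sing] using fin[of z] by (simp add: emeasure_count_space)
  qed
qed

lemma dense_sequence: "\<exists>Y :: nat \<Rightarrow> 'a. \<forall>z e. 0 < e \<longrightarrow> (\<exists>j. dist (Y j) z < e)"
proof -
  obtain C :: "'a set" where C: "countable C" "\<And>X. open X \<Longrightarrow> X \<noteq> {} \<Longrightarrow> \<exists>d\<in>C. d \<in> X"
    using countable_dense_setE by blast
  have ne: "C \<noteq> {}" using C(2)[of UNIV] by auto
  show ?thesis
  proof (intro exI[of _ "from_nat_into C"] allI impI)
    fix z :: 'a and e :: real assume "0 < e"
    then obtain d where "d \<in> C" "d \<in> ball z e" using C(2)[of "ball z e"] by auto
    then show "\<exists>j. dist (from_nat_into C j) z < e"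
      using from_nat_into_surj[OF C(1)] by (metis dist_commute mem_ball)
  qed
qed

subsection \<open>Compact sets of configurations\<close>

lemma points_reindex:
  assumes b: "bij_betw b J I" and eq: "\<And>j. j \<in> J \<Longrightarrow> x' j = x (b j)"
  shows "points m J x' = points m I x"
proof (rule measure_eqI)
  fix A assume "A \<in> sets (points m J x')"
  then have A: "A \<in> sets m" by simp
  show "emeasure (points m J x') A = emeasure (points m I x) A"
    unfolding emeasure_points_nn[OF A] nn_integral_bij_count_space[OF b, symmetric]
    by (rule nn_integral_cong) (simp add: eq)
qed simp

text \<open>
  A set of configurations is contained in a compact set if, for all \<open>R\<close>, the number of points in the
  ball of radius \<open>R\<close> is bounded and these points stay in a compact set. The configurations are
  parametrised by a product of compact spaces: for each shell \<open>R - 1 \<le> d \<le> R\<close> there are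
  finitely many slots, and each of them is either empty or contains a point of the shell.
\<close>

lemma vague_relatively_compact:
  fixes K :: "nat \<Rightarrow> 'a set" and N :: "nat \<Rightarrow> nat"
  assumes K: "\<And>R. compact (K R)"
    and F: "\<And>\<gamma> (I :: nat set) x R. points m I x \<in> F \<Longrightarrow> lfin I x \<Longrightarrow>
      card (inds I x (real R)) \<le> N R \<and> x ` inds I x (real R) \<subseteq> K R"
    and FC: "F \<subseteq> config_space m"
  shows "\<exists>C. compactin (vague_topology m) C \<and> F \<subseteq> C"
proof -
  define shell where "shell R = {x::'a. real R - 1 \<le> dist undefined x \<and> dist undefined x \<le> real R}" for R :: nat
  \<comment> \<open>a slot with first component \<open>0\<close> is empty; its second component is then irrelevant\<close>
  define S where "S = (\<lambda>(R, i). {(0::real, undefined::'a)} \<union> (if i < N R then {1} \<times> (K R \<inter> shell R) else {}))"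
  define X where "X = (\<lambda>j. top_of_set (S j))"
  define P where "P = product_topology X UNIV"
  define \<Psi> where "\<Psi> z = points m {j :: nat \<times> nat. fst (z j) = (1::real)} (\<lambda>j. snd (z j))" for z :: "nat \<times> nat \<Rightarrow> real \<times> 'a"
  have shell: "closed (shell R)" for R
  proof -
    have "shell R = {x. real R - 1 \<le> dist undefined x} \<inter> {x. dist undefined x \<le> real R}" unfolding shell_def by blast
    then show ?thesis by (auto intro!: closed_Collect_le continuous_intros)
  qed
  have Sc: "compact (S j)" for j
  proof -
    obtain R i where j: "j = (R, i)" by force
    have "compact ({1::real} \<times> (K R \<inter> shell R))" by (intro compact_Times compact_Int_closed K shell) simp
    then show ?thesis unfolding S_def j by auto
  qed
  have tP: "topspace P = {z. \<forall>j. z j \<in> S j}" unfolding P_def X_def by auto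
  have Pc: "compact_space P"
    unfolding P_def X_def by (auto simp: compact_space_product_topology compact_space_subtopology Sc compactin_euclidean_iff)
  have mem: "fst (z (R, i)) = 1 \<Longrightarrow> i < N R \<and> snd (z (R, i)) \<in> K R \<inter> shell R"
    "fst (z (R, i)) \<noteq> 1 \<Longrightarrow> fst (z (R, i)) = 0" if "z \<in> topspace P" for z R i
  proof -
    have "z (R, i) \<in> S (R, i)" using that tP by blast
    then show "fst (z (R, i)) = 1 \<Longrightarrow> i < N R \<and> snd (z (R, i)) \<in> K R \<inter> shell R"
      "fst (z (R, i)) \<noteq> 1 \<Longrightarrow> fst (z (R, i)) = 0"
      unfolding S_def by (auto split: if_splits)
  qed
  \<comment> \<open>the shells that meet the ball of radius \<open>r\<close> have \<open>R \<le> r + 1\<close>\<close>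
  define slots where "slots r = (SIGMA R:{R. real R \<le> r + 1}. {..<N R})" for r :: real
  have fs: "finite (slots r)" for r
  proof -
    have "{R. real R \<le> r + 1} \<subseteq> {..nat \<lceil>r + 1\<rceil>}" by (auto simp: le_nat_iff le_ceiling_iff nat_le_iff) linarith+
    then have "finite {R. real R \<le> r + 1}" using finite_subset by blast
    then show ?thesis unfolding slots_def by auto
  qed
  have sub: "inds {j. fst (z j) = 1} (\<lambda>j. snd (z j)) r \<subseteq> slots r" if z: "z \<in> topspace P" for z r
  proof
    fix j assume j: "j \<in> inds {j. fst (z j) = 1} (\<lambda>j. snd (z j)) r"
    obtain R i where Ri: "j = (R, i)" by force
    from j have "fst (z (R, i)) = 1" "dist undefined (snd (z (R, i))) \<le> r" by (auto simp: inds_def Ri)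
    then show "j \<in> slots r" using mem(1)[OF z, of R i] by (auto simp: slots_def Ri shell_def)
  qed
  have lf: "lfin {j. fst (z j) = 1} (\<lambda>j. snd (z j))" if z: "z \<in> topspace P" for z
    unfolding lfin_def using finite_subset[OF sub[OF z] fs] by blast
  have \<Psi>c: "\<Psi> z \<in> config_space m" if z: "z \<in> topspace P" for z
    unfolding \<Psi>_def by (rule points_config[OF _ lf[OF z]]) auto
  have cont: "continuous_map P (vague_topology m) \<Psi>"
    unfolding vague_topology_def
  proof (rule continuous_on_generated_topo)
    show "\<Psi> ` topspace P \<subseteq> \<Union> {{\<gamma> \<in> config_space m. star f \<gamma> \<in> U} | f U. f \<in> Cbs \<and> open (U::real set)}"
      using \<Psi>c topspace_vague unfolding vague_topology_def topology_generated_by_topspace by blast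
    fix W assume "W \<in> {{\<gamma> \<in> config_space m. star f \<gamma> \<in> U} | f U. f \<in> Cbs \<and> open (U::real set)}"
    then obtain f U where W: "W = {\<gamma> \<in> config_space m. star f \<gamma> \<in> U}" and f: "f \<in> Cbs" and U: "open U" by blast
    obtain r where r: "\<And>y. f y \<noteq> 0 \<Longrightarrow> y \<in> ball0 r" and fm: "f \<in> borel_measurable m"
      using Cbs_bsupp[OF f] unfolding bsupp_def by blast
    have fc: "continuous_on UNIV f" using f by (simp add: Cbs_def)
    have star: "star f (\<Psi> z) = (\<Sum>j\<in>slots r. fst (z j) * f (snd (z j)))" if z: "z \<in> topspace P" for z
    proof -
      let ?J = "inds {j. fst (z j) = 1} (\<lambda>j. snd (z j)) r"
      have "star f (\<Psi> z) = (\<Sum>j\<in>?J. f (snd (z j)))"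
        unfolding \<Psi>_def by (rule star_points[OF lf[OF z] fm r])
      also have "\<dots> = (\<Sum>j\<in>?J. fst (z j) * f (snd (z j)))" by (rule sum.cong) (auto simp: inds_def)
      also have "\<dots> = (\<Sum>j\<in>slots r. fst (z j) * f (snd (z j)))"
      proof (rule sum.mono_neutral_left[OF fs sub[OF z]], rule ballI)
        fix j assume j: "j \<in> slots r - ?J"
        obtain R i where Ri: "j = (R, i)" by force
        show "fst (z j) * f (snd (z j)) = 0"
        proof (cases "fst (z j) = 1")
          case True
          then have "snd (z j) \<notin> ball0 r" using j by (auto simp: inds_def)
          then show ?thesis using r by auto
        next
          case False then show ?thesis using mem(2)[OF z, of R i] Ri by simp
        qed
      qed
      finally show ?thesis .
    qed
    have "continuous_map P euclideanreal (\<lambda>z. \<Sum>j\<in>slots r. fst (z j) * f (snd (z j)))"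
    proof (rule continuous_map_sum[OF fs])
      fix j assume "j \<in> slots r"
      have "continuous_map P (X j) (\<lambda>z. z j)"
        unfolding P_def by (rule continuous_map_product_projection) simp
      moreover have "continuous_map (X j) euclideanreal (\<lambda>p. fst p * f (snd p))"
        unfolding X_def
        by (auto intro!: continuous_intros continuous_on_compose2[OF fc])
      ultimately show "continuous_map P euclideanreal (\<lambda>z. fst (z j) * f (snd (z j)))"
        using continuous_map_compose[of P "X j" "\<lambda>z. z j" euclideanreal "\<lambda>p. fst p * f (snd p)"] by (simp add: o_def)
    qed
    then have "openin P {z \<in> topspace P. (\<Sum>j\<in>slots r. fst (z j) * f (snd (z j))) \<in> U}"
      using U by (auto simp: continuous_map_def)
    moreover have "\<Psi> -` W \<inter> topspace P = {z \<in> topspace P. (\<Sum>j\<in>slots r. fst (z j) * f (snd (z j))) \<in> U}"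
      using \<Psi>c star by (auto simp: W)
    ultimately show "openin P (\<Psi> -` W \<inter> topspace P)" by simp
  qed
  have "compactin (vague_topology m) (\<Psi> ` topspace P)"
    by (rule image_compactin[OF _ cont]) (use Pc in \<open>simp add: compact_space_def\<close>)
  moreover have "F \<subseteq> \<Psi> ` topspace P"
  proof
    fix \<gamma> assume g: "\<gamma> \<in> F"
    obtain I :: "nat set" and x where \<gamma>: "\<gamma> = points m I x" "lfin I x" using config_points FC g by blast
    \<comment> \<open>closed shells overlap; each point is assigned to one of them by rounding up\<close>
    define \<rho> where "\<rho> i = nat \<lceil>dist undefined (x i)\<rceil>" for i
    define J where "J R = {i \<in> I. \<rho> i = R}" for R
    have \<rho>: "dist undefined (x i) \<le> real (\<rho> i)" "real (\<rho> i) - 1 \<le> dist undefined (x i)" for i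
      unfolding \<rho>_def using ceiling_correct[of "dist undefined (x i)"] by (auto simp: of_nat_nat)
    have JI: "J R \<subseteq> inds I x (real R)" for R using \<rho> unfolding J_def inds_def by auto
    have finJ: "finite (inds I x (real R))" for R using \<gamma>(2) by (simp add: lfin_def)
    have JN: "card (J R) \<le> N R" for R
      using card_mono[OF finJ JI, of R] F[OF g[unfolded \<gamma>(1)] \<gamma>(2), of R] by simp
    have JK: "x i \<in> K R \<inter> shell R" if "i \<in> J R" for i R
      using F[OF g[unfolded \<gamma>(1)] \<gamma>(2), of R] JI[of R] that \<rho>[of i] unfolding shell_def J_def by auto
    define e where "e R = from_nat_into (J R)" for R
    have e: "bij_betw (e R) {..<card (J R)} (J R)" for R
      unfolding e_def by (rule bij_betw_from_nat_into_finite) (rule finite_subset[OF JI finJ])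
    define z where "z = (\<lambda>(R, i). if i < card (J R) then (1::real, x (e R i)) else (0, undefined))"
    have zP: "z \<in> topspace P"
      unfolding tP
    proof (intro CollectI allI)
      fix j :: "nat \<times> nat" obtain R i where j: "j = (R, i)" by force
      show "z j \<in> S j"
      proof (cases "i < card (J R)")
        case True
        then have "e R i \<in> J R" using e[of R] by (auto simp: bij_betw_def)
        then show ?thesis using True JK[of "e R i" R] JN[of R] by (simp add: j z_def S_def)
      qed (simp add: j z_def S_def)
    qed
    have "bij_betw (\<lambda>(R, i). e R i) {j. fst (z j) = 1} I"
      unfolding bij_betw_def
    proof
      show "inj_on (\<lambda>(R, i). e R i) {j. fst (z j) = 1}"
      proof (rule inj_onI)
        fix j j' assume a: "j \<in> {j. fst (z j) = 1}" "j' \<in> {j. fst (z j) = 1}" "(\<lambda>(R, i). e R i) j = (\<lambda>(R, i). e R i) j'"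
        obtain R i R' i' where j: "j = (R, i)" "j' = (R', i')" by force
        have i: "i < card (J R)" "i' < card (J R')" and ee: "e R i = e R' i'"
          using a by (auto simp: j z_def split: if_splits)
        have "e R i \<in> J R" "e R' i' \<in> J R'" using e i by (auto simp: bij_betw_def)
        then have "R = R'" using ee by (auto simp: J_def)
        then show "j = j'" using e[of R] i ee by (auto simp: j bij_betw_def inj_on_def)
      qed
      show "(\<lambda>(R, i). e R i) ` {j. fst (z j) = 1} = I"
      proof
        show "(\<lambda>(R, i). e R i) ` {j. fst (z j) = 1} \<subseteq> I"
        proof clarify
          fix R i assume "fst (z (R, i)) = 1"
          then have "i < card (J R)" by (auto simp: z_def split: if_splits)
          then have "e R i \<in> J R" using e[of R] by (auto simp: bij_betw_def)
          then show "e R i \<in> I" by (simp add: J_def)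
        qed
        show "I \<subseteq> (\<lambda>(R, i). e R i) ` {j. fst (z j) = 1}"
        proof
          fix i assume "i \<in> I"
          then have "i \<in> J (\<rho> i)" by (simp add: J_def)
          then have "i \<in> e (\<rho> i) ` {..<card (J (\<rho> i))}" using e[of "\<rho> i"] by (simp add: bij_betw_def)
          then obtain n where "i = e (\<rho> i) n" "n \<in> {..<card (J (\<rho> i))}" by (rule imageE)
          then show "i \<in> (\<lambda>(R, i). e R i) ` {j. fst (z j) = 1}"
            by (intro image_eqI[of _ _ "(\<rho> i, n)"]) (auto simp: z_def)
        qed
      qed
    qed
    then have "\<Psi> z = \<gamma>"
      unfolding \<Psi>_def \<gamma>(1) by (rule points_reindex) (auto simp: z_def split: if_splits)
    then show "\<gamma> \<in> \<Psi> ` topspace P" using zP by blast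
  qed
  ultimately show ?thesis by blast
qed


section \<open>Lipschitz functions with compact sublevel sets\<close>

text \<open>A cut-off function equal to \<open>1\<close> on the ball of radius \<open>R\<close>, and \<open>0\<close> outside that of radius \<open>R + 1\<close>.\<close>

definition cutoff :: "nat \<Rightarrow> 'a \<Rightarrow> real" where
  "cutoff R x = max 0 (min 1 (real R + 1 - dist undefined x))"

text \<open>The distance to the first points of a sequence \<open>Y\<close>, increased by \<open>1 / (n + 1)\<close>, truncated at \<open>1\<close>
  and localised to a ball. For dense \<open>Y\<close> these functions decrease to \<open>0\<close>.\<close>

definition bump :: "(nat \<Rightarrow> 'a) \<Rightarrow> nat \<Rightarrow> nat \<Rightarrow> 'a \<Rightarrow> real" where
  "bump Y n R x = min 1 (infdist x (Y ` {..n}) + 1 / real (Suc n)) * cutoff R x"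

lemma bump_range: "0 \<le> bump Y n R x" "bump Y n R x \<le> 1"
proof -
  have "0 \<le> min 1 (infdist x (Y ` {..n}) + 1 / real (Suc n))" by (simp add: infdist_nonneg)
  then show "0 \<le> bump Y n R x" "bump Y n R x \<le> 1"
    unfolding bump_def cutoff_def by (auto intro!: mult_nonneg_nonneg mult_le_one)
qed

lemma bump_Lipschitz: "\<bar>bump Y n R x - bump Y n R y\<bar> \<le> 2 * dist x y"
proof -
  define a where "a x = min 1 (infdist x (Y ` {..n}) + 1 / real (Suc n))" for x
  define b where "b x = cutoff R x" for x
  have ab: "bump Y n R x = a x * b x" for x by (simp add: bump_def a_def b_def)
  have a: "\<bar>a x - a y\<bar> \<le> dist x y" "\<bar>a y\<bar> \<le> 1"
    using infdist_triangle_abs[of x "Y ` {..n}" y] infdist_nonneg[of y "Y ` {..n}"]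
    unfolding a_def by (auto simp: min_def abs_le_iff)
  have b: "\<bar>b x - b y\<bar> \<le> dist x y" "\<bar>b x\<bar> \<le> 1"
    using dist_triangle[of undefined x y] dist_triangle[of undefined y x]
    unfolding b_def cutoff_def by (auto simp: dist_commute)
  have "a x * b x - a y * b y = (a x - a y) * b x + a y * (b x - b y)" by (simp add: algebra_simps)
  then have "\<bar>a x * b x - a y * b y\<bar> \<le> \<bar>a x - a y\<bar> * \<bar>b x\<bar> + \<bar>a y\<bar> * \<bar>b x - b y\<bar>"
    using abs_triangle_ineq[of "(a x - a y) * b x" "a y * (b x - b y)"] by (simp add: abs_mult)
  also have "\<dots> \<le> dist x y * 1 + 1 * dist x y"
    using a b by (intro add_mono mult_mono) auto
  finally show ?thesis unfolding ab by simp
qed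

lemma bump_Cbs: "bump Y n R \<in> Cbs"
  unfolding Cbs_def
proof (intro CollectI conjI)
  show "continuous_on UNIV (bump Y n R)"
    unfolding bump_def cutoff_def by (intro continuous_intros)
  show "bounded (range (bump Y n R))"
    using bump_range by (auto simp: bounded_iff intro!: exI[of _ 1])
  have "{x. bump Y n R x \<noteq> 0} \<subseteq> ball0 (real R + 1)"
    by (auto simp: bump_def cutoff_def max_def split: if_splits)
  then show "bounded {x. bump Y n R x \<noteq> 0}" using bounded_cball bounded_subset by blast
qed

lemma bump_decreasing: "bump Y (Suc n) R x \<le> bump Y n R x"
proof -
  have "infdist x (Y ` {..Suc n}) \<le> infdist x (Y ` {..n})" by (rule infdist_mono) auto
  moreover have "1 / real (Suc (Suc n)) \<le> 1 / real (Suc n)" by (rule divide_left_mono) auto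
  ultimately show ?thesis
    unfolding bump_def by (intro mult_right_mono) (auto simp: cutoff_def)
qed

lemma bump_tendsto:
  assumes dense: "\<And>z e. 0 < e \<Longrightarrow> \<exists>j::nat. dist (Y j) z < e"
  shows "(\<lambda>n. bump Y n R x) \<longlonglongrightarrow> 0"
proof -
  have inf: "(\<lambda>n. infdist x (Y ` {..n})) \<longlonglongrightarrow> 0"
  proof (rule LIMSEQ_I)
    fix e :: real assume "0 < e"
    then obtain j where j: "dist (Y j) x < e" using dense by blast
    have "norm (infdist x (Y ` {..n}) - 0) < e" if "j \<le> n" for n
      using infdist_le[of "Y j" "Y ` {..n}" x] that j infdist_nonneg[of x "Y ` {..n}"]
      by (simp add: dist_commute)
    then show "\<exists>N. \<forall>n\<ge>N. norm (infdist x (Y ` {..n}) - 0) < e" by blast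
  qed
  have "(\<lambda>n. infdist x (Y ` {..n}) + 1 / real (Suc n)) \<longlonglongrightarrow> 0"
    using tendsto_add[OF inf LIMSEQ_Suc[OF lim_1_over_n]] by simp
  then show ?thesis
  proof (rule Lim_null_comparison[rotated], intro always_eventually allI)
    fix n
    have "min 1 (infdist x (Y ` {..n}) + 1 / real (Suc n)) * cutoff R x
        \<le> (infdist x (Y ` {..n}) + 1 / real (Suc n)) * 1"
      by (rule mult_mono) (auto simp: cutoff_def infdist_nonneg)
    then show "norm (bump Y n R x) \<le> infdist x (Y ` {..n}) + 1 / real (Suc n)"
      using bump_range(1)[of Y n R x] unfolding bump_def by simp
  qed
qed

text \<open>The truncation at \<open>1\<close> of the norm of \<open>bump Y n R\<close> in \<open>L\<^sup>2(\<gamma>)\<close>.\<close>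

definition bump_root :: "(nat \<Rightarrow> 'a) \<Rightarrow> nat \<Rightarrow> nat \<Rightarrow> 'a measure \<Rightarrow> real" where
  "bump_root Y n R \<gamma> = min 1 (sqrt (star (\<lambda>x. (bump Y n R x)\<^sup>2) \<gamma>))"

text \<open>All radii \<open>R\<close> are combined in one function. Its smallness for a sequence of \<open>n\<close> bounds the
  number of points in each ball, and confines them to a totally bounded set.\<close>

definition potential :: "(nat \<Rightarrow> 'a) \<Rightarrow> nat \<Rightarrow> 'a measure \<Rightarrow> real" where
  "potential Y n \<gamma> = (SUP R. (1 / 2) ^ R * bump_root Y n R \<gamma>)"

lemma bump_root_range: "0 \<le> bump_root Y n R \<gamma>" "bump_root Y n R \<gamma> \<le> 1"
  unfolding bump_root_def by auto

lemma potential_term: "0 \<le> (1 / 2) ^ R * bump_root Y n R \<gamma>" "(1 / 2) ^ R * bump_root Y n R \<gamma> \<le> 1"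
  using bump_root_range[of Y n R \<gamma>] by (auto intro!: mult_le_one power_le_one)

lemma potential_bdd: "bdd_above (range (\<lambda>R. (1 / 2) ^ R * bump_root Y n R \<gamma>))"
  using potential_term(2) by (auto intro!: bdd_aboveI[of _ 1])

lemma potential_ge: "(1 / 2) ^ R * bump_root Y n R \<gamma> \<le> potential Y n \<gamma>"
  unfolding potential_def by (rule cSUP_upper[OF _ potential_bdd]) simp

lemma potential_leI: "(\<And>R. (1 / 2) ^ R * bump_root Y n R \<gamma> \<le> c) \<Longrightarrow> potential Y n \<gamma> \<le> c"
  unfolding potential_def by (rule cSUP_least) auto

lemma potential_range: "0 \<le> potential Y n \<gamma>" "potential Y n \<gamma> \<le> 1"
  using potential_ge[of 0 Y n \<gamma>] potential_term[where Y = Y and n = n and \<gamma> = \<gamma>] potential_leI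
  by (meson order_trans)+

lemma potential_Lipschitz: "transport_Lipschitz m 2 (potential Y n)"
proof (rule transport_LipschitzI)
  fix \<gamma> \<eta> q and r :: ennreal
  assume a: "\<gamma> \<in> config_space m" "\<eta> \<in> config_space m" "q \<in> couplings m \<gamma> \<eta>"
    "r\<^sup>2 = (\<integral>\<^sup>+p. ennreal ((dist (fst p) (snd p))\<^sup>2) \<partial>q)" "r < \<infinity>"
  have br: "\<bar>bump_root Y n R \<gamma> - bump_root Y n R \<eta>\<bar> \<le> 2 * enn2real r" for R
    using root_star_coupling[OF bump_Cbs _ bump_Lipschitz a, of Y n R] unfolding bump_root_def by linarith
  have d: "\<bar>(1 / 2) ^ R * bump_root Y n R \<gamma> - (1 / 2) ^ R * bump_root Y n R \<eta>\<bar> \<le> 2 * enn2real r" for R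
  proof -
    have "\<bar>(1 / 2) ^ R * bump_root Y n R \<gamma> - (1 / 2) ^ R * bump_root Y n R \<eta>\<bar>
        = (1 / 2) ^ R * \<bar>bump_root Y n R \<gamma> - bump_root Y n R \<eta>\<bar>"
      unfolding right_diff_distrib[symmetric] abs_mult by simp
    also have "\<dots> \<le> 1 * \<bar>bump_root Y n R \<gamma> - bump_root Y n R \<eta>\<bar>"
      by (rule mult_right_mono) (simp_all add: power_le_one)
    also have "\<dots> \<le> 2 * enn2real r" using br[of R] by simp
    finally show ?thesis .
  qed
  have "potential Y n \<gamma> \<le> potential Y n \<eta> + 2 * enn2real r"
  proof (rule potential_leI)
    fix R show "(1 / 2) ^ R * bump_root Y n R \<gamma> \<le> potential Y n \<eta> + 2 * enn2real r"
      using d[of R] potential_ge[of R Y n \<eta>] by linarith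
  qed
  moreover have "potential Y n \<eta> \<le> potential Y n \<gamma> + 2 * enn2real r"
  proof (rule potential_leI)
    fix R show "(1 / 2) ^ R * bump_root Y n R \<eta> \<le> potential Y n \<gamma> + 2 * enn2real r"
      using d[of R] potential_ge[of R Y n \<gamma>] by linarith
  qed
  ultimately show "\<bar>potential Y n \<gamma> - potential Y n \<eta>\<bar> \<le> 2 * enn2real r" by linarith
qed simp

lemma potential_measurable: "potential Y n \<in> borel_measurable (config_algebra m)"
  unfolding potential_def[abs_def] bump_root_def
  by (rule borel_measurable_cSUP)
    (use potential_bdd truncated_root_measurable[OF bump_Cbs] in \<open>auto simp: bump_root_def\<close>)

lemma star_bump_points:
  assumes "lfin (I :: nat set) x"
  shows "star (\<lambda>x. (bump Y n R x)\<^sup>2) (points m I x) = (\<Sum>i\<in>inds I x (real R + 1). (bump Y n R (x i))\<^sup>2)"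
proof (rule star_points[OF assms])
  show "(\<lambda>x. (bump Y n R x)\<^sup>2) \<in> borel_measurable m"
    using Cbs_bsupp[OF Cbs_square[OF bump_Cbs]] unfolding bsupp_def by blast
  show "y \<in> ball0 (real R + 1)" if "(bump Y n R y)\<^sup>2 \<noteq> 0" for y
    using that by (auto simp: bump_def cutoff_def max_def split: if_splits)
qed

lemma potential_decreasing:
  assumes "\<gamma> \<in> config_space m"
  shows "potential Y (Suc n) \<gamma> \<le> potential Y n \<gamma>"
proof -
  obtain I :: "nat set" and x where \<gamma>: "\<gamma> = points m I x" "lfin I x" using config_points[OF assms] by blast
  have "bump_root Y (Suc n) R \<gamma> \<le> bump_root Y n R \<gamma>" for R
    unfolding bump_root_def \<gamma>(1) star_bump_points[OF \<gamma>(2)]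
    by (intro min.mono order_refl real_sqrt_le_mono sum_mono power_mono bump_decreasing bump_range)
  then have "(1 / 2) ^ R * bump_root Y (Suc n) R \<gamma> \<le> (1 / 2) ^ R * bump_root Y n R \<gamma>" for R
    by (intro mult_left_mono) auto
  then show ?thesis by (intro potential_leI) (meson potential_ge order_trans)
qed

lemma potential_tendsto:
  assumes dense: "\<And>z e. 0 < e \<Longrightarrow> \<exists>j::nat. dist (Y j) z < e" and g: "\<gamma> \<in> config_space m"
  shows "(\<lambda>n. potential Y n \<gamma>) \<longlonglongrightarrow> 0"
proof (rule LIMSEQ_I)
  fix e :: real assume e: "0 < e"
  obtain I :: "nat set" and x where \<gamma>: "\<gamma> = points m I x" "lfin I x" using config_points[OF g] by blast
  have lim: "(\<lambda>n. bump_root Y n R \<gamma>) \<longlonglongrightarrow> 0" for R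
  proof -
    have "(\<lambda>n. \<Sum>i\<in>inds I x (real R + 1). (bump Y n R (x i))\<^sup>2) \<longlonglongrightarrow> (\<Sum>i\<in>inds I x (real R + 1). 0\<^sup>2)"
      by (intro tendsto_intros bump_tendsto dense)
    then have "(\<lambda>n. sqrt (\<Sum>i\<in>inds I x (real R + 1). (bump Y n R (x i))\<^sup>2)) \<longlonglongrightarrow> sqrt 0"
      by (intro tendsto_real_sqrt) simp
    from tendsto_min[OF tendsto_const[of 1] this] show ?thesis
      unfolding bump_root_def \<gamma>(1) star_bump_points[OF \<gamma>(2)] by simp
  qed
  obtain R0 where R0: "(1 / 2 :: real) ^ R0 < e / 2" using real_arch_pow_inv[of "e / 2" "1 / 2"] e by auto
  have "\<forall>\<^sub>F n in sequentially. \<forall>R\<in>{..<R0}. bump_root Y n R \<gamma> < e / 2"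
    by (intro eventually_ball_finite ballI order_tendstoD(2)[OF lim]) (use e in auto)
  then obtain n0 where n0: "\<And>n R. n \<ge> n0 \<Longrightarrow> R < R0 \<Longrightarrow> bump_root Y n R \<gamma> < e / 2"
    unfolding eventually_sequentially by auto
  have "norm (potential Y n \<gamma> - 0) < e" if "n \<ge> n0" for n
  proof -
    have "potential Y n \<gamma> \<le> e / 2"
    proof (rule potential_leI)
      fix R
      show "(1 / 2) ^ R * bump_root Y n R \<gamma> \<le> e / 2"
      proof (cases "R < R0")
        case True
        have "(1 / 2) ^ R * bump_root Y n R \<gamma> \<le> 1 * bump_root Y n R \<gamma>"
          by (intro mult_right_mono bump_root_range) (simp add: power_le_one)
        then show ?thesis using n0[OF that True] by simp
      next
        case False
        then have "(1 / 2 :: real) ^ R \<le> (1 / 2) ^ R0" by (intro power_decreasing) auto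
        moreover have "(1 / 2) ^ R * bump_root Y n R \<gamma> \<le> (1 / 2) ^ R * 1"
          by (intro mult_left_mono bump_root_range) simp
        ultimately show ?thesis using R0 by linarith
      qed
    qed
    then show ?thesis using potential_range(1)[of Y n \<gamma>] e by simp
  qed
  then show "\<exists>N. \<forall>n\<ge>N. norm (potential Y n \<gamma> - 0) < e" by blast
qed

lemma potential_closed: "closedin (vague_topology m) {\<gamma> \<in> config_space m. potential Y n \<gamma> \<le> c}"
proof -
  have "closedin (vague_topology m) {\<gamma> \<in> topspace (vague_topology m). (1 / 2) ^ R * bump_root Y n R \<gamma> \<in> {..c}}" for R
    by (rule closedin_continuous_map_preimage[where Y = euclideanreal])
      (use truncated_root_continuous[OF bump_Cbs] in \<open>auto intro!: continuous_map_real_mult simp: bump_root_def[abs_def]\<close>)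
  then have "closedin (vague_topology m) (\<Inter>R. {\<gamma> \<in> config_space m. (1 / 2) ^ R * bump_root Y n R \<gamma> \<le> c})"
    by (intro closedin_Inter) auto
  moreover have "(\<Inter>R. {\<gamma> \<in> config_space m. (1 / 2) ^ R * bump_root Y n R \<gamma> \<le> c}) = {\<gamma> \<in> config_space m. potential Y n \<gamma> \<le> c}"
    by (auto intro: potential_leI order_trans[OF potential_ge])
  ultimately show ?thesis by simp
qed

text \<open>The members of the nest, for a sequence of indices \<open>N\<close> that is a parameter.\<close>

definition sublevel :: "(nat \<Rightarrow> 'a) \<Rightarrow> (nat \<Rightarrow> nat) \<Rightarrow> nat \<Rightarrow> 'a measure set" where
  "sublevel Y N k = {\<gamma> \<in> config_space m. \<forall>j\<ge>k. potential Y (N j) \<gamma> \<le> (1 / 2) ^ j}"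

lemma sublevel_closed: "closedin (vague_topology m) (sublevel Y N k)"
proof -
  have "sublevel Y N k = (\<Inter>j\<in>{k..}. {\<gamma> \<in> config_space m. potential Y (N j) \<gamma> \<le> (1 / 2) ^ j})"
    unfolding sublevel_def by auto
  then show ?thesis using potential_closed by (auto intro!: closedin_Inter)
qed

text \<open>In such a set, every point of a configuration in the ball of radius \<open>R\<close> has distance at most
  \<open>2\<^bsup>R-j\<^esup>\<close> to finitely many points of \<open>Y\<close>, for all large \<open>j\<close>. Moreover it contributes at least
  \<open>(N j + 1)\<^sup>-\<^sup>2\<close> to an integral that is at most \<open>1\<close>, so that the number of such points is bounded.\<close>

lemma sublevel_compact: "compactin (vague_topology m) (sublevel Y N k)"
proof -
  \<comment> \<open>from \<open>j = R + 1\<close> on, the truncation at \<open>1\<close> is not active\<close>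
  define j0 where "j0 R = max k (Suc R)" for R
  define K where "K R = {x \<in> ball0 (real R). \<forall>j\<ge>j0 R. infdist x (Y ` {..N j}) \<le> (1 / 2) ^ (j - R)}" for R
  define cnt where "cnt R = (Suc (N (j0 R)))\<^sup>2" for R
  have K: "compact (K R)" for R
    unfolding compact_eq_totally_bounded complete_eq_closed
  proof (intro conjI allI impI)
    have "K R = ball0 (real R) \<inter> (\<Inter>j\<in>{j0 R..}. {x. infdist x (Y ` {..N j}) \<le> (1 / 2) ^ (j - R)})"
      unfolding K_def by auto
    then show "closed (K R)" by (auto intro!: closed_Int closed_INT closed_Collect_le continuous_intros)
    fix e :: real assume e: "0 < e"
    obtain n where n: "(1 / 2 :: real) ^ n < e" using real_arch_pow_inv[of e "1 / 2"] e by auto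
    define j where "j = max (j0 R) (n + R)"
    have "(1 / 2 :: real) ^ (j - R) \<le> (1 / 2) ^ n" by (rule power_decreasing) (auto simp: j_def)
    then have je: "(1 / 2 :: real) ^ (j - R) < e" using n by linarith
    show "\<exists>C. finite C \<and> K R \<subseteq> (\<Union>x\<in>C. ball x e)"
    proof (intro exI[of _ "Y ` {..N j}"] conjI subsetI)
      fix x assume "x \<in> K R"
      moreover have "j0 R \<le> j" by (simp add: j_def)
      ultimately have "infdist x (Y ` {..N j}) \<le> (1 / 2) ^ (j - R)" unfolding K_def by blast
      then have "infdist x (Y ` {..N j}) < e" using je by linarith
      moreover have "infdist x (Y ` {..N j}) = (INF a\<in>Y ` {..N j}. dist x a)" by (simp add: infdist_def)
      ultimately obtain a where "a \<in> Y ` {..N j}" "dist x a < e"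
        by (auto simp: cINF_less_iff[OF _ bdd_below_image_dist])
      then show "x \<in> (\<Union>x\<in>Y ` {..N j}. ball x e)" by (auto simp: dist_commute)
    qed simp
  qed
  have F: "card (inds I x (real R)) \<le> cnt R \<and> x ` inds I x (real R) \<subseteq> K R"
    if g: "points m I x \<in> sublevel Y N k" and l: "lfin I x" for I :: "nat set" and x R
  proof -
    let ?\<gamma> = "points m I x" and ?I = "inds I x (real R)"
    have fin: "finite (inds I x r)" for r using l by (simp add: lfin_def)
    have sub: "?I \<subseteq> inds I x (real R + 1)" by (auto simp: inds_def)
    have key: "(\<Sum>i\<in>?I. (bump Y (N j) R (x i))\<^sup>2) \<le> ((1 / 2) ^ (j - R))\<^sup>2" if j: "j \<ge> j0 R" for j
    proof -
      have jk: "k \<le> j" "R < j" using j by (auto simp: j0_def)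
      have "(1 / 2) ^ R * bump_root Y (N j) R ?\<gamma> \<le> (1 / 2) ^ j"
        using g potential_ge[of R Y "N j" ?\<gamma>] jk(1) unfolding sublevel_def by force
      also have "(1 / 2 :: real) ^ j = (1 / 2) ^ R * (1 / 2) ^ (j - R)"
        using jk(2) by (simp flip: power_add)
      finally have "bump_root Y (N j) R ?\<gamma> \<le> (1 / 2) ^ (j - R)" by simp
      moreover have "(1 / 2 :: real) ^ (j - R) < 1" using jk(2) by (simp add: power_less_one_iff)
      ultimately have "sqrt (star (\<lambda>x. (bump Y (N j) R x)\<^sup>2) ?\<gamma>) \<le> (1 / 2) ^ (j - R)"
        unfolding bump_root_def by linarith
      then have "(sqrt (star (\<lambda>x. (bump Y (N j) R x)\<^sup>2) ?\<gamma>))\<^sup>2 \<le> ((1 / 2) ^ (j - R))\<^sup>2"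
        by (intro power_mono) auto
      then have "(\<Sum>i\<in>inds I x (real R + 1). (bump Y (N j) R (x i))\<^sup>2) \<le> ((1 / 2) ^ (j - R))\<^sup>2"
        unfolding star_bump_points[OF l] by (simp add: sum_nonneg)
      moreover have "(\<Sum>i\<in>?I. (bump Y (N j) R (x i))\<^sup>2) \<le> (\<Sum>i\<in>inds I x (real R + 1). (bump Y (N j) R (x i))\<^sup>2)"
        by (rule sum_mono2[OF fin sub]) simp
      ultimately show ?thesis by linarith
    qed
    have cut1: "cutoff R (x i) = 1" if "i \<in> ?I" for i
      using that unfolding inds_def cutoff_def by auto
    have "x i \<in> K R" if i: "i \<in> ?I" for i
    proof -
      have "infdist (x i) (Y ` {..N j}) \<le> (1 / 2) ^ (j - R)" if j: "j \<ge> j0 R" for j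
      proof -
        have "(bump Y (N j) R (x i))\<^sup>2 \<le> (\<Sum>i\<in>?I. (bump Y (N j) R (x i))\<^sup>2)"
          by (rule member_le_sum[OF i _ fin]) simp
        then have "(bump Y (N j) R (x i))\<^sup>2 \<le> ((1 / 2) ^ (j - R))\<^sup>2" using key[OF j] by linarith
        then have "bump Y (N j) R (x i) \<le> (1 / 2) ^ (j - R)" by (rule power2_le_imp_le) simp
        then have "min 1 (infdist (x i) (Y ` {..N j}) + 1 / real (Suc (N j))) \<le> (1 / 2) ^ (j - R)"
          unfolding bump_def cut1[OF i] by simp
        moreover have "(1 / 2 :: real) ^ (j - R) < 1" using j by (simp add: j0_def power_less_one_iff)
        moreover have "0 \<le> 1 / real (Suc (N j))" by simp
        ultimately show ?thesis by linarith
      qed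
      then show ?thesis using i unfolding K_def by (auto simp: inds_def)
    qed
    moreover have "card ?I \<le> cnt R"
    proof -
      let ?c = "1 / real (Suc (N (j0 R)))"
      have "real (card ?I) * ?c\<^sup>2 = (\<Sum>i\<in>?I. ?c\<^sup>2)" by simp
      also have "\<dots> \<le> (\<Sum>i\<in>?I. (bump Y (N (j0 R)) R (x i))\<^sup>2)"
      proof (rule sum_mono, rule power_mono)
        fix i assume "i \<in> ?I"
        have "?c \<le> 1" by simp
        then show "?c \<le> bump Y (N (j0 R)) R (x i)"
          unfolding bump_def cut1[OF \<open>i \<in> ?I\<close>] using infdist_nonneg[of "x i"] by (simp del: of_nat_Suc)
      qed simp
      also have "\<dots> \<le> ((1 / 2) ^ (j0 R - R))\<^sup>2" by (rule key) simp
      also have "\<dots> \<le> 1" by (simp add: power_le_one)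
      finally have "real (card ?I) \<le> (real (Suc (N (j0 R))))\<^sup>2"
        by (simp add: power_divide divide_le_eq del: of_nat_Suc)
      then show ?thesis unfolding cnt_def by (simp only: of_nat_power[symmetric] of_nat_le_iff)
    qed
    ultimately show ?thesis by blast
  qed
  have sub: "sublevel Y N k \<subseteq> config_space m" unfolding sublevel_def by blast
  have "\<exists>C. compactin (vague_topology m) C \<and> sublevel Y N k \<subseteq> C"
    by (rule vague_relatively_compact[of K "sublevel Y N k" cnt, OF K _ sub]) (rule F)
  then obtain C where "compactin (vague_topology m) C" "sublevel Y N k \<subseteq> C" by (elim exE conjE)
  then show ?thesis using sublevel_closed by (rule closed_compactin)
qed

end


section \<open>The square field operator on configurations\<close>

text \<open>A metric local diffusion space with a strong lifting.\<close>

locale lifted_diffusion_space = metric_local_diffusion_space m D \<Gamma>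
  for m :: "'a::polish_space measure" and D :: "('a \<Rightarrow> real) set"
    and \<Gamma> :: "('a \<Rightarrow> real) \<Rightarrow> ('a \<Rightarrow> real) \<Rightarrow> 'a \<Rightarrow> real" +
  fixes l :: "('a \<Rightarrow> real) \<Rightarrow> 'a \<Rightarrow> real"
  assumes lifting: "strong_lifting m l"
begin

sublocale config_base m
  by unfold_locales (use space_m borel_le in auto)

text \<open>Bounded measurable functions, on which the lifting acts.\<close>

abbreviation bf :: "('a \<Rightarrow> real) set" where "bf \<equiv> bounded_functions m"

lemma bf_iff: "f \<in> bf \<longleftrightarrow> f \<in> borel_measurable m \<and> (\<exists>c. \<forall>x. \<bar>f x\<bar> \<le> c)"
  by (auto simp: bounded_functions_def bounded_iff space_UNIV)

lemma bf_cont: "continuous_on UNIV f \<Longrightarrow> bounded (range f) \<Longrightarrow> f \<in> bf"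
  by (auto simp: bounded_functions_def space_UNIV continuous_measurable)

lemma bf_add: "f \<in> bf \<Longrightarrow> g \<in> bf \<Longrightarrow> (\<lambda>x. f x + g x) \<in> bf"
  unfolding bf_iff
proof (elim conjE exE, intro conjI exI allI)
  fix c d x assume "\<forall>x. \<bar>f x\<bar> \<le> c" "\<forall>x. \<bar>g x\<bar> \<le> d"
  then show "\<bar>f x + g x\<bar> \<le> c + d" using abs_triangle_ineq[of "f x" "g x"] by (meson add_mono order_trans)
qed measurable

lemma bf_mult: "f \<in> bf \<Longrightarrow> g \<in> bf \<Longrightarrow> (\<lambda>x. f x * g x) \<in> bf"
  unfolding bf_iff
proof (elim conjE exE, intro conjI exI allI)
  fix c d x assume "\<forall>x. \<bar>f x\<bar> \<le> c" "\<forall>x. \<bar>g x\<bar> \<le> d"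
  then show "\<bar>f x * g x\<bar> \<le> c * d"
    unfolding abs_mult by (intro mult_mono) (auto intro: order_trans[OF abs_ge_zero])
qed measurable

lemma bf_const: "(\<lambda>_. c) \<in> bf"
  by (rule bf_cont) auto

lemma bf_sum: "finite S \<Longrightarrow> (\<And>i. i \<in> S \<Longrightarrow> a i \<in> bf) \<Longrightarrow> (\<lambda>x. \<Sum>i\<in>S. a i x) \<in> bf"
  by (induction S rule: finite_induct) (auto intro: bf_const bf_add)

lemma l_bf: "f \<in> bf \<Longrightarrow> l f \<in> bf"
  using lifting by (simp add: strong_lifting_def)

lemma l_mono: "f \<in> bf \<Longrightarrow> g \<in> bf \<Longrightarrow> AE x in m. f x \<le> g x \<Longrightarrow> l f x \<le> l g x"
  using lifting unfolding strong_lifting_def le_fun_def by blast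

lemma l_cong: "f \<in> bf \<Longrightarrow> g \<in> bf \<Longrightarrow> AE x in m. f x = g x \<Longrightarrow> l f x = l g x"
  by (rule antisym; rule l_mono) (auto elim: eventually_mono)

lemma l_lin: "f \<in> bf \<Longrightarrow> g \<in> bf \<Longrightarrow> l (\<lambda>x. a * f x + b * g x) = (\<lambda>x. a * l f x + b * l g x)"
  using lifting unfolding strong_lifting_def by blast

lemma l_mult: "f \<in> bf \<Longrightarrow> g \<in> bf \<Longrightarrow> l (\<lambda>x. f x * g x) = (\<lambda>x. l f x * l g x)"
  using lifting unfolding strong_lifting_def by blast

lemma l_cont: "continuous_on UNIV f \<Longrightarrow> bounded (range f) \<Longrightarrow> l f = f"
  using lifting unfolding strong_lifting_def by blast

lemma l_add: "f \<in> bf \<Longrightarrow> g \<in> bf \<Longrightarrow> l (\<lambda>x. f x + g x) = (\<lambda>x. l f x + l g x)"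
  using l_lin[of f g 1 1] by simp

lemma l_zero: "l (\<lambda>_. 0) = (\<lambda>_. 0)"
  by (rule l_cont) auto

lemma l_sum: "finite S \<Longrightarrow> (\<And>i. i \<in> S \<Longrightarrow> a i \<in> bf) \<Longrightarrow> l (\<lambda>x. \<Sum>i\<in>S. a i x) = (\<lambda>x. \<Sum>i\<in>S. l (a i) x)"
proof (induction S rule: finite_induct)
  case (insert i S)
  then show ?case using l_add[of "a i" "\<lambda>x. \<Sum>i\<in>S. a i x"] bf_sum[of S a] by simp
qed (simp add: l_zero)

lemma D_continuous: "f \<in> D \<Longrightarrow> continuous_on UNIV f"
  using D_Cbs by (auto simp: Cbs_def)

lemma D_bsupp: "f \<in> D \<Longrightarrow> bsupp m f"
  using D_Cbs Cbs_bsupp by blast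

lemma Cb_comp_D:
  assumes \<Phi>: "\<Phi> \<in> Cb_infinity k" and f: "\<And>n. n < k \<Longrightarrow> f n \<in> D"
  shows "continuous_on UNIV (\<lambda>y. \<Phi> (\<lambda>n. f n y))" "bounded (range (\<lambda>y. \<Phi> (\<lambda>n. f n y)))"
proof -
  define f' where "f' n = (if n < k then f n else (\<lambda>_. 0))" for n
  have f': "f' n \<in> D" for n using f D_zero by (simp add: f'_def)
  have eq: "\<Phi> (\<lambda>n. f n y) = \<Phi> (\<lambda>n. f' n y)" for y by (rule Cb_cong[OF \<Phi>]) (simp add: f'_def)
  show "continuous_on UNIV (\<lambda>y. \<Phi> (\<lambda>n. f n y))"
    unfolding eq
    by (rule continuous_on_compose2[OF Cb_continuous[OF \<Phi>]])
      (auto intro!: continuous_on_coordinatewise_then_product D_continuous[OF f'])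
  show "bounded (range (\<lambda>y. \<Phi> (\<lambda>n. f n y)))"
    using Cb_bounded[OF \<Phi>] by (auto simp: bounded_iff)
qed

lemma \<Gamma>_bf: "f \<in> D \<Longrightarrow> g \<in> D \<Longrightarrow> \<Gamma> f g \<in> bf"
  using \<Gamma>_bounded by blast

text \<open>
  The lifting of \<open>\<Gamma> f g\<close> has bounded support, since \<open>\<Gamma> f g\<close> equals its product with a continuous
  cut-off function, and such functions and products are preserved.
\<close>

lemma l\<Gamma>_bsupp:
  assumes f: "f \<in> D" and g: "g \<in> D"
  shows "bsupp m (l (\<Gamma> f g))" "\<exists>c. \<forall>x. \<bar>l (\<Gamma> f g) x\<bar> \<le> c"
proof -
  have lb: "l (\<Gamma> f g) \<in> bf" by (rule l_bf[OF \<Gamma>_bf[OF f g]])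
  then show "\<exists>c. \<forall>x. \<bar>l (\<Gamma> f g) x\<bar> \<le> c" by (simp add: bf_iff)
  have "bounded {x. \<Gamma> f g x \<noteq> 0}" using \<Gamma>_bounded[OF f g] by (simp add: bounded_sets_def)
  then obtain r where r: "{x. \<Gamma> f g x \<noteq> 0} \<subseteq> ball0 r" using bounded_subset_ball0 by blast
  define cut where "cut y = max 0 (min 1 (r + 1 - dist undefined y))" for y :: 'a
  have cut: "continuous_on UNIV cut" "bounded (range cut)"
    unfolding cut_def by (intro continuous_intros) (auto simp: bounded_iff intro!: exI[of _ 1])
  have "(\<lambda>x. cut x * \<Gamma> f g x) = \<Gamma> f g"
  proof
    fix x show "cut x * \<Gamma> f g x = \<Gamma> f g x"
    proof (cases "\<Gamma> f g x = 0")
      case False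
      then have "dist undefined x \<le> r" using r by auto
      then show ?thesis by (simp add: cut_def)
    qed simp
  qed
  then have "l (\<Gamma> f g) = (\<lambda>x. cut x * l (\<Gamma> f g) x)"
    using l_mult[OF bf_cont[OF cut] \<Gamma>_bf[OF f g]] l_cont[OF cut] by simp
  then have eq: "l (\<Gamma> f g) x = cut x * l (\<Gamma> f g) x" for x by (rule fun_cong)
  have "x \<in> ball0 (r + 1)" if "l (\<Gamma> f g) x \<noteq> 0" for x
  proof (rule ccontr)
    assume "x \<notin> ball0 (r + 1)"
    then have "cut x = 0" by (simp add: cut_def)
    with eq[of x] that show False by simp
  qed
  then show "bsupp m (l (\<Gamma> f g))" using lb unfolding bsupp_def bf_iff by blast
qed

subsection \<open>Independence of the representation\<close>

text \<open>
  The increment of \<open>u\<close> when a point at \<open>y\<close> is added to the configuration without its \<open>i\<close>-th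
  point. As a function of \<open>y\<close> it belongs to \<open>D\<close>, and it does not refer to a representation
  of \<open>u\<close>.
\<close>

definition incr :: "('a measure \<Rightarrow> real) \<Rightarrow> nat set \<Rightarrow> (nat \<Rightarrow> 'a) \<Rightarrow> nat \<Rightarrow> 'a \<Rightarrow> real" where
  "incr u I x i y = u (points m I (x(i := y))) - u (points m (I - {i}) x)"

text \<open>The contribution of the \<open>i\<close>-th point to the square field operator.\<close>

definition local_field :: "('a measure \<Rightarrow> real) \<Rightarrow> ('a measure \<Rightarrow> real) \<Rightarrow> nat set \<Rightarrow> (nat \<Rightarrow> 'a) \<Rightarrow> nat \<Rightarrow> real" where
  "local_field u v I x i = l (\<Gamma> (incr u I x i) (incr v I x i)) (x i)"

lemma repD:
  assumes "cylinder_rep m D u k f F"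
  shows "F \<in> Cb_infinity k" "\<And>n. n < k \<Longrightarrow> f n \<in> D" "\<And>\<gamma>. \<gamma> \<in> config_space m \<Longrightarrow> u \<gamma> = F (\<lambda>n. star (f n) \<gamma>)"
  using assms by (auto simp: cylinder_rep_def)

lemma points_config_nat: "lfin I x \<Longrightarrow> points m I x \<in> config_space m" for I :: "nat set"
  by (rule points_config) auto

lemma incr_eq:
  assumes u: "cylinder_rep m D u k f F" and l: "lfin I x" and i: "i \<in> I"
    and \<phi>_def: "\<phi> = (\<lambda>a. F (\<lambda>n. (star (f n) (points m I x) - f n (x i)) + a n))"
  shows "\<phi> \<in> Cb_infinity k" "incr u I x i = (\<lambda>y. \<phi> (\<lambda>n. f n y) - \<phi> (\<lambda>_. 0))"
    "\<And>p. p < k \<Longrightarrow> partial_deriv p \<phi> (\<lambda>n. f n (x i)) = partial_deriv p F (\<lambda>n. star (f n) (points m I x))"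
proof -
  note R = repD[OF u]
  show "\<phi> \<in> Cb_infinity k" unfolding \<phi>_def by (rule Cb_translate(1)[OF R(1)])
  have 1: "u (points m I (x(i := y))) = \<phi> (\<lambda>n. f n y)" for y
    unfolding R(3)[OF points_config_nat[OF lfin_upd[OF l]]] \<phi>_def
    by (rule Cb_cong[OF R(1)]) (rule star_upd(1)[OF l D_bsupp[OF R(2)] i])
  have 2: "u (points m (I - {i}) x) = \<phi> (\<lambda>_. 0)"
    unfolding R(3)[OF points_config_nat[OF lfin_subset[OF l Diff_subset]]] \<phi>_def
    by (rule Cb_cong[OF R(1)]) (simp add: star_upd(2)[OF l D_bsupp[OF R(2)] i])
  show "incr u I x i = (\<lambda>y. \<phi> (\<lambda>n. f n y) - \<phi> (\<lambda>_. 0))"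
    unfolding incr_def 1 2 ..
  show "partial_deriv p \<phi> (\<lambda>n. f n (x i)) = partial_deriv p F (\<lambda>n. star (f n) (points m I x))" if "p < k" for p
    unfolding \<phi>_def Cb_translate(2)[OF R(1) that] by simp
qed

lemma incr_D:
  assumes u: "u \<in> cylinder_functions m D" and l: "lfin I x" and i: "i \<in> I"
  shows "incr u I x i \<in> D"
proof -
  obtain k f F where u: "cylinder_rep m D u k f F" using u unfolding cylinder_functions_def by blast
  show ?thesis
    unfolding incr_eq(2)[OF u l i refl] by (rule D_comp[OF repD(2)[OF u] incr_eq(1)[OF u l i refl]])
qed

text \<open>By the diffusion property \<open>\<Gamma>\<close> of two increments is a combination of the \<open>\<Gamma> (f p) (g q)\<close> with
  continuous coefficients, almost everywhere, and the lifting turns this into an identity at every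
  point. At \<open>y = x i\<close> the arguments of the derivatives are the integrals over the whole configuration.\<close>

lemma local_field_rep:
  assumes u: "cylinder_rep m D u k f F" and v: "cylinder_rep m D v k' g G" and lf: "lfin I x" and i: "i \<in> I"
  shows "local_field u v I x i = (\<Sum>p<k. \<Sum>q<k'.
    partial_deriv p F (\<lambda>n. star (f n) (points m I x)) * partial_deriv q G (\<lambda>n. star (g n) (points m I x)) *
    l (\<Gamma> (f p) (g q)) (x i))"
proof -
  define \<phi> where "\<phi> = (\<lambda>a. F (\<lambda>n. (star (f n) (points m I x) - f n (x i)) + a n))"
  define \<psi> where "\<psi> = (\<lambda>a. G (\<lambda>n. (star (g n) (points m I x) - g n (x i)) + a n))"
  note U = incr_eq[OF u lf i \<phi>_def] and V = incr_eq[OF v lf i \<psi>_def]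
  note fD = repD(2)[OF u] and gD = repD(2)[OF v]
  define w where "w p q = (\<lambda>y. partial_deriv p \<phi> (\<lambda>n. f n y) * partial_deriv q \<psi> (\<lambda>n. g n y))" for p q
  have w: "continuous_on UNIV (w p q)" "bounded (range (w p q))" if "p < k" "q < k'" for p q
  proof -
    note c1 = Cb_comp_D[OF Cb_partial[OF U(1) that(1)] fD] and c2 = Cb_comp_D[OF Cb_partial[OF V(1) that(2)] gD]
    show "continuous_on UNIV (w p q)" unfolding w_def by (intro continuous_on_mult c1 c2)
    have "w p q \<in> bf" unfolding w_def by (intro bf_mult bf_cont c1 c2)
    then show "bounded (range (w p q))" by (simp add: bounded_functions_def space_UNIV)
  qed
  have wb: "(\<lambda>y. w p q y * \<Gamma> (f p) (g q) y) \<in> bf" if "p < k" "q < k'" for p q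
    by (intro bf_mult bf_cont w that \<Gamma>_bf fD gD)
  have inner: "(\<lambda>y. \<Sum>q<k'. w p q y * \<Gamma> (f p) (g q) y) \<in> bf" if "p < k" for p
    by (rule bf_sum) (use wb that in auto)
  have D: "incr u I x i \<in> D" "incr v I x i \<in> D"
    using incr_D[OF _ lf i] u v unfolding cylinder_functions_def by blast+
  have "AE y in m. \<Gamma> (incr u I x i) (incr v I x i) y = (\<Sum>p<k. \<Sum>q<k'. w p q y * \<Gamma> (f p) (g q) y)"
    unfolding U(2) V(2) w_def by (rule \<Gamma>_diffusion[OF fD gD U(1) V(1)])
  then have "local_field u v I x i = l (\<lambda>y. \<Sum>p<k. \<Sum>q<k'. w p q y * \<Gamma> (f p) (g q) y) (x i)"
    unfolding local_field_def by (intro l_cong \<Gamma>_bf D bf_sum inner) auto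
  also have "\<dots> = (\<Sum>p<k. l (\<lambda>y. \<Sum>q<k'. w p q y * \<Gamma> (f p) (g q) y) (x i))"
    by (subst l_sum) (use inner in auto)
  also have "\<dots> = (\<Sum>p<k. \<Sum>q<k'. w p q (x i) * l (\<Gamma> (f p) (g q)) (x i))"
  proof (rule sum.cong[OF refl])
    fix p assume p: "p \<in> {..<k}"
    have "l (\<lambda>y. \<Sum>q<k'. w p q y * \<Gamma> (f p) (g q) y) (x i) = (\<Sum>q<k'. l (\<lambda>y. w p q y * \<Gamma> (f p) (g q) y) (x i))"
      by (subst l_sum) (use wb p in auto)
    also have "\<dots> = (\<Sum>q<k'. w p q (x i) * l (\<Gamma> (f p) (g q)) (x i))"
    proof (rule sum.cong[OF refl])
      fix q assume q: "q \<in> {..<k'}"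
      then show "l (\<lambda>y. w p q y * \<Gamma> (f p) (g q) y) (x i) = w p q (x i) * l (\<Gamma> (f p) (g q)) (x i)"
        using l_mult[OF bf_cont[OF w] \<Gamma>_bf[OF fD gD], of p q p q] l_cont[OF w, of p q] p by simp
    qed
    finally show "l (\<lambda>y. \<Sum>q<k'. w p q y * \<Gamma> (f p) (g q) y) (x i) = (\<Sum>q<k'. w p q (x i) * l (\<Gamma> (f p) (g q)) (x i))" .
  qed
  finally show ?thesis by (simp add: w_def U(3) V(3))
qed

text \<open>The value given by a representation.\<close>

definition rep_value ::
  "nat \<Rightarrow> (nat \<Rightarrow> 'a \<Rightarrow> real) \<Rightarrow> ((nat \<Rightarrow> real) \<Rightarrow> real) \<Rightarrow>
   nat \<Rightarrow> (nat \<Rightarrow> 'a \<Rightarrow> real) \<Rightarrow> ((nat \<Rightarrow> real) \<Rightarrow> real) \<Rightarrow> 'a measure \<Rightarrow> real" where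
  "rep_value k f F k' g G \<gamma> = (\<Sum>p<k. \<Sum>q<k'.
    partial_deriv p F (\<lambda>n. star (f n) \<gamma>) * partial_deriv q G (\<lambda>n. star (g n) \<gamma>) * star (l (\<Gamma> (f p) (g q))) \<gamma>)"

text \<open>Hence the value given by two representations is the sum of the contributions of the points.
  It is a finite sum, as only points in a ball contribute.\<close>

lemma rep_value_points:
  assumes u: "cylinder_rep m D u k f F" and v: "cylinder_rep m D v k' g G"
  shows "\<exists>r. \<forall>I x. lfin I x \<longrightarrow> (\<forall>r'\<ge>r.
    rep_value k f F k' g G (points m I x) = (\<Sum>i\<in>inds I x r'. local_field u v I x i))"
proof -
  note fD = repD(2)[OF u] and gD = repD(2)[OF v]
  have "\<forall>p<k. \<forall>q<k'. \<exists>r. \<forall>(I :: nat set) x r'. lfin I x \<longrightarrow> r \<le> r' \<longrightarrow>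
      star (l (\<Gamma> (f p) (g q))) (points m I x) = (\<Sum>i\<in>inds I x r'. l (\<Gamma> (f p) (g q)) (x i))"
    using star_points_ex[OF l\<Gamma>_bsupp(1)[OF fD gD]] by blast
  then obtain r where r: "\<And>p q (I :: nat set) x r'. p < k \<Longrightarrow> q < k' \<Longrightarrow> lfin I x \<Longrightarrow> r p q \<le> r' \<Longrightarrow>
      star (l (\<Gamma> (f p) (g q))) (points m I x) = (\<Sum>i\<in>inds I x r'. l (\<Gamma> (f p) (g q)) (x i))"
    by metis
  define R where "R = Max (insert 0 ((\<lambda>(p, q). r p q) ` ({..<k} \<times> {..<k'})))"
  have R: "r p q \<le> R" if "p < k" "q < k'" for p q
    unfolding R_def by (rule Max_ge) (use that in auto)
  show ?thesis
  proof (intro exI[of _ R] allI impI)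
    fix I :: "nat set" and x r' assume lf: "lfin I x" and r': "R \<le> r'"
    have "(\<Sum>i\<in>inds I x r'. local_field u v I x i) = (\<Sum>i\<in>inds I x r'. \<Sum>p<k. \<Sum>q<k'.
      partial_deriv p F (\<lambda>n. star (f n) (points m I x)) * partial_deriv q G (\<lambda>n. star (g n) (points m I x)) *
      l (\<Gamma> (f p) (g q)) (x i))"
      by (intro sum.cong refl local_field_rep[OF u v lf]) (simp add: inds_def)
    also have "\<dots> = (\<Sum>p<k. \<Sum>i\<in>inds I x r'. \<Sum>q<k'.
      partial_deriv p F (\<lambda>n. star (f n) (points m I x)) * partial_deriv q G (\<lambda>n. star (g n) (points m I x)) *
      l (\<Gamma> (f p) (g q)) (x i))" by (rule sum.swap)
    also have "\<dots> = (\<Sum>p<k. \<Sum>q<k'. \<Sum>i\<in>inds I x r'.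
      partial_deriv p F (\<lambda>n. star (f n) (points m I x)) * partial_deriv q G (\<lambda>n. star (g n) (points m I x)) *
      l (\<Gamma> (f p) (g q)) (x i))" by (intro sum.cong refl sum.swap)
    also have "\<dots> = rep_value k f F k' g G (points m I x)"
      unfolding rep_value_def
    proof (intro sum.cong refl)
      fix p q assume pq: "p \<in> {..<k}" "q \<in> {..<k'}"
      then have s: "star (l (\<Gamma> (f p) (g q))) (points m I x) = (\<Sum>i\<in>inds I x r'. l (\<Gamma> (f p) (g q)) (x i))"
        using r[OF _ _ lf, of p q r'] R[of p q] r' by simp
      show "(\<Sum>i\<in>inds I x r'. partial_deriv p F (\<lambda>n. star (f n) (points m I x)) *
          partial_deriv q G (\<lambda>n. star (g n) (points m I x)) * l (\<Gamma> (f p) (g q)) (x i)) =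
        partial_deriv p F (\<lambda>n. star (f n) (points m I x)) * partial_deriv q G (\<lambda>n. star (g n) (points m I x)) *
          star (l (\<Gamma> (f p) (g q))) (points m I x)"
        unfolding s by (simp add: sum_distrib_left)
    qed
    finally show "rep_value k f F k' g G (points m I x) = (\<Sum>i\<in>inds I x r'. local_field u v I x i)" by simp
  qed
qed

text \<open>The square field operator on configurations and its domain, the cylinder functions.\<close>

abbreviation CF :: "('a measure \<Rightarrow> real) \<Rightarrow> ('a measure \<Rightarrow> real) \<Rightarrow> 'a measure \<Rightarrow> real" where
  "CF \<equiv> config_square_field m D \<Gamma> l"

abbreviation cyl :: "('a measure \<Rightarrow> real) set" where
  "cyl \<equiv> cylinder_functions m D"

lemma CF_eq:
  assumes u: "cylinder_rep m D u k f F" and v: "cylinder_rep m D v k' g G" and g: "\<gamma> \<in> config_space m"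
  shows "CF u v \<gamma> = rep_value k f F k' g G \<gamma>"
proof -
  obtain I :: "nat set" and x where \<gamma>: "\<gamma> = points m I x" "lfin I x" using config_points[OF g] by blast
  have uniq: "rep_value k1 f1 F1 k2 g2 G2 \<gamma> = rep_value k f F k' g G \<gamma>"
    if u1: "cylinder_rep m D u k1 f1 F1" and v1: "cylinder_rep m D v k2 g2 G2" for k1 f1 F1 k2 g2 G2
  proof -
    obtain r1 where r1: "\<forall>I x. lfin I x \<longrightarrow> (\<forall>r'\<ge>r1.
      rep_value k1 f1 F1 k2 g2 G2 (points m I x) = (\<Sum>i\<in>inds I x r'. local_field u v I x i))"
      using rep_value_points[OF u1 v1] ..
    obtain r2 where r2: "\<forall>I x. lfin I x \<longrightarrow> (\<forall>r'\<ge>r2.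
      rep_value k f F k' g G (points m I x) = (\<Sum>i\<in>inds I x r'. local_field u v I x i))"
      using rep_value_points[OF u v] ..
    show ?thesis
      unfolding \<gamma>(1) using r1[rule_format, OF \<gamma>(2), of "max r1 r2"] r2[rule_format, OF \<gamma>(2), of "max r1 r2"] by simp
  qed
  show ?thesis
    unfolding config_square_field_def
  proof (rule the_equality)
    show "\<exists>ka fa Fa k'a ga Ga. cylinder_rep m D u ka fa Fa \<and> cylinder_rep m D v k'a ga Ga \<and>
        rep_value k f F k' g G \<gamma> = (\<Sum>i<ka. \<Sum>j<k'a. partial_deriv i Fa (\<lambda>n. star (fa n) \<gamma>) *
          partial_deriv j Ga (\<lambda>n. star (ga n) \<gamma>) * star (l (\<Gamma> (fa i) (ga j))) \<gamma>)"
      using u v unfolding rep_value_def by blast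
    fix c assume "\<exists>k f F k' g G. cylinder_rep m D u k f F \<and> cylinder_rep m D v k' g G \<and>
        c = (\<Sum>i<k. \<Sum>j<k'. partial_deriv i F (\<lambda>n. star (f n) \<gamma>) *
          partial_deriv j G (\<lambda>n. star (g n) \<gamma>) * star (l (\<Gamma> (f i) (g j))) \<gamma>)"
    then show "c = rep_value k f F k' g G \<gamma>"
      using uniq unfolding rep_value_def by blast
  qed
qed

lemma CF_points:
  assumes u: "u \<in> cyl" and v: "v \<in> cyl"
  shows "\<exists>r. \<forall>I x. lfin I x \<longrightarrow> (\<forall>r'\<ge>r. CF u v (points m I x) = (\<Sum>i\<in>inds I x r'. local_field u v I x i))"
proof -
  obtain k f F k' g G where r: "cylinder_rep m D u k f F" "cylinder_rep m D v k' g G"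
    using u v unfolding cylinder_functions_def by blast
  show ?thesis
    using rep_value_points[OF r] CF_eq[OF r points_config_nat] by simp
qed

subsection \<open>Algebraic properties\<close>

lemma cyl_lin:
  assumes u: "u \<in> cyl" and v: "v \<in> cyl"
  shows "(\<lambda>\<gamma>. a * u \<gamma> + b * v \<gamma>) \<in> cyl"
proof -
  obtain k f F k' g G where r: "cylinder_rep m D u k f F" "cylinder_rep m D v k' g G"
    using u v unfolding cylinder_functions_def by blast
  note U = repD[OF r(1)] and V = repD[OF r(2)]
  define h where "h n = (if n < k then f n else g (n - k))" for n
  define H where "H = (\<lambda>c. a * F (\<lambda>i. c (0 + i)) + b * G (\<lambda>i. c (k + i)))"
  have "cylinder_rep m D (\<lambda>\<gamma>. a * u \<gamma> + b * v \<gamma>) (k + k') h H"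
    unfolding cylinder_rep_def
  proof (intro conjI allI impI ballI)
    show "H \<in> Cb_infinity (k + k')"
      unfolding H_def by (intro Cb_lin Cb_shift[OF U(1)] Cb_shift[OF V(1)]) auto
    show "h i \<in> D" if "i < k + k'" for i using that U(2) V(2) by (auto simp: h_def)
    fix \<gamma> assume g: "\<gamma> \<in> config_space m"
    have "F (\<lambda>n. star (f n) \<gamma>) = F (\<lambda>i. star (h (0 + i)) \<gamma>)" by (rule Cb_cong[OF U(1)]) (simp add: h_def)
    moreover have "G (\<lambda>n. star (g n) \<gamma>) = G (\<lambda>i. star (h (k + i)) \<gamma>)" by (rule Cb_cong[OF V(1)]) (simp add: h_def)
    ultimately show "a * u \<gamma> + b * v \<gamma> = H (\<lambda>i. star (h i) \<gamma>)"
      unfolding H_def U(3)[OF g] V(3)[OF g] by simp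
  qed
  then show ?thesis unfolding cylinder_functions_def by blast
qed

lemma incr_lin: "incr (\<lambda>\<gamma>. a * u \<gamma> + b * v \<gamma>) I x i = (\<lambda>y. a * incr u I x i y + b * incr v I x i y)"
  unfolding incr_def by (auto simp: algebra_simps)

lemma CF_lin:
  assumes u: "u \<in> cyl" and v: "v \<in> cyl" and w: "w \<in> cyl" and g: "\<gamma> \<in> config_space m"
  shows "CF (\<lambda>\<gamma>. a * u \<gamma> + b * v \<gamma>) w \<gamma> = a * CF u w \<gamma> + b * CF v w \<gamma>"
proof -
  obtain I :: "nat set" and x where \<gamma>: "\<gamma> = points m I x" "lfin I x" using config_points[OF g] by blast
  obtain r1 where r1: "\<forall>I x. lfin I x \<longrightarrow> (\<forall>r'\<ge>r1. CF u w (points m I x) = (\<Sum>i\<in>inds I x r'. local_field u w I x i))"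
    using CF_points[OF u w] ..
  obtain r2 where r2: "\<forall>I x. lfin I x \<longrightarrow> (\<forall>r'\<ge>r2. CF v w (points m I x) = (\<Sum>i\<in>inds I x r'. local_field v w I x i))"
    using CF_points[OF v w] ..
  let ?z = "\<lambda>\<gamma>. a * u \<gamma> + b * v \<gamma>"
  obtain r3 where r3: "\<forall>I x. lfin I x \<longrightarrow> (\<forall>r'\<ge>r3. CF ?z w (points m I x) = (\<Sum>i\<in>inds I x r'. local_field ?z w I x i))"
    using CF_points[OF cyl_lin[OF u v] w] ..
  define r where "r = max r1 (max r2 r3)"
  have r: "r1 \<le> r" "r2 \<le> r" "r3 \<le> r" unfolding r_def by auto
  have "local_field ?z w I x i = a * local_field u w I x i + b * local_field v w I x i" if i: "i \<in> I" for i
  proof -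
    note D = incr_D[OF u \<gamma>(2) i] incr_D[OF v \<gamma>(2) i] incr_D[OF w \<gamma>(2) i]
    have "local_field ?z w I x i = l (\<lambda>y. a * \<Gamma> (incr u I x i) (incr w I x i) y + b * \<Gamma> (incr v I x i) (incr w I x i) y) (x i)"
      unfolding local_field_def incr_lin
      by (intro l_cong \<Gamma>_lin D D_lin \<Gamma>_bf bf_add bf_mult bf_const)
    then show ?thesis unfolding local_field_def by (simp add: l_lin[OF \<Gamma>_bf[OF D(1,3)] \<Gamma>_bf[OF D(2,3)]])
  qed
  then have "(\<Sum>i\<in>inds I x r. local_field ?z w I x i)
      = (\<Sum>i\<in>inds I x r. a * local_field u w I x i + b * local_field v w I x i)"
    by (intro sum.cong) (auto simp: inds_def)
  then show ?thesis
    unfolding \<gamma>(1) using r1[rule_format, OF \<gamma>(2) r(1)] r2[rule_format, OF \<gamma>(2) r(2)] r3[rule_format, OF \<gamma>(2) r(3)]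
    by (simp add: sum.distrib sum_distrib_left)
qed

lemma CF_sym:
  assumes u: "u \<in> cyl" and v: "v \<in> cyl" and g: "\<gamma> \<in> config_space m"
  shows "CF u v \<gamma> = CF v u \<gamma>"
proof -
  obtain I :: "nat set" and x where \<gamma>: "\<gamma> = points m I x" "lfin I x" using config_points[OF g] by blast
  obtain r1 where r1: "\<forall>I x. lfin I x \<longrightarrow> (\<forall>r'\<ge>r1. CF u v (points m I x) = (\<Sum>i\<in>inds I x r'. local_field u v I x i))"
    using CF_points[OF u v] ..
  obtain r2 where r2: "\<forall>I x. lfin I x \<longrightarrow> (\<forall>r'\<ge>r2. CF v u (points m I x) = (\<Sum>i\<in>inds I x r'. local_field v u I x i))"
    using CF_points[OF v u] ..
  have "local_field u v I x i = local_field v u I x i" if i: "i \<in> I" for i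
    unfolding local_field_def
    by (intro l_cong \<Gamma>_bf \<Gamma>_sym incr_D[OF u \<gamma>(2) i] incr_D[OF v \<gamma>(2) i])
  then have "(\<Sum>i\<in>inds I x (max r1 r2). local_field u v I x i) = (\<Sum>i\<in>inds I x (max r1 r2). local_field v u I x i)"
    by (intro sum.cong) (auto simp: inds_def)
  then show ?thesis
    unfolding \<gamma>(1) using r1[rule_format, OF \<gamma>(2) max.cobounded1] r2[rule_format, OF \<gamma>(2) max.cobounded2] by simp
qed

lemma CF_nonneg:
  assumes u: "u \<in> cyl" and g: "\<gamma> \<in> config_space m"
  shows "0 \<le> CF u u \<gamma>"
proof -
  obtain I :: "nat set" and x where \<gamma>: "\<gamma> = points m I x" "lfin I x" using config_points[OF g] by blast
  obtain r1 where r1: "\<forall>I x. lfin I x \<longrightarrow> (\<forall>r'\<ge>r1. CF u u (points m I x) = (\<Sum>i\<in>inds I x r'. local_field u u I x i))"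
    using CF_points[OF u u] ..
  have "0 \<le> local_field u u I x i" if i: "i \<in> I" for i
  proof -
    note d = incr_D[OF u \<gamma>(2) i]
    have "l (\<lambda>_. 0) (x i) \<le> local_field u u I x i"
      unfolding local_field_def by (intro l_mono bf_const \<Gamma>_bf \<Gamma>_nonneg d)
    then show ?thesis by (simp add: l_zero)
  qed
  then show ?thesis
    unfolding \<gamma>(1) r1[rule_format, OF \<gamma>(2) order_refl] by (intro sum_nonneg) (simp add: inds_def)
qed

lemma cyl_one: "(\<lambda>_. 1) \<in> cyl" and CF_one: "v \<in> cyl \<Longrightarrow> \<gamma> \<in> config_space m \<Longrightarrow> CF (\<lambda>_. 1) v \<gamma> = 0"
proof -
  have r: "cylinder_rep m D (\<lambda>_. 1) 0 f (\<lambda>_. 1)" for f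
    by (simp add: cylinder_rep_def Cb_const)
  then show "(\<lambda>_. 1) \<in> cyl" unfolding cylinder_functions_def by blast
  show "CF (\<lambda>_. 1) v \<gamma> = 0" if v: "v \<in> cyl" and g: "\<gamma> \<in> config_space m"
  proof -
    obtain k h G where "cylinder_rep m D v k h G" using v unfolding cylinder_functions_def by blast
    from CF_eq[OF r this g] show ?thesis by (simp add: rep_value_def)
  qed
qed

lemma CF_chain:
  assumes u: "u \<in> cyl" and v: "v \<in> cyl"
    and \<psi>: "\<And>F k. F \<in> Cb_infinity k \<Longrightarrow> (\<lambda>a. \<psi> (F a)) \<in> Cb_infinity k"
    and d: "\<And>t. (\<psi> has_real_derivative \<psi>' t) (at t)"
  shows "(\<lambda>\<gamma>. \<psi> (u \<gamma>)) \<in> cyl"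
    "\<gamma> \<in> config_space m \<Longrightarrow> CF (\<lambda>\<gamma>. \<psi> (u \<gamma>)) v \<gamma> = \<psi>' (u \<gamma>) * CF u v \<gamma>"
proof -
  obtain k f F k' g G where r: "cylinder_rep m D u k f F" "cylinder_rep m D v k' g G"
    using u v unfolding cylinder_functions_def by blast
  note U = repD[OF r(1)]
  have ru: "cylinder_rep m D (\<lambda>\<gamma>. \<psi> (u \<gamma>)) k f (\<lambda>a. \<psi> (F a))"
    using U \<psi>[OF U(1)] by (simp add: cylinder_rep_def)
  then show "(\<lambda>\<gamma>. \<psi> (u \<gamma>)) \<in> cyl" unfolding cylinder_functions_def by blast
  assume g: "\<gamma> \<in> config_space m"
  have "partial_deriv i (\<lambda>a. \<psi> (F a)) a = \<psi>' (F a) * partial_deriv i F a" if "i < k" for i a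
    by (rule partial_deriv_eqI, rule partial_deriv_comp[OF Cb_bdiff[OF U(1)] that d])
  then show "CF (\<lambda>\<gamma>. \<psi> (u \<gamma>)) v \<gamma> = \<psi>' (u \<gamma>) * CF u v \<gamma>"
    unfolding CF_eq[OF ru r(2) g] CF_eq[OF r g] rep_value_def U(3)[OF g]
    by (simp add: sum_distrib_left mult.assoc)
qed

lemma cyl_bounded: "u \<in> cyl \<Longrightarrow> \<exists>c. \<forall>\<gamma>\<in>config_space m. \<bar>u \<gamma>\<bar> \<le> c"
proof -
  assume "u \<in> cyl"
  then obtain k f F where r: "cylinder_rep m D u k f F" unfolding cylinder_functions_def by blast
  obtain c where "\<forall>a. \<bar>F a\<bar> \<le> c" using Cb_bounded[OF repD(1)[OF r]] by blast
  then show ?thesis using repD(3)[OF r] by (intro exI[of _ c]) simp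
qed

lemma Cb_star_measurable:
  assumes \<Phi>: "\<Phi> \<in> Cb_infinity k" and f: "\<And>n. n < k \<Longrightarrow> f n \<in> D"
  shows "(\<lambda>\<gamma>. \<Phi> (\<lambda>n. star (f n) \<gamma>)) \<in> borel_measurable (config_algebra m)"
proof -
  define f' where "f' n = (if n < k then f n else (\<lambda>_. 0))" for n
  have f': "f' n \<in> D" for n using f D_zero by (simp add: f'_def)
  have eq: "\<Phi> (\<lambda>n. star (f n) \<gamma>) = \<Phi> (\<lambda>n. star (f' n) \<gamma>)" for \<gamma> by (rule Cb_cong[OF \<Phi>]) (simp add: f'_def)
  have "(\<lambda>\<gamma> n. star (f' n) \<gamma>) \<in> borel_measurable (config_algebra m)"
    by (rule measurable_coordinatewise_then_product) (rule star_measurable[OF D_bsupp[OF f']])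
  from measurable_compose[OF this borel_measurable_continuous_onI[OF Cb_continuous[OF \<Phi>]]]
  show ?thesis unfolding eq .
qed

lemma CF_integrable:
  assumes \<mu>: "sets \<mu> = sets (config_algebra m)"
    and fin: "\<And>A. A \<in> bounded_sets m \<Longrightarrow> (\<integral>\<^sup>+\<gamma>. emeasure \<gamma> A \<partial>\<mu>) < \<infinity>"
    and u: "u \<in> cyl" and v: "v \<in> cyl"
  shows "integrable \<mu> (CF u v)"
proof -
  have sp: "space \<mu> = config_space m" using sets_eq_imp_space_eq[OF \<mu>] by simp
  obtain k f F k' g G where r: "cylinder_rep m D u k f F" "cylinder_rep m D v k' g G"
    using u v unfolding cylinder_functions_def by blast
  note U = repD[OF r(1)] and V = repD[OF r(2)]
  have "integrable \<mu> (\<lambda>\<gamma>. partial_deriv p F (\<lambda>n. star (f n) \<gamma>) * partial_deriv q G (\<lambda>n. star (g n) \<gamma>) *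
      star (l (\<Gamma> (f p) (g q))) \<gamma>)" if pq: "p < k" "q < k'" for p q
  proof -
    note P = Cb_partial[OF U(1) pq(1)] and Q = Cb_partial[OF V(1) pq(2)]
    obtain c where c: "\<forall>y. \<bar>l (\<Gamma> (f p) (g q)) y\<bar> \<le> c" using l\<Gamma>_bsupp(2)[OF U(2)[OF pq(1)] V(2)[OF pq(2)]] ..
    have i: "integrable \<mu> (star (l (\<Gamma> (f p) (g q))))"
      by (rule star_integrable[OF l\<Gamma>_bsupp(1)[OF U(2)[OF pq(1)] V(2)[OF pq(2)]] c[rule_format] \<mu> fin])
    obtain a b where ab: "\<forall>x. \<bar>partial_deriv p F x\<bar> \<le> a" "\<forall>x. \<bar>partial_deriv q G x\<bar> \<le> b"
      using Cb_bounded[OF P] Cb_bounded[OF Q] by blast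
    have ms: "(\<lambda>\<gamma>. partial_deriv p F (\<lambda>n. star (f n) \<gamma>) * partial_deriv q G (\<lambda>n. star (g n) \<gamma>)) \<in> borel_measurable \<mu>"
      unfolding measurable_cong_sets[OF \<mu> refl]
      by (intro borel_measurable_times Cb_star_measurable[OF P U(2)] Cb_star_measurable[OF Q V(2)])
    show ?thesis
    proof (rule Bochner_Integration.integrable_bound[OF integrable_mult_right[OF i, of "a * b"]])
      show "AE \<gamma> in \<mu>. norm (partial_deriv p F (\<lambda>n. star (f n) \<gamma>) * partial_deriv q G (\<lambda>n. star (g n) \<gamma>) *
          star (l (\<Gamma> (f p) (g q))) \<gamma>) \<le> norm (a * b * star (l (\<Gamma> (f p) (g q))) \<gamma>)"
      proof (intro AE_I2)
        fix \<gamma>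
        have "\<bar>partial_deriv p F (\<lambda>n. star (f n) \<gamma>) * partial_deriv q G (\<lambda>n. star (g n) \<gamma>)\<bar> \<le> a * b"
          unfolding abs_mult using ab by (intro mult_mono) (auto intro: order_trans[OF abs_ge_zero])
        then have "\<bar>partial_deriv p F (\<lambda>n. star (f n) \<gamma>) * partial_deriv q G (\<lambda>n. star (g n) \<gamma>)\<bar> \<le> \<bar>a * b\<bar>"
          by linarith
        then show "norm (partial_deriv p F (\<lambda>n. star (f n) \<gamma>) * partial_deriv q G (\<lambda>n. star (g n) \<gamma>) *
          star (l (\<Gamma> (f p) (g q))) \<gamma>) \<le> norm (a * b * star (l (\<Gamma> (f p) (g q))) \<gamma>)"
          unfolding real_norm_def abs_mult[of _ "star (l (\<Gamma> (f p) (g q))) \<gamma>"]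
          by (rule mult_right_mono) simp
      qed
    qed (use ms i in measurable)
  qed
  then have "integrable \<mu> (rep_value k f F k' g G)"
    unfolding rep_value_def by (intro Bochner_Integration.integrable_sum) auto
  then show ?thesis
    by (subst Bochner_Integration.integrable_cong[OF refl CF_eq[OF r]]) (auto simp: sp)
qed

text \<open>Bilinearity, symmetry and non-negativity come from the sum over the points, the chain rule from
  the formula for a representation.\<close>

theorem config_preform_diffusion:
  assumes P: "prob_space \<mu>" and \<mu>: "sets \<mu> = sets (config_algebra m)" and c: "closability_assumption m D \<Gamma> l \<mu>"
  shows "diffusion_preform \<mu> cyl CF"
proof -
  have sp: "space \<mu> = config_space m" using sets_eq_imp_space_eq[OF \<mu>] by simp
  interpret prob_space \<mu> by fact
  have fin: "(\<integral>\<^sup>+\<gamma>. emeasure \<gamma> A \<partial>\<mu>) < \<infinity>" if "A \<in> bounded_sets m" for A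
    using c that by (simp add: closability_assumption_def)
  have cl: "closable \<mu> (\<lambda>u v. \<integral>\<gamma>. CF u v \<gamma> \<partial>\<mu>) cyl"
    using c by (simp add: closability_assumption_def config_preform_def[abs_def])
  show ?thesis
  proof unfold_locales
    show "L2_dense \<mu> cyl" using c by (simp add: closability_assumption_def)
  qed (use cyl_bounded CF_integrable[OF \<mu> fin] cl CF_chain[OF _ _ Cb_sqrt inv_sqrt_deriv(2)]
      CF_chain(1)[OF _ cyl_one Cb_sqrt inv_sqrt_deriv(2)]
      CF_chain[OF _ _ Cb_trunc inv_sqrt_deriv(3)] CF_chain(1)[OF _ cyl_one Cb_trunc inv_sqrt_deriv(3)] in
      \<open>auto simp: sp cyl_lin cyl_one CF_one CF_lin CF_sym CF_nonneg\<close>)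
qed


section \<open>Quasi-regularity\<close>

lemma cyl_continuous:
  assumes "u \<in> cyl"
  shows "continuous_map (vague_topology m) euclideanreal u"
proof -
  obtain k f F where r: "cylinder_rep m D u k f F" using assms unfolding cylinder_functions_def by blast
  note R = repD[OF r]
  define f' where "f' n = (if n < k then f n else (\<lambda>_. 0))" for n
  have f': "f' n \<in> Cbs" for n using R(2) D_zero D_Cbs by (auto simp: f'_def)
  have c: "continuous_map (vague_topology m) euclidean (\<lambda>\<gamma> n. star (f' n) \<gamma>)"
    unfolding euclidean_product_topology[symmetric]
    by (simp add: continuous_map_componentwise_UNIV star_continuous[OF f'])
  have "continuous_map (vague_topology m) euclideanreal (F \<circ> (\<lambda>\<gamma> n. star (f' n) \<gamma>))"
    by (rule continuous_map_compose[OF c]) (use Cb_continuous[OF R(1)] in simp)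
  moreover have "u \<gamma> = (F \<circ> (\<lambda>\<gamma> n. star (f' n) \<gamma>)) \<gamma>" if "\<gamma> \<in> topspace (vague_topology m)" for \<gamma>
  proof -
    have "F (\<lambda>n. star (f n) \<gamma>) = F (\<lambda>n. star (f' n) \<gamma>)" by (rule Cb_cong[OF R(1)]) (simp add: f'_def)
    then show ?thesis using R(3)[of \<gamma>] that by simp
  qed
  ultimately show ?thesis using continuous_map_eq by (metis (no_types, lifting))
qed

text \<open>
  The Rademacher property is used for the potentials, which are \<open>2\<close>-Lipschitz and produce the compact
  nest, and for the truncated roots of tents, which are continuous and separate the configurations.
  Being measurable for the sigma-algebra of \<open>\<mu>\<close> itself, these functions belong to the domain as they
  are.
\<close>

theorem quasi_regular_config:
  assumes P: "prob_space \<mu>" and \<mu>: "sets \<mu> = sets (config_algebra m)"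
    and c: "closability_assumption m D \<Gamma> l \<mu>" and rad: "Rademacher_property m D \<Gamma> l \<mu>"
  shows "quasi_regular (vague_topology m) \<mu> (config_form m D \<Gamma> l \<mu>) (config_dom m D \<Gamma> l \<mu>)"
proof -
  interpret diffusion_preform \<mu> cyl CF by (rule config_preform_diffusion[OF P \<mu> c])
  have sp: "space \<mu> = config_space m" using sets_eq_imp_space_eq[OF \<mu>] by simp
  have pre: "config_preform m D \<Gamma> l \<mu> = E" by (simp add: config_preform_def[abs_def])
  have form: "config_form m D \<Gamma> l \<mu> = EE" and cdom: "config_dom m D \<Gamma> l \<mu> = dom"
    by (simp_all add: config_form_def config_dom_def pre)
  have bm: "borel_measurable \<mu> = borel_measurable (config_algebra m)" by (rule measurable_cong_sets[OF \<mu> refl])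
  have lip: "v \<in> dom \<and> EE.nrm v \<le> L"
    if v: "v \<in> borel_measurable (config_algebra m)" "\<And>\<gamma>. \<bar>v \<gamma>\<bar> \<le> b" and L: "transport_Lipschitz m L v" for v b L
  proof -
    have vm: "v \<in> borel_measurable \<mu>" using v(1) by (simp only: bm)
    have "v \<in> bounded_functions (completion \<mu>)"
      using measurable_completion[OF vm] v(2) by (auto simp: bounded_functions_def bounded_iff)
    with rad L obtain u where u: "u \<in> dom" "AE \<gamma> in \<mu>. u \<gamma> = v \<gamma>"
      "AE \<gamma> in \<mu>. Gc u u \<gamma> \<le> L\<^sup>2"
      unfolding Rademacher_property_def cdom config_closed_square_field_def pre by blast
    have vL: "v \<in> L2 \<mu>" by (rule bounded_imp_L2[OF vm, of b]) (use v(2) in simp)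
    note d = dom_cong[OF u(2,1) vL]
    have "EE u u = EE v v"
      using d(2)[OF u(1)] d(2)[OF d(1)] EE.Q_sym[OF u(1) d(1)] by simp
    then have "EE.nrm u = EE.nrm v" by (simp add: EE.nrm_def)
    moreover have "EE.nrm u \<le> L"
      by (rule EE_nrm_le_of_Gc[OF u(1) _ u(3)]) (use L in \<open>simp add: transport_Lipschitz_def\<close>)
    ultimately show ?thesis using d(1) by simp
  qed
  obtain Y :: "nat \<Rightarrow> 'a" where Y: "\<And>z e. 0 < e \<Longrightarrow> \<exists>j. dist (Y j) z < e" using dense_sequence by blast
  have pot: "potential Y n \<in> dom \<and> EE.nrm (potential Y n) \<le> 2" for n
    by (rule lip[OF potential_measurable _ potential_Lipschitz, of _ _ 1]) (use potential_range[of Y n] in simp)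
  have "\<exists>N::nat \<Rightarrow> nat. \<forall>F. (\<forall>k. closedin (vague_topology m) (F k)) \<and> incseq F \<and>
    (\<forall>k. AE x in \<mu>. (\<forall>j\<ge>k. potential Y (N j) x \<le> (1 / 2) ^ j) \<longrightarrow> x \<in> F k) \<longrightarrow> nest (vague_topology m) \<mu> EE dom F"
  proof (rule nest_of_decreasing[where C = 2])
    show "AE x in \<mu>. potential Y (Suc n) x \<le> potential Y n x" for n
      by (intro AE_I2 potential_decreasing) (simp add: sp)
    show "AE x in \<mu>. (\<lambda>n. potential Y n x) \<longlonglongrightarrow> 0"
      by (intro AE_I2 potential_tendsto[OF Y]) (simp_all add: sp)
  qed (use pot potential_range in auto)
  then obtain N :: "nat \<Rightarrow> nat" where N: "\<And>F. (\<forall>k. closedin (vague_topology m) (F k)) \<Longrightarrow> incseq F \<Longrightarrow>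
    (\<forall>k. AE x in \<mu>. (\<forall>j\<ge>k. potential Y (N j) x \<le> (1 / 2) ^ j) \<longrightarrow> x \<in> F k) \<Longrightarrow> nest (vague_topology m) \<mu> EE dom F"
    by blast
  have nest: "nest (vague_topology m) \<mu> EE dom (sublevel Y N)"
  proof (rule N)
    show "\<forall>k. AE x in \<mu>. (\<forall>j\<ge>k. potential Y (N j) x \<le> (1 / 2) ^ j) \<longrightarrow> x \<in> sublevel Y N k"
      by (intro allI AE_I2) (simp add: sublevel_def sp)
    show "incseq (sublevel Y N)" unfolding incseq_def sublevel_def by auto
  qed (simp add: sublevel_closed)
  have whole: "nest (vague_topology m) \<mu> EE dom (\<lambda>_. topspace (vague_topology m))"
    by (rule nest_topspace) (simp add: sp)
  have qc: "quasi_continuous (vague_topology m) \<mu> EE dom f"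
    if "continuous_map (vague_topology m) euclideanreal f" for f
    unfolding quasi_continuous_def
    by (rule exI[of _ "\<lambda>_. topspace (vague_topology m)"])
      (use whole that in \<open>simp add: continuous_map_from_subtopology\<close>)
  \<comment> \<open>the functions \<open>w t\<close> enumerate all centres, slopes and truncation levels\<close>
  define w where "w t = (case prod_decode t of (j, s) \<Rightarrow> case prod_decode s of (n, c) \<Rightarrow>
    (\<lambda>\<gamma>. min (real c) (sqrt (star (\<lambda>x. (tent (Y j) (Suc n) x)\<^sup>2) \<gamma>))))" for t
  have w_eq: "w (prod_encode (j, prod_encode (n, c))) = (\<lambda>\<gamma>. min (real c) (sqrt (star (\<lambda>x. (tent (Y j) (Suc n) x)\<^sup>2) \<gamma>)))" for j n c
    unfolding w_def by simp
  have w: "w t \<in> dom \<and> continuous_map (vague_topology m) euclideanreal (w t)" for t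
  proof -
    obtain j s where t: "prod_decode t = (j, s)" by force
    obtain n c where s: "prod_decode s = (n, c)" by force
    have wt: "w t = (\<lambda>\<gamma>. min (real c) (sqrt (star (\<lambda>x. (tent (Y j) (Suc n) x)\<^sup>2) \<gamma>)))"
      by (simp add: w_def t s)
    have g: "tent (Y j) (Suc n) \<in> Cbs" by (rule tent_Cbs) simp
    have "w t \<in> dom \<and> EE.nrm (w t) \<le> real (Suc n)"
      unfolding wt
    proof (rule lip[of _ "real c"])
      show "transport_Lipschitz m (real (Suc n)) (\<lambda>\<gamma>. min (real c) (sqrt (star (\<lambda>x. (tent (Y j) (Suc n) x)\<^sup>2) \<gamma>)))"
        by (rule truncated_root_Lipschitz[OF g _ tent_Lipschitz]) simp
      show "\<bar>min (real c) (sqrt (star (\<lambda>x. (tent (Y j) (Suc n) x)\<^sup>2) \<gamma>))\<bar> \<le> real c" for \<gamma> :: "'a measure"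
        by (simp add: abs_le_iff min_le_iff_disj)
    qed (rule truncated_root_measurable[OF g])
    moreover have "continuous_map (vague_topology m) euclideanreal (w t)"
      unfolding wt by (rule truncated_root_continuous[OF g])
    ultimately show ?thesis by blast
  qed
  show ?thesis
    unfolding quasi_regular_def form cdom
  proof (intro conjI)
    show "\<exists>F. nest (vague_topology m) \<mu> EE dom F \<and> (\<forall>k. compactin (vague_topology m) (F k))"
      using nest sublevel_compact by blast
    show "\<exists>A\<subseteq>dom. (\<forall>u\<in>dom. \<forall>e>0. \<exists>v\<in>A. energy1 \<mu> EE (\<lambda>x. u x - v x) < e) \<and>
       (\<forall>v\<in>A. \<exists>w. quasi_continuous (vague_topology m) \<mu> EE dom w \<and> (AE x in \<mu>. w x = v x))"
    proof (intro exI[of _ cyl] conjI ballI allI impI)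
      show "cyl \<subseteq> dom" using D0_dom by blast
      fix u and e :: real assume u: "u \<in> dom" and e: "0 < e"
      then have "sqrt e > 0" by simp
      from D0_energy_dense[OF u this] obtain v where v: "v \<in> cyl" "H.nrm (\<lambda>x. u x - v x) < sqrt e" .
      have d: "(\<lambda>x. u x - v x) \<in> dom" by (rule EE.diff[OF u D0_dom[OF v(1)]])
      have "(H.nrm (\<lambda>x. u x - v x))\<^sup>2 < (sqrt e)\<^sup>2"
        using v(2) H.nrm_nonneg[OF d] by (intro power_strict_mono) auto
      then show "\<exists>v\<in>cyl. energy1 \<mu> EE (\<lambda>x. u x - v x) < e"
        using v(1) e by (intro bexI[of _ v]) (simp_all add: H_nrm_sq[OF d])
    next
      fix v assume "v \<in> cyl"
      then show "\<exists>w. quasi_continuous (vague_topology m) \<mu> EE dom w \<and> (AE x in \<mu>. w x = v x)"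
        using qc[OF cyl_continuous] by (intro exI[of _ v]) simp
    qed
    show "\<exists>un wn N. (\<forall>n. un n \<in> dom \<and> quasi_continuous (vague_topology m) \<mu> EE dom (wn n) \<and> (AE x in \<mu>. wn n x = un n x)) \<and>
       exceptional (vague_topology m) \<mu> EE dom N \<and>
       (\<forall>x\<in>topspace (vague_topology m) - N. \<forall>y\<in>topspace (vague_topology m) - N. x \<noteq> y \<longrightarrow> (\<exists>n::nat. wn n x \<noteq> wn n y))"
    proof (intro exI[of _ w] exI[of _ "{}"] conjI allI ballI impI)
      fix t show "w t \<in> dom" using w by blast
      show "quasi_continuous (vague_topology m) \<mu> EE dom (w t)" using w qc by blast
      show "AE x in \<mu>. w t x = w t x" by simp
    next
      show "exceptional (vague_topology m) \<mu> EE dom {}" unfolding exceptional_def using whole by blast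
    next
      fix \<gamma> \<eta> assume "\<gamma> \<in> topspace (vague_topology m) - {}" "\<eta> \<in> topspace (vague_topology m) - {}" and ne: "\<gamma> \<noteq> \<eta>"
      then have g: "\<gamma> \<in> config_space m" "\<eta> \<in> config_space m" by auto
      show "\<exists>n. w n \<gamma> \<noteq> w n \<eta>"
      proof (rule ccontr)
        assume "\<not> ?thesis"
        then have "w t \<gamma> = w t \<eta>" for t by blast
        then have "min (real c) (sqrt (star (\<lambda>x. (tent (Y j) (Suc n) x)\<^sup>2) \<gamma>))
            = min (real c) (sqrt (star (\<lambda>x. (tent (Y j) (Suc n) x)\<^sup>2) \<eta>))" for j n c
          using fun_cong[OF w_eq, of j n c \<gamma>] fun_cong[OF w_eq, of j n c \<eta>] by metis
        from tents_separate[OF Y g this] ne show False by blast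
      qed
    qed
  qed
qed

end


theorem proposition6p1:
  fixes m :: "'a::polish_space measure"
    and D :: "('a \<Rightarrow> real) set"
    and \<Gamma> :: "('a \<Rightarrow> real) \<Rightarrow> ('a \<Rightarrow> real) \<Rightarrow> 'a \<Rightarrow> real"
    and l :: "('a \<Rightarrow> real) \<Rightarrow> 'a \<Rightarrow> real"
    and \<mu> :: "'a measure measure"
  assumes "metric_local_diffusion_space m D \<Gamma>"
    and "strong_lifting m l"
    and "prob_space \<mu>"
    and "sets \<mu> = sets (config_algebra m)"
    and "closability_assumption m D \<Gamma> l \<mu>"
    and "Rademacher_property m D \<Gamma> l \<mu>"
  shows "Dirichlet_form \<mu> (config_form m D \<Gamma> l \<mu>) (config_dom m D \<Gamma> l \<mu>) \<and>
    conservative \<mu> (config_form m D \<Gamma> l \<mu>) (config_dom m D \<Gamma> l \<mu>) \<and>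
    quasi_regular (vague_topology m) \<mu> (config_form m D \<Gamma> l \<mu>) (config_dom m D \<Gamma> l \<mu>) \<and>
    strongly_local \<mu> (config_form m D \<Gamma> l \<mu>) (config_dom m D \<Gamma> l \<mu>)"
proof -
  interpret metric_local_diffusion_space m D \<Gamma> by (rule assms(1))
  interpret lifted_diffusion_space m D \<Gamma> l by unfold_locales (rule assms(2))
  interpret diffusion_preform \<mu> cyl CF
    by (rule config_preform_diffusion[OF assms(3-5)])
  have "config_preform m D \<Gamma> l \<mu> = E" by (simp add: config_preform_def[abs_def])
  then have "config_form m D \<Gamma> l \<mu> = EE" "config_dom m D \<Gamma> l \<mu> = dom"
    by (simp_all add: config_form_def config_dom_def)
  then show ?thesis
    using Dirichlet_form_closure conservative_closure strongly_local_closure quasi_regular_config[OF assms(3-6)] by simp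
qed

end
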